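(* Let $R$ be a local ring with residue field $k$. Let $M$ be an $R$-module in $\operatorname{Add}\{\Omega_R^n k\mid n\geq 0\}$ and let $N$ be an $R$-module satisfying some $( * )$-property. Then $R$ is regular if either of the following conditions holds: (1) There exists an exact sequence $M\to N\to 0$ of $R$-modules. (2) There exists an exact sequence $0\to N\to M\to L\to 0$ of $R$-modules such that $L$ is a balanced big Cohen--Macaulay $R$-module, or $L$ belongs to $\operatorname{Add} K$ for some deep $R$-module $K$.
   Context: All rings are commutative and noetherian. Modules are not assumed to be finitely generated unless stated. $\Omega_R^n k$ denotes the $n$-th syzygy of $k$ in its minimal $R$-free resolution ($\Omega_R^0k=k$). For a class (full subcategory) $\mathcal{X}$ of $R$-modules, $\operatorname{Add}\mathcal{X}$ is the full subcategory of all $R$-modules that are (isomorphic to) direct summands of (possibly infinite) direct sums of objects of $\mathcal{X}$; $\operatorname{Add}K=\operatorname{Add}\{K\}$. An $R$-module $L$ is a balanced big Cohen--Macaulay module if every system of parameters of $R$ is an $L$-sequence (i.e. an $L$-regular sequence). A finitely generated $R$-module $K$ is deep if $\operatorname{depth} K\geq\operatorname{depth} R$ (with $\operatorname{depth} 0=\infty$). A property $\mathcal{P}$ of modules over local rings specifies, for each local ring $R$, which $R$-modules satisfy $\mathcal{P}$. It is called a $( * )$-property if the following two conditions hold for all local rings $R$ and all (not necessarily finitely generated) $R$-modules $M$: $( *1)$ If $M$ satisfies $\mathcal{P}$ as an $R$-module, then $M/xM$ satisfies $\mathcal{P}$ as an $R/xR$-module for every $R$-regular element $x$ (i.e. every non-zerodivisor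 $x$ on $R$ lying in the maximal ideal). $( *2)$ If $\operatorname{depth} R=0$ and $M$ satisfies $\mathcal{P}$ as an $R$-module, then $\operatorname{Ann}_R M=0$. *)

theory Defs
  imports "HOL-Library.Extended_Nat" "HOL-Algebra.Algebra"
begin

section \<open>Noetherian local rings\<close>

definition noetherian_local_ring :: "('a, 'r) ring_scheme \<Rightarrow> bool" where
  "noetherian_local_ring R \<longleftrightarrow>
     cring R \<and> noetherian_ring R \<and> (\<exists>!\<mm>. maximalideal \<mm> R)"

definition max_ideal :: "('a, 'r) ring_scheme \<Rightarrow> 'a set" where
  "max_ideal R = (THE \<mm>. maximalideal \<mm> R)"

definition krull_dim :: "('a, 'r) ring_scheme \<Rightarrow> enat" where
  "krull_dim R = Sup {enat n | n. \<exists>p :: nat \<Rightarrow> 'a set.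
     (\<forall>i\<le>n. primeideal (p i) R) \<and> (\<forall>i<n. p i \<subset> p (Suc i))}"

definition system_of_parameters :: "('a, 'r) ring_scheme \<Rightarrow> 'a list \<Rightarrow> bool" where
  "system_of_parameters R xs \<longleftrightarrow>
     set xs \<subseteq> max_ideal R \<and> enat (length xs) = krull_dim R \<and>
     (\<forall>y\<in>max_ideal R. \<exists>n::nat. y [^]\<^bsub>R\<^esub> n \<in> Idl\<^bsub>R\<^esub> (set xs))"

definition regular_local_ring :: "('a, 'r) ring_scheme \<Rightarrow> bool" where
  "regular_local_ring R \<longleftrightarrow> noetherian_local_ring R \<and>
     (\<exists>xs. set xs \<subseteq> carrier R \<and> enat (length xs) = krull_dim R \<and>
           max_ideal R = Idl\<^bsub>R\<^esub> (set xs))"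


section \<open>Constructions on modules\<close>

text \<open>
  The record type of modules extends that of rings, so a module record carries a
  multiplication and a unit that no axiom of \<^locale>\<open>module\<close> mentions; they are left
  undefined in the constructions below.
\<close>

definition ring_as_module :: "('a, 'r) ring_scheme \<Rightarrow> ('a, 'a) module" where
  "ring_as_module R = \<lparr>carrier = carrier R, monoid.mult = undefined, one = undefined,
     ring.zero = \<zero>\<^bsub>R\<^esub>, add = add R, smult = monoid.mult R\<rparr>"

definition generated_submodule ::
    "('a, 'r) ring_scheme \<Rightarrow> ('a, 'b) module \<Rightarrow> 'b set \<Rightarrow> 'b set" where
  "generated_submodule R M S = \<Inter>{H. submodule H R M \<and> S \<subseteq> H}"

definition finitely_generated_module ::
    "('a, 'r) ring_scheme \<Rightarrow> ('a, 'b) module \<Rightarrow> bool" where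
  "finitely_generated_module R M \<longleftrightarrow> module R M \<and>
     (\<exists>S. finite S \<and> S \<subseteq> carrier M \<and> carrier M = generated_submodule R M S)"

definition ideal_times_module ::
    "('a, 'r) ring_scheme \<Rightarrow> 'a set \<Rightarrow> ('a, 'b) module \<Rightarrow> 'b set" where
  "ideal_times_module R I M =
     generated_submodule R M {r \<odot>\<^bsub>M\<^esub> y | r y. r \<in> I \<and> y \<in> carrier M}"

definition annihilator :: "('a, 'r) ring_scheme \<Rightarrow> ('a, 'b) module \<Rightarrow> 'a set" where
  "annihilator R M = {r \<in> carrier R. \<forall>y\<in>carrier M. r \<odot>\<^bsub>M\<^esub> y = \<zero>\<^bsub>M\<^esub>}"

definition quotient_module :: "('a, 'b) module \<Rightarrow> 'b set \<Rightarrow> ('a, 'b set) module" where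
  "quotient_module M H = \<lparr>carrier = a_rcosets\<^bsub>M\<^esub> H, monoid.mult = undefined, one = undefined,
     ring.zero = H, add = set_add M, smult = (\<lambda>r Y. \<Union>y\<in>Y. H +>\<^bsub>M\<^esub> (r \<odot>\<^bsub>M\<^esub> y))\<rparr>"

text \<open>\<open>M / I M\<close> as a module over the quotient ring \<open>R Quot I\<close>.\<close>

definition reduced_module ::
    "('a, 'r) ring_scheme \<Rightarrow> ('a, 'b) module \<Rightarrow> 'a set \<Rightarrow> ('a set, 'b set) module" where
  "reduced_module R M I = (let H = ideal_times_module R I M in
     \<lparr>carrier = a_rcosets\<^bsub>M\<^esub> H, monoid.mult = undefined, one = undefined,
      ring.zero = H, add = set_add M, smult = (\<lambda>C Y. \<Union>r\<in>C. \<Union>y\<in>Y. H +>\<^bsub>M\<^esub> (r \<odot>\<^bsub>M\<^esub> y))\<rparr>)"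

definition residue_field :: "('a, 'r) ring_scheme \<Rightarrow> ('a, 'a set) module" where
  "residue_field R = quotient_module (ring_as_module R) (max_ideal R)"

definition direct_sum :: "'i set \<Rightarrow> ('i \<Rightarrow> ('a, 'b) module) \<Rightarrow> ('a, 'i \<Rightarrow> 'b) module" where
  "direct_sum I E =
     \<lparr>carrier = {f \<in> \<Pi>\<^sub>E i\<in>I. carrier (E i). finite {i \<in> I. f i \<noteq> \<zero>\<^bsub>E i\<^esub>}},
      monoid.mult = undefined, one = undefined,
      ring.zero = (\<lambda>i\<in>I. \<zero>\<^bsub>E i\<^esub>),
      add = (\<lambda>f g. \<lambda>i\<in>I. f i \<oplus>\<^bsub>E i\<^esub> g i),
      smult = (\<lambda>r f. \<lambda>i\<in>I. r \<odot>\<^bsub>E i\<^esub> f i)\<rparr>"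

definition free_module :: "('a, 'r) ring_scheme \<Rightarrow> nat \<Rightarrow> ('a, nat \<Rightarrow> 'a) module" where
  "free_module R n = direct_sum {..<n} (\<lambda>_. ring_as_module R)"


section \<open>Homomorphisms and exact sequences\<close>

definition module_hom ::
    "('a, 'r) ring_scheme \<Rightarrow> ('a, 'b) module \<Rightarrow> ('a, 'c) module \<Rightarrow> ('b \<Rightarrow> 'c) set" where
  "module_hom R M N = {f \<in> hom (add_monoid M) (add_monoid N).
     \<forall>r\<in>carrier R. \<forall>y\<in>carrier M. f (r \<odot>\<^bsub>M\<^esub> y) = r \<odot>\<^bsub>N\<^esub> f y}"

definition module_ker :: "('a, 'b) module \<Rightarrow> ('a, 'c) module \<Rightarrow> ('b \<Rightarrow> 'c) \<Rightarrow> 'b set" where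
  "module_ker M N f = {y \<in> carrier M. f y = \<zero>\<^bsub>N\<^esub>}"

definition module_isomorphic ::
    "('a, 'r) ring_scheme \<Rightarrow> ('a, 'b) module \<Rightarrow> ('a, 'c) module \<Rightarrow> bool" where
  "module_isomorphic R M N \<longleftrightarrow>
     (\<exists>f\<in>module_hom R M N. bij_betw f (carrier M) (carrier N))"

text \<open>\<open>M \<rightarrow> N \<rightarrow> 0\<close> and \<open>0 \<rightarrow> N \<rightarrow> M \<rightarrow> L \<rightarrow> 0\<close>\<close>

definition right_exact_modules ::
    "('a, 'r) ring_scheme \<Rightarrow> ('a, 'b) module \<Rightarrow> ('b \<Rightarrow> 'c) \<Rightarrow> ('a, 'c) module \<Rightarrow> bool" where
  "right_exact_modules R M g N \<longleftrightarrow> g \<in> module_hom R M N \<and> g ` carrier M = carrier N"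

definition short_exact_modules ::
    "('a, 'r) ring_scheme \<Rightarrow> ('a, 'b) module \<Rightarrow> ('b \<Rightarrow> 'c) \<Rightarrow> ('a, 'c) module \<Rightarrow>
     ('c \<Rightarrow> 'd) \<Rightarrow> ('a, 'd) module \<Rightarrow> bool" where
  "short_exact_modules R N f M g L \<longleftrightarrow>
     f \<in> module_hom R N M \<and> g \<in> module_hom R M L \<and>
     inj_on f (carrier N) \<and> f ` carrier N = module_ker M L g \<and> g ` carrier M = carrier L"


section \<open>Syzygies\<close>

text \<open>
  The augmented complex
  \<open>\<dots> \<rightarrow> R\<^bsup>b 2\<^esup> \<rightarrow> R\<^bsup>b 1\<^esup> \<rightarrow> R\<^bsup>b 0\<^esup> \<rightarrow> E \<rightarrow> 0\<close>, where \<open>d n\<close> goes from \<open>R\<^bsup>b (n + 1)\<^esup>\<close> to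
  \<open>R\<^bsup>b n\<^esup>\<close> and \<open>e\<close> is the augmentation.
\<close>

definition minimal_free_resolution ::
    "('a, 'r) ring_scheme \<Rightarrow> ('a, 'b) module \<Rightarrow> (nat \<Rightarrow> nat) \<Rightarrow> ((nat \<Rightarrow> 'a) \<Rightarrow> 'b) \<Rightarrow>
     (nat \<Rightarrow> (nat \<Rightarrow> 'a) \<Rightarrow> (nat \<Rightarrow> 'a)) \<Rightarrow> bool" where
  "minimal_free_resolution R E b e d \<longleftrightarrow> (let F = (\<lambda>n. free_module R (b n)) in
     e \<in> module_hom R (F 0) E \<and> e ` carrier (F 0) = carrier E \<and>
     (\<forall>n. d n \<in> module_hom R (F (Suc n)) (F n)) \<and>
     d 0 ` carrier (F 1) = module_ker (F 0) E e \<and>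
     (\<forall>n. d (Suc n) ` carrier (F (Suc (Suc n))) = module_ker (F (Suc n)) (F n) (d n)) \<and>
     (\<forall>n. d n ` carrier (F (Suc n)) \<subseteq> ideal_times_module R (max_ideal R) (F n)))"

definition is_syzygy ::
    "('a, 'r) ring_scheme \<Rightarrow> ('a, 'b) module \<Rightarrow> nat \<Rightarrow> ('a, 'c) module \<Rightarrow> bool" where
  "is_syzygy R E n Z \<longleftrightarrow> module R Z \<and>
     (\<exists>b e d. minimal_free_resolution R E b e d \<and>
       (case n of
          0 \<Rightarrow> module_isomorphic R Z E
        | Suc j \<Rightarrow> module_isomorphic R Z
            ((free_module R (b j)) \<lparr>carrier := d j ` carrier (free_module R (b (Suc j)))\<rparr>)))"

text \<open>
  Modules are only determined up to isomorphism here. The carrier type \<^typ>\<open>nat \<Rightarrow> 'a\<close>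
  accommodates a copy of every syzygy of the residue field: the higher ones are submodules of
  finite free modules, and the residue field itself is copied into \<open>R\<^bsup>1\<^esup>\<close> by choosing
  representatives of the cosets.
\<close>

definition residue_field_syzygies ::
    "('a, 'r) ring_scheme \<Rightarrow> ('a, nat \<Rightarrow> 'a) module set" where
  "residue_field_syzygies R = {Z. \<exists>n. is_syzygy R (residue_field R) n Z}"


section \<open>Additive closure\<close>

definition isomorphic_to_direct_summand ::
    "('a, 'r) ring_scheme \<Rightarrow> ('a, 'b) module \<Rightarrow> ('a, 'c) module \<Rightarrow> bool" where
  "isomorphic_to_direct_summand R M D \<longleftrightarrow>
     (\<exists>A B. submodule A R D \<and> submodule B R D \<and> A \<inter> B = {\<zero>\<^bsub>D\<^esub>} \<and>
            A <+>\<^bsub>D\<^esub> B = carrier D \<and> module_isomorphic R M (D\<lparr>carrier := A\<rparr>))"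

text \<open>
  An existential quantifier cannot range over types, so the type from which the index set of
  the direct sum is taken is a parameter. A hypothesis \<open>in_Add TYPE('i) \<dots>\<close> in a theorem where
  \<open>'i\<close> is a type variable therefore covers direct sums of every size.
\<close>

definition in_Add ::
    "'i itself \<Rightarrow> ('a, 'r) ring_scheme \<Rightarrow> ('a, 'b) module set \<Rightarrow> ('a, 'c) module \<Rightarrow> bool" where
  "in_Add _ R \<C> M \<longleftrightarrow> module R M \<and>
     (\<exists>(I :: 'i set) E. (\<forall>i\<in>I. E i \<in> \<C>) \<and>
        isomorphic_to_direct_summand R M (direct_sum I E))"


section \<open>Regular sequences and depth\<close>

definition regular_element ::
    "('a, 'r) ring_scheme \<Rightarrow> ('a, 'b) module \<Rightarrow> 'a \<Rightarrow> bool" where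
  "regular_element R M x \<longleftrightarrow> x \<in> carrier R \<and>
     (\<forall>y\<in>carrier M. x \<odot>\<^bsub>M\<^esub> y = \<zero>\<^bsub>M\<^esub> \<longrightarrow> y = \<zero>\<^bsub>M\<^esub>)"

definition regular_sequence ::
    "('a, 'r) ring_scheme \<Rightarrow> ('a, 'b) module \<Rightarrow> 'a list \<Rightarrow> bool" where
  "regular_sequence R M xs \<longleftrightarrow> set xs \<subseteq> carrier R \<and>
     (\<forall>i<length xs. regular_element R
        (quotient_module M (ideal_times_module R (Idl\<^bsub>R\<^esub> (set (take i xs))) M)) (xs ! i)) \<and>
     ideal_times_module R (Idl\<^bsub>R\<^esub> (set xs)) M \<noteq> carrier M"

text \<open>The depth is only used for finitely generated modules over noetherian local rings.\<close>

definition depth :: "('a, 'r) ring_scheme \<Rightarrow> ('a, 'b) module \<Rightarrow> enat" where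
  "depth R M = (if carrier M = {\<zero>\<^bsub>M\<^esub>} then \<infinity>
     else Sup {enat (length xs) | xs. set xs \<subseteq> max_ideal R \<and> regular_sequence R M xs})"

definition deep_module :: "('a, 'r) ring_scheme \<Rightarrow> ('a, 'b) module \<Rightarrow> bool" where
  "deep_module R K \<longleftrightarrow>
     finitely_generated_module R K \<and> depth R K \<ge> depth R (ring_as_module R)"

definition balanced_big_CM :: "('a, 'r) ring_scheme \<Rightarrow> ('a, 'b) module \<Rightarrow> bool" where
  "balanced_big_CM R L \<longleftrightarrow>
     module R L \<and> (\<forall>xs. system_of_parameters R xs \<longrightarrow> regular_sequence R L xs)"


section \<open>Properties of modules over local rings\<close>

definition ring_module_isomorphic ::
    "('a, 'r) ring_scheme \<Rightarrow> ('a, 'b) module \<Rightarrow> ('c, 's) ring_scheme \<Rightarrow> ('c, 'd) module \<Rightarrow> bool"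
    where
  "ring_module_isomorphic R M R' M' \<longleftrightarrow>
     (\<exists>\<phi> \<psi>. \<phi> \<in> ring_iso R R' \<and> \<psi> \<in> iso (add_monoid M) (add_monoid M') \<and>
        (\<forall>r\<in>carrier R. \<forall>y\<in>carrier M. \<psi> (r \<odot>\<^bsub>M\<^esub> y) = \<phi> r \<odot>\<^bsub>M'\<^esub> \<psi> y))"

text \<open>
  A property is a predicate on pairs of a ring and a module over it, with elements in types
  \<open>'a\<close> and \<open>'b\<close>. The pair \<open>(R/xR, M/xM)\<close> consists of cosets and has other types; by choosing
  representatives it has isomorphic copies with elements in \<open>'a\<close> and \<open>'b\<close>, and the first
  condition is imposed on all of these. As properties of modules are invariant under
  isomorphism, restricting a property of all modules over all local rings to the two types
  yields a \<open>star_property\<close>.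
\<close>

definition star_property :: "('a ring \<Rightarrow> ('a, 'b) module \<Rightarrow> bool) \<Rightarrow> bool" where
  "star_property P \<longleftrightarrow>
     (\<forall>R M x R' M'.
        noetherian_local_ring R \<and> module R M \<and> P R M \<and>
        x \<in> max_ideal R \<and> regular_element R (ring_as_module R) x \<and>
        module R' M' \<and>
        ring_module_isomorphic (R Quot (PIdl\<^bsub>R\<^esub> x)) (reduced_module R M (PIdl\<^bsub>R\<^esub> x)) R' M'
        \<longrightarrow> P R' M') \<and>
     (\<forall>R M.
        noetherian_local_ring R \<and> module R M \<and> P R M \<and> depth R (ring_as_module R) = 0
        \<longrightarrow> annihilator R M = {\<zero>\<^bsub>R\<^esub>})"

end

theory Submission
  imports Defs "HOL-Library.Function_Algebras"
begin

text \<open>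
  Let \<open>R\<close> be a local ring with maximal ideal \<open>\<mm>\<close> and residue field \<open>k\<close>. The proof rests on a sequence
  \<open>xs\<close> that is regular on \<open>R\<close>, each member of which lies outside of \<open>\<mm>\<^sup>2\<close> plus the ideal of its
  predecessors. Such a sequence can be continued until it generates \<open>\<mm>\<close>, in which case \<open>R\<close> is regular,
  or \<open>R / (xs)\<close> has a nonzero socle, that is, there is an \<open>s \<in> \<mm>\<close> outside of \<open>(xs)\<close> with
  \<open>\<mm> s \<subseteq> (xs)\<close>. The second case leads to a contradiction.

  The central point (\<open>socle_kills_resolution\<close>) is that in the second case \<open>s Z \<subseteq> (xs) Z\<close> for every
  syzygy \<open>Z\<close> of \<open>k\<close>. When \<open>xs\<close> is empty, \<open>s\<close> annihilates all higher syzygies because they are contained in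
  \<open>\<mm>\<close> times a free module. If \<open>x\<close> is a regular element outside of \<open>\<mm>\<^sup>2\<close>, then
  \<open>\<mm> / x \<mm> \<cong> k \<oplus> \<mm> / x R\<close>, so that modulo \<open>x\<close> the higher syzygies of \<open>k\<close> over \<open>R\<close> become direct sums of
  syzygies of \<open>k\<close> over \<open>R / x R\<close>, and one proceeds by induction.

  The inclusion passes to direct sums and summands, hence \<open>s M \<subseteq> (xs) M\<close>. It passes to a quotient \<open>N\<close>
  of \<open>M\<close>, and also to the kernel \<open>N\<close> of a surjection of \<open>M\<close> onto \<open>L\<close> if \<open>xs\<close> is weakly regular on \<open>L\<close>, since
  then \<open>N \<inter> (xs) M = (xs) N\<close> (\<open>kills_kernel\<close>). So \<open>s\<close> annihilates \<open>N / (xs) N\<close>. On the other hand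
  \<open>R / (xs)\<close> has depth \<open>0\<close> because of the socle element \<open>s\<close>, and the two conditions on a star property
  make \<open>N / (xs) N\<close> faithful over \<open>R / (xs)\<close> (\<open>star_property_not_killed\<close>). This is absurd as \<open>s\<close> is not in
  \<open>(xs)\<close>.

  It remains to choose \<open>xs\<close> weakly regular on \<open>L\<close>. If \<open>L\<close> is balanced big Cohen--Macaulay this
  holds because a regular sequence on \<open>R\<close> is part of a system of parameters, by Krull's height theorem. If
  \<open>L\<close> belongs to \<open>Add K\<close> with \<open>K\<close> deep, it suffices that \<open>xs\<close> is weakly regular on \<open>K\<close>. While \<open>R / (xs)\<close>
  has zero socle, so does \<open>K / (xs) K\<close>, since all maximal regular sequences on \<open>K\<close> have the
  same length and \<open>K\<close> has at least the depth of \<open>R\<close>; then prime avoidance continues \<open>xs\<close>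
  on both modules at once (\<open>exists_adapted_sequence\<close>).

  The commutative algebra is carried out in quotients \<open>S / I\<close> of a fixed ring \<open>S\<close> whose elements form a
  type. Factoring out further elements then changes only the ideal \<open>I\<close>. A polynomial ring over the
  integers serves as \<open>S\<close> for an arbitrary ring \<open>R\<close>.
\<close>

section \<open>Noetherian modules and prime ideals\<close>

locale lmod = Modules.module scale
  for scale :: "'a::comm_ring_1 \<Rightarrow> 'b::ab_group_add \<Rightarrow> 'b" (infixr \<open>*s\<close> 75)
begin

text \<open>
  That the quotient \<open>A / B\<close> is Noetherian, in terms of the submodules between \<open>B\<close> and \<open>A\<close>.
  Quotients are treated in this way throughout: a submodule is enlarged while the ambient
  module stays the same.
\<close>

definition noeth :: "'b set \<Rightarrow> 'b set \<Rightarrow> bool" where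
  "noeth B A \<longleftrightarrow>
     (\<forall>H. subspace H \<and> B \<subseteq> H \<and> H \<subseteq> A \<longrightarrow> (\<exists>G. finite G \<and> H = span (B \<union> G)))"

lemma noeth_max:
  assumes "noeth B A" "J \<in> C" and C: "\<And>H. H \<in> C \<Longrightarrow> subspace H \<and> B \<subseteq> H \<and> H \<subseteq> A"
  shows "\<exists>M\<in>C. \<forall>H\<in>C. M \<subseteq> H \<longrightarrow> H = M"
proof (rule subset_Zorn_nonempty)
  show "C \<noteq> {}" using \<open>J \<in> C\<close> by blast
  fix D assume D: "D \<noteq> {}" "subset.chain C D"
  have DC: "D \<subseteq> C" using D(2) by (simp add: subset_chain_def)
  have lin: "G \<subseteq> Y \<or> Y \<subseteq> G" if "G \<in> D" "Y \<in> D" for G Y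
    using D(2) that by (auto simp: subset_chain_def)
  have "subspace (\<Union>D)"
  proof (rule subspaceI)
    show "0 \<in> \<Union>D" using D(1) DC C subspace_0 by blast
    fix x y assume "x \<in> \<Union>D" "y \<in> \<Union>D"
    then obtain G Y where XY: "G \<in> D" "Y \<in> D" "x \<in> G" "y \<in> Y" by blast
    then have "\<exists>Z\<in>D. x \<in> Z \<and> y \<in> Z" using lin[of G Y] by blast
    then show "x + y \<in> \<Union>D" using DC C subspace_add by blast
  next
    fix c x assume "x \<in> \<Union>D"
    then show "c *s x \<in> \<Union>D" using DC C subspace_scale by blast
  qed
  moreover have "B \<subseteq> \<Union>D" "\<Union>D \<subseteq> A" using D(1) DC C by blast+
  ultimately obtain G where G: "finite G" "\<Union>D = span (B \<union> G)"
    using assms(1) unfolding noeth_def by meson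
  have "G \<subseteq> \<Union>D" using G(2) span_superset by blast
  then obtain H where H: "H \<in> D" "G \<subseteq> H"
    using finite_subset_Union_chain[OF G(1) _ D(1,2)] by blast
  have "span (B \<union> G) \<subseteq> H" using H DC C by (intro span_minimal) blast+
  then have "\<Union>D = H" using G(2) H(1) by blast
  then show "\<Union>D \<in> C" using H(1) DC by blast
qed

end

interpretation rg: lmod "(*) :: 's::comm_ring_1 \<Rightarrow> 's \<Rightarrow> 's"
  by unfold_locales (auto simp: algebra_simps)

declare rg.scale_scale [simp del]

definition prime_id :: "'s::comm_ring_1 set \<Rightarrow> bool" where
  "prime_id p \<longleftrightarrow> rg.subspace p \<and> 1 \<notin> p \<and> (\<forall>a b. a * b \<in> p \<longrightarrow> a \<in> p \<or> b \<in> p)"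

definition min_prime :: "'s::comm_ring_1 set \<Rightarrow> 's set \<Rightarrow> bool" where
  "min_prime J p \<longleftrightarrow> prime_id p \<and> J \<subseteq> p \<and> (\<forall>q. prime_id q \<and> J \<subseteq> q \<and> q \<subseteq> p \<longrightarrow> q = p)"

lemma ideal_times: "rg.subspace J \<Longrightarrow> x \<in> J \<Longrightarrow> c * x \<in> J" "rg.subspace J \<Longrightarrow> x \<in> J \<Longrightarrow> x * c \<in> J"
  by (metis rg.subspace_scale) (metis rg.subspace_scale mult.commute)

lemma prime_id_ideal: "prime_id p \<Longrightarrow> rg.subspace p"
  by (simp add: prime_id_def)

lemma prime_id_pow: "prime_id p \<Longrightarrow> x ^ n \<in> p \<Longrightarrow> x \<in> p"
  by (induction n) (auto simp: prime_id_def)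

lemma span_insert_ideal:
  "rg.subspace J \<Longrightarrow> rg.span (insert a J) = {r. \<exists>c. r - c * a \<in> J}"
  by (simp add: rg.span_insert rg.span_eq_iff[THEN iffD2])

lemma span_span_insert_Un: "rg.span (rg.span (insert x I) \<union> S) = rg.span (I \<union> insert x S)"
proof
  have "insert x I \<subseteq> rg.span (I \<union> insert x S)" "S \<subseteq> rg.span (I \<union> insert x S)"
    using rg.span_superset[of "I \<union> insert x S"] by auto
  then show "rg.span (rg.span (insert x I) \<union> S) \<subseteq> rg.span (I \<union> insert x S)"
    by (intro rg.span_minimal Un_least) auto
  have "I \<union> insert x S \<subseteq> rg.span (insert x I) \<union> S" using rg.span_superset[of "insert x I"] by auto
  then show "rg.span (I \<union> insert x S) \<subseteq> rg.span (rg.span (insert x I) \<union> S)" by (rule rg.span_mono)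
qed

lemma prod_list_not_in_prime:
  "prime_id P \<Longrightarrow> (\<And>q. q \<in> set ps \<Longrightarrow> u q \<notin> P) \<Longrightarrow> prod_list (map u ps) \<notin> P"
  by (induction ps) (auto simp: prime_id_def)

text \<open>
  Noetherian induction: an ideal maximal among those containing no product of primes above them
  would be proper and not prime, and \<open>(a) + J\<close>, \<open>(b) + J\<close> with \<open>a b \<in> J\<close> would contain such
  products. The product of ideals is expressed through products of one chosen element per prime; a
  prime that is repeated in the list contributes a power of its element.
\<close>

lemma ideal_contains_prime_product:
  assumes n: "rg.noeth aa UNIV" and "rg.subspace J" "aa \<subseteq> J"
  shows "\<exists>ps. (\<forall>p\<in>set ps. prime_id p \<and> J \<subseteq> p) \<and>
              (\<forall>u. (\<forall>p\<in>set ps. u p \<in> p) \<longrightarrow> prod_list (map u ps) \<in> J)" (is "?P J")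
proof (rule ccontr)
  assume "\<not> ?P J"
  define C where "C = {J. rg.subspace J \<and> aa \<subseteq> J \<and> \<not> ?P J}"
  have "J \<in> C" using assms \<open>\<not> ?P J\<close> by (simp add: C_def)
  moreover have "rg.subspace H \<and> aa \<subseteq> H \<and> H \<subseteq> UNIV" if "H \<in> C" for H
    using that by (simp add: C_def)
  ultimately obtain M where M: "M \<in> C" and max: "\<forall>H\<in>C. M \<subseteq> H \<longrightarrow> H = M"
    using rg.noeth_max[OF n] by meson
  have sM: "rg.subspace M" "aa \<subseteq> M" and nP: "\<not> ?P M" using M by (auto simp: C_def)
  have "1 \<notin> M"
  proof
    assume "1 \<in> M"
    then have "?P M" by (intro exI[of _ "[]"]) auto
    then show False using nP by blast
  qed
  moreover have "\<not> prime_id M"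
  proof
    assume "prime_id M"
    then have "?P M" by (intro exI[of _ "[M]"]) auto
    then show False using nP by blast
  qed
  ultimately obtain a b where ab: "a * b \<in> M" "a \<notin> M" "b \<notin> M"
    using sM unfolding prime_id_def by blast
  have larger: "?P (rg.span (insert c M))" if "c \<notin> M" for c
  proof (rule ccontr)
    assume a: "\<not> ?P (rg.span (insert c M))"
    have "rg.span (insert c M) \<in> C" unfolding C_def using a sM rg.span_superset[of "insert c M"] by auto
    from max[rule_format, OF this] have "rg.span (insert c M) = M" using rg.span_superset[of "insert c M"] by auto
    then show False using that rg.span_superset[of "insert c M"] by auto
  qed
  obtain ps where ps: "\<And>p. p \<in> set ps \<Longrightarrow> prime_id p \<and> rg.span (insert a M) \<subseteq> p"
    and pp: "\<And>u. (\<forall>p\<in>set ps. u p \<in> p) \<Longrightarrow> prod_list (map u ps) \<in> rg.span (insert a M)"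
    using larger[OF ab(2)] by blast
  obtain qs where qs: "\<And>p. p \<in> set qs \<Longrightarrow> prime_id p \<and> rg.span (insert b M) \<subseteq> p"
    and qq: "\<And>u. (\<forall>p\<in>set qs. u p \<in> p) \<Longrightarrow> prod_list (map u qs) \<in> rg.span (insert b M)"
    using larger[OF ab(3)] by blast
  have "?P M"
  proof (intro exI[of _ "ps @ qs"] conjI ballI allI impI)
    fix p assume "p \<in> set (ps @ qs)"
    then show "prime_id p" using ps qs by auto
    show "M \<subseteq> p" using \<open>p \<in> set (ps @ qs)\<close> ps qs rg.span_superset by fastforce
  next
    fix u assume u: "\<forall>p\<in>set (ps @ qs). u p \<in> p"
    obtain c d where "prod_list (map u ps) - c * a \<in> M" "prod_list (map u qs) - d * b \<in> M"
      using pp[of u] qq[of u] u span_insert_ideal[OF sM(1)] by auto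
    moreover obtain v w where vw: "v = prod_list (map u ps) - c * a" "w = prod_list (map u qs) - d * b" by blast
    ultimately have "v \<in> M" "w \<in> M" by auto
    have "prod_list (map u (ps @ qs)) = (v + c * a) * (w + d * b)" using vw by simp
    also have "\<dots> = v * (w + d * b) + c * a * w + c * d * (a * b)" by (simp add: algebra_simps)
    also have "\<dots> \<in> M"
      by (intro rg.subspace_add sM(1) ideal_times(1)[OF sM(1) ab(1)] ideal_times(1)[OF sM(1) \<open>w \<in> M\<close>]
          ideal_times(2)[OF sM(1) \<open>v \<in> M\<close>])
    finally show "prod_list (map u (ps @ qs)) \<in> M" .
  qed
  then show False using nP by blast
qed

lemma min_primes_finite_below:
  assumes n: "rg.noeth aa UNIV" and J: "rg.subspace J" "aa \<subseteq> J"
  shows "finite {p. min_prime J p}"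
    and "prime_id P \<Longrightarrow> J \<subseteq> P \<Longrightarrow> \<exists>p. min_prime J p \<and> p \<subseteq> P"
proof -
  obtain ps where ps: "\<And>p. p \<in> set ps \<Longrightarrow> prime_id p \<and> J \<subseteq> p"
    and pr: "\<And>u. (\<forall>p\<in>set ps. u p \<in> p) \<Longrightarrow> prod_list (map u ps) \<in> J"
    using ideal_contains_prime_product[OF n J] by blast
  have contains: "\<exists>p\<in>set ps. p \<subseteq> P" if "prime_id P" "J \<subseteq> P" for P
  proof (rule ccontr)
    assume "\<not> ?thesis"
    then have "\<forall>p\<in>set ps. \<exists>x. x \<in> p \<and> x \<notin> P" by blast
    from bchoice[OF this] obtain u where u: "\<forall>p\<in>set ps. u p \<in> p \<and> u p \<notin> P" by blast
    then have "prod_list (map u ps) \<notin> P" by (intro prod_list_not_in_prime[OF that(1)]) auto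
    then show False using pr[of u] u that(2) by blast
  qed
  have "{p. min_prime J p} \<subseteq> set ps"
  proof
    fix p assume "p \<in> {p. min_prime J p}"
    then have p: "min_prime J p" by simp
    then obtain q where "q \<in> set ps" "q \<subseteq> p" using contains unfolding min_prime_def by blast
    then show "p \<in> set ps" using p ps unfolding min_prime_def by blast
  qed
  then show "finite {p. min_prime J p}" using finite_subset by blast
  assume P: "prime_id P" "J \<subseteq> P"
  have ne: "{p \<in> set ps. p \<subseteq> P} \<noteq> {}" using contains[OF P] by blast
  then obtain p where p: "p \<in> {p \<in> set ps. p \<subseteq> P}" and
    min: "\<forall>q\<in>{p \<in> set ps. p \<subseteq> P}. q \<subseteq> p \<longrightarrow> p = q"
    using finite_has_minimal[OF _ ne] by auto
  have "min_prime J p" unfolding min_prime_def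
  proof (intro conjI allI impI)
    show "prime_id p" "J \<subseteq> p" using ps p by auto
    fix q assume q: "prime_id q \<and> J \<subseteq> q \<and> q \<subseteq> p"
    then obtain p' where "p' \<in> set ps" "p' \<subseteq> q" using contains by blast
    then show "q = p" using min q p by blast
  qed
  then show "\<exists>p. min_prime J p \<and> p \<subseteq> P" using p by blast
qed

text \<open>
  Suppose \<open>x \<in> p\<close>. Take primes above \<open>J\<close> whose product lies in \<open>J\<close> and choose from each prime other than \<open>p\<close> an
  element outside \<open>p\<close>, and \<open>x\<close> itself from \<open>p\<close>. In the resulting element of \<open>J\<close> every factor \<open>x\<close>
  can be cancelled, leaving a product of elements outside \<open>p \<supseteq> J\<close>.
\<close>

lemma regular_avoids_min_primes:
  assumes n: "rg.noeth aa UNIV" and J: "rg.subspace J" "aa \<subseteq> J"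
    and reg: "\<And>r. x * r \<in> J \<Longrightarrow> r \<in> J" and p: "min_prime J p"
  shows "x \<notin> p"
proof
  assume "x \<in> p"
  obtain ps where ps: "\<And>p. p \<in> set ps \<Longrightarrow> prime_id p \<and> J \<subseteq> p"
    and pr: "\<And>u. (\<forall>p\<in>set ps. u p \<in> p) \<Longrightarrow> prod_list (map u ps) \<in> J"
    using ideal_contains_prime_product[OF n J] by blast
  have "\<forall>q\<in>set ps. \<exists>y. q \<noteq> p \<longrightarrow> y \<in> q \<and> y \<notin> p"
    using p ps unfolding min_prime_def by blast
  from bchoice[OF this] obtain v where v: "\<And>q. q \<in> set ps \<Longrightarrow> q \<noteq> p \<Longrightarrow> v q \<in> q \<and> v q \<notin> p" by blast
  define u where "u q = (if q = p then x else v q)" for q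
  have pp: "prime_id p" "J \<subseteq> p" using p by (auto simp: min_prime_def)
  have *: "w * prod_list (map u qs) \<notin> J" if "set qs \<subseteq> set ps" "w \<notin> p" for w qs
    using that
  proof (induction qs arbitrary: w)
    case Nil
    then show ?case using pp by auto
  next
    case (Cons q qs)
    show ?case
    proof (cases "q = p")
      case True
      then have e: "w * prod_list (map u (q # qs)) = x * (w * prod_list (map u qs))"
        by (simp add: u_def mult.left_commute)
      have "w * prod_list (map u qs) \<notin> J" using Cons.prems by (intro Cons.IH) auto
      then show ?thesis unfolding e using reg by blast
    next
      case False
      then have "u q \<notin> p" using v[of q] Cons.prems(1) by (simp add: u_def)
      then have "w * u q \<notin> p" using Cons.prems(2) pp unfolding prime_id_def by blast
      then have "(w * u q) * prod_list (map u qs) \<notin> J" using Cons.prems(1) by (intro Cons.IH) auto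
      then show ?thesis by (simp add: mult.assoc)
    qed
  qed
  have "prod_list (map u ps) \<in> J" using v \<open>x \<in> p\<close> by (intro pr) (auto simp: u_def)
  then show False using *[of ps 1] pp by (auto simp: prime_id_def)
qed

section \<open>Krull's height theorem\<close>

text \<open>
  For a prime \<open>P\<close> these are the ideals contracted from the localization at \<open>P\<close>. Working with them
  replaces passing to the localization.
\<close>

definition saturated :: "'s::comm_ring_1 set \<Rightarrow> 's set \<Rightarrow> bool" where
  "saturated P K \<longleftrightarrow> rg.subspace K \<and> (\<forall>u r. u \<notin> P \<longrightarrow> u * r \<in> K \<longrightarrow> r \<in> K)"

definition stabilizes :: "(nat \<Rightarrow> 'c set) \<Rightarrow> bool" where
  "stabilizes K \<longleftrightarrow> (\<exists>N. \<forall>n\<ge>N. K n = K N)"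

text \<open>
  The contraction of the extension of \<open>J + (a)\<close> to the localization at \<open>P\<close>.
\<close>

definition sat_add :: "'s::comm_ring_1 set \<Rightarrow> 's set \<Rightarrow> 's \<Rightarrow> 's set" where
  "sat_add P J a = {r. \<exists>u c. u \<notin> P \<and> u * r - c * a \<in> J}"

lemma sat_addI: "u \<notin> P \<Longrightarrow> u * r - c * a \<in> J \<Longrightarrow> r \<in> sat_add P J a"
  by (auto simp: sat_add_def)

lemma saturated_sat_add:
  assumes P: "prime_id P" and J: "rg.subspace J"
  shows "saturated P (sat_add P J a)"
  unfolding saturated_def
proof (intro conjI allI impI)
  have one: "1 \<notin> P" and mult: "\<And>u v. u \<notin> P \<Longrightarrow> v \<notin> P \<Longrightarrow> u * v \<notin> P" using P by (auto simp: prime_id_def)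
  show "rg.subspace (sat_add P J a)"
  proof (rule rg.subspaceI)
    show "0 \<in> sat_add P J a" using one rg.subspace_0[OF J] by (intro sat_addI[of 1 _ _ 0]) auto
    fix r s assume "r \<in> sat_add P J a" "s \<in> sat_add P J a"
    then obtain u c v d where uv: "u \<notin> P" "u * r - c * a \<in> J" "v \<notin> P" "v * s - d * a \<in> J"
      by (auto simp: sat_add_def)
    have "u * v * (r + s) - (v * c + u * d) * a = v * (u * r - c * a) + u * (v * s - d * a)"
      by (simp add: algebra_simps)
    then show "r + s \<in> sat_add P J a" using uv J
      by (intro sat_addI[of "u * v" _ _ "v * c + u * d"]) (simp_all add: mult rg.subspace_add ideal_times(1))
  next
    fix e r assume "r \<in> sat_add P J a"
    then obtain u c where u: "u \<notin> P" "u * r - c * a \<in> J" by (auto simp: sat_add_def)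
    have "u * (e * r) - (e * c) * a = e * (u * r - c * a)" by (simp add: algebra_simps)
    then show "e * r \<in> sat_add P J a" using u J
      by (intro sat_addI[of u _ _ "e * c"]) (simp_all add: ideal_times(1))
  qed
  fix u r assume "u \<notin> P" "u * r \<in> sat_add P J a"
  then obtain v c where v: "v \<notin> P" "v * (u * r) - c * a \<in> J" by (auto simp: sat_add_def)
  then show "r \<in> sat_add P J a" using mult[OF v(1) \<open>u \<notin> P\<close>]
    by (intro sat_addI[of "v * u" _ r c]) (auto simp: mult.assoc)
qed

lemma sat_add_superset:
  assumes P: "prime_id P" and J: "rg.subspace J"
  shows "J \<subseteq> sat_add P J a" "a \<in> sat_add P J a"
proof -
  have one: "1 \<notin> P" using P by (auto simp: prime_id_def)
  show "J \<subseteq> sat_add P J a" using one by (auto intro: sat_addI[of 1 _ _ 0])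
  show "a \<in> sat_add P J a" using one rg.subspace_0[OF J] by (intro sat_addI[of 1 _ _ 1]) auto
qed

lemma sat_add_mono: "J \<subseteq> J' \<Longrightarrow> sat_add P J a \<subseteq> sat_add P J' a"
  unfolding sat_add_def by blast

text \<open>
  This is the statement that a local Noetherian ring of dimension \<open>0\<close>, here the localization at \<open>P\<close>
  modulo \<open>A\<close>, is Artinian. Let \<open>B\<close> be maximal among the ideals above \<open>A\<close> over which a non-stationary
  chain exists. Below \<open>P\<close> there is no prime above \<open>A\<close> except \<open>P\<close>, so \<open>B\<close> is not prime. With \<open>a b \<in> B\<close>,
  the chains \<open>K n + (a)\<close> and \<open>(K n : a)\<close> lie over \<open>B + (a)\<close> and \<open>B + (b)\<close> and hence are stationary,
  and together they determine \<open>K n\<close>.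
\<close>

lemma saturated_dcc:
  assumes n: "rg.noeth aa UNIV" and P: "prime_id P"
    and A: "rg.subspace A" "aa \<subseteq> A" "\<And>p. prime_id p \<Longrightarrow> A \<subseteq> p \<Longrightarrow> p \<subseteq> P \<Longrightarrow> p = P"
    and K: "\<And>n. saturated P (K n)" "\<And>n. A \<subseteq> K n" "decseq K"
  shows "stabilizes K"
proof (rule ccontr)
  assume nK: "\<not> stabilizes K"
  define bad where "bad B K \<longleftrightarrow> (\<forall>n. saturated P (K n)) \<and> (\<forall>n. B \<subseteq> K n) \<and> decseq K \<and> \<not> stabilizes K"
    for B and K :: "nat \<Rightarrow> 'a set"
  define C where "C = {B. rg.subspace B \<and> A \<subseteq> B \<and> (\<exists>K. bad B K)}"
  have "A \<in> C" using A K nK by (auto simp: C_def bad_def)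
  moreover have "rg.subspace H \<and> aa \<subseteq> H \<and> H \<subseteq> UNIV" if "H \<in> C" for H
    using that A(2) by (auto simp: C_def)
  ultimately obtain B where B: "B \<in> C" and max: "\<forall>H\<in>C. B \<subseteq> H \<longrightarrow> H = B"
    using rg.noeth_max[OF n] by meson
  then obtain K where sB: "rg.subspace B" "A \<subseteq> B" and K: "\<And>n. saturated P (K n)" "\<And>n. B \<subseteq> K n" "decseq K"
    and nK: "\<not> stabilizes K" by (auto simp: C_def bad_def)
  have sK: "rg.subspace (K n)" for n using K(1) by (simp add: saturated_def)
  have sat: "r \<in> K n" if "u \<notin> P" "u * r \<in> K n" for u r n using K(1) that by (auto simp: saturated_def)
  have full: "K n = UNIV" if "u \<in> K n" "u \<notin> P" for u n
  proof -
    have "r \<in> K n" for r using sat[OF that(2), of r n] that(1) sK by (simp add: ideal_times)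
    then show ?thesis by auto
  qed
  have dec: "K n \<subseteq> K m" if "m \<le> n" for m n using K(3) that by (simp add: decseq_def)
  have "\<exists>N. K N \<noteq> UNIV" using nK unfolding stabilizes_def by metis
  then obtain N where N: "K N \<noteq> UNIV" by blast
  have below: "K n \<subseteq> P" if "n \<ge> N" for n using full[of _ n] dec[OF that] N by blast
  have BP: "B \<subseteq> P" using below[of N] K(2)[of N] by blast
  have "B \<noteq> P"
  proof
    assume "B = P"
    then have "K n = P" if "n \<ge> N" for n using below[OF that] K(2)[of n] by blast
    then have "stabilizes K" unfolding stabilizes_def by (intro exI[of _ N]) simp
    then show False using nK by blast
  qed
  then have "\<not> prime_id B" using A(3) sB BP by blast
  moreover have "1 \<notin> B" using BP P by (auto simp: prime_id_def)
  ultimately obtain a b where ab: "a * b \<in> B" "a \<notin> B" "b \<notin> B" using sB unfolding prime_id_def by blast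
  have stab: "stabilizes K'" if "c \<notin> B" "\<And>n. saturated P (K' n)" "\<And>n. B \<subseteq> K' n" "\<And>n. c \<in> K' n" "decseq K'" for c K'
  proof (rule ccontr)
    assume "\<not> stabilizes K'"
    moreover have "rg.span (insert c B) \<subseteq> K' n" for n
      using that(2,3,4) by (intro rg.span_minimal) (auto simp: saturated_def)
    ultimately have "bad (rg.span (insert c B)) K'" using that by (simp add: bad_def)
    then have "rg.span (insert c B) \<in> C" using sB rg.span_superset[of "insert c B"] by (auto simp: C_def)
    from max[rule_format, OF this] show False using that(1) rg.span_superset[of "insert c B"] by auto
  qed
  \<comment> \<open>the image and the kernel part of multiplication by \<open>a\<close>: up to a factor outside \<open>P\<close>, an element
    of \<open>K M\<close> is congruent modulo \<open>K n\<close> to some \<open>c * a\<close>, and then \<open>c\<close> lies in \<open>(K M : a)\<close>\<close>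
  define K1 where "K1 n = sat_add P (K n) a" for n
  define K2 where "K2 n = {r. r * a \<in> K n}" for n
  have "stabilizes K1"
  proof (rule stab[OF ab(2)])
    fix n
    show "saturated P (K1 n)" unfolding K1_def by (rule saturated_sat_add[OF P sK])
    show "B \<subseteq> K1 n" using K(2)[of n] sat_add_superset[OF P sK[of n], of a] by (auto simp: K1_def)
    show "a \<in> K1 n" using sat_add_superset[OF P sK[of n], of a] by (auto simp: K1_def)
  next
    show "decseq K1" unfolding decseq_def K1_def using dec sat_add_mono by blast
  qed
  moreover have "stabilizes K2"
  proof (rule stab[OF ab(3)])
    fix n
    have "rg.subspace (K2 n)" unfolding K2_def
      using sK[of n] by (intro rg.subspaceI) (simp_all add: rg.subspace_0 rg.subspace_add ideal_times(1) distrib_right mult.assoc)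
    moreover have "r \<in> K2 n" if "u \<notin> P" "u * r \<in> K2 n" for u r
      using sat[OF that(1), of "r * a" n] that(2) by (simp add: K2_def mult.assoc)
    ultimately show "saturated P (K2 n)" unfolding saturated_def by blast
    show "B \<subseteq> K2 n" using K(2)[of n] sK[of n] by (auto simp: K2_def ideal_times(2))
    show "b \<in> K2 n" using K(2)[of n] ab(1) by (auto simp: K2_def mult.commute)
  next
    show "decseq K2" unfolding decseq_def K2_def using dec by blast
  qed
  ultimately obtain N1 N2 where N12: "\<And>n. n \<ge> N1 \<Longrightarrow> K1 n = K1 N1" "\<And>n. n \<ge> N2 \<Longrightarrow> K2 n = K2 N2"
    unfolding stabilizes_def by blast
  define M where "M = max N1 N2"
  have "K n = K M" if "n \<ge> M" for n
  proof
    show "K n \<subseteq> K M" using dec that by simp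
    show "K M \<subseteq> K n"
    proof
      fix r assume r: "r \<in> K M"
      then have "r \<in> K1 M" using sat_add_superset(1)[OF P sK[of M], of a] by (auto simp: K1_def)
      then have "r \<in> K1 n" using N12(1)[of M] N12(1)[of n] that by (simp add: M_def)
      then obtain u c where u: "u \<notin> P" "u * r - c * a \<in> K n" by (auto simp: K1_def sat_add_def)
      then have "u * r - (u * r - c * a) \<in> K M" using dec[OF that] r sK[of M]
        by (meson rg.subspace_diff ideal_times(1) subsetD)
      then have "c \<in> K2 M" by (simp add: K2_def)
      then have "c \<in> K2 n" using N12(2)[of M] N12(2)[of n] that by (simp add: M_def)
      then have "(u * r - c * a) + c * a \<in> K n" using u(2) sK[of n] unfolding K2_def
        by (intro rg.subspace_add) auto
      then show "r \<in> K n" using sat[OF u(1)] by simp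
    qed
  qed
  then have "stabilizes K" unfolding stabilizes_def by blast
  then show False using nK by blast
qed

text \<open>
  Nakayama's lemma over the localization at \<open>P\<close>, with denominators cleared. The proof eliminates one
  generator at a time: the coefficient \<open>u - c x\<close> of \<open>g x\<close> in its own relation lies outside \<open>P\<close>, so \<open>g x\<close>
  can be removed from the relations of the other generators.
\<close>

lemma (in lmod) nakayama_prime:
  assumes P: "prime_id P" and "finite S" "local.subspace H"
    and "\<And>a. a \<in> S \<Longrightarrow> \<exists>u c. u \<notin> P \<and> (\<forall>b\<in>S. c b \<in> P) \<and> u *s g a - (\<Sum>b\<in>S. c b *s g b) \<in> H"
  shows "\<exists>w. w \<notin> P \<and> (\<forall>a\<in>S. w *s g a \<in> H)"
  using assms(2,4)
proof (induction S rule: finite_induct)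
  case empty
  then show ?case using P by (auto simp: prime_id_def)
next
  case (insert x S)
  note H = \<open>local.subspace H\<close> and PI = prime_id_ideal[OF P]
  have mult: "\<And>u v. u \<notin> P \<Longrightarrow> v \<notin> P \<Longrightarrow> u * v \<notin> P" using P by (auto simp: prime_id_def)
  obtain u c where u: "u \<notin> P" "\<forall>b\<in>insert x S. c b \<in> P" "u *s g x - (\<Sum>b\<in>insert x S. c b *s g b) \<in> H"
    using insert.prems[of x] by blast
  define v where "v = u - c x"
  have vP: "v \<notin> P"
  proof
    assume "v \<in> P"
    then have "v + c x \<in> P" using u(2) PI by (intro rg.subspace_add) auto
    then show False using u(1) by (simp add: v_def)
  qed
  have vx: "v *s g x - (\<Sum>b\<in>S. c b *s g b) \<in> H"
    using u(3) insert.hyps by (simp add: v_def algebra_simps)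
  have "\<exists>w. w \<notin> P \<and> (\<forall>a\<in>S. w *s g a \<in> H)"
  proof (rule insert.IH)
    fix a assume "a \<in> S"
    then obtain u' d where d: "u' \<notin> P" "\<forall>b\<in>insert x S. d b \<in> P" "u' *s g a - (\<Sum>b\<in>insert x S. d b *s g b) \<in> H"
      using insert.prems[of a] by blast
    have 1: "u' *s g a - d x *s g x - (\<Sum>b\<in>S. d b *s g b) \<in> H"
      using d(3) insert.hyps by (simp add: algebra_simps)
    have "v *s (u' *s g a - d x *s g x - (\<Sum>b\<in>S. d b *s g b)) + d x *s (v *s g x - (\<Sum>b\<in>S. c b *s g b)) \<in> H"
      using 1 vx H by (intro subspace_add subspace_scale)
    also have "v *s (u' *s g a - d x *s g x - (\<Sum>b\<in>S. d b *s g b)) + d x *s (v *s g x - (\<Sum>b\<in>S. c b *s g b))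
      = (v * u') *s g a - (\<Sum>b\<in>S. (v * d b + d x * c b) *s g b)"
      by (simp add: scale_right_diff_distrib scale_left_distrib sum.distrib scale_sum_right mult.commute[of "d x" v])
    finally show "\<exists>u c. u \<notin> P \<and> (\<forall>b\<in>S. c b \<in> P) \<and> u *s g a - (\<Sum>b\<in>S. c b *s g b) \<in> H"
      using mult[OF vP d(1)] d(2) u(2) PI
      by (intro exI[of _ "v * u'"] exI[of _ "\<lambda>b. v * d b + d x * c b"]) (auto intro!: rg.subspace_add ideal_times(1))
  qed
  then obtain w where w: "w \<notin> P" "\<forall>a\<in>S. w *s g a \<in> H" by blast
  have "w *s (v *s g x - (\<Sum>b\<in>S. c b *s g b)) + (\<Sum>b\<in>S. c b *s (w *s g b)) \<in> H"
    using w by (intro subspace_add[OF H] subspace_scale[OF H vx] subspace_sum[OF H] subspace_scale[OF H, of "w *s g _"]) auto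
  also have "w *s (v *s g x - (\<Sum>b\<in>S. c b *s g b)) + (\<Sum>b\<in>S. c b *s (w *s g b)) = (w * v) *s g x"
    by (simp add: scale_right_diff_distrib scale_sum_right mult.commute)
  finally have wx: "(w * v) *s g x \<in> H" .
  have "(w * v) *s g a \<in> H" if "a \<in> S" for a
    using subspace_scale[OF H, of "w *s g a" v] w that by (simp add: mult.commute)
  then show ?case using wx mult[OF w(1) vP] by (intro exI[of _ "w * v"]) auto
qed

text \<open>
  Otherwise \<open>P\<close> would be minimal over \<open>q' + (x)\<close>. For \<open>y \<in> q\<close> outside of \<open>q'\<close> the symbolic powers of
  \<open>y\<close> modulo \<open>q'\<close> would then be stationary modulo \<open>x\<close> by the descending chain condition above, hence
  stationary by Nakayama, which is impossible in the domain modulo \<open>q'\<close>.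
\<close>

lemma principal_ideal_theorem:
  assumes n: "rg.noeth aa UNIV" and pr: "prime_id q'" "prime_id q" "prime_id P"
    and c: "aa \<subseteq> q'" "q' \<subset> q" "q \<subset> P" and x: "x \<in> P"
  shows "\<exists>p. prime_id p \<and> q' \<subseteq> p \<and> x \<in> p \<and> p \<subset> P"
proof (rule ccontr)
  assume "\<not> ?thesis"
  then have min: "\<And>p. prime_id p \<Longrightarrow> q' \<subseteq> p \<Longrightarrow> x \<in> p \<Longrightarrow> p \<subseteq> P \<Longrightarrow> p = P" by blast
  have xq: "x \<notin> q" using min[of q] pr c by blast
  obtain y where y: "y \<in> q" "y \<notin> q'" using c by blast
  note q'I = prime_id_ideal[OF pr(1)] and qI = prime_id_ideal[OF pr(2)]
  \<comment> \<open>the symbolic powers of \<open>(y)\<close> at \<open>q\<close>, modulo \<open>q'\<close>\<close>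
  define L where "L n = sat_add q q' (y ^ n)" for n
  have Ls: "saturated q (L n)" for n unfolding L_def by (rule saturated_sat_add[OF pr(2) q'I])
  have LI: "rg.subspace (L n)" for n using Ls by (simp add: saturated_def)
  have Lq': "q' \<subseteq> L n" "y ^ n \<in> L n" for n unfolding L_def using sat_add_superset[OF pr(2) q'I] by auto
  have Lsat: "u \<notin> q \<Longrightarrow> u * r \<in> L n \<Longrightarrow> r \<in> L n" for u r n using Ls[of n] by (auto simp: saturated_def)
  have Lstep: "L (Suc n) \<subseteq> L n" for n
  proof
    fix r assume "r \<in> L (Suc n)"
    then obtain u c where "u \<notin> q" "u * r - (c * y) * y ^ n \<in> q'" by (auto simp: L_def sat_add_def mult.assoc)
    then show "r \<in> L n" unfolding L_def by (rule sat_addI)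
  qed
  define K where "K n = sat_add P (L n) x" for n
  have "stabilizes K"
  proof (rule saturated_dcc[OF n pr(3)])
    let ?A = "rg.span (insert x q')"
    show "rg.subspace ?A" by simp
    show "aa \<subseteq> ?A" using c(1) rg.span_superset[of "insert x q'"] by blast
    show "p = P" if "prime_id p" "?A \<subseteq> p" "p \<subseteq> P" for p
      using that rg.span_superset[of "insert x q'"] by (intro min) auto
    show "saturated P (K n)" for n unfolding K_def by (rule saturated_sat_add[OF pr(3) LI])
    then have "rg.subspace (K n)" for n by (simp add: saturated_def)
    then show "?A \<subseteq> K n" for n
      using sat_add_superset[OF pr(3) LI[of n], of x] Lq'(1)[of n]
      by (intro rg.span_minimal) (auto simp: K_def)
    show "decseq K" unfolding K_def by (intro decseq_SucI sat_add_mono Lstep)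
  qed
  then obtain n where Kn: "K n = K (Suc n)" unfolding stabilizes_def by (metis le_SucI order_refl)
  obtain S where S: "finite S" "L n = rg.span (aa \<union> S)"
    using n LI[of n] Lq'(1)[of n] c(1) unfolding rg.noeth_def by blast
  have aaL: "aa \<subseteq> L (Suc n)" using c(1) Lq'(1) by blast
  \<comment> \<open>\<open>K n = K (Suc n)\<close> gives \<open>L n \<subseteq> L (Suc n) + x L n\<close> locally at \<open>P\<close>, because \<open>x\<close> lies outside \<open>q\<close>
    and \<open>L n\<close> is saturated at \<open>q\<close>\<close>
  have "\<exists>w. w \<notin> P \<and> (\<forall>a\<in>S. w * a \<in> L (Suc n))"
  proof (rule rg.nakayama_prime[where g = "\<lambda>x. x", OF pr(3) S(1) LI])
    fix a assume "a \<in> S"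
    then have aL: "a \<in> L n" using S(2) rg.span_superset[of "aa \<union> S"] by blast
    then have "a \<in> K (Suc n)" using Kn sat_add_superset(1)[OF pr(3) LI[of n], of x] by (auto simp: K_def)
    then obtain u c where u: "u \<notin> P" "u * a - c * x \<in> L (Suc n)" by (auto simp: K_def sat_add_def)
    have f: "u * a - c * x \<in> L n" using u(2) Lstep by blast
    have "u * a - (u * a - c * x) \<in> L n"
      by (rule rg.subspace_diff[OF LI ideal_times(1)[OF LI aL] f])
    then have "x * c \<in> L n" by (simp add: mult.commute)
    then have "c \<in> L n" using Lsat[OF xq] by blast
    then obtain b s where bs: "b \<in> rg.span aa" "s \<in> rg.span S" "c = b + s" 
      unfolding S(2) rg.span_Un by blast
    then obtain e where e: "s = (\<Sum>t\<in>S. e t * t)" using rg.span_finite[OF S(1)] by auto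
    have "b \<in> L (Suc n)" using bs(1) rg.span_minimal[OF aaL LI] by blast
    then have "(u * a - c * x) + b * x \<in> L (Suc n)" using u(2) by (intro rg.subspace_add[OF LI] ideal_times(2)[OF LI])
    also have "(u * a - c * x) + b * x = u * a - (\<Sum>t\<in>S. (e t * x) * t)"
      by (simp add: bs(3) e algebra_simps sum_distrib_left sum_distrib_right)
    finally show "\<exists>u c. u \<notin> P \<and> (\<forall>b\<in>S. c b \<in> P) \<and> u * a - (\<Sum>b\<in>S. c b * b) \<in> L (Suc n)"
      using u(1) x prime_id_ideal[OF pr(3)]
      by (intro exI[of _ u] exI[of _ "\<lambda>t. e t * x"]) (auto intro: ideal_times(1))
  qed
  then obtain w where w: "w \<notin> P" "\<And>a. a \<in> S \<Longrightarrow> w * a \<in> L (Suc n)" by blast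
  then have "w \<notin> q" using c by blast
  then have "S \<subseteq> L (Suc n)" using w(2) Lsat by blast
  then have "L n \<subseteq> L (Suc n)" unfolding S(2) using aaL by (intro rg.span_minimal LI) auto
  then have "y ^ n \<in> L (Suc n)" using Lq'(2) by blast
  then obtain u d where u: "u \<notin> q" "u * y ^ n - d * y ^ Suc n \<in> q'" by (auto simp: L_def sat_add_def)
  have "u * y ^ n - d * y ^ Suc n = (u - d * y) * y ^ n" by (simp add: algebra_simps)
  then have "u - d * y \<in> q'" using u(2) prime_id_pow[OF pr(1), of y n] y(2) pr(1) unfolding prime_id_def by metis
  then have "(u - d * y) + d * y \<in> q" using c y(1) by (intro rg.subspace_add[OF qI] ideal_times(1)[OF qI]) auto
  then show False using u(1) by simp
qed

definition prime_chain :: "nat \<Rightarrow> (nat \<Rightarrow> 's::comm_ring_1 set) \<Rightarrow> bool" where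
  "prime_chain n p \<longleftrightarrow> (\<forall>i\<le>n. prime_id (p i)) \<and> (\<forall>i<n. p i \<subset> p (Suc i))"

lemma prime_chain_mono: "prime_chain n p \<Longrightarrow> i \<le> j \<Longrightarrow> j \<le> n \<Longrightarrow> p i \<subseteq> p j"
proof (induction j)
  case (Suc j)
  then show ?case by (cases "i = Suc j") (auto simp: prime_chain_def, metis Suc_leD Suc_le_lessD psubset_imp_subset subsetD le_SucE)
qed simp

text \<open>
  The principal ideal theorem applied along the chain from the top downwards pushes \<open>y\<close> into ever
  smaller members.
\<close>

lemma prime_chain_through:
  assumes n: "rg.noeth aa UNIV" 
  shows "prime_chain (Suc n) p \<Longrightarrow> aa \<subseteq> p 0 \<Longrightarrow> y \<in> p (Suc n) \<Longrightarrow>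
    \<exists>p'. prime_chain (Suc n) p' \<and> p' 0 = p 0 \<and> p' (Suc n) = p (Suc n) \<and> y \<in> p' 1"
proof (induction n arbitrary: p)
  case 0
  then show ?case by auto
next
  case (Suc n)
  have ch: "prime_chain (Suc n) p" and pr: "\<And>i. i \<le> Suc (Suc n) \<Longrightarrow> prime_id (p i)" 
    and st: "\<And>i. i < Suc (Suc n) \<Longrightarrow> p i \<subset> p (Suc i)" using Suc.prems(1) by (auto simp: prime_chain_def)
  have "\<exists>q. prime_id q \<and> p n \<subset> q \<and> y \<in> q \<and> q \<subset> p (Suc (Suc n))"
  proof (cases "y \<in> p (Suc n)")
    case True
    then show ?thesis using pr[of "Suc n"] st[of n] st[of "Suc n"] by (intro exI[of _ "p (Suc n)"]) simp
  next
    case False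
    have "aa \<subseteq> p n" using prime_chain_mono[OF Suc.prems(1), of 0 n] Suc.prems(2) by auto
    then obtain q where q: "prime_id q" "p n \<subseteq> q" "y \<in> q" "q \<subset> p (Suc (Suc n))"
      using principal_ideal_theorem[OF n, of "p n" "p (Suc n)" "p (Suc (Suc n))" y] pr st Suc.prems(3) by auto
    moreover have "y \<notin> p n" using False st[of n] by auto
    ultimately show ?thesis by blast
  qed
  then obtain q where q: "prime_id q" "p n \<subset> q" "y \<in> q" "q \<subset> p (Suc (Suc n))" by blast
  have "prime_chain (Suc n) (p(Suc n := q))" using pr st q by (auto simp: prime_chain_def less_Suc_eq)
  from Suc.IH[OF this] obtain p' where p': "prime_chain (Suc n) p'" "p' 0 = p 0" "p' (Suc n) = q" "y \<in> p' 1"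
    using Suc.prems(2) q(3) by auto
  let ?p = "p'(Suc (Suc n) := p (Suc (Suc n)))"
  have "prime_chain (Suc (Suc n)) ?p" using p' q pr by (auto simp: prime_chain_def less_Suc_eq le_Suc_eq)
  moreover have "?p 0 = p 0" "?p (Suc (Suc n)) = p (Suc (Suc n))" "y \<in> ?p 1" using p' by auto
  ultimately show ?case by blast
qed

text \<open>
  Krull's height theorem. A chain passing through the first generator at height \<open>1\<close> leaves a chain
  of length \<open>n - 1\<close> above it, to which induction over the generators applies.
\<close>

lemma height_le_generators:
  assumes n: "rg.noeth aa UNIV" 
  shows "prime_chain n p \<Longrightarrow> aa \<subseteq> p 0 \<Longrightarrow> set ys \<subseteq> p n \<Longrightarrow>
    (\<And>q. prime_id q \<Longrightarrow> p 0 \<subseteq> q \<Longrightarrow> set ys \<subseteq> q \<Longrightarrow> q \<subseteq> p n \<Longrightarrow> q = p n) \<Longrightarrow> n \<le> length ys"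
proof (induction ys arbitrary: n p)
  case Nil
  show ?case
  proof (rule ccontr)
    assume "\<not> ?case"
    then have n0: "0 < n" by simp
    then have "p 0 \<subset> p 1" "p 1 \<subseteq> p n" "prime_id (p 0)"
      using Nil.prems(1) prime_chain_mono[OF Nil.prems(1), of 1 n] by (auto simp: prime_chain_def)
    then show False using Nil.prems(4)[of "p 0"] by auto
  qed
next
  case (Cons y ys)
  show ?case
  proof (cases n)
    case (Suc k)
    obtain p' where p': "prime_chain (Suc k) p'" "p' 0 = p 0" "p' (Suc k) = p n" "y \<in> p' 1"
      using prime_chain_through[OF n, of k p y] Cons.prems Suc by auto
    have m: "p' 0 \<subseteq> p' 1" using prime_chain_mono[OF p'(1), of 0 1] by simp
    have "k \<le> length ys"
    proof (rule Cons.IH[of k "\<lambda>i. p' (Suc i)"])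
      show "prime_chain k (\<lambda>i. p' (Suc i))" using p'(1) by (auto simp: prime_chain_def)
      show "aa \<subseteq> p' (Suc 0)" using m p'(2) Cons.prems(2) by auto
      show "set ys \<subseteq> p' (Suc k)" using p'(3) Cons.prems(3) by auto
      fix q assume q: "prime_id q" "p' (Suc 0) \<subseteq> q" "set ys \<subseteq> q" "q \<subseteq> p' (Suc k)"
      then have "p 0 \<subseteq> q" "set (y # ys) \<subseteq> q" using m p'(2,4) by auto
      then show "q = p' (Suc k)" using q p'(3) Cons.prems(4)[of q] by simp
    qed
    then show ?thesis using Suc by simp
  qed simp
qed

section \<open>Parameter sequences in local rings\<close>

text \<open>
  Each member avoids all minimal primes of the ideal generated so far, so that the height grows
  in every step. In a local ring such a sequence inside the maximal ideal is part of a
  system of parameters.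
\<close>

definition param_seq :: "'s::comm_ring_1 set \<Rightarrow> 's list \<Rightarrow> bool" where
  "param_seq aa ys \<longleftrightarrow>
     (\<forall>i<length ys. \<forall>p. min_prime (rg.span (aa \<union> set (take i ys))) p \<longrightarrow> ys ! i \<notin> p)"

lemma prime_chain_of_param_seq:
  assumes n: "rg.noeth aa UNIV" and ys: "param_seq aa ys"
  shows "k \<le> length ys \<Longrightarrow> min_prime (rg.span (aa \<union> set (take k ys))) P \<Longrightarrow>
    \<exists>p. prime_chain k p \<and> aa \<subseteq> p 0 \<and> p k = P"
proof (induction k arbitrary: P)
  case 0
  then show ?case using rg.span_superset[of aa]
    by (intro exI[of _ "\<lambda>_. P"]) (auto simp: prime_chain_def min_prime_def)
next
  case (Suc k)
  let ?J = "\<lambda>k. rg.span (aa \<union> set (take k ys))"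
  have take: "set (take (Suc k) ys) = insert (ys ! k) (set (take k ys))"
    using Suc.prems(1) by (simp add: take_Suc_conv_app_nth)
  have "?J k \<subseteq> ?J (Suc k)" unfolding take by (intro rg.span_mono) auto
  then have P: "prime_id P" "?J k \<subseteq> P" "ys ! k \<in> P"
    using Suc.prems(2) rg.span_superset[of "aa \<union> set (take (Suc k) ys)"] unfolding take min_prime_def by auto
  have "aa \<subseteq> ?J k" using rg.span_superset[of "aa \<union> set (take k ys)"] by auto
  then obtain q where q: "min_prime (?J k) q" "q \<subseteq> P"
    using min_primes_finite_below(2)[OF n _ _ P(1,2)] by auto
  have "ys ! k \<notin> q" using q(1) ys Suc.prems(1) by (simp add: param_seq_def)
  then have "q \<subset> P" using q(2) P(3) by blast
  obtain p where p: "prime_chain k p" "aa \<subseteq> p 0" "p k = q" using Suc.IH[OF _ q(1)] Suc.prems(1) by auto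
  have "prime_chain (Suc k) (p(Suc k := P))"
    using p P(1) \<open>q \<subset> P\<close> by (auto simp: prime_chain_def less_Suc_eq le_Suc_eq)
  moreover have "aa \<subseteq> (p(Suc k := P)) 0" "(p(Suc k := P)) (Suc k) = P" using p by auto
  ultimately show ?case by blast
qed

text \<open>
  The local ring \<open>S / aa\<close> with maximal ideal \<open>mm / aa\<close>, where \<open>S\<close> is the ring formed by the whole type.
  Ideals of the local ring are represented by ideals of \<open>S\<close> above \<open>aa\<close>. The residue class rings that
  occur are then all quotients of one ring, and passing from one to the next only enlarges \<open>aa\<close>.
\<close>

locale local_base =
  fixes aa mm :: "'a::comm_ring_1 set"
  assumes noeth_aa: "rg.noeth aa UNIV" and aa_ideal: "rg.subspace aa" and mm_ideal: "rg.subspace mm"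
    and aa_mm: "aa \<subseteq> mm" and one_mm: "1 \<notin> mm"
    and unit_mod: "w \<notin> mm \<Longrightarrow> \<exists>v. v * w - 1 \<in> aa"
begin

lemma ideal_in_mm: "rg.subspace J \<Longrightarrow> aa \<subseteq> J \<Longrightarrow> 1 \<notin> J \<Longrightarrow> J \<subseteq> mm"
proof
  fix w assume J: "rg.subspace J" "aa \<subseteq> J" "1 \<notin> J" and w: "w \<in> J"
  show "w \<in> mm"
  proof (rule ccontr)
    assume "w \<notin> mm"
    then obtain v where "v * w - 1 \<in> aa" using unit_mod by blast
    then have f: "v * w - 1 \<in> J" using J(2) by blast
    have "v * w - (v * w - 1) \<in> J" by (rule rg.subspace_diff[OF J(1) ideal_times(1)[OF J(1) w] f])
    then show False using J(3) by simp
  qed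
qed

lemma prime_in_mm: "prime_id p \<Longrightarrow> aa \<subseteq> p \<Longrightarrow> p \<subseteq> mm"
  by (intro ideal_in_mm) (auto simp: prime_id_def)

lemma mm_prime: "prime_id mm"
  unfolding prime_id_def
proof (intro conjI allI impI mm_ideal one_mm)
  fix a b assume ab: "a * b \<in> mm"
  show "a \<in> mm \<or> b \<in> mm"
  proof (rule ccontr)
    assume nab: "\<not> (a \<in> mm \<or> b \<in> mm)"
    then obtain v where v: "v * a - 1 \<in> mm" using unit_mod aa_mm by blast
    have "v * (a * b) - b * (v * a - 1) \<in> mm"
      by (rule rg.subspace_diff[OF mm_ideal ideal_times(1)[OF mm_ideal ab] ideal_times(1)[OF mm_ideal v]])
    then show False using nab by (simp add: algebra_simps)
  qed
qed

text \<open>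
  A prime \<open>q\<close> contains \<open>x + y ^ j\<close> for at most one \<open>j \<ge> 1\<close>: the difference of two such elements is
  \<open>y ^ j\<close> times the unit \<open>1 - y ^ (k - j)\<close>, so \<open>q\<close> would contain \<open>y\<close> and then \<open>x\<close>. Finitely many primes
  therefore leave infinitely many exponents.
\<close>

lemma shift_avoids_primes:
  assumes Q: "finite Q" "\<And>q. q \<in> Q \<Longrightarrow> prime_id q \<and> aa \<subseteq> q"
    and y: "y \<in> mm" and xy: "\<And>q. q \<in> Q \<Longrightarrow> \<not> (x \<in> q \<and> y \<in> q)"
  shows "\<exists>j\<ge>1. \<forall>q\<in>Q. x + y ^ j \<notin> q"
proof -
  define B where "B q = {j. j \<ge> 1 \<and> x + y ^ j \<in> q}" for q
  have no_two: False if q: "q \<in> Q" and jk: "j \<in> B q" "k \<in> B q" "j < k" for q j k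
  proof -
    note qI = prime_id_ideal[of q]
    have pq: "prime_id q" "aa \<subseteq> q" using Q(2)[OF q] by auto
    have "(x + y ^ j) - (x + y ^ k) \<in> q" using jk pq by (intro rg.subspace_diff qI) (auto simp: B_def)
    moreover have "(x + y ^ j) - (x + y ^ k) = y ^ j * (1 - y ^ (k - j))"
      using jk(3) by (simp add: algebra_simps power_add[symmetric])
    ultimately have "y ^ j \<in> q \<or> 1 - y ^ (k - j) \<in> q" using pq(1) unfolding prime_id_def by metis
    moreover have "y \<notin> q"
    proof
      assume "y \<in> q"
      have "y ^ j = y * y ^ (j - 1)" using jk(1) by (auto simp: B_def power_eq_if)
      then have "y ^ j \<in> q" using \<open>y \<in> q\<close> ideal_times(2)[OF qI[OF pq(1)]] by simp
      then have "(x + y ^ j) - y ^ j \<in> q" using jk(1) pq by (intro rg.subspace_diff qI) (auto simp: B_def)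
      then show False using xy[OF q] \<open>y \<in> q\<close> by simp
    qed
    ultimately have "1 - y ^ (k - j) \<in> mm" using prime_id_pow[OF pq(1)] prime_in_mm[OF pq] by blast
    moreover have "y ^ (k - j) \<in> mm"
    proof -
      have "y ^ (k - j) = y * y ^ (k - j - 1)" using jk(3) by (simp add: power_eq_if)
      then show ?thesis using y ideal_times(2)[OF mm_ideal] by simp
    qed
    ultimately have "(1 - y ^ (k - j)) + y ^ (k - j) \<in> mm" by (rule rg.subspace_add[OF mm_ideal])
    then show False using one_mm by simp
  qed
  have "finite (B q)" if "q \<in> Q" for q
  proof (cases "B q = {}")
    case False
    then obtain j where j: "j \<in> B q" by blast
    then have "B q \<subseteq> {j}" using no_two[OF that] by (metis insertI1 linorder_neqE_nat subsetI)
    then show ?thesis using finite_subset by blast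
  qed simp
  then have "finite (insert 0 (\<Union>q\<in>Q. B q))" using Q(1) by blast
  then obtain j where "j \<notin> insert 0 (\<Union>q\<in>Q. B q)" using ex_new_if_finite[OF infinite_UNIV_nat] by blast
  then show ?thesis by (intro exI[of _ j]) (auto simp: B_def)
qed

lemma prime_avoidance:
  assumes "finite Q" "\<And>q. q \<in> Q \<Longrightarrow> prime_id q \<and> aa \<subseteq> q \<and> \<not> mm \<subseteq> q"
  shows "\<exists>x\<in>mm. \<forall>q\<in>Q. x \<notin> q"
  using assms
proof (induction Q rule: finite_induct)
  case empty
  then show ?case using rg.subspace_0[OF mm_ideal] by blast
next
  case (insert p Q)
  then obtain x where x: "x \<in> mm" "\<forall>q\<in>Q. x \<notin> q" by auto
  obtain y where y: "y \<in> mm" "y \<notin> p" using insert.prems[of p] by blast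
  obtain j where j: "j \<ge> 1" "\<forall>q\<in>insert p Q. x + y ^ j \<notin> q"
    using shift_avoids_primes[of "insert p Q" y x] insert.hyps insert.prems x y by auto
  have "y ^ j = y * y ^ (j - 1)" using j(1) by (simp add: power_eq_if)
  then have "x + y ^ j \<in> mm" using x(1) y(1) ideal_times(2)[OF mm_ideal] rg.subspace_add[OF mm_ideal] by simp
  then show ?case using j(2) by blast
qed

text \<open>
  Among the ideals generated by extensions of \<open>xs\<close> inside \<open>mm\<close> choose a maximal one. If \<open>mm\<close> were not
  minimal over it, prime avoidance would provide one more element. As \<open>mm\<close> is the largest prime, it is
  then the only prime over this ideal, and a product of primes in the ideal is a power of \<open>mm\<close>.
\<close>

lemma param_seq_extend:
  assumes "param_seq aa xs" "set xs \<subseteq> mm"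
  shows "\<exists>ys. param_seq aa (xs @ ys) \<and> set ys \<subseteq> mm \<and>
    (\<forall>x\<in>mm. \<exists>n. x ^ n \<in> rg.span (aa \<union> set (xs @ ys)))"
proof -
  let ?J = "\<lambda>ys. rg.span (aa \<union> set (xs @ ys))"
  define C where "C = {?J ys | ys. param_seq aa (xs @ ys) \<and> set ys \<subseteq> mm}"
  have "?J [] \<in> C" unfolding C_def using assms by (intro CollectI exI[of _ "[]"]) auto
  moreover have "rg.subspace H \<and> aa \<subseteq> H \<and> H \<subseteq> UNIV" if "H \<in> C" for H
  proof -
    obtain ys where "H = ?J ys" using \<open>H \<in> C\<close> unfolding C_def by blast
    then show ?thesis using rg.span_superset[of "aa \<union> set (xs @ ys)"] by auto
  qed
  ultimately obtain M where M: "M \<in> C" and max: "\<forall>H\<in>C. M \<subseteq> H \<longrightarrow> H = M"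
    using rg.noeth_max[OF noeth_aa] by meson
  then obtain ys where ys: "M = ?J ys" "param_seq aa (xs @ ys)" "set ys \<subseteq> mm" unfolding C_def by blast
  have MI: "rg.subspace M" "aa \<subseteq> M" using rg.span_superset[of "aa \<union> set (xs @ ys)"] by (auto simp: ys(1))
  have "\<exists>p. min_prime M p \<and> mm \<subseteq> p"
  proof (rule ccontr)
    assume a: "\<nexists>p. min_prime M p \<and> mm \<subseteq> p"
    have "\<exists>x\<in>mm. \<forall>q\<in>{p. min_prime M p}. x \<notin> q"
      using a MI by (intro prime_avoidance min_primes_finite_below(1)[OF noeth_aa MI]) (auto simp: min_prime_def)
    then obtain y where y: "y \<in> mm" "\<And>p. min_prime M p \<Longrightarrow> y \<notin> p" by blast
    have "param_seq aa (xs @ (ys @ [y]))" unfolding param_seq_def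
    proof (intro allI impI)
      fix i p assume i: "i < length (xs @ ys @ [y])" and p: "min_prime (rg.span (aa \<union> set (take i (xs @ ys @ [y])))) p"
      show "(xs @ ys @ [y]) ! i \<notin> p"
      proof (cases "i < length (xs @ ys)")
        case True
        then have "take i (xs @ ys @ [y]) = take i (xs @ ys)" "(xs @ ys @ [y]) ! i = (xs @ ys) ! i"
          by (auto simp: nth_append)
        then show ?thesis using ys(2) True p unfolding param_seq_def by simp
      next
        case False
        then have "i = length (xs @ ys)" using i by simp
        then have "take i (xs @ ys @ [y]) = xs @ ys" "(xs @ ys @ [y]) ! i = y" by (auto simp: nth_append)
        then show ?thesis using p y(2) ys(1) by simp
      qed
    qed
    then have "?J (ys @ [y]) \<in> C" unfolding C_def using ys(3) y(1) by (intro CollectI exI[of _ "ys @ [y]"]) auto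
    moreover have "M \<subseteq> ?J (ys @ [y])" unfolding ys(1) by (intro rg.span_mono) auto
    ultimately have "?J (ys @ [y]) = M" using max by blast
    then have yM: "y \<in> M" using rg.span_superset[of "aa \<union> set (xs @ ys @ [y])"] by auto
    show False
    proof (cases "1 \<in> M")
      case True
      have "set (xs @ ys) \<subseteq> mm" using assms(2) ys(3) by auto
      then have "M \<subseteq> mm" unfolding ys(1) using aa_mm by (intro rg.span_minimal mm_ideal) auto
      then show ?thesis using True one_mm by blast
    next
      case False
      then obtain p where "min_prime M p" using min_primes_finite_below(2)[OF noeth_aa MI mm_prime ideal_in_mm[OF MI]] by blast
      then show ?thesis using y(2) yM by (auto simp: min_prime_def)
    qed
  qed
  then obtain p where p: "min_prime M p" "mm \<subseteq> p" by blast
  then have pm: "p = mm" using prime_in_mm[of p] MI unfolding min_prime_def by blast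
  obtain ps where ps: "\<forall>p\<in>set ps. prime_id p \<and> M \<subseteq> p"
    and pr: "\<forall>u. (\<forall>p\<in>set ps. u p \<in> p) \<longrightarrow> prod_list (map u ps) \<in> M"
    using ideal_contains_prime_product[OF noeth_aa MI] by blast
  have "q = mm" if "q \<in> set ps" for q
    using that ps p(1) pm prime_in_mm[of q] MI(2) unfolding min_prime_def by blast
  then have "x ^ length ps \<in> M" if "x \<in> mm" for x
    using pr[rule_format, of "\<lambda>_. x"] that by (auto simp: map_replicate_const)
  then show ?thesis using ys by blast
qed

text \<open>
  The dimension equals the length: \<open>mm\<close> is the only prime above \<open>ys\<close>, so chains are bounded by the
  height theorem, and the parameter property builds a chain of the maximal length.
\<close>

lemma dim_of_param_seq:
  assumes "param_seq aa ys" "set ys \<subseteq> mm"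
    and rad: "\<And>x. x \<in> mm \<Longrightarrow> \<exists>n. x ^ n \<in> rg.span (aa \<union> set ys)"
  shows "(\<exists>p. prime_chain n p \<and> aa \<subseteq> p 0) \<longleftrightarrow> n \<le> length ys"
proof
  have q_eq: "q = mm" if "prime_id q" "aa \<subseteq> q" "set ys \<subseteq> q" for q
  proof
    show "q \<subseteq> mm" using prime_in_mm that by blast
    show "mm \<subseteq> q"
    proof
      fix x assume "x \<in> mm"
      then obtain n where "x ^ n \<in> rg.span (aa \<union> set ys)" using rad by blast
      moreover have "rg.span (aa \<union> set ys) \<subseteq> q" using that by (intro rg.span_minimal prime_id_ideal) auto
      ultimately show "x \<in> q" using prime_id_pow[OF that(1)] by blast
    qed
  qed
  have upper: "n \<le> length ys" if "prime_chain n p" "aa \<subseteq> p 0" "p n = mm" for n p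
  proof (rule height_le_generators[OF noeth_aa that(1,2)])
    show "set ys \<subseteq> p n" using that assms by simp
    fix q assume "prime_id q" "p 0 \<subseteq> q" "set ys \<subseteq> q"
    then show "q = p n" using q_eq[of q] that by auto
  qed
  show "n \<le> length ys" if ex: "\<exists>p. prime_chain n p \<and> aa \<subseteq> p 0"
  proof -
    obtain p where p: "prime_chain n p" "aa \<subseteq> p 0" using ex by blast
    have "aa \<subseteq> p n" using prime_chain_mono[OF p(1), of 0 n] p(2) by auto
    then have "p n \<subseteq> mm" using p(1) by (intro prime_in_mm) (auto simp: prime_chain_def)
    show ?thesis
    proof (cases "p n = mm")
      case False
      then have "prime_chain (Suc n) (p(Suc n := mm))"
        using p \<open>p n \<subseteq> mm\<close> mm_prime by (auto simp: prime_chain_def less_Suc_eq le_Suc_eq)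
      then have "Suc n \<le> length ys" by (rule upper) (use p(2) in simp_all)
      then show ?thesis by simp
    qed (use upper p in auto)
  qed
  show "\<exists>p. prime_chain n p \<and> aa \<subseteq> p 0" if le: "n \<le> length ys"
  proof -
    have "rg.span (aa \<union> set ys) \<subseteq> mm" using assms(2) aa_mm by (intro rg.span_minimal mm_ideal) auto
    moreover have "q = mm" if "prime_id q" "rg.span (aa \<union> set ys) \<subseteq> q" for q
      using that rg.span_superset[of "aa \<union> set ys"] by (intro q_eq) blast+
    ultimately have "min_prime (rg.span (aa \<union> set (take (length ys) ys))) mm"
      unfolding min_prime_def take_all[OF order_refl] using mm_prime by blast
    from prime_chain_of_param_seq[OF noeth_aa assms(1) order_refl this]
    obtain p where "prime_chain (length ys) p" "aa \<subseteq> p 0" by blast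
    then show ?thesis using le by (intro exI[of _ p]) (auto simp: prime_chain_def)
  qed
qed

lemma param_seq_of_regular:
  assumes "\<And>i r. i < length xs \<Longrightarrow> xs ! i * r \<in> rg.span (aa \<union> set (take i xs)) \<Longrightarrow>
    r \<in> rg.span (aa \<union> set (take i xs))"
  shows "param_seq aa xs"
  unfolding param_seq_def
proof (intro allI impI)
  fix i p assume i: "i < length xs" and p: "min_prime (rg.span (aa \<union> set (take i xs))) p"
  have "aa \<subseteq> rg.span (aa \<union> set (take i xs))" using rg.span_superset[of "aa \<union> set (take i xs)"] by auto
  then show "xs ! i \<notin> p" using assms[OF i] by (intro regular_avoids_min_primes[OF noeth_aa _ _ _ p]) auto
qed

end

section \<open>Associated primes and regular sequences\<close>

text \<open>
  The Noetherian module \<open>A / B\<close> over the local ring \<open>S / aa\<close>. Its quotients are \<open>A / H\<close> for the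
  submodules \<open>H\<close> between \<open>B\<close> and \<open>A\<close>.
\<close>

locale local_module = lmod scale + local_base aa mm
  for scale :: "'a::comm_ring_1 \<Rightarrow> 'b::ab_group_add \<Rightarrow> 'b" (infixr \<open>*s\<close> 75) and aa mm +
  fixes B A :: "'b set"
  assumes noeth_BA: "noeth B A" and A_sub: "local.subspace A"
    and aa_B: "r \<in> aa \<Longrightarrow> a \<in> A \<Longrightarrow> r *s a \<in> B"
begin

definition submod :: "'b set \<Rightarrow> bool" where
  "submod H \<longleftrightarrow> local.subspace H \<and> B \<subseteq> H \<and> H \<subseteq> A"

definition colon :: "'b set \<Rightarrow> 'b \<Rightarrow> 'a set" where
  "colon H a = {r. r *s a \<in> H}"

definition assoc_prime :: "'b set \<Rightarrow> 'a set \<Rightarrow> bool" where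
  "assoc_prime H p \<longleftrightarrow> prime_id p \<and> (\<exists>a\<in>A. a \<notin> H \<and> p = colon H a)"

definition regular_on :: "'b set \<Rightarrow> 'a \<Rightarrow> bool" where
  "regular_on H x \<longleftrightarrow> (\<forall>a\<in>A. x *s a \<in> H \<longrightarrow> a \<in> H)"

definition no_socle :: "'b set \<Rightarrow> bool" where
  "no_socle H \<longleftrightarrow> (\<forall>a\<in>A. (\<forall>r\<in>mm. r *s a \<in> H) \<longrightarrow> a \<in> H)"

text \<open>
  The submodule \<open>H + S A\<close>, which represents factoring out the elements of \<open>S\<close> from \<open>A / H\<close>.
\<close>

definition ext :: "'b set \<Rightarrow> 'a set \<Rightarrow> 'b set" where
  "ext H S = span (H \<union> {x *s a | x a. x \<in> S \<and> a \<in> A})"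

definition regseq :: "'b set \<Rightarrow> 'a list \<Rightarrow> bool" where
  "regseq H xs \<longleftrightarrow> (\<forall>i<length xs. regular_on (ext H (set (take i xs))) (xs ! i))"

lemma colon_ideal: "submod H \<Longrightarrow> rg.subspace (colon H a)"
  unfolding colon_def submod_def
  by (intro rg.subspaceI) (auto simp: scale_left_distrib subspace_add subspace_0 scale_scale[symmetric] subspace_scale simp del: scale_scale)

lemma aa_colon: "submod H \<Longrightarrow> a \<in> A \<Longrightarrow> aa \<subseteq> colon H a"
  using aa_B by (auto simp: colon_def submod_def)

lemma colon_scale: "submod H \<Longrightarrow> colon H a \<subseteq> colon H (r *s a)"
  unfolding colon_def submod_def by (auto simp: scale_left_commute[of _ r] subspace_scale simp del: scale_scale)

text \<open>
  An annihilator maximal among those of the elements outside \<open>H\<close> is prime.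
\<close>

lemma assoc_prime_above:
  assumes H: "submod H" and a: "a \<in> A" "a \<notin> H"
  shows "\<exists>p. assoc_prime H p \<and> colon H a \<subseteq> p"
proof -
  define C where "C = {colon H b | b. b \<in> A \<and> b \<notin> H \<and> colon H a \<subseteq> colon H b}"
  have "colon H a \<in> C" using a by (auto simp: C_def)
  moreover have "rg.subspace J \<and> aa \<subseteq> J \<and> J \<subseteq> UNIV" if "J \<in> C" for J
    using that colon_ideal[OF H] aa_colon[OF H] by (auto simp: C_def)
  ultimately obtain M where M: "M \<in> C" and max: "\<forall>J\<in>C. M \<subseteq> J \<longrightarrow> J = M"
    using rg.noeth_max[OF noeth_aa] by meson
  then obtain b where b: "M = colon H b" "b \<in> A" "b \<notin> H" "colon H a \<subseteq> colon H b" by (auto simp: C_def)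
  have "prime_id M" unfolding prime_id_def
  proof (intro conjI allI impI)
    show "rg.subspace M" using colon_ideal[OF H] b by simp
    show "1 \<notin> M" using b by (simp add: colon_def)
    fix x y assume xy: "x * y \<in> M"
    show "x \<in> M \<or> y \<in> M"
    proof (cases "y \<in> M")
      case False
      then have "y *s b \<notin> H" by (simp add: b colon_def)
      moreover have "y *s b \<in> A" using b A_sub subspace_scale by blast
      moreover have sub: "colon H b \<subseteq> colon H (y *s b)" by (rule colon_scale[OF H])
      ultimately have "colon H (y *s b) \<in> C" using b unfolding C_def by blast
      then have "colon H (y *s b) = M" using max sub b(1) by blast
      moreover have "x \<in> colon H (y *s b)" using xy by (simp add: b colon_def)
      ultimately show ?thesis by simp
    qed simp
  qed
  then show ?thesis using b unfolding assoc_prime_def by blast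
qed

text \<open>
  Let \<open>M\<close> be maximal among the submodules with infinitely many associated primes, and let
  \<open>p = (M : c)\<close> be one of them. An associated prime \<open>(M : b)\<close> of \<open>A / M\<close> either remains associated to
  \<open>A / (M + S c)\<close>, or a multiple of \<open>b\<close> is congruent to a multiple of \<open>c\<close>, and comparing annihilators
  shows that it equals \<open>p\<close>.
\<close>

lemma finite_assoc_primes:
  assumes H: "submod H" shows "finite {p. assoc_prime H p}"
proof (rule ccontr)
  assume inf: "infinite {p. assoc_prime H p}"
  define C where "C = {H. submod H \<and> infinite {p. assoc_prime H p}}"
  have "H \<in> C" using H inf by (simp add: C_def)
  moreover have "local.subspace H \<and> B \<subseteq> H \<and> H \<subseteq> A" if "H \<in> C" for H using that by (simp add: C_def submod_def)
  ultimately obtain M where M: "M \<in> C" and max: "\<forall>H\<in>C. M \<subseteq> H \<longrightarrow> H = M"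
    using noeth_max[OF noeth_BA] by meson
  have sM: "submod M" and iM: "infinite {p. assoc_prime M p}" using M by (auto simp: C_def)
  then obtain p where "assoc_prime M p" using infinite_imp_nonempty by blast
  then obtain c where c: "c \<in> A" "c \<notin> M" "p = colon M c" "prime_id p" unfolding assoc_prime_def by blast
  define H' where "H' = span (insert c M)"
  have MH': "M \<subseteq> H'" "c \<in> H'" using span_superset[of "insert c M"] by (auto simp: H'_def)
  have "H' \<subseteq> A" unfolding H'_def using sM c(1) by (intro span_minimal A_sub) (auto simp: submod_def)
  moreover have "B \<subseteq> H'" using MH'(1) sM by (auto simp: submod_def)
  ultimately have sH': "submod H'" by (simp add: submod_def H'_def)
  have "H' \<notin> C" using max MH' c by blast
  then have fin: "finite {p. assoc_prime H' p}" using sH' by (simp add: C_def)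
  have "{p. assoc_prime M p} \<subseteq> insert p {p. assoc_prime H' p}"
  proof
    fix q assume "q \<in> {p. assoc_prime M p}"
    then obtain b where b: "b \<in> A" "b \<notin> M" "q = colon M b" "prime_id q" unfolding assoc_prime_def by blast
    show "q \<in> insert p {p. assoc_prime H' p}"
    proof (cases "colon H' b = q")
      case True
      have "b \<notin> H'"
      proof
        assume "b \<in> H'"
        then have "1 \<in> colon H' b" by (simp add: colon_def)
        then show False using True b(4) by (simp add: prime_id_def)
      qed
      then show ?thesis using True b unfolding assoc_prime_def by blast
    next
      case False
      then obtain r where r: "r *s b \<in> H'" "r \<notin> q" using MH'(1) b(3) unfolding colon_def by blast
      then obtain k where k: "r *s b - k *s c \<in> M"
        unfolding H'_def span_insert using sM by (auto simp: submod_def span_eq_iff[THEN iffD2])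
      have Ms: "local.subspace M" using sM by (simp add: submod_def)
      have eq: "t *s (r *s b) \<in> M \<longleftrightarrow> t *s (k *s c) \<in> M" for t
      proof -
        have d: "t *s (r *s b) - t *s (k *s c) \<in> M"
          using subspace_scale[OF Ms k, of t] by (simp only: scale_right_diff_distrib)
        show ?thesis using subspace_diff[OF Ms _ d, of "t *s (r *s b)"] subspace_add[OF Ms _ d, of "t *s (k *s c)"] by auto
      qed
      have cq: "colon M (r *s b) = q"
      proof
        show "q \<subseteq> colon M (r *s b)" unfolding b(3) by (rule colon_scale[OF sM])
        show "colon M (r *s b) \<subseteq> q"
        proof
          fix t assume "t \<in> colon M (r *s b)"
          then have "t * r \<in> q" by (simp add: b(3) colon_def)
          then show "t \<in> q" using r(2) b(4) unfolding prime_id_def by blast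
        qed
      qed
      have "k *s c \<notin> M" using eq[of 1] r(2) by (auto simp: b(3) colon_def)
      then have "k \<notin> p" by (simp add: c(3) colon_def)
      have "colon M (k *s c) = p"
      proof
        show "p \<subseteq> colon M (k *s c)" unfolding c(3) by (rule colon_scale[OF sM])
        show "colon M (k *s c) \<subseteq> p"
        proof
          fix t assume "t \<in> colon M (k *s c)"
          then have "t * k \<in> p" by (simp add: c(3) colon_def)
          then show "t \<in> p" using \<open>k \<notin> p\<close> c(4) unfolding prime_id_def by blast
        qed
      qed
      moreover have "colon M (k *s c) = colon M (r *s b)" unfolding colon_def using eq by auto
      ultimately show ?thesis using cq by simp
    qed
  qed
  then show False using fin iM finite_subset by blast
qed

lemma regular_on_of_avoid:
  assumes H: "submod H" and "\<And>p. assoc_prime H p \<Longrightarrow> z \<notin> p"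
  shows "regular_on H z"
  unfolding regular_on_def
proof (intro ballI impI)
  fix a assume a: "a \<in> A" "z *s a \<in> H"
  show "a \<in> H"
  proof (rule ccontr)
    assume "a \<notin> H"
    then obtain p where "assoc_prime H p" "colon H a \<subseteq> p" using assoc_prime_above[OF H a(1)] by blast
    then show False using assms(2) a(2) by (auto simp: colon_def)
  qed
qed

lemma assoc_prime_no_socle:
  assumes H: "submod H" "no_socle H" and p: "assoc_prime H p"
  shows "prime_id p \<and> aa \<subseteq> p \<and> \<not> mm \<subseteq> p"
proof -
  obtain a where a: "a \<in> A" "a \<notin> H" "p = colon H a" "prime_id p" using p unfolding assoc_prime_def by blast
  then have "aa \<subseteq> p" using aa_colon[OF H(1)] by blast
  moreover have "\<not> mm \<subseteq> p" using H(2) a unfolding no_socle_def colon_def by blast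
  ultimately show ?thesis using a by blast
qed

text \<open>
  A vanishing socle means that \<open>mm\<close> is not associated, so prime avoidance applies to the associated
  primes of all these quotients at once.
\<close>

lemma exists_common_regular:
  assumes "finite W" "\<And>H. H \<in> W \<Longrightarrow> submod H \<and> no_socle H"
  shows "\<exists>z\<in>mm. \<forall>H\<in>W. regular_on H z"
proof -
  have "\<exists>z\<in>mm. \<forall>q\<in>(\<Union>H\<in>W. {p. assoc_prime H p}). z \<notin> q"
  proof (rule prime_avoidance)
    show "finite (\<Union>H\<in>W. {p. assoc_prime H p})" using assms finite_assoc_primes by simp
    fix q assume "q \<in> (\<Union>H\<in>W. {p. assoc_prime H p})"
    then obtain H where "H \<in> W" "assoc_prime H q" by blast
    then show "prime_id q \<and> aa \<subseteq> q \<and> \<not> mm \<subseteq> q" using assms(2)[of H] assoc_prime_no_socle[of H q] by blast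
  qed
  then obtain z where z: "z \<in> mm" "\<forall>q\<in>(\<Union>H\<in>W. {p. assoc_prime H p}). z \<notin> q" by blast
  have "regular_on H z" if "H \<in> W" for H
    using that z(2) assms(2)[of H] by (intro regular_on_of_avoid) auto
  then show ?thesis using z(1) by blast
qed

lemma no_socle_of_regular: "z \<in> mm \<Longrightarrow> regular_on H z \<Longrightarrow> no_socle H"
  unfolding no_socle_def regular_on_def by blast

lemma scaled_subspace: "local.subspace {x *s a | a. a \<in> A}"
proof (rule subspaceI)
  show "0 \<in> {x *s a | a. a \<in> A}" using subspace_0[OF A_sub] by force
next
  fix u v assume "u \<in> {x *s a | a. a \<in> A}" "v \<in> {x *s a | a. a \<in> A}"
  then obtain a b where "u = x *s a" "v = x *s b" "a \<in> A" "b \<in> A" by blast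
  then have "u + v = x *s (a + b)" "a + b \<in> A" using A_sub by (auto simp: scale_right_distrib subspace_add)
  then show "u + v \<in> {x *s a | a. a \<in> A}" by blast
next
  fix c u assume "u \<in> {x *s a | a. a \<in> A}"
  then obtain a where "u = x *s a" "a \<in> A" by blast
  then have "c *s u = x *s (c *s a)" "c *s a \<in> A" using A_sub by (auto simp: subspace_scale mult.commute)
  then show "c *s u \<in> {x *s a | a. a \<in> A}" by blast
qed

lemma ext_insert: "v \<in> ext H (insert x S) \<longleftrightarrow> (\<exists>h\<in>ext H S. \<exists>a\<in>A. v = h + x *s a)"
proof -
  have e: "H \<union> {y *s a | y a. y \<in> insert x S \<and> a \<in> A} = (H \<union> {y *s a | y a. y \<in> S \<and> a \<in> A}) \<union> {x *s a | a. a \<in> A}"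
    by blast
  show ?thesis unfolding ext_def e span_Un span_eq_iff[THEN iffD2, OF scaled_subspace] by blast
qed

lemma ext_empty: "submod H \<Longrightarrow> ext H {} = H"
  by (simp add: ext_def submod_def span_eq_iff[THEN iffD2])

lemma ext_ext: "ext (ext H S) T = ext H (S \<union> T)"
proof
  show "ext (ext H S) T \<subseteq> ext H (S \<union> T)"
    unfolding ext_def by (intro span_minimal subspace_span Un_least span_mono) (auto intro: span_base)
  have "H \<union> {x *s a |x a. x \<in> S \<and> a \<in> A} \<subseteq> ext H S" unfolding ext_def by (rule span_superset)
  moreover have "ext H S \<union> {x *s a |x a. x \<in> T \<and> a \<in> A} \<subseteq> ext (ext H S) T"
    unfolding ext_def[of "ext H S"] by (rule span_superset)
  ultimately have "H \<union> {x *s a |x a. x \<in> S \<union> T \<and> a \<in> A} \<subseteq> ext (ext H S) T" by blast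
  then show "ext H (S \<union> T) \<subseteq> ext (ext H S) T"
    unfolding ext_def[of H "S \<union> T"] by (rule span_minimal) (simp add: ext_def)
qed

lemma submod_ext: "submod H \<Longrightarrow> submod (ext H S)"
  unfolding submod_def
proof (intro conjI)
  assume H: "local.subspace H \<and> B \<subseteq> H \<and> H \<subseteq> A"
  show "local.subspace (ext H S)" by (simp add: ext_def)
  show "B \<subseteq> ext H S" using H span_superset[of "H \<union> {x *s a | x a. x \<in> S \<and> a \<in> A}"] by (auto simp: ext_def)
  show "ext H S \<subseteq> A" unfolding ext_def using H A_sub by (intro span_minimal) (auto simp: subspace_scale)
qed

lemma subspace_ext [simp]: "local.subspace (ext H S)"
  by (simp add: ext_def)

text \<open>
  In \<open>x a = g + z b\<close> the regularity of \<open>z\<close> modulo \<open>x\<close> gives \<open>b \<equiv> x c\<close>, and \<open>x\<close> cancels from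
  \<open>x (a - z c)\<close>.
\<close>

lemma regular_commute:
  assumes x: "regular_on G x" and z: "regular_on (ext G {x}) z" and G: "submod G"
  shows "regular_on (ext G {z}) x"
  unfolding regular_on_def
proof (intro ballI impI)
  fix a assume a: "a \<in> A" "x *s a \<in> ext G {z}"
  have GI: "local.subspace G" using G by (simp add: submod_def)
  obtain g b where gb: "g \<in> G" "b \<in> A" "x *s a = g + z *s b"
    using a(2) unfolding ext_insert ext_empty[OF G] by blast
  have "z *s b = - g + x *s a" using gb(3) by (simp add: algebra_simps)
  then have "z *s b \<in> ext G {x}" unfolding ext_insert ext_empty[OF G] using gb(1) a(1) subspace_neg[OF GI] by blast
  then have "b \<in> ext G {x}" using z gb(2) by (simp add: regular_on_def)
  then obtain g' c where gc: "g' \<in> G" "c \<in> A" "b = g' + x *s c" unfolding ext_insert ext_empty[OF G] by blast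
  have "x *s (a - z *s c) = g + z *s g'"
    using gb(3) gc(3) by (simp add: algebra_simps)
  then have "x *s (a - z *s c) \<in> G" using gb(1) gc(1) GI by (simp add: subspace_add subspace_scale)
  moreover have "a - z *s c \<in> A" using a(1) gc(2) A_sub by (simp add: subspace_diff subspace_scale)
  ultimately have "a - z *s c \<in> G" using x by (simp add: regular_on_def)
  moreover have "a = (a - z *s c) + z *s c" by simp
  ultimately show "a \<in> ext G {z}" unfolding ext_insert ext_empty[OF G] using gc(2) by blast
qed

text \<open>
  The socles of \<open>A / (G + x A)\<close> and \<open>A / (G + z A)\<close> are isomorphic when \<open>x\<close> and \<open>z\<close> are regular
  on \<open>A / G\<close>: if \<open>mm u \<subseteq> G + x A\<close>, the element \<open>v\<close> with \<open>z u \<equiv> x v\<close> lies in the other socle, and \<open>u\<close> vanishes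
  with \<open>v\<close>.
\<close>

lemma socle_exchange:
  assumes G: "submod G" and x: "regular_on G x" "x \<in> mm" and z: "regular_on G z" "z \<in> mm" 
    and n: "no_socle (ext G {z})"
  shows "no_socle (ext G {x})"
  unfolding no_socle_def
proof (intro ballI impI)
  fix u assume u: "u \<in> A" "\<forall>r\<in>mm. r *s u \<in> ext G {x}"
  have GI: "local.subspace G" using G by (simp add: submod_def)
  obtain g v where gv: "g \<in> G" "v \<in> A" "z *s u = g + x *s v"
    using u(2) z(2) unfolding ext_insert ext_empty[OF G] by blast
  have "v \<in> ext G {z}"
  proof -
    have "r *s v \<in> ext G {z}" if r: "r \<in> mm" for r
    proof -
      obtain g' w where gw: "g' \<in> G" "w \<in> A" "r *s u = g' + x *s w"
        using u(2) r unfolding ext_insert ext_empty[OF G] by blast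
      have "x *s (r *s v - z *s w) = r *s (z *s u - g) - z *s (r *s u - g')"
        using gv(3) gw(3) by (simp add: algebra_simps)
      also have "\<dots> = z *s g' - r *s g" by (simp add: algebra_simps)
      finally have "x *s (r *s v - z *s w) \<in> G" using gv(1) gw(1) GI by (simp add: subspace_diff subspace_scale)
      moreover have "r *s v - z *s w \<in> A" using gv(2) gw(2) A_sub by (simp add: subspace_diff subspace_scale)
      ultimately have "r *s v - z *s w \<in> G" using x by (simp add: regular_on_def)
      moreover have "r *s v = (r *s v - z *s w) + z *s w" by simp
      ultimately show ?thesis unfolding ext_insert ext_empty[OF G] using gw(2) by blast
    qed
    then show ?thesis using n gv(2) by (simp add: no_socle_def)
  qed
  then obtain g' w where gw: "g' \<in> G" "w \<in> A" "v = g' + z *s w" unfolding ext_insert ext_empty[OF G] by blast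
  have "z *s (u - x *s w) = g + x *s g'" using gv(3) gw(3) by (simp add: algebra_simps)
  then have "z *s (u - x *s w) \<in> G" using gv(1) gw(1) GI by (simp add: subspace_add subspace_scale)
  moreover have "u - x *s w \<in> A" using u(1) gw(2) A_sub by (simp add: subspace_diff subspace_scale)
  ultimately have "u - x *s w \<in> G" using z by (simp add: regular_on_def)
  moreover have "u = (u - x *s w) + x *s w" by simp
  ultimately show "u \<in> ext G {x}" unfolding ext_insert ext_empty[OF G] using gw(2) by blast
qed

lemma regseq_mod_regular:
  assumes H: "submod H" and xs: "regseq H xs" 
    and z: "\<And>j. j \<le> n \<Longrightarrow> regular_on (ext H (set (take j xs))) z" and n: "n \<le> length xs"
  shows "regseq (ext H {z}) (take n xs)"
  unfolding regseq_def
proof (intro allI impI)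
  fix i assume "i < length (take n xs)"
  then have i: "i < n" "i < length xs" using n by auto
  have s: "insert (xs ! i) (set (take i xs)) = set (take (Suc i) xs)"
    using i(2) by (simp add: take_Suc_conv_app_nth)
  have "regular_on (ext (ext H (set (take i xs))) {z}) (xs ! i)"
  proof (rule regular_commute[OF _ _ submod_ext[OF H]])
    show "regular_on (ext H (set (take i xs))) (xs ! i)" using xs i(2) by (simp add: regseq_def)
    show "regular_on (ext (ext H (set (take i xs))) {xs ! i}) z"
      unfolding ext_ext using z[of "Suc i"] i s by simp
  qed
  then show "regular_on (ext (ext H {z}) (set (take i (take n xs)))) (take n xs ! i)"
    using i by (simp add: ext_ext min_def)
qed

text \<open>
  Weakly regular sequences that stop at a nonzero socle have the maximal length. For a sequence
  of length \<open>1\<close> against the empty one this is clear. In general an element \<open>z\<close> that is regular on all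
  quotients along both sequences can be divided out, after which both sequences may be shortened by
  their last members. The exchange property replaces \<open>z\<close> by the last member of \<open>xs\<close> again.
\<close>

theorem longer_regseq_no_socle:
  "regseq H xs \<Longrightarrow> regseq H ys \<Longrightarrow> length ys = Suc (length xs) \<Longrightarrow> set xs \<subseteq> mm \<Longrightarrow> set ys \<subseteq> mm \<Longrightarrow>
   submod H \<Longrightarrow> no_socle (ext H (set xs))"
proof (induction "length xs" arbitrary: H xs ys)
  case 0
  then have "regular_on (ext H {}) (ys ! 0)" "ys ! 0 \<in> mm" by (auto simp: regseq_def subset_eq)
  then show ?case using 0 no_socle_of_regular by simp
next
  case (Suc n)
  define W where "W = (\<lambda>j. ext H (set (take j xs))) ` {..n} \<union> (\<lambda>j. ext H (set (take j ys))) ` {..Suc n}"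
  have rx: "regular_on (ext H (set (take j xs))) (xs ! j)" "xs ! j \<in> mm" if "j \<le> n" for j
    using Suc.prems(1,4) Suc.hyps(2) that by (auto simp: regseq_def subset_eq)
  have ry: "regular_on (ext H (set (take j ys))) (ys ! j)" "ys ! j \<in> mm" if "j \<le> Suc n" for j
    using Suc.prems(2,3,5) Suc.hyps(2) that by (auto simp: regseq_def subset_eq)
  have "\<exists>z\<in>mm. \<forall>H\<in>W. regular_on H z"
  proof (rule exists_common_regular)
    show "finite W" by (simp add: W_def)
    fix G assume "G \<in> W"
    then consider j where "j \<le> n" "G = ext H (set (take j xs))"
      | j where "j \<le> Suc n" "G = ext H (set (take j ys))" by (auto simp: W_def)
    then show "submod G \<and> no_socle G"
      by cases (use rx ry submod_ext[OF Suc.prems(6)] no_socle_of_regular in metis)+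
  qed
  then obtain z where z: "z \<in> mm" "\<forall>H\<in>W. regular_on H z" by blast
  have "no_socle (ext (ext H {z}) (set (take n xs)))"
  proof (rule Suc.hyps(1))
    show "n = length (take n xs)" "length (take (Suc n) ys) = Suc (length (take n xs))"
      using Suc.hyps(2) Suc.prems(3) by auto
    show "regseq (ext H {z}) (take n xs)"
      by (rule regseq_mod_regular[OF Suc.prems(6,1)]) (use Suc.hyps(2) z(2) in \<open>auto simp: W_def\<close>)
    show "regseq (ext H {z}) (take (Suc n) ys)"
      by (rule regseq_mod_regular[OF Suc.prems(6,2)]) (use Suc.hyps(2) Suc.prems(3) z(2) in \<open>auto simp: W_def\<close>)
    show "set (take n xs) \<subseteq> mm" "set (take (Suc n) ys) \<subseteq> mm"
      using Suc.prems(4,5) set_take_subset[of n xs] set_take_subset[of "Suc n" ys] by blast+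
    show "submod (ext H {z})" by (rule submod_ext[OF Suc.prems(6)])
  qed
  then have "no_socle (ext (ext H (set (take n xs))) {z})" by (simp add: ext_ext)
  then have "no_socle (ext (ext H (set (take n xs))) {xs ! n})"
  proof (rule socle_exchange[OF submod_ext[OF Suc.prems(6)] _ _ _ z(1), rotated -1])
    show "regular_on (ext H (set (take n xs))) (xs ! n)" "xs ! n \<in> mm" using rx[of n] by auto
    show "regular_on (ext H (set (take n xs))) z" using z(2) unfolding W_def by blast
  qed
  moreover have "set xs = set (take n xs) \<union> {xs ! n}"
  proof -
    have "take (Suc n) xs = take n xs @ [xs ! n]" using Suc.hyps(2) by (intro take_Suc_conv_app_nth) simp
    moreover have "take (Suc n) xs = xs" using Suc.hyps(2) by simp
    ultimately have "set xs = set (take n xs @ [xs ! n])" by (metis (no_types))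
    then show ?thesis by simp
  qed
  ultimately show ?case by (simp add: ext_ext)
qed

end

section \<open>Free modules and presentations\<close>

definition sc :: "'s::comm_ring_1 \<Rightarrow> ('i \<Rightarrow> 's) \<Rightarrow> 'i \<Rightarrow> 's" where
  "sc r v = (\<lambda>i. r * v i)"

interpretation vec: lmod "sc :: 's::comm_ring_1 \<Rightarrow> ('i \<Rightarrow> 's) \<Rightarrow> _"
  by unfold_locales (auto simp: sc_def fun_eq_iff algebra_simps)

abbreviation linmap :: "(('i \<Rightarrow> 's::comm_ring_1) \<Rightarrow> 'j \<Rightarrow> 's) \<Rightarrow> bool" where
  "linmap \<equiv> Modules.module_hom sc sc"

text \<open>
  The free module on \<open>A\<close> has the elements \<open>vecs A UNIV\<close>; the vectors \<open>vecs A J\<close> form its submodule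
  \<open>J S\<^sup>A\<close>. The index set is a set and not a type, as the ranks in a resolution vary.
\<close>

definition vecs :: "'i set \<Rightarrow> 's::comm_ring_1 set \<Rightarrow> ('i \<Rightarrow> 's) set" where
  "vecs A J = {v. (\<forall>i\<in>A. v i \<in> J) \<and> (\<forall>i. i \<notin> A \<longrightarrow> v i = 0)}"

definition unit :: "'i \<Rightarrow> 'i \<Rightarrow> 's::comm_ring_1" where
  "unit i = (\<lambda>j. if j = i then 1 else 0)"

text \<open>
  The linear map on \<open>S\<^sup>A\<close> that sends the basis vector \<open>unit i\<close> to \<open>t i\<close>.
\<close>

definition comb :: "'i set \<Rightarrow> ('i \<Rightarrow> 'j \<Rightarrow> 's) \<Rightarrow> ('i \<Rightarrow> 's::comm_ring_1) \<Rightarrow> 'j \<Rightarrow> 's" where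
  "comb A t v = (\<Sum>i\<in>A. sc (v i) (t i))"

lemma sc_apply: "sc r v i = r * v i"
  by (simp add: sc_def)

lemma sum_apply: "(\<Sum>i\<in>A. f i) x = (\<Sum>i\<in>A. f i x)"
  by (induction A rule: infinite_finite_induct) auto

lemma linmapI:
  "(\<And>u v. f (u + v) = f u + f v) \<Longrightarrow> (\<And>r v. f (sc r v) = sc r (f v)) \<Longrightarrow> linmap f"
  by (simp add: Modules.module_hom_def Modules.module_hom_axioms_def vec.module_axioms)

lemma subspace_vecs [simp]: "rg.subspace J \<Longrightarrow> vec.subspace (vecs A J)"
  by (rule vec.subspaceI) (auto simp: vecs_def sc_def rg.subspace_0 rg.subspace_add ideal_times(1))

lemma vecs_mono: "J \<subseteq> K \<Longrightarrow> vecs A J \<subseteq> vecs A K"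
  by (auto simp: vecs_def)

lemma vecs_UNIV: "v \<in> vecs A J \<Longrightarrow> v \<in> vecs A UNIV"
  by (auto simp: vecs_def)

lemma sc_vecs: "v \<in> vecs A UNIV \<Longrightarrow> (\<And>i. i \<in> A \<Longrightarrow> r * v i \<in> J) \<Longrightarrow> sc r v \<in> vecs A J"
  by (auto simp: vecs_def sc_def)

lemma unit_vecs: "i \<in> A \<Longrightarrow> unit i \<in> vecs A UNIV"
  by (auto simp: vecs_def unit_def)

lemma linmap_comb: "linmap (comb A t)"
  by (rule linmapI) (simp_all add: comb_def vec.scale_left_distrib sum.distrib vec.scale_sum_right sc_apply)

lemma comb_in:
  "vec.subspace H \<Longrightarrow> (\<And>i. i \<in> A \<Longrightarrow> sc (v i) (t i) \<in> H) \<Longrightarrow> comb A t v \<in> H"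
  unfolding comb_def by (rule vec.subspace_sum)

lemma comb_unit: "finite A \<Longrightarrow> i \<in> A \<Longrightarrow> comb A t (unit i) = t i"
proof -
  assume A: "finite A" "i \<in> A"
  have "comb A t (unit i) = (\<Sum>j\<in>A. if j = i then t i else 0)"
    unfolding comb_def by (intro sum.cong) (auto simp: unit_def)
  then show ?thesis using A by simp
qed

lemma vec_eq_comb:
  assumes "finite A" "v \<in> vecs A UNIV" shows "v = comb A unit v"
proof
  fix j
  have "comb A unit v j = (\<Sum>i\<in>A. if i = j then v j else 0)"
    unfolding comb_def sum_apply by (intro sum.cong) (auto simp: unit_def sc_def)
  then show "v j = comb A unit v j" using assms by (auto simp: vecs_def)
qed

lemma linmap_eq_comb:
  assumes "finite A" "v \<in> vecs A UNIV" "linmap f" shows "f v = comb A (\<lambda>i. f (unit i)) v"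
proof -
  interpret f: Modules.module_hom sc sc f by fact
  have "f v = f (comb A unit v)" using vec_eq_comb[OF assms(1,2)] by simp
  then show ?thesis by (simp add: comb_def f.sum f.scale)
qed

lemma linmap_vecs:
  assumes "finite A" "linmap f" "f ` vecs A UNIV \<subseteq> vecs A' UNIV" "rg.subspace J" "v \<in> vecs A J"
  shows "f v \<in> vecs A' J"
proof -
  have "sc (v i) (f (unit i)) \<in> vecs A' J" if "i \<in> A" for i
  proof -
    have "f (unit i) \<in> vecs A' UNIV" using assms(3) unit_vecs[OF that] by blast
    moreover have "v i \<in> J" using assms(5) that by (simp add: vecs_def)
    ultimately show ?thesis using assms(4) by (intro sc_vecs ideal_times(2))
  qed
  then show ?thesis unfolding linmap_eq_comb[OF assms(1) vecs_UNIV[OF assms(5)] assms(2)]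
    using assms(4) by (intro comb_in) auto
qed

lemma comb_vecs_le:
  fixes H :: "('i \<Rightarrow> 's::comm_ring_1) set"
  assumes "finite A" "vec.subspace H" "\<And>i. i \<in> A \<Longrightarrow> unit i \<in> H"
  shows "vecs A UNIV \<subseteq> H"
proof
  fix v :: "'i \<Rightarrow> 's" assume "v \<in> vecs A UNIV"
  then have "v = comb A unit v" using vec_eq_comb assms(1) by blast
  also have "\<dots> \<in> H" using assms by (intro comb_in vec.subspace_scale) auto
  finally show "v \<in> H" .
qed

text \<open>
  Induction on the rank: a submodule is generated by its intersection with the smaller free module
  and by elements whose last coordinates generate the ideal of all last coordinates.
\<close>

lemma vecs_noeth:
  assumes "rg.noeth aa UNIV" "rg.subspace aa" "finite A"
  shows "vec.noeth (vecs A aa) (vecs A UNIV)"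
  using assms(3)
proof (induction A rule: finite_induct)
  case empty
  have "H = vec.span (vecs {} aa \<union> {})" if "vecs {} aa \<subseteq> H" "H \<subseteq> vecs {} UNIV" for H
  proof -
    have "vecs {} aa = vecs {} (UNIV :: 'a set)" "rg.subspace (UNIV :: 'a set)" by (auto simp: vecs_def)
    then show ?thesis using that by (metis Un_empty_right antisym subspace_vecs vec.span_eq_iff)
  qed
  then show ?case unfolding vec.noeth_def by blast
next
  case (insert i A)
  show ?case unfolding vec.noeth_def
  proof (intro allI impI)
    fix H assume H: "vec.subspace H \<and> vecs (insert i A) aa \<subseteq> H \<and> H \<subseteq> vecs (insert i A) UNIV"
    have Hs: "vec.subspace H" using H by blast
    define J where "J = (\<lambda>v. v i) ` H"
    have "rg.subspace J"
    proof (rule rg.subspaceI)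
      show "0 \<in> J" unfolding J_def using vec.subspace_0[OF Hs] by (intro image_eqI[of _ _ 0]) auto
      fix x y assume "x \<in> J" "y \<in> J"
      then obtain u v where "u \<in> H" "v \<in> H" "x = u i" "y = v i" by (auto simp: J_def)
      then show "x + y \<in> J" unfolding J_def using vec.subspace_add[OF Hs, of u v] by (intro image_eqI[of _ _ "u + v"]) auto
    next
      fix c x assume "x \<in> J"
      then obtain u where "u \<in> H" "x = u i" by (auto simp: J_def)
      then show "c * x \<in> J" unfolding J_def using vec.subspace_scale[OF Hs, of u c] by (intro image_eqI[of _ _ "sc c u"]) (auto simp: sc_def)
    qed
    moreover have "aa \<subseteq> J"
    proof
      fix a assume "a \<in> aa"
      then have "sc a (unit i) \<in> vecs (insert i A) aa" using rg.subspace_0[OF assms(2)] by (auto simp: vecs_def sc_def unit_def)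
      then have "sc a (unit i) \<in> H" using H by blast
      then show "a \<in> J" unfolding J_def by (intro image_eqI[of _ _ "sc a (unit i)"]) (auto simp: sc_def unit_def)
    qed
    ultimately obtain S where S: "finite S" "J = rg.span (aa \<union> S)" using assms(1) unfolding rg.noeth_def by blast
    then have "S \<subseteq> J" using rg.span_superset by blast
    then have "\<forall>x\<in>S. \<exists>h. h \<in> H \<and> h i = x" by (force simp: J_def)
    from bchoice[OF this] obtain h where h: "\<forall>x\<in>S. h x \<in> H \<and> h x i = x" by blast
    have "vec.subspace (H \<inter> vecs A UNIV)" using Hs by (intro vec.subspace_inter) auto
    moreover have "vecs A aa \<subseteq> H \<inter> vecs A UNIV"
      using H rg.subspace_0[OF assms(2)] insert.hyps by (auto simp: vecs_def)
    ultimately obtain T where T: "finite T" "H \<inter> vecs A UNIV = vec.span (vecs A aa \<union> T)"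
      using insert.IH unfolding vec.noeth_def by blast
    let ?G = "vec.span (vecs (insert i A) aa \<union> (h ` S \<union> T))"
    have "T \<subseteq> H" using T(2) vec.span_superset[of "vecs A aa \<union> T"] by blast
    then have "?G \<subseteq> H" using H h by (intro vec.span_minimal) auto
    moreover have "H \<subseteq> ?G"
    proof
      fix v assume v: "v \<in> H"
      then have "v i \<in> rg.span (aa \<union> S)" unfolding S(2)[symmetric] by (auto simp: J_def)
      then obtain a c where a: "a \<in> aa" "v i = a + (\<Sum>x\<in>S. c x * x)"
        unfolding rg.span_Un rg.span_finite[OF S(1)] rg.span_eq_iff[THEN iffD2, OF assms(2)] by blast
      have ua: "sc a (unit i) \<in> vecs (insert i A) aa"
        using a(1) rg.subspace_0[OF assms(2)] by (auto simp: vecs_def sc_def unit_def)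
      define w where "w = (\<Sum>x\<in>S. sc (c x) (h x))"
      have wG: "w \<in> ?G" unfolding w_def by (intro vec.span_sum vec.span_scale vec.span_base) auto
      have wH: "w \<in> H" unfolding w_def using h by (intro vec.subspace_sum[OF Hs] vec.subspace_scale[OF Hs]) auto
      have wi: "w i = (\<Sum>x\<in>S. c x * x)" unfolding w_def sum_apply using h by (intro sum.cong) (auto simp: sc_def)
      have 1: "v - w - sc a (unit i) \<in> H" using v wH ua H by (intro vec.subspace_diff[OF Hs]) auto
      then have "v - w - sc a (unit i) \<in> vecs (insert i A) UNIV" using H by blast
      moreover have "(v - w - sc a (unit i)) i = 0" using wi a(2) by (simp add: sc_def unit_def)
      ultimately have "v - w - sc a (unit i) \<in> vecs A UNIV" by (auto simp: vecs_def)
      then have "v - w - sc a (unit i) \<in> vec.span (vecs A aa \<union> T)" using 1 T(2) by blast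
      moreover have "vec.span (vecs A aa \<union> T) \<subseteq> ?G"
        using rg.subspace_0[OF assms(2)] by (intro vec.span_mono) (auto simp: vecs_def)
      moreover have "sc a (unit i) \<in> ?G" using ua by (intro vec.span_base) auto
      ultimately have "(v - w - sc a (unit i)) + (w + sc a (unit i)) \<in> ?G" using wG
        by (intro vec.span_add) auto
      then show "v \<in> ?G" by simp
    qed
    ultimately have "H = ?G" by blast
    then show "\<exists>G. finite G \<and> H = vec.span (vecs (insert i A) aa \<union> G)"
      using S(1) T(1) by (intro exI[of _ "h ` S \<union> T"]) auto
  qed
qed

text \<open>
  The image of \<open>d\<close> in the free module over \<open>S / I\<close>. In an exact complex this is the module of cycles,
  and the cokernel of \<open>d\<close> over \<open>S / I\<close> is \<open>vecs A UNIV\<close> modulo \<open>cyc I A A' d\<close>.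
\<close>

definition cyc :: "'s::comm_ring_1 set \<Rightarrow> 'i set \<Rightarrow> 'j set \<Rightarrow> (('j \<Rightarrow> 's) \<Rightarrow> 'i \<Rightarrow> 's) \<Rightarrow> ('i \<Rightarrow> 's) set" where
  "cyc I A A' d = {v. \<exists>u\<in>vecs A' UNIV. v - d u \<in> vecs A I}"

context local_base
begin

lemma cycI: "u \<in> vecs A' UNIV \<Longrightarrow> v - d u \<in> vecs A I \<Longrightarrow> v \<in> cyc I A A' d"
  by (auto simp: cyc_def)

lemma subspace_cyc:
  fixes A' :: "'j set" and I :: "'a set"
  assumes d: "linmap d" and I: "rg.subspace I"
  shows "vec.subspace (cyc I A A' d)" "vecs A I \<subseteq> cyc I A A' d"
proof -
  interpret d: Modules.module_hom sc sc d by fact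
  have s: "vec.subspace (vecs A' (UNIV :: 'a set))" "vec.subspace (vecs A I)" using I by auto
  show "vec.subspace (cyc I A A' d)"
  proof (rule vec.subspaceI)
    show "0 \<in> cyc I A A' d" using vec.subspace_0[OF s(1)] vec.subspace_0[OF s(2)]
      by (intro cycI[of 0]) (simp_all add: d.zero)
    fix u v :: "_ \<Rightarrow> 'a" assume "u \<in> cyc I A A' d" "v \<in> cyc I A A' d"
    then obtain p q where pq: "p \<in> vecs A' UNIV" "u - d p \<in> vecs A I" "q \<in> vecs A' UNIV" "v - d q \<in> vecs A I"
      by (auto simp: cyc_def)
    have "u + v - d (p + q) = (u - d p) + (v - d q)" by (simp add: d.add)
    also have "\<dots> \<in> vecs A I" by (rule vec.subspace_add[OF s(2) pq(2,4)])
    finally show "u + v \<in> cyc I A A' d" unfolding cyc_def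
      using vec.subspace_add[OF s(1) pq(1,3)] by blast
  next
    fix c and u :: "_ \<Rightarrow> 'a" assume "u \<in> cyc I A A' d"
    then obtain p where p: "p \<in> vecs A' UNIV" "u - d p \<in> vecs A I" by (auto simp: cyc_def)
    have "sc c u - d (sc c p) = sc c (u - d p)" by (simp add: d.scale vec.scale_right_diff_distrib)
    then show "sc c u \<in> cyc I A A' d" unfolding cyc_def
      using p s by (intro CollectI bexI[of _ "sc c p"]) (simp_all add: vec.subspace_scale)
  qed
  show "vecs A I \<subseteq> cyc I A A' d" using vec.subspace_0[OF s(1)] by (auto simp: d.zero intro!: cycI[of 0])
qed

lemma cycE:
  assumes "v \<in> cyc I A A' d" obtains u where "u \<in> vecs A' UNIV" "v - d u \<in> vecs A I"
  using assms by (auto simp: cyc_def)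

lemma cyc_le_mm:
  assumes "I \<subseteq> mm" "d ` vecs A' UNIV \<subseteq> vecs A mm"
  shows "cyc I A A' d \<subseteq> vecs A mm"
proof
  fix v assume "v \<in> cyc I A A' d"
  then obtain u where u: "u \<in> vecs A' UNIV" "v - d u \<in> vecs A I" by (rule cycE)
  then have "(v - d u) + d u \<in> vecs A mm" using assms vecs_mono[OF assms(1), of A] mm_ideal
    by (intro vec.subspace_add) auto
  then show "v \<in> vecs A mm" by simp
qed

lemma nakayama_vecs:
  assumes A: "finite A" and H: "vec.subspace H" "vecs A aa \<subseteq> H"
    and gen: "\<And>i. i \<in> A \<Longrightarrow> \<exists>h\<in>H. unit i - h \<in> vecs A mm"
  shows "vecs A UNIV \<subseteq> H"
proof -
  have "\<exists>w. w \<notin> mm \<and> (\<forall>i\<in>A. sc w (unit i) \<in> H)"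
  proof (rule vec.nakayama_prime[OF mm_prime A H(1)])
    fix i assume "i \<in> A"
    then obtain h where h: "h \<in> H" "unit i - h \<in> vecs A mm" using gen by blast
    have "(\<Sum>j\<in>A. sc ((unit i - h) j) (unit j)) = unit i - h"
      using vec_eq_comb[OF A vecs_UNIV[OF h(2)]] unfolding comb_def by (rule sym)
    then have "sc 1 (unit i) - (\<Sum>j\<in>A. sc ((unit i - h) j) (unit j)) = h"
      by (simp only: vec.scale_one) simp
    moreover have "\<forall>j\<in>A. (unit i - h) j \<in> mm" using h(2) by (auto simp: vecs_def)
    ultimately show "\<exists>u c. u \<notin> mm \<and> (\<forall>b\<in>A. c b \<in> mm) \<and> sc u (unit i) - (\<Sum>b\<in>A. sc (c b) (unit b)) \<in> H"
      using h(1) one_mm by (intro exI[of _ 1] exI[of _ "unit i - h"]) simp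
  qed
  then obtain w where w: "w \<notin> mm" "\<And>i. i \<in> A \<Longrightarrow> sc w (unit i) \<in> H" by blast
  obtain v where v: "v * w - 1 \<in> aa" using unit_mod[OF w(1)] by blast
  have "unit i \<in> H" if i: "i \<in> A" for i
  proof -
    have "sc (v * w - 1) (unit i) \<in> H" using v i aa_ideal H(2)
      by (intro subsetD[OF H(2)] sc_vecs unit_vecs) (auto intro: ideal_times(2))
    then have "sc v (sc w (unit i)) - sc (v * w - 1) (unit i) \<in> H"
      using vec.subspace_diff[OF H(1) vec.subspace_scale[OF H(1) w(2)[OF i]]] by blast
    then show ?thesis by (simp add: vec.scale_left_diff_distrib)
  qed
  then show ?thesis using A H(1) by (intro comb_vecs_le)
qed

text \<open>
  The map \<open>\<beta>\<close> between free modules induces an isomorphism from \<open>E / CE\<close> to \<open>F / CF\<close>.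
\<close>

definition presents_iso where
  "presents_iso E CE F CF \<beta> \<longleftrightarrow> linmap \<beta> \<and> \<beta> ` vecs E UNIV \<subseteq> vecs F UNIV \<and>
     (\<forall>v\<in>vecs E UNIV. \<beta> v \<in> CF \<longleftrightarrow> v \<in> CE) \<and> (\<forall>f\<in>vecs F UNIV. \<exists>v\<in>vecs E UNIV. f - \<beta> v \<in> CF)"

text \<open>
  If \<open>CE\<close> and \<open>CF\<close> lie in \<open>mm\<close> times the free modules, these are minimal covers of the
  presented modules, and by Nakayama \<open>\<beta>\<close> is itself an isomorphism over \<open>S / I\<close>. Surjectivity gives a
  section \<open>\<sigma>\<close>, and injectivity of \<open>\<beta>\<close> is surjectivity of \<open>\<sigma>\<close>.
\<close>

lemma presents_iso_bijective:
  assumes inv: "presents_iso E CE F CF \<beta>" and fin: "finite E" "finite F" and I: "rg.subspace I" "aa \<subseteq> I"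
    and CE: "CE \<subseteq> vecs E mm" and CF: "vecs F I \<subseteq> CF" "CF \<subseteq> vecs F mm" "vec.subspace CF"
  shows "\<forall>f\<in>vecs F UNIV. \<exists>v\<in>vecs E UNIV. f - \<beta> v \<in> vecs F I"
    and "\<forall>v\<in>vecs E UNIV. \<beta> v \<in> vecs F I \<longrightarrow> v \<in> vecs E I"
proof -
  have lin: "linmap \<beta>" and im: "\<beta> ` vecs E UNIV \<subseteq> vecs F UNIV" using inv by (auto simp: presents_iso_def)
  interpret b: Modules.module_hom sc sc \<beta> by (rule lin)
  have inv_surj: "\<forall>f\<in>vecs F UNIV. \<exists>v\<in>vecs E UNIV. f - \<beta> v \<in> CF" using inv by (simp add: presents_iso_def)
  have uni [simp]: "rg.subspace (UNIV :: 'a set)" by simp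
  have sE: "vec.subspace (vecs E UNIV)" "vec.subspace (vecs E I)" and sF: "vec.subspace (vecs F UNIV)" "vec.subspace (vecs F I)"
    using I by auto
  have *: "vec.subspace {f. \<exists>v\<in>vecs P UNIV. f - g v \<in> vecs Q I}" if "linmap g" for P Q and g :: "('x \<Rightarrow> 'a) \<Rightarrow> 'y \<Rightarrow> 'a"
  proof (rule vec.subspaceI)
    interpret g: Modules.module_hom sc sc g by fact
    have s: "vec.subspace (vecs P (UNIV :: 'a set))" "vec.subspace (vecs Q I)" using I by auto
    show "0 \<in> {f. \<exists>v\<in>vecs P UNIV. f - g v \<in> vecs Q I}"
      using vec.subspace_0[OF s(1)] vec.subspace_0[OF s(2)] by (auto intro!: bexI[of _ 0] simp: g.zero)
    fix f f' assume "f \<in> {f. \<exists>v\<in>vecs P UNIV. f - g v \<in> vecs Q I}" "f' \<in> {f. \<exists>v\<in>vecs P UNIV. f - g v \<in> vecs Q I}"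
    then obtain v v' where v: "v \<in> vecs P UNIV" "f - g v \<in> vecs Q I" "v' \<in> vecs P UNIV" "f' - g v' \<in> vecs Q I" by blast
    have "f + f' - g (v + v') = (f - g v) + (f' - g v')" by (simp add: g.add)
    also have "\<dots> \<in> vecs Q I" by (rule vec.subspace_add[OF s(2) v(2,4)])
    finally show "f + f' \<in> {f. \<exists>v\<in>vecs P UNIV. f - g v \<in> vecs Q I}"
      using vec.subspace_add[OF s(1) v(1,3)] by blast
  next
    interpret g: Modules.module_hom sc sc g by fact
    have s: "vec.subspace (vecs P (UNIV :: 'a set))" "vec.subspace (vecs Q I)" using I by auto
    fix c f assume "f \<in> {f. \<exists>v\<in>vecs P UNIV. f - g v \<in> vecs Q I}"
    then obtain v where v: "v \<in> vecs P UNIV" "f - g v \<in> vecs Q I" by blast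
    have "sc c f - g (sc c v) = sc c (f - g v)" by (simp add: g.scale vec.scale_right_diff_distrib)
    then show "sc c f \<in> {f. \<exists>v\<in>vecs P UNIV. f - g v \<in> vecs Q I}"
      using v s by (intro CollectI bexI[of _ "sc c v"]) (simp_all add: vec.subspace_scale)
  qed
  have aaI: "vecs P aa \<subseteq> {f. \<exists>v\<in>vecs Q UNIV. f - g v \<in> vecs P I}" if "linmap g" for P Q and g :: "('x \<Rightarrow> 'a) \<Rightarrow> 'y \<Rightarrow> 'a"
  proof -
    interpret g: Modules.module_hom sc sc g by fact
    show ?thesis using vecs_mono[OF I(2), of P] vec.subspace_0[of "vecs Q (UNIV :: 'a set)"] 
      by (auto intro!: bexI[of _ 0] simp: g.zero)
  qed
  have sub: "vec.subspace {f. \<exists>v\<in>vecs E UNIV. f - \<beta> v \<in> vecs F I}" by (rule *[OF lin])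
  have sup: "vecs F aa \<subseteq> {f. \<exists>v\<in>vecs E UNIV. f - \<beta> v \<in> vecs F I}" by (rule aaI[OF lin])
  have "vecs F UNIV \<subseteq> {f. \<exists>v\<in>vecs E UNIV. f - \<beta> v \<in> vecs F I}"
  proof (rule nakayama_vecs[OF fin(2) sub sup])
    fix i assume "i \<in> F"
    then obtain v where v: "v \<in> vecs E UNIV" "unit i - \<beta> v \<in> CF" using bspec[OF inv_surj unit_vecs] by blast
    have "\<beta> v \<in> {f. \<exists>v\<in>vecs E UNIV. f - \<beta> v \<in> vecs F I}"
      using v(1) vec.subspace_0[OF sF(2)] by (intro CollectI bexI[of _ v]) simp_all
    then show "\<exists>h\<in>{f. \<exists>v\<in>vecs E UNIV. f - \<beta> v \<in> vecs F I}. unit i - h \<in> vecs F mm"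
      using CF(2) v(2) by blast
  qed
  then show surj: "\<forall>f\<in>vecs F UNIV. \<exists>v\<in>vecs E UNIV. f - \<beta> v \<in> vecs F I" by blast
  have "\<forall>i\<in>F. \<exists>v. v \<in> vecs E UNIV \<and> unit i - \<beta> v \<in> vecs F I"
    using bspec[OF surj unit_vecs] by blast
  from bchoice[OF this] obtain t where t: "\<forall>i\<in>F. t i \<in> vecs E UNIV \<and> unit i - \<beta> (t i) \<in> vecs F I" by blast
  define \<sigma> where "\<sigma> = comb F t"
  have ls: "linmap \<sigma>" unfolding \<sigma>_def by (rule linmap_comb)
  have ims: "\<sigma> ` vecs F UNIV \<subseteq> vecs E UNIV"
    unfolding \<sigma>_def using t sE(1) by (auto intro!: comb_in vec.subspace_scale[OF sE(1)])
  interpret s: Modules.module_hom sc sc \<sigma> by (rule ls)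
  have bs: "f - \<beta> (\<sigma> f) \<in> vecs F I" if f: "f \<in> vecs F UNIV" for f
  proof -
    have "linmap (\<lambda>f. f - \<beta> (\<sigma> f))"
      by (rule linmapI) (simp_all add: s.add b.add s.scale b.scale vec.scale_right_diff_distrib)
    then have "f - \<beta> (\<sigma> f) = comb F (\<lambda>i. unit i - \<beta> (\<sigma> (unit i))) f" by (rule linmap_eq_comb[OF fin(2) f])
    also have "\<dots> \<in> vecs F I"
      by (intro comb_in[OF sF(2)] vec.subspace_scale[OF sF(2)]) (simp add: \<sigma>_def comb_unit[OF fin(2)] t)
    finally show ?thesis .
  qed
  have sub: "vec.subspace {v. \<exists>f\<in>vecs F UNIV. v - \<sigma> f \<in> vecs E I}" by (rule *[OF ls])
  have sup: "vecs E aa \<subseteq> {v. \<exists>f\<in>vecs F UNIV. v - \<sigma> f \<in> vecs E I}" by (rule aaI[OF ls])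
  have E: "vecs E UNIV \<subseteq> {v. \<exists>f\<in>vecs F UNIV. v - \<sigma> f \<in> vecs E I}"
  proof (rule nakayama_vecs[OF fin(1) sub sup])
    fix i assume i: "i \<in> E"
    let ?h = "\<sigma> (\<beta> (unit i))"
    have b: "\<beta> (unit i) \<in> vecs F UNIV" using im unit_vecs[OF i] by blast
    then have h: "?h \<in> vecs E UNIV" using ims by blast
    have "\<beta> (unit i - ?h) = \<beta> (unit i) - \<beta> (\<sigma> (\<beta> (unit i)))" by (simp add: b.diff)
    also have "\<dots> \<in> CF" using bs[OF b] CF(1) by blast
    finally have "unit i - ?h \<in> CE" using inv vec.subspace_diff[OF sE(1) unit_vecs[OF i] h] by (simp add: presents_iso_def)
    moreover have "?h \<in> {v. \<exists>f\<in>vecs F UNIV. v - \<sigma> f \<in> vecs E I}"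
      using b vec.subspace_0[OF sE(2)] by (intro CollectI bexI[of _ "\<beta> (unit i)"]) simp_all
    ultimately show "\<exists>h\<in>{v. \<exists>f\<in>vecs F UNIV. v - \<sigma> f \<in> vecs E I}. unit i - h \<in> vecs E mm"
      using CE by blast
  qed
  show "\<forall>v\<in>vecs E UNIV. \<beta> v \<in> vecs F I \<longrightarrow> v \<in> vecs E I"
  proof (intro ballI impI)
    fix v assume v: "v \<in> vecs E UNIV" "\<beta> v \<in> vecs F I"
    then obtain f where f: "f \<in> vecs F UNIV" "v - \<sigma> f \<in> vecs E I" using E by blast
    have "\<beta> (v - \<sigma> f) \<in> vecs F I" by (rule linmap_vecs[OF fin(1) lin im I(1) f(2)])
    then have "(f - \<beta> (\<sigma> f)) + (\<beta> v - \<beta> (v - \<sigma> f)) \<in> vecs F I"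
      by (intro vec.subspace_add[OF sF(2)] vec.subspace_diff[OF sF(2)] bs f(1) v(2))
    then have "f \<in> vecs F I" by (simp add: b.diff)
    then have "\<sigma> f \<in> vecs E I" by (rule linmap_vecs[OF fin(2) ls ims I(1)])
    then have "(v - \<sigma> f) + \<sigma> f \<in> vecs E I" using f(2) by (intro vec.subspace_add[OF sE(2)])
    then show "v \<in> vecs E I" by simp
  qed
qed

text \<open>
  An isomorphism of modules with minimal covers induces an isomorphism of their first syzygies,
  and a lift \<open>\<gamma>\<close> to the next free modules presents it.
\<close>

lemma presents_iso_step:
  fixes E' :: "'p set" and F' :: "'q set"
  assumes inv: "presents_iso E (cyc I E E' dE) F (cyc I F F' dF) \<beta>"
    and fin: "finite E" "finite F" "finite E'" "finite F'" and I: "rg.subspace I" "aa \<subseteq> I" "I \<subseteq> mm"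
    and dE: "linmap dE" "dE ` vecs E' UNIV \<subseteq> vecs E mm" and dF: "linmap dF" "dF ` vecs F' UNIV \<subseteq> vecs F mm"
    and CE': "\<And>v. v \<in> vecs E' UNIV \<Longrightarrow> dE v \<in> vecs E I \<longleftrightarrow> v \<in> CE'"
    and CF': "\<And>v. v \<in> vecs F' UNIV \<Longrightarrow> dF v \<in> vecs F I \<longleftrightarrow> v \<in> CF'"
  shows "\<exists>\<beta>'. presents_iso E' CE' F' CF' \<beta>'"
proof -
  interpret dE: Modules.module_hom sc sc dE by fact
  interpret dF: Modules.module_hom sc sc dF by fact
  have lin: "linmap \<beta>" and im: "\<beta> ` vecs E UNIV \<subseteq> vecs F UNIV" using inv by (auto simp: presents_iso_def)
  interpret b: Modules.module_hom sc sc \<beta> by (rule lin)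
  have uni [simp]: "rg.subspace (UNIV :: 'a set)" by simp
  have s: "vec.subspace (vecs E I)" "vec.subspace (vecs F I)" "vec.subspace (vecs F mm)" "vec.subspace (vecs E mm)"
    "vec.subspace (vecs F' (UNIV :: 'a set))"
    using I mm_ideal by auto
  note cycF = subspace_cyc[OF dF(1) I(1), of F F']
  note bij = presents_iso_bijective[OF inv fin(1,2) I(1,2) cyc_le_mm[OF I(3) dE(2)] cycF(2) cyc_le_mm[OF I(3) dF(2)] cycF(1)]
  have sub: "\<And>v. v \<in> vecs E UNIV \<Longrightarrow> \<beta> v \<in> cyc I F F' dF \<longleftrightarrow> v \<in> cyc I E E' dE" using inv by (simp add: presents_iso_def)
  have dE_UNIV: "dE v \<in> vecs E UNIV" if "v \<in> vecs E' UNIV" for v using dE(2) that vecs_UNIV by blast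
  have dE_cyc: "dE v \<in> cyc I E E' dE" if "v \<in> vecs E' UNIV" for v
    using that vec.subspace_0[OF s(1)] by (auto simp: cyc_def intro!: bexI[of _ v])
  have "\<forall>i\<in>E'. \<exists>u. u \<in> vecs F' UNIV \<and> \<beta> (dE (unit i)) - dF u \<in> vecs F I"
  proof
    fix i assume i: "i \<in> E'"
    have "\<beta> (dE (unit i)) \<in> cyc I F F' dF"
      using sub[OF dE_UNIV[OF unit_vecs[OF i]]] dE_cyc[OF unit_vecs[OF i]] by blast
    then show "\<exists>u. u \<in> vecs F' UNIV \<and> \<beta> (dE (unit i)) - dF u \<in> vecs F I"
      unfolding cyc_def by blast
  qed
  from bchoice[OF this] obtain t where t: "\<forall>i\<in>E'. t i \<in> vecs F' UNIV \<and> \<beta> (dE (unit i)) - dF (t i) \<in> vecs F I" by blast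
  define \<gamma> where "\<gamma> = comb E' t"
  have lg: "linmap \<gamma>" unfolding \<gamma>_def by (rule linmap_comb)
  interpret g: Modules.module_hom sc sc \<gamma> by (rule lg)
  have img: "\<gamma> v \<in> vecs F' UNIV" for v
    unfolding \<gamma>_def using t by (intro comb_in[OF s(5)] vec.subspace_scale[OF s(5)]) auto
  have comm: "\<beta> (dE v) - dF (\<gamma> v) \<in> vecs F I" if v: "v \<in> vecs E' UNIV" for v
  proof -
    have "linmap (\<lambda>v. \<beta> (dE v) - dF (\<gamma> v))"
      by (rule linmapI) (simp_all add: dE.add dF.add b.add g.add dE.scale dF.scale b.scale g.scale vec.scale_right_diff_distrib)
    then have "\<beta> (dE v) - dF (\<gamma> v) = comb E' (\<lambda>i. \<beta> (dE (unit i)) - dF (\<gamma> (unit i))) v" by (rule linmap_eq_comb[OF fin(3) v])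
    also have "\<dots> \<in> vecs F I"
      by (intro comb_in[OF s(2)] vec.subspace_scale[OF s(2)]) (simp add: \<gamma>_def comb_unit[OF fin(3)] t)
    finally show ?thesis .
  qed
  have "presents_iso E' CE' F' CF' \<gamma>" unfolding presents_iso_def
  proof (intro conjI ballI lg)
    show "\<gamma> ` vecs E' UNIV \<subseteq> vecs F' UNIV" using img by blast
  next
    fix v :: "'p \<Rightarrow> 'a" assume v: "v \<in> vecs E' UNIV"
    have "\<gamma> v \<in> CF' \<longleftrightarrow> dF (\<gamma> v) \<in> vecs F I" using CF' img by blast
    also have "\<dots> \<longleftrightarrow> \<beta> (dE v) \<in> vecs F I"
      using vec.subspace_add[OF s(2) comm[OF v], of "dF (\<gamma> v)"] vec.subspace_diff[OF s(2) _ comm[OF v], of "\<beta> (dE v)"] by auto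
    also have "\<dots> \<longleftrightarrow> dE v \<in> vecs E I"
      using bij(2) dE_UNIV[OF v] linmap_vecs[OF fin(1) lin im I(1), of "dE v"] by blast
    also have "\<dots> \<longleftrightarrow> v \<in> CE'" using CE' v by blast
    finally show "\<gamma> v \<in> CF' \<longleftrightarrow> v \<in> CE'" .
  next
    fix f :: "'q \<Rightarrow> 'a" assume f: "f \<in> vecs F' UNIV"
    have "dF f \<in> vecs F UNIV" using dF(2) f vecs_UNIV by blast
    then obtain e where e: "e \<in> vecs E UNIV" "dF f - \<beta> e \<in> vecs F I" using bij(1) by blast
    have "dF f - (dF f - \<beta> e) \<in> cyc I F F' dF"
    proof (rule vec.subspace_diff[OF cycF(1)])
      show "dF f \<in> cyc I F F' dF" using f vec.subspace_0[OF s(2)] by (auto simp: cyc_def intro!: bexI[of _ f])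
      show "dF f - \<beta> e \<in> cyc I F F' dF" using e(2) cycF(2) by blast
    qed
    then have "e \<in> cyc I E E' dE" using sub[OF e(1)] by simp
    then obtain v where v: "v \<in> vecs E' UNIV" "e - dE v \<in> vecs E I" by (auto simp: cyc_def)
    have "\<beta> (e - dE v) \<in> vecs F I" by (rule linmap_vecs[OF fin(1) lin im I(1) v(2)])
    then have "(dF f - \<beta> e) + \<beta> (e - dE v) + (\<beta> (dE v) - dF (\<gamma> v)) \<in> vecs F I"
      by (intro vec.subspace_add[OF s(2)] e(2) comm v(1))
    then have "dF (f - \<gamma> v) \<in> vecs F I" by (simp add: b.diff dF.diff)
    then show "\<exists>v\<in>vecs E' UNIV. f - \<gamma> v \<in> CF'"
      using CF'[OF vec.subspace_diff[OF s(5) f img]] v(1) by blast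
  qed
  then show ?thesis by blast
qed

end

section \<open>Minimal resolutions\<close>

context local_base
begin

text \<open>
  A complex of finite free modules over \<open>S / I\<close> which is minimal and exact except at the end, that is,
  a minimal resolution of the cokernel of \<open>d 0\<close>. All conditions are imposed on representatives over
  \<open>S\<close>, where \<open>d n \<circ> d (Suc n)\<close> vanishes only modulo \<open>I\<close>.
\<close>

definition exact_min :: "'a set \<Rightarrow> (nat \<Rightarrow> 'i set) \<Rightarrow> (nat \<Rightarrow> ('i \<Rightarrow> 'a) \<Rightarrow> 'i \<Rightarrow> 'a) \<Rightarrow> bool" where
  "exact_min I A d \<longleftrightarrow> (\<forall>n. finite (A n) \<and> linmap (d n) \<and> d n ` vecs (A (Suc n)) UNIV \<subseteq> vecs (A n) mm \<and>
     (\<forall>v\<in>vecs (A (Suc n)) UNIV.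
        d n v \<in> vecs (A n) I \<longleftrightarrow> v \<in> cyc I (A (Suc n)) (A (Suc (Suc n))) (d (Suc n))))"

text \<open>
  With \<open>Z n\<close> the cokernel of \<open>d n\<close>, this says \<open>s Z n \<subseteq> b Z n\<close> for all \<open>n\<close>.
\<close>

definition killed :: "'a \<Rightarrow> 'a set \<Rightarrow> (nat \<Rightarrow> 'i set) \<Rightarrow> (nat \<Rightarrow> ('i \<Rightarrow> 'a) \<Rightarrow> 'i \<Rightarrow> 'a) \<Rightarrow> bool" where
  "killed s b A d \<longleftrightarrow> (\<forall>n. \<forall>v\<in>vecs (A n) UNIV. sc s v \<in> cyc b (A n) (A (Suc n)) (d n))"

lemma exact_minD:
  assumes "exact_min I A d"
  shows "finite (A n)" "linmap (d n)" "d n ` vecs (A (Suc n)) UNIV \<subseteq> vecs (A n) mm"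
    "v \<in> vecs (A (Suc n)) UNIV \<Longrightarrow> d n v \<in> vecs (A n) mm" "v \<in> vecs (A (Suc n)) UNIV \<Longrightarrow> d n v \<in> vecs (A n) UNIV"
    "v \<in> vecs (A (Suc n)) UNIV \<Longrightarrow>
        d n v \<in> vecs (A n) I \<longleftrightarrow> v \<in> cyc I (A (Suc n)) (A (Suc (Suc n))) (d (Suc n))"
proof -
  show "finite (A n)" "linmap (d n)" and im: "d n ` vecs (A (Suc n)) UNIV \<subseteq> vecs (A n) mm"
    using assms by (auto simp: exact_min_def)
  show "d n v \<in> vecs (A n) mm" if "v \<in> vecs (A (Suc n)) UNIV" using im that by blast
  then show "d n v \<in> vecs (A n) UNIV" if "v \<in> vecs (A (Suc n)) UNIV" using that vecs_UNIV by blast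
  show "v \<in> vecs (A (Suc n)) UNIV \<Longrightarrow>
        d n v \<in> vecs (A n) I \<longleftrightarrow> v \<in> cyc I (A (Suc n)) (A (Suc (Suc n))) (d (Suc n))"
    using assms by (auto simp: exact_min_def)
qed

lemma presents_iso_all:
  assumes E: "exact_min I E dE" and F: "exact_min I F dF" and I: "rg.subspace I" "aa \<subseteq> I" "I \<subseteq> mm"
    and "presents_iso (E 0) (cyc I (E 0) (E 1) (dE 0)) (F 0) (cyc I (F 0) (F 1) (dF 0)) \<beta>"
  shows "\<exists>\<beta>. presents_iso (E n) (cyc I (E n) (E (Suc n)) (dE n)) (F n) (cyc I (F n) (F (Suc n)) (dF n)) \<beta>"
proof (induction n)
  case 0
  then show ?case using assms(6) by auto
next
  case (Suc n)
  then obtain \<beta> where "presents_iso (E n) (cyc I (E n) (E (Suc n)) (dE n)) (F n) (cyc I (F n) (F (Suc n)) (dF n)) \<beta>"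
    by blast
  from presents_iso_step[OF this exact_minD(1)[OF E] exact_minD(1)[OF F] exact_minD(1)[OF E] exact_minD(1)[OF F]
      I exact_minD(2,3)[OF E] exact_minD(2,3)[OF F] exact_minD(6)[OF E] exact_minD(6)[OF F]]
  show ?case .
qed

text \<open>
  The modules resolved are isomorphic, and hence so are all syzygies; the inclusion is transported
  along these isomorphisms.
\<close>

lemma killed_transfer:
  fixes F :: "nat \<Rightarrow> 'q set"
  assumes E: "exact_min I E dE" and F: "exact_min I F dF" and I: "rg.subspace I" "aa \<subseteq> I" "I \<subseteq> mm"
    and inv: "presents_iso (E 0) (cyc I (E 0) (E 1) (dE 0)) (F 0) (cyc I (F 0) (F 1) (dF 0)) \<beta>"
    and b: "rg.subspace b" "I \<subseteq> b" and k: "killed s b E dE"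
  shows "killed s b F dF"
  unfolding killed_def
proof (intro allI ballI)
  fix n and f :: "'q \<Rightarrow> 'a" assume f: "f \<in> vecs (F n) UNIV"
  let ?CF = "cyc I (F n) (F (Suc n)) (dF n)" and ?CE = "cyc I (E n) (E (Suc n)) (dE n)"
  obtain \<beta> where inv: "presents_iso (E n) ?CE (F n) ?CF \<beta>"
    using presents_iso_all[OF E F I inv] by blast
  have lin: "linmap \<beta>" and im: "\<beta> ` vecs (E n) UNIV \<subseteq> vecs (F n) UNIV"
    and sub: "\<forall>v\<in>vecs (E n) UNIV. \<beta> v \<in> ?CF \<longleftrightarrow> v \<in> ?CE" using inv by (auto simp: presents_iso_def)
  interpret b: Modules.module_hom sc sc \<beta> by (rule lin)
  note finE = exact_minD(1)[OF E] and finF = exact_minD(1)[OF F]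
  note bij = presents_iso_bijective(1)[OF inv finE finF I(1,2) cyc_le_mm[OF I(3) exact_minD(3)[OF E]]
      subspace_cyc(2)[OF exact_minD(2)[OF F] I(1)] cyc_le_mm[OF I(3) exact_minD(3)[OF F]]
      subspace_cyc(1)[OF exact_minD(2)[OF F] I(1)]]
  have sb: "vec.subspace (vecs (F n) b)" using b(1) by simp
  obtain v where v: "v \<in> vecs (E n) UNIV" "f - \<beta> v \<in> vecs (F n) I" using bspec[OF bij f] by blast
  obtain u where u: "u \<in> vecs (E (Suc n)) UNIV" "sc s v - dE n u \<in> vecs (E n) b"
    using k v(1) unfolding killed_def by (blast elim: cycE)
  have dEu: "dE n u \<in> vecs (E n) UNIV" by (rule exact_minD(5)[OF E u(1)])
  have "dE n u \<in> ?CE" using u(1) vec.subspace_0[of "vecs (E n) I"] I(1) by (intro cycI[of u]) auto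
  then have "\<beta> (dE n u) \<in> ?CF" using bspec[OF sub dEu] by blast
  then obtain w where w: "w \<in> vecs (F (Suc n)) UNIV" "\<beta> (dE n u) - dF n w \<in> vecs (F n) I" by (rule cycE)
  have "\<beta> (sc s v - dE n u) \<in> vecs (F n) b" by (rule linmap_vecs[OF finE lin im b(1) u(2)])
  moreover have "sc s (f - \<beta> v) \<in> vecs (F n) b"
    using v(2) vecs_mono[OF b(2), of "F n"] by (intro vec.subspace_scale[OF sb]) auto
  moreover have "\<beta> (dE n u) - dF n w \<in> vecs (F n) b" using w(2) vecs_mono[OF b(2), of "F n"] by auto
  ultimately have "sc s (f - \<beta> v) + \<beta> (sc s v - dE n u) + (\<beta> (dE n u) - dF n w) \<in> vecs (F n) b"
    by (intro vec.subspace_add[OF sb])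
  then have "sc s f - dF n w \<in> vecs (F n) b"
    by (simp add: b.diff b.scale vec.scale_right_diff_distrib)
  then show "sc s f \<in> cyc b (F n) (F (Suc n)) (dF n)" using w(1) by (intro cycI)
qed

text \<open>
  Generators of least number satisfy only relations with coefficients in \<open>mm\<close>, because a relation with
  a unit coefficient makes one generator superfluous. The generators may be taken in a prescribed
  submodule \<open>T\<close> that equals \<open>C\<close> modulo \<open>J\<close>; over \<open>S / J\<close> both are the same, but the representatives
  differ.
\<close>

lemma minimal_generators:
  fixes A :: "'i set"
  assumes A: "finite A" and J: "rg.subspace J" "aa \<subseteq> J"
    and C: "vec.subspace C" "vecs A J \<subseteq> C" "C \<subseteq> vecs A UNIV"
    and T: "vec.subspace T" "T \<subseteq> C" "\<And>c. c \<in> C \<Longrightarrow> \<exists>t\<in>T. c - t \<in> vecs A J"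
  shows "\<exists>(A' :: nat set) t. finite A' \<and> (\<forall>i\<in>A'. t i \<in> T) \<and> C \<subseteq> cyc J A A' (comb A' t) \<and>
     (\<forall>u\<in>vecs A' UNIV. comb A' t u \<in> vecs A J \<longrightarrow> u \<in> vecs A' mm)"
proof -
  define P where "P k \<longleftrightarrow> (\<exists>(A' :: nat set) t. finite A' \<and> card A' = k \<and> (\<forall>i\<in>A'. t i \<in> T) \<and> C \<subseteq> cyc J A A' (comb A' t))" for k
  have sJ: "vec.subspace (vecs A J)" using J by simp
  have aaJ: "vecs A aa \<subseteq> vecs A J" by (rule vecs_mono[OF J(2)])
  have "vec.noeth (vecs A aa) (vecs A UNIV)" by (rule vecs_noeth[OF noeth_aa aa_ideal A])
  moreover have "vecs A aa \<subseteq> C" using aaJ C(2) by blast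
  ultimately obtain S where S: "finite S" "C = vec.span (vecs A aa \<union> S)" using C unfolding vec.noeth_def by blast
  have SC: "S \<subseteq> C" using S(2) vec.span_superset[of "vecs A aa \<union> S"] by blast
  obtain cs where cs: "set cs = S" using finite_list[OF S(1)] by blast
  have "\<forall>c\<in>S. \<exists>t. t \<in> T \<and> c - t \<in> vecs A J" using T(3) SC by blast
  from bchoice[OF this] obtain g where g: "\<forall>c\<in>S. g c \<in> T \<and> c - g c \<in> vecs A J" by blast
  have in_cyc: "t i \<in> cyc J A A' (comb A' t)" if "finite A'" "i \<in> A'" for A' and t :: "nat \<Rightarrow> 'i \<Rightarrow> 'a" and i
    using that vec.subspace_0[OF sJ] by (intro cycI[of "unit i"] unit_vecs) (simp_all add: comb_unit)
  have "P (length cs)" unfolding P_def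
  proof (intro exI[of _ "{..<length cs}"] exI[of _ "\<lambda>i. g (cs ! i)"] conjI ballI)
    show "g (cs ! i) \<in> T" if "i \<in> {..<length cs}" for i using g cs that by auto
    let ?K = "cyc J A {..<length cs} (comb {..<length cs} (\<lambda>i. g (cs ! i)))"
    note K = subspace_cyc[OF linmap_comb[of "{..<length cs}" "\<lambda>i. g (cs ! i)"] J(1), of A "{..<length cs}"]
    have "S \<subseteq> ?K"
    proof
      fix c assume c: "c \<in> S"
      then obtain i where i: "i < length cs" "c = cs ! i" using cs by (metis in_set_conv_nth)
      have "g c \<in> ?K" using in_cyc[of "{..<length cs}" i "\<lambda>i. g (cs ! i)"] i by simp
      moreover have "c - g c \<in> ?K" using g c K(2) by blast
      ultimately have "(c - g c) + g c \<in> ?K" by (intro vec.subspace_add[OF K(1)])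
      then show "c \<in> ?K" by simp
    qed
    then show "C \<subseteq> ?K" unfolding S(2) using K aaJ by (intro vec.span_minimal) auto
  qed simp_all
  then have PL: "P (LEAST k. P k)" by (rule LeastI)
  then obtain A' :: "nat set" and t where A': "finite A'" "card A' = (LEAST k. P k)" "\<forall>i\<in>A'. t i \<in> T"
    "C \<subseteq> cyc J A A' (comb A' t)" unfolding P_def by blast
  have tA: "t i \<in> vecs A UNIV" if "i \<in> A'" for i using A'(3) that T(2) C(3) by blast
  have "u \<in> vecs A' mm" if u: "u \<in> vecs A' UNIV" "comb A' t u \<in> vecs A J" for u
  proof (rule ccontr)
    assume "u \<notin> vecs A' mm"
    then obtain i where i: "i \<in> A'" "u i \<notin> mm" using u(1) by (auto simp: vecs_def)
    obtain v where v: "v * u i - 1 \<in> aa" using unit_mod[OF i(2)] by blast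
    define A'' where "A'' = A' - {i}"
    let ?K = "cyc J A A'' (comb A'' t)"
    note K = subspace_cyc[OF linmap_comb[of A'' t] J(1), of A A'']
    have fin: "finite A''" using A'(1) by (simp add: A''_def)
    have tj: "t j \<in> ?K" if "j \<in> A''" for j by (rule in_cyc[OF fin that])
    have ti: "t i \<in> ?K"
    proof -
      have "comb A' t u = sc (u i) (t i) + comb A'' t u"
        unfolding comb_def A''_def by (rule sum.remove[OF A'(1) i(1)])
      then have e: "t i = sc v (comb A' t u) - sc v (comb A'' t u) - sc (v * u i - 1) (t i)"
        by (simp add: vec.scale_right_distrib vec.scale_left_diff_distrib)
      have 1: "sc v (comb A' t u) \<in> ?K" using u(2) K by (intro vec.subspace_scale[OF K(1)]) auto
      have 2: "sc v (comb A'' t u) \<in> ?K"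
        by (intro vec.subspace_scale[OF K(1)] comb_in[OF K(1)] tj)
      have "sc (v * u i - 1) (t i) \<in> vecs A aa"
        using v tA[OF i(1)] aa_ideal by (intro sc_vecs ideal_times(2))
      then have 3: "sc (v * u i - 1) (t i) \<in> ?K" using aaJ K(2) by blast
      show ?thesis by (subst e) (rule vec.subspace_diff[OF K(1) vec.subspace_diff[OF K(1) 1 2] 3])
    qed
    have "t j \<in> ?K" if "j \<in> A'" for j using ti tj that by (cases "j = i") (auto simp: A''_def)
    then have cK: "comb A' t w \<in> ?K" for w by (intro comb_in[OF K(1)] vec.subspace_scale[OF K(1)])
    have "C \<subseteq> ?K"
    proof
      fix c assume "c \<in> C"
      then have "c \<in> cyc J A A' (comb A' t)" using A'(4) by blast
      then obtain w where "w \<in> vecs A' UNIV" "c - comb A' t w \<in> vecs A J" by (rule cycE)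
      then have "(c - comb A' t w) + comb A' t w \<in> ?K" using K(2) cK by (intro vec.subspace_add[OF K(1)]) auto
      then show "c \<in> ?K" by simp
    qed
    then have "P (card A'')" unfolding P_def using fin A'(3) by (intro exI[of _ A''] exI[of _ t]) (auto simp: A''_def)
    then have "(LEAST k. P k) \<le> card A''" by (rule Least_le)
    moreover have "card A'' < card A'" unfolding A''_def by (rule card_Diff1_less[OF A'(1) i(1)])
    ultimately show False using A'(2) by simp
  qed
  then show ?thesis using A' by blast
qed

text \<open>
  The resolution of \<open>vecs A0 UNIV\<close> modulo \<open>mm\<close>, a sum of copies of the residue field, with control over
  the representatives of the first differential: they can be placed in any \<open>T\<close> that represents
  all of \<open>mm S\<^sup>A\<close> modulo \<open>J\<close>.
\<close>

lemma exists_minimal_resolution: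
  fixes A0 :: "nat set"
  assumes A0: "finite A0" and J: "rg.subspace J" "aa \<subseteq> J" "J \<subseteq> mm"
    and T: "vec.subspace T" "T \<subseteq> vecs A0 mm" "\<And>c. c \<in> vecs A0 mm \<Longrightarrow> \<exists>t\<in>T. c - t \<in> vecs A0 J"
  shows "\<exists>A d. A 0 = A0 \<and> exact_min J A d \<and> cyc J (A 0) (A 1) (d 0) = vecs A0 mm \<and> d 0 ` vecs (A 1) UNIV \<subseteq> T"
proof -
  \<comment> \<open>a triple of the next index set, the current index set and the differential between them\<close>
  define good where "good = (\<lambda>(A' :: nat set, A :: nat set, d :: (nat \<Rightarrow> 'a) \<Rightarrow> nat \<Rightarrow> 'a).
    finite A' \<and> finite A \<and> linmap d \<and> d ` vecs A' UNIV \<subseteq> vecs A mm \<and>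
    (\<forall>u\<in>vecs A' UNIV. d u \<in> vecs A J \<longrightarrow> u \<in> vecs A' mm))"
  define P where "P n x \<longleftrightarrow> good x \<and> (n = 0 \<longrightarrow> (case x of (A', A, d) \<Rightarrow> A = A0 \<and> 
     d ` vecs A' UNIV \<subseteq> T \<and> cyc J A A' d = vecs A0 mm))" for n :: nat and x
  define Q where "Q = (\<lambda>(A' :: nat set, A :: nat set, d :: (nat \<Rightarrow> 'a) \<Rightarrow> nat \<Rightarrow> 'a).
     \<lambda>(B' :: nat set, B :: nat set, e :: (nat \<Rightarrow> 'a) \<Rightarrow> nat \<Rightarrow> 'a). B = A' \<and>
     (\<forall>v\<in>vecs A' (UNIV :: 'a set). d v \<in> vecs A J \<longleftrightarrow> v \<in> cyc J A' B' e))"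
  have s: "vec.subspace (vecs A J)" "vec.subspace (vecs A mm)" "vec.subspace (vecs A (UNIV :: 'a set))" for A :: "nat set"
    using J mm_ideal by auto
  have gen: "\<exists>(A' :: nat set) d. finite A' \<and> linmap d \<and> d ` vecs A' UNIV \<subseteq> T \<and> cyc J A A' d = C \<and>
      (\<forall>u\<in>vecs A' UNIV. d u \<in> vecs A J \<longrightarrow> u \<in> vecs A' mm)"
    if A: "finite A" and C: "vec.subspace C" "vecs A J \<subseteq> C" "C \<subseteq> vecs A UNIV" 
      and T: "vec.subspace T" "T \<subseteq> C" "\<And>c. c \<in> C \<Longrightarrow> \<exists>t\<in>T. c - t \<in> vecs A J" for A C T
  proof -
    from minimal_generators[OF A J(1,2) C T]
    obtain A' :: "nat set" and t where A': "finite A'" "\<forall>i\<in>A'. t i \<in> T" "C \<subseteq> cyc J A A' (comb A' t)"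
      "\<forall>u\<in>vecs A' UNIV. comb A' t u \<in> vecs A J \<longrightarrow> u \<in> vecs A' mm" by blast
    have ct: "comb A' t u \<in> T" for u using A'(2) by (intro comb_in[OF T(1)] vec.subspace_scale[OF T(1)]) auto
    have "cyc J A A' (comb A' t) \<subseteq> C"
    proof
      fix v assume "v \<in> cyc J A A' (comb A' t)"
      then obtain u where "u \<in> vecs A' UNIV" "v - comb A' t u \<in> vecs A J" by (rule cycE)
      then have "(v - comb A' t u) + comb A' t u \<in> C" using ct T(2) C by (intro vec.subspace_add[OF C(1)]) auto
      then show "v \<in> C" by simp
    qed
    then show ?thesis using A' ct by (intro exI[of _ A'] exI[of _ "comb A' t"]) (auto simp: linmap_comb)
  qed
  have "\<exists>f. \<forall>n. P n (f n) \<and> Q (f n) (f (Suc n))"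
  proof (rule dependent_nat_choice)
    have "vecs A0 mm \<subseteq> vecs A0 UNIV" by (rule vecs_mono) simp
    from gen[OF A0 s(2) vecs_mono[OF J(3)] this T]
    obtain A' :: "nat set" and d where d: "finite A'" "linmap d" "d ` vecs A' UNIV \<subseteq> T" "cyc J A0 A' d = vecs A0 mm"
      "\<forall>u\<in>vecs A' UNIV. d u \<in> vecs A0 J \<longrightarrow> u \<in> vecs A' mm" by blast
    then have "P 0 (A', A0, d)" unfolding P_def good_def using A0 T(2) by auto
    then show "\<exists>x. P 0 x" by blast
  next
    fix x n assume Px: "P n x"
    obtain A' A d where x: "x = (A', A, d)" by (cases x) 
    have g: "finite A'" "finite A" "linmap d" "d ` vecs A' UNIV \<subseteq> vecs A mm"
      "\<forall>u\<in>vecs A' UNIV. d u \<in> vecs A J \<longrightarrow> u \<in> vecs A' mm"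
      using Px by (auto simp: P_def good_def x)
    interpret d: Modules.module_hom sc sc d by (rule g(3))
    define C where "C = {u \<in> vecs A' UNIV. d u \<in> vecs A J}"
    have "vec.subspace C" unfolding C_def
      using s by (intro vec.subspaceI) (auto simp: d.zero d.add d.scale vec.subspace_0 vec.subspace_add vec.subspace_scale)
    moreover have "d ` vecs A' UNIV \<subseteq> vecs A UNIV" using g(4) vecs_UNIV by blast
    then have "vecs A' J \<subseteq> C" unfolding C_def using linmap_vecs[OF g(1,3) _ J(1)] vecs_UNIV by blast
    moreover have "C \<subseteq> vecs A' UNIV" by (auto simp: C_def)
    moreover have "\<exists>t\<in>C. c - t \<in> vecs A' J" if "c \<in> C" for c using that vec.subspace_0[OF s(1)] by (intro bexI[of _ c]) auto
    ultimately obtain B' :: "nat set" and e where e: "finite B'" "linmap e" "e ` vecs B' UNIV \<subseteq> C" "cyc J A' B' e = C"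
      "\<forall>u\<in>vecs B' UNIV. e u \<in> vecs A' J \<longrightarrow> u \<in> vecs B' mm" using gen[OF g(1), of C C] by blast
    have "C \<subseteq> vecs A' mm" using g(5) by (auto simp: C_def)
    then have "good (B', A', e)" using e g(1) by (auto simp: good_def)
    moreover have "Q x (B', A', e)" unfolding Q_def x using e(4) by (auto simp: C_def)
    ultimately show "\<exists>y. P (Suc n) y \<and> Q x y" unfolding P_def by blast
  qed
  then obtain f where f: "\<And>n. P n (f n)" "\<And>n. Q (f n) (f (Suc n))" by blast
  define A where "A n = fst (snd (f n))" for n
  define d where "d n = snd (snd (f n))" for n
  have fst: "fst (f n) = A (Suc n)" for n
    using f(2)[of n] by (auto simp: Q_def A_def split: prod.splits)
  have fn: "f n = (A (Suc n), A n, d n)" for n using fst[of n] by (simp add: A_def d_def prod_eq_iff)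
  have "exact_min J A d" unfolding exact_min_def
  proof
    fix n
    have "good (A (Suc n), A n, d n)" using f(1)[of n] by (simp add: P_def fn)
    moreover have "\<forall>v\<in>vecs (A (Suc n)) UNIV. d n v \<in> vecs (A n) J \<longleftrightarrow> v \<in> cyc J (A (Suc n)) (A (Suc (Suc n))) (d (Suc n))"
      using f(2)[of n] by (simp add: Q_def fn)
    ultimately show "finite (A n) \<and> linmap (d n) \<and> d n ` vecs (A (Suc n)) UNIV \<subseteq> vecs (A n) mm \<and>
     (\<forall>v\<in>vecs (A (Suc n)) UNIV. d n v \<in> vecs (A n) J \<longleftrightarrow> v \<in> cyc J (A (Suc n)) (A (Suc (Suc n))) (d (Suc n)))"
      by (simp add: good_def)
  qed
  moreover have "A 0 = A0 \<and> d 0 ` vecs (A 1) UNIV \<subseteq> T \<and> cyc J (A 0) (A 1) (d 0) = vecs A0 mm"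
    using f(1)[of 0] by (auto simp: P_def fn)
  ultimately show ?thesis by blast
qed

lemma vecs_span_insert:
  assumes I: "rg.subspace I"
  shows "v \<in> vecs A (rg.span (insert x I)) \<Longrightarrow> \<exists>q\<in>vecs A UNIV. v - sc x q \<in> vecs A I"
    and "q \<in> vecs A UNIV \<Longrightarrow> sc x q \<in> vecs A (rg.span (insert x I))"
    and "vecs A I \<subseteq> vecs A (rg.span (insert x I))"
proof -
  show "vecs A I \<subseteq> vecs A (rg.span (insert x I))"
    using rg.span_superset[of "insert x I"] by (intro vecs_mono) auto
  show "sc x q \<in> vecs A (rg.span (insert x I))" if "q \<in> vecs A UNIV"
    using that rg.span_base[of x "insert x I"] by (intro sc_vecs ideal_times(2)) auto
  assume v: "v \<in> vecs A (rg.span (insert x I))"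
  then have "\<forall>i\<in>A. \<exists>c. v i - c * x \<in> I" by (auto simp: vecs_def span_insert_ideal[OF I])
  from bchoice[OF this] obtain c where c: "\<forall>i\<in>A. v i - c i * x \<in> I" by blast
  show "\<exists>q\<in>vecs A UNIV. v - sc x q \<in> vecs A I"
  proof (rule bexI[of _ "\<lambda>i. if i \<in> A then c i else 0"])
    show "v - sc x (\<lambda>i. if i \<in> A then c i else 0) \<in> vecs A I"
      using c v by (auto simp: vecs_def sc_def mult.commute)
  qed (auto simp: vecs_def)
qed

lemma vecs_regular:
  assumes "\<And>r. x * r \<in> I \<Longrightarrow> r \<in> I" "v \<in> vecs A UNIV" "sc x v \<in> vecs A I"
  shows "v \<in> vecs A I"
  using assms by (auto simp: vecs_def sc_def)

text \<open>
  If \<open>x\<close> is regular on \<open>S / I\<close>, it is regular on all syzygies, so reduction modulo \<open>x\<close> keeps the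
  resolution of the first syzygy exact.
\<close>

lemma exact_min_tail:
  fixes A :: "nat \<Rightarrow> 'i set"
  assumes e: "exact_min I A d" and I: "rg.subspace I" and reg: "\<And>r. x * r \<in> I \<Longrightarrow> r \<in> I"
  shows "exact_min (rg.span (insert x I)) (\<lambda>n. A (Suc n)) (\<lambda>n. d (Suc n))"
  unfolding exact_min_def
proof (intro allI conjI ballI)
  fix n
  let ?J = "rg.span (insert x I)"
  show "finite (A (Suc n))" "linmap (d (Suc n))"
    "d (Suc n) ` vecs (A (Suc (Suc n))) UNIV \<subseteq> vecs (A (Suc n)) mm" using exact_minD(1-3)[OF e] by auto
  interpret d0: Modules.module_hom sc sc "d n" by (rule exact_minD(2)[OF e])
  interpret d1: Modules.module_hom sc sc "d (Suc n)" by (rule exact_minD(2)[OF e])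
  interpret d2: Modules.module_hom sc sc "d (Suc (Suc n))" by (rule exact_minD(2)[OF e])
  have s: "vec.subspace (vecs B I)" "vec.subspace (vecs B ?J)" "vec.subspace (vecs B (UNIV :: 'a set))" for B using I by auto
  have im0: "d n ` vecs (A (Suc n)) UNIV \<subseteq> vecs (A n) UNIV" and
    im1: "d (Suc n) ` vecs (A (Suc (Suc n))) UNIV \<subseteq> vecs (A (Suc n)) UNIV"
    using exact_minD(5)[OF e] by auto
  have cyc_im: "d k u \<in> cyc I (A k) (A (Suc k)) (d k)" if "u \<in> vecs (A (Suc k)) UNIV" for k u
    using that vec.subspace_0[OF s(1)] by (intro cycI[of u]) auto
  have dd: "d k (d (Suc k) u) \<in> vecs (A k) I" if "u \<in> vecs (A (Suc (Suc k))) UNIV" for k u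
    using exact_minD(6)[OF e exact_minD(5)[OF e that]] cyc_im[OF that] by blast
  fix v :: "'i \<Rightarrow> 'a" assume v: "v \<in> vecs (A (Suc (Suc n))) UNIV"
  show "d (Suc n) v \<in> vecs (A (Suc n)) ?J \<longleftrightarrow> v \<in> cyc ?J (A (Suc (Suc n))) (A (Suc (Suc (Suc n)))) (d (Suc (Suc n)))"
  proof
    assume "d (Suc n) v \<in> vecs (A (Suc n)) ?J"
    then obtain f where f: "f \<in> vecs (A (Suc n)) UNIV" "d (Suc n) v - sc x f \<in> vecs (A (Suc n)) I"
      using vecs_span_insert(1)[OF I] by blast
    have "d n (d (Suc n) v - sc x f) \<in> vecs (A n) I" by (rule linmap_vecs[OF exact_minD(1,2)[OF e] im0 I f(2)])
    then have "d n (d (Suc n) v) - d n (d (Suc n) v - sc x f) \<in> vecs (A n) I"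
      using dd[OF v] by (intro vec.subspace_diff[OF s(1)])
    then have "sc x (d n f) \<in> vecs (A n) I" by (simp add: d0.diff d0.scale)
    moreover have "d n f \<in> vecs (A n) UNIV" using im0 f(1) by blast
    ultimately have "d n f \<in> vecs (A n) I" using vecs_regular[of x I "d n f" "A n"] reg by blast
    then have "f \<in> cyc I (A (Suc n)) (A (Suc (Suc n))) (d (Suc n))" using exact_minD(6)[OF e f(1)] by blast
    then obtain g where g: "g \<in> vecs (A (Suc (Suc n))) UNIV" "f - d (Suc n) g \<in> vecs (A (Suc n)) I" by (rule cycE)
    have "(d (Suc n) v - sc x f) + sc x (f - d (Suc n) g) \<in> vecs (A (Suc n)) I"
      using f(2) g(2) by (intro vec.subspace_add[OF s(1)] vec.subspace_scale[OF s(1)])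
    then have "d (Suc n) (v - sc x g) \<in> vecs (A (Suc n)) I"
      by (simp add: d1.diff d1.scale vec.scale_right_diff_distrib)
    moreover have "v - sc x g \<in> vecs (A (Suc (Suc n))) UNIV"
      by (intro vec.subspace_diff[OF s(3)] vec.subspace_scale[OF s(3)] v g(1))
    ultimately have "v - sc x g \<in> cyc I (A (Suc (Suc n))) (A (Suc (Suc (Suc n)))) (d (Suc (Suc n)))"
      using exact_minD(6)[OF e] by blast
    then obtain w where w: "w \<in> vecs (A (Suc (Suc (Suc n)))) UNIV" 
      "v - sc x g - d (Suc (Suc n)) w \<in> vecs (A (Suc (Suc n))) I" by (rule cycE)
    have "(v - sc x g - d (Suc (Suc n)) w) + sc x g \<in> vecs (A (Suc (Suc n))) ?J"
      by (rule vec.subspace_add[OF s(2) subsetD[OF vecs_span_insert(3)[OF I] w(2)] vecs_span_insert(2)[OF I g(1)]])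
    then have "v - d (Suc (Suc n)) w \<in> vecs (A (Suc (Suc n))) ?J" by simp
    then show "v \<in> cyc ?J (A (Suc (Suc n))) (A (Suc (Suc (Suc n)))) (d (Suc (Suc n)))"
      using w(1) by (intro cycI)
  next
    assume "v \<in> cyc ?J (A (Suc (Suc n))) (A (Suc (Suc (Suc n)))) (d (Suc (Suc n)))"
    then obtain w where w: "w \<in> vecs (A (Suc (Suc (Suc n)))) UNIV" 
      "v - d (Suc (Suc n)) w \<in> vecs (A (Suc (Suc n))) ?J" by (rule cycE)
    have "d (Suc n) (v - d (Suc (Suc n)) w) \<in> vecs (A (Suc n)) ?J"
      by (rule linmap_vecs[OF exact_minD(1,2)[OF e] im1 _ w(2)]) simp
    moreover have "d (Suc n) (d (Suc (Suc n)) w) \<in> vecs (A (Suc n)) ?J" using dd[OF w(1)] vecs_span_insert(3)[OF I] by blast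
    ultimately have "d (Suc n) (v - d (Suc (Suc n)) w) + d (Suc n) (d (Suc (Suc n)) w) \<in> vecs (A (Suc n)) ?J"
      by (intro vec.subspace_add[OF s(2)])
    then show "d (Suc n) v \<in> vecs (A (Suc n)) ?J" by (simp add: d1.diff)
  qed
qed

end

section \<open>Syzygies of the residue field modulo a regular sequence\<close>

text \<open>
  The direct sum of two complexes has as index sets disjoint sums, and this is its differential.
\<close>

definition direct_map :: "((('j \<Rightarrow> 's) \<Rightarrow> 'i \<Rightarrow> 's)) \<Rightarrow> (('q \<Rightarrow> 's) \<Rightarrow> 'p \<Rightarrow> 's) \<Rightarrow> ('j + 'q \<Rightarrow> 's) \<Rightarrow> 'i + 'p \<Rightarrow> 's" where
  "direct_map d e v = case_sum (d (v \<circ> Inl)) (e (v \<circ> Inr))"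

lemma direct_map_comp [simp]: "direct_map d e v \<circ> Inl = d (v \<circ> Inl)" "direct_map d e v \<circ> Inr = e (v \<circ> Inr)"
  by (auto simp: direct_map_def)

lemma comp_ops [simp]: "(u + v) \<circ> f = (u \<circ> f) + (v \<circ> f)" "(u - v) \<circ> f = (u \<circ> f) - (v \<circ> f)" "sc r v \<circ> f = sc r (v \<circ> f)"
  for u :: "'i \<Rightarrow> 's::comm_ring_1"
  by (auto simp: fun_eq_iff sc_def)

lemma sum_fun_eqI: "u \<circ> Inl = v \<circ> Inl \<Longrightarrow> u \<circ> Inr = v \<circ> Inr \<Longrightarrow> u = v"
  by (metis case_sum_o_inj(1) surjective_sum comp_apply sumE ext)

lemma linmap_direct_map: "linmap d \<Longrightarrow> linmap e \<Longrightarrow> linmap (direct_map d e)"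
proof (rule linmapI)
  assume d: "linmap d" and e: "linmap e"
  interpret d: Modules.module_hom sc sc d by (rule d)
  interpret e: Modules.module_hom sc sc e by (rule e)
  show "direct_map d e (u + v) = direct_map d e u + direct_map d e v" for u v
    by (rule sum_fun_eqI) (simp_all add: d.add e.add fun_eq_iff)
  show "direct_map d e (sc r v) = sc r (direct_map d e v)" for r v
    by (rule sum_fun_eqI) (simp_all add: d.scale e.scale)
qed

lemma vecs_Plus: "v \<in> vecs (A <+> B) J \<longleftrightarrow> v \<circ> Inl \<in> vecs A J \<and> v \<circ> Inr \<in> vecs B J"
proof -
  have "i \<in> A <+> B \<longleftrightarrow> (case i of Inl a \<Rightarrow> a \<in> A | Inr b \<Rightarrow> b \<in> B)" for i by (cases i) auto
  then show ?thesis unfolding vecs_def by (auto split: sum.splits)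
qed

lemma cyc_Plus: "v \<in> cyc J (A <+> B) (A' <+> B') (direct_map d e) \<longleftrightarrow>
    v \<circ> Inl \<in> cyc J A A' d \<and> v \<circ> Inr \<in> cyc J B B' e" (is "?l \<longleftrightarrow> ?r")
proof
  assume ?l
  then show ?r unfolding cyc_def by (auto simp: vecs_Plus)
next
  assume ?r
  then obtain u w where u: "u \<in> vecs A' UNIV" "(v \<circ> Inl) - d u \<in> vecs A J" "w \<in> vecs B' UNIV" "(v \<circ> Inr) - e w \<in> vecs B J"
    unfolding cyc_def by blast
  have c: "case_sum u w \<circ> Inl = u" "case_sum u w \<circ> Inr = w" by auto
  show ?l unfolding cyc_def using u by (intro CollectI bexI[of _ "case_sum u w"]) (auto simp: vecs_Plus c)
qed

context local_base
begin

lemma exact_min_direct_sum: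
  assumes e: "exact_min J A d"
  shows "exact_min J (\<lambda>n. A n <+> A (Suc n)) (\<lambda>n. direct_map (d n) (d (Suc n)))"
  unfolding exact_min_def
proof (intro allI conjI ballI)
  fix n
  show "finite (A n <+> A (Suc n))" "linmap (direct_map (d n) (d (Suc n)))"
    using exact_minD(1,2)[OF e] by (auto intro: linmap_direct_map)
  show "direct_map (d n) (d (Suc n)) ` vecs (A (Suc n) <+> A (Suc (Suc n))) UNIV \<subseteq> vecs (A n <+> A (Suc n)) mm"
    using exact_minD(4)[OF e] by (auto simp: vecs_Plus)
  fix v assume "v \<in> vecs (A (Suc n) <+> A (Suc (Suc n))) (UNIV :: 'a set)"
  then show "direct_map (d n) (d (Suc n)) v \<in> vecs (A n <+> A (Suc n)) J \<longleftrightarrow>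
    v \<in> cyc J (A (Suc n) <+> A (Suc (Suc n))) (A (Suc (Suc n)) <+> A (Suc (Suc (Suc n)))) (direct_map (d (Suc n)) (d (Suc (Suc n))))"
    using exact_minD(6)[OF e] by (auto simp: vecs_Plus cyc_Plus)
qed

lemma killed_direct_sum:
  "killed s b A d \<Longrightarrow> killed s b (\<lambda>n. A n <+> A (Suc n)) (\<lambda>n. direct_map (d n) (d (Suc n)))"
  by (auto simp: killed_def vecs_Plus cyc_Plus)

text \<open>
  A regular sequence on \<open>S / I\<close> whose members are linearly independent modulo \<open>mm\<^sup>2 + I\<close>, so that they
  are part of a minimal system of generators of the maximal ideal.
\<close>

fun min_regular_seq :: "'a set \<Rightarrow> 'a list \<Rightarrow> bool" where
  "min_regular_seq I [] \<longleftrightarrow> True"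
| "min_regular_seq I (x # xs) \<longleftrightarrow> x \<in> mm \<and> (\<forall>r. x * r \<in> I \<longrightarrow> r \<in> I) \<and>
     x \<notin> rg.span ({a * b | a b. a \<in> mm \<and> b \<in> mm} \<union> I) \<and> min_regular_seq (rg.span (insert x I)) xs"

text \<open>
  The ideal \<open>U\<close> corresponds to a hyperplane of the vector space \<open>mm / (mm\<^sup>2 + I)\<close> complementary to the
  line spanned by \<open>x\<close>. An ideal maximal with respect to excluding \<open>x\<close> has this property, since for
  \<open>y\<close> outside of it a relation \<open>x \<equiv> r y\<close> must have a unit \<open>r\<close>.
\<close>

lemma exists_hyperplane:
  assumes x: "x \<notin> rg.span ({a * b | a b. a \<in> mm \<and> b \<in> mm} \<union> I)" and I: "aa \<subseteq> I" "I \<subseteq> mm" and xm: "x \<in> mm"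
  shows "\<exists>U. rg.subspace U \<and> I \<subseteq> U \<and> U \<subseteq> mm \<and> (\<forall>a\<in>mm. \<forall>b\<in>mm. a * b \<in> U) \<and>
    (\<forall>y\<in>mm. \<exists>c. y - c * x \<in> U) \<and> (\<forall>r. x * r \<in> U \<longrightarrow> r \<in> mm)"
proof -
  let ?M = "rg.span ({a * b | a b. a \<in> mm \<and> b \<in> mm} \<union> I)"
  have Mmm: "?M \<subseteq> mm" using I mm_ideal by (intro rg.span_minimal) (auto intro: ideal_times(1))
  have aaM: "aa \<subseteq> ?M" using I rg.span_superset[of "{a * b | a b. a \<in> mm \<and> b \<in> mm} \<union> I"] by blast
  define C where "C = {U. rg.subspace U \<and> ?M \<subseteq> U \<and> U \<subseteq> mm \<and> x \<notin> U}"
  have "?M \<in> C" using x Mmm by (simp add: C_def)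
  moreover have "rg.subspace H \<and> aa \<subseteq> H \<and> H \<subseteq> UNIV" if "H \<in> C" for H using that aaM by (auto simp: C_def)
  ultimately obtain U where "U \<in> C" and max: "\<forall>H\<in>C. U \<subseteq> H \<longrightarrow> H = U"
    using rg.noeth_max[OF noeth_aa] by meson
  then have U: "rg.subspace U" "?M \<subseteq> U" "U \<subseteq> mm" "x \<notin> U" by (auto simp: C_def)
  have mmU: "a * b \<in> U" if "a \<in> mm" "b \<in> mm" for a b
    using that U(2) rg.span_superset[of "{a * b | a b. a \<in> mm \<and> b \<in> mm} \<union> I"] by blast
  have aaU: "c \<in> aa \<Longrightarrow> c * y \<in> U" for c y using aaM U(1,2) by (intro ideal_times(2)) auto
  have "\<exists>c. y - c * x \<in> U" if y: "y \<in> mm" for y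
  proof (cases "y \<in> U")
    case True
    then show ?thesis by (intro exI[of _ 0]) simp
  next
    case False
    have yU: "insert y U \<subseteq> rg.span (insert y U)" by (rule rg.span_superset)
    have "rg.span (insert y U) \<subseteq> mm" using y U(3) mm_ideal by (intro rg.span_minimal) auto
    moreover have "rg.span (insert y U) \<noteq> U" using False yU by blast
    ultimately have "x \<in> rg.span (insert y U)"
    proof -
      assume a: "rg.span (insert y U) \<subseteq> mm" "rg.span (insert y U) \<noteq> U"
      have "rg.span (insert y U) \<notin> C" using max a(2) yU by blast
      moreover have "?M \<subseteq> rg.span (insert y U)" using U(2) yU by blast
      ultimately show ?thesis using a(1) by (simp add: C_def)
    qed
    then obtain r where r: "x - r * y \<in> U" using span_insert_ideal[OF U(1)] by blast
    have "r \<notin> mm"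
    proof
      assume "r \<in> mm"
      then have "(x - r * y) + r * y \<in> U" using r mmU y by (intro rg.subspace_add[OF U(1)])
      then show False using U(4) by simp
    qed
    then obtain v where v: "v * r - 1 \<in> aa" using unit_mod by blast
    have "- (v * (x - r * y)) - (v * r - 1) * y \<in> U"
      by (rule rg.subspace_diff[OF U(1) rg.subspace_neg[OF U(1) ideal_times(1)[OF U(1) r]] aaU[OF v]])
    moreover have "- (v * (x - r * y)) - (v * r - 1) * y = y - v * x" by (simp add: algebra_simps)
    ultimately show ?thesis by metis
  qed
  moreover have "r \<in> mm" if r: "x * r \<in> U" for r
  proof (rule ccontr)
    assume "r \<notin> mm"
    then obtain v where v: "v * r - 1 \<in> aa" using unit_mod by blast
    have "v * (x * r) - (v * r - 1) * x \<in> U"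
      by (rule rg.subspace_diff[OF U(1) ideal_times(1)[OF U(1) r] aaU[OF v]])
    then show False using U(4) by (simp add: algebra_simps)
  qed
  moreover have "I \<subseteq> U" using U(2) rg.span_superset[of "{a * b | a b. a \<in> mm \<and> b \<in> mm} \<union> I"] by blast
  ultimately show ?thesis using U mmU by blast
qed

text \<open>
  The resolved module is \<open>vecs (A 0) UNIV\<close> modulo \<open>mm\<close>, a sum of copies of the residue field \<open>k\<close>, and \<open>s\<close>
  represents a socle element of the local ring modulo \<open>xs\<close>.

  If \<open>xs\<close> is empty, \<open>s\<close> annihilates all syzygies as they lie in \<open>mm\<close> times a free module. For
  \<open>x # xs\<close> let \<open>J = I + (x)\<close>. Because \<open>x\<close> lies outside of \<open>mm\<^sup>2 + I\<close>, the first syzygy \<open>mm\<close> of \<open>k\<close> over \<open>S / I\<close>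
  (all ideals being read modulo \<open>I\<close>) satisfies \<open>mm / x mm \<cong> k \<oplus> mm / J\<close>: the class
  of \<open>x\<close> spans a copy of \<open>k\<close>, split off by a hyperplane of \<open>mm\<close> modulo \<open>mm\<^sup>2\<close>. Both summands are syzygies of \<open>k\<close> over \<open>S / J\<close>. As resolutions of syzygies over
  \<open>S / I\<close> stay exact modulo \<open>x\<close>, the syzygies of \<open>k\<close> over \<open>S / I\<close> reduce modulo \<open>x\<close> to direct sums of syzygies
  over \<open>S / J\<close>, to which the induction hypothesis applies.
\<close>

theorem socle_kills_resolution:
  fixes A :: "nat \<Rightarrow> nat set"
  assumes "min_regular_seq I xs" "rg.subspace I" "aa \<subseteq> I" "I \<subseteq> mm" "s \<in> mm"
    "\<And>r. r \<in> mm \<Longrightarrow> s * r \<in> rg.span (I \<union> set xs)"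
    "exact_min I A d" "cyc I (A 0) (A 1) (d 0) = vecs (A 0) mm"
  shows "killed s (rg.span (I \<union> set xs)) A d"
  using assms
proof (induction xs arbitrary: I A d)
  case Nil
  have I: "rg.span (I \<union> set []) = I" using Nil.prems(2) by (simp add: rg.span_eq_iff[THEN iffD2])
  note e = Nil.prems(7)
  show ?case unfolding I killed_def
  proof (intro allI ballI)
    fix n and v :: "nat \<Rightarrow> 'a" assume v: "v \<in> vecs (A n) UNIV"
    show "sc s v \<in> cyc I (A n) (A (Suc n)) (d n)"
    proof (cases n)
      case 0
      have "sc s v \<in> vecs (A 0) mm" using v 0 Nil.prems(5) mm_ideal by (intro sc_vecs ideal_times(2)) auto
      then show ?thesis using Nil.prems(8) 0 by simp
    next
      case (Suc k)
      have "d k v \<in> vecs (A k) mm" using exact_minD(4)[OF e] v Suc by simp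
      then have "sc s (d k v) \<in> vecs (A k) I" using Nil.prems(6) unfolding I
        by (intro sc_vecs vecs_UNIV) (auto simp: vecs_def)
      moreover have "d k (sc s v) = sc s (d k v)" by (rule Modules.module_hom.scale[OF exact_minD(2)[OF e]])
      moreover have "sc s v \<in> vecs (A (Suc k)) UNIV" using v Suc by (intro sc_vecs) auto
      ultimately show ?thesis using exact_minD(6)[OF e, of "sc s v" k] Suc by simp
    qed
  qed
next
  case (Cons x xs)
  let ?J = "rg.span (insert x I)"
  let ?b = "rg.span (I \<union> set (x # xs))"
  note I = Cons.prems(2-4) and e = Cons.prems(7) and A0 = Cons.prems(8)
  have x: "x \<in> mm" "\<And>r. x * r \<in> I \<Longrightarrow> r \<in> I" "x \<notin> rg.span ({a * b | a b. a \<in> mm \<and> b \<in> mm} \<union> I)" 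
    "min_regular_seq ?J xs" using Cons.prems(1) by auto
  have IJ: "I \<subseteq> ?J" using rg.span_superset[of "insert x I"] by blast
  have Jmm: "?J \<subseteq> mm" using I(3) x(1) by (intro rg.span_minimal mm_ideal) auto
  have J: "rg.subspace ?J" "aa \<subseteq> ?J" "?J \<subseteq> mm" using I(2) IJ Jmm by auto
  have b: "rg.span (?J \<union> set xs) = ?b" by (simp add: span_span_insert_Un)
  have Jb: "?J \<subseteq> ?b" using b rg.span_superset[of "?J \<union> set xs"] by auto
  obtain U where U: "rg.subspace U" "I \<subseteq> U" "U \<subseteq> mm" "\<And>a b. a \<in> mm \<Longrightarrow> b \<in> mm \<Longrightarrow> a * b \<in> U"
    "\<And>y. y \<in> mm \<Longrightarrow> \<exists>c. y - c * x \<in> U" "\<And>r. x * r \<in> U \<Longrightarrow> r \<in> mm"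
    using exists_hyperplane[OF x(3) I(2,3) x(1)] by blast
  note fin = exact_minD(1)[OF e]
  have s: "vec.subspace (vecs B I)" "vec.subspace (vecs B ?J)" "vec.subspace (vecs B (UNIV :: 'a set))" "vec.subspace (vecs B mm)"
    "vec.subspace (vecs B U)" for B using I J U mm_ideal by auto
  have "\<exists>t\<in>vecs (A 0) U. c - t \<in> vecs (A 0) ?J" if c: "c \<in> vecs (A 0) mm" for c
  proof -
    have "\<forall>i\<in>A 0. \<exists>k. c i - k * x \<in> U" using c U(5) by (auto simp: vecs_def)
    from bchoice[OF this] obtain k where k: "\<forall>i\<in>A 0. c i - k i * x \<in> U" by blast
    define q where "q = (\<lambda>i. if i \<in> A 0 then k i else 0)"
    have q: "q \<in> vecs (A 0) UNIV" by (auto simp: q_def vecs_def)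
    have "c - sc x q \<in> vecs (A 0) U" using c k by (auto simp: vecs_def q_def sc_def mult.commute)
    moreover have "c - (c - sc x q) \<in> vecs (A 0) ?J" using vecs_span_insert(2)[OF I(1) q] by simp
    ultimately show ?thesis by blast
  qed
  \<comment> \<open>the minimal resolution of the same sum of copies of \<open>k\<close> over \<open>S / J\<close>, with the image of \<open>p 0\<close>
    taken inside the hyperplane, which splits off \<open>x\<close>\<close>
  from exists_minimal_resolution[OF fin J s(5) vecs_mono[OF U(3)] this]
  obtain P p where P0: "P 0 = A 0" and eP: "exact_min ?J P p" and cP: "cyc ?J (P 0) (P 1) (p 0) = vecs (A 0) mm"
    and pU: "p 0 ` vecs (P 1) UNIV \<subseteq> vecs (A 0) U" by blast
  have kP: "killed s ?b P p"
    using Cons.IH[OF x(4) J Cons.prems(5) _ eP] Cons.prems(6) cP P0 unfolding b by simp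
  note eF = exact_min_tail[OF e I(1) x(2)]
  note eE = exact_min_direct_sum[OF eP] and kE = killed_direct_sum[OF kP]
  let ?E = "P 0 <+> P 1"
  interpret d0: Modules.module_hom sc sc "d 0" by (rule exact_minD(2)[OF e])
  interpret p0: Modules.module_hom sc sc "p 0" by (rule exact_minD(2)[OF eP])
  have im0: "d 0 ` vecs (A 1) UNIV \<subseteq> vecs (A 0) UNIV" using exact_minD(5)[OF e] by auto
  \<comment> \<open>\<open>d 0\<close> identifies the cokernel of \<open>d 1\<close> over \<open>S / J\<close> with \<open>mm / x mm\<close>, up to the number of copies\<close>
  have CF: "f \<in> cyc ?J (A 1) (A (Suc 1)) (d 1) \<longleftrightarrow> (\<exists>u\<in>vecs (A 0) mm. d 0 f - sc x u \<in> vecs (A 0) I)"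
    if f: "f \<in> vecs (A 1) UNIV" for f
  proof
    assume "f \<in> cyc ?J (A 1) (A (Suc 1)) (d 1)"
    then obtain g where g: "g \<in> vecs (A (Suc 1)) UNIV" "f - d 1 g \<in> vecs (A 1) ?J" by (rule cycE)
    then obtain f' where f': "f' \<in> vecs (A 1) UNIV" "f - d 1 g - sc x f' \<in> vecs (A 1) I"
      using vecs_span_insert(1)[OF I(1)] by blast
    have "d 1 g \<in> cyc I (A 1) (A (Suc 1)) (d 1)" using g(1) vec.subspace_0[OF s(1)] by (intro cycI[of g]) auto
    then have dd: "d 0 (d 1 g) \<in> vecs (A 0) I" using exact_minD(5)[OF e] exact_minD(6)[OF e, of "d 1 g" 0] g(1) by simp
    have "d 0 (f - d 1 g - sc x f') \<in> vecs (A 0) I" by (rule linmap_vecs[OF fin exact_minD(2)[OF e] im0 I(1) f'(2)])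
    from vec.subspace_add[OF s(1) this dd] have "d 0 f - sc x (d 0 f') \<in> vecs (A 0) I"
      by (simp add: d0.diff d0.scale)
    moreover have "d 0 f' \<in> vecs (A 0) mm" using exact_minD(4)[OF e] f'(1) by simp
    ultimately show "\<exists>u\<in>vecs (A 0) mm. d 0 f - sc x u \<in> vecs (A 0) I" by blast
  next
    assume "\<exists>u\<in>vecs (A 0) mm. d 0 f - sc x u \<in> vecs (A 0) I"
    then obtain u where u: "u \<in> vecs (A 0) mm" "d 0 f - sc x u \<in> vecs (A 0) I" by blast
    have "u \<in> cyc I (A 0) (A 1) (d 0)" using u(1) A0 by simp
    then obtain g where g: "g \<in> vecs (A 1) UNIV" "u - d 0 g \<in> vecs (A 0) I" by (rule cycE)
    have "(d 0 f - sc x u) + sc x (u - d 0 g) \<in> vecs (A 0) I"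
      by (rule vec.subspace_add[OF s(1) u(2) vec.subspace_scale[OF s(1) g(2)]])
    then have "d 0 (f - sc x g) \<in> vecs (A 0) I" by (simp add: d0.diff d0.scale vec.scale_right_diff_distrib)
    moreover have fg: "f - sc x g \<in> vecs (A 1) UNIV"
      by (rule vec.subspace_diff[OF s(3) f vec.subspace_scale[OF s(3) g(1)]])
    ultimately have "f - sc x g \<in> cyc I (A 1) (A (Suc 1)) (d 1)" using exact_minD(6)[OF e, of "f - sc x g" 0] unfolding One_nat_def by blast
    then obtain w where w: "w \<in> vecs (A (Suc 1)) UNIV" "f - sc x g - d 1 w \<in> vecs (A 1) I" by (rule cycE)
    have "(f - sc x g - d 1 w) + sc x g \<in> vecs (A 1) ?J"
      by (rule vec.subspace_add[OF s(2) subsetD[OF vecs_span_insert(3)[OF I(1)] w(2)] vecs_span_insert(2)[OF I(1) g(1)]])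
    then show "f \<in> cyc ?J (A 1) (A (Suc 1)) (d 1)" using w(1) by (intro cycI[of w]) simp_all
  qed
  \<comment> \<open>the map \<open>k \<oplus> mm / J \<longrightarrow> mm / x mm\<close> on minimal covers: the first summand goes to the class of \<open>x\<close>,
    the second one is embedded through the hyperplane; \<open>\<beta>\<close> lifts it along \<open>d 0\<close>\<close>
  define g where "g v = sc x (v \<circ> Inl) + p 0 (v \<circ> Inr)" for v
  have lg: "linmap g"
    unfolding g_def by (rule linmapI) (simp_all add: p0.add p0.scale vec.scale_right_distrib mult.commute)
  interpret g: Modules.module_hom sc sc g by (rule lg)
  have gmm: "g v \<in> vecs (A 0) mm" if "v \<in> vecs ?E UNIV" for v
  proof -
    have "v \<circ> Inl \<in> vecs (A 0) UNIV" "v \<circ> Inr \<in> vecs (P 1) UNIV" using that P0 by (auto simp: vecs_Plus)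
    moreover from this have "sc x (v \<circ> Inl) \<in> vecs (A 0) mm" using x(1) mm_ideal by (intro sc_vecs ideal_times(2))
    moreover have "p 0 (v \<circ> Inr) \<in> vecs (A 0) mm" using calculation(2) pU vecs_mono[OF U(3)] by blast
    ultimately show ?thesis unfolding g_def by (intro vec.subspace_add[OF s(4)])
  qed
  have finE: "finite ?E" using exact_minD(1)[OF eP] by auto
  have "\<forall>i\<in>?E. \<exists>t. t \<in> vecs (A 1) UNIV \<and> g (unit i) - d 0 t \<in> vecs (A 0) I"
  proof
    fix i assume "i \<in> ?E"
    then have "g (unit i) \<in> cyc I (A 0) (A 1) (d 0)" unfolding A0 by (intro gmm unit_vecs)
    then show "\<exists>t. t \<in> vecs (A 1) UNIV \<and> g (unit i) - d 0 t \<in> vecs (A 0) I" by (rule cycE) blast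
  qed
  from bchoice[OF this] obtain t where t: "\<forall>i\<in>?E. t i \<in> vecs (A 1) UNIV \<and> g (unit i) - d 0 (t i) \<in> vecs (A 0) I" by blast
  define \<beta> where "\<beta> = comb ?E t"
  have lb: "linmap \<beta>" unfolding \<beta>_def by (rule linmap_comb)
  interpret b: Modules.module_hom sc sc \<beta> by (rule lb)
  have imb: "\<beta> v \<in> vecs (A 1) UNIV" for v
    unfolding \<beta>_def using t by (intro comb_in[OF s(3)] vec.subspace_scale[OF s(3)]) auto
  have comm: "g v - d 0 (\<beta> v) \<in> vecs (A 0) I" if v: "v \<in> vecs ?E UNIV" for v
  proof -
    have "linmap (\<lambda>v. g v - d 0 (\<beta> v))"
      by (rule linmapI) (simp_all add: g.add d0.add b.add g.scale d0.scale b.scale vec.scale_right_diff_distrib)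
    then have "g v - d 0 (\<beta> v) = comb ?E (\<lambda>i. g (unit i) - d 0 (\<beta> (unit i))) v"
      by (rule linmap_eq_comb[OF finE v])
    also have "\<dots> \<in> vecs (A 0) I"
    proof (intro comb_in[OF s(1)] vec.subspace_scale[OF s(1)])
      fix i assume i: "i \<in> ?E"
      have "\<beta> (unit i) = t i" unfolding \<beta>_def by (rule comb_unit[OF finE i])
      then show "g (unit i) - d 0 (\<beta> (unit i)) \<in> vecs (A 0) I" using bspec[OF t i] by simp
    qed
    finally show ?thesis .
  qed
  let ?CE = "cyc ?J (P 0 <+> P (Suc 0)) (P 1 <+> P (Suc 1)) (direct_map (p 0) (p (Suc 0)))"
  let ?CF = "cyc ?J (A (Suc 0)) (A (Suc 1)) (d (Suc 0))"
  have CE: "v \<in> ?CE \<longleftrightarrow> v \<circ> Inl \<in> vecs (A 0) mm \<and> p 0 (v \<circ> Inr) \<in> vecs (A 0) ?J" if v: "v \<in> vecs ?E UNIV" for v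
    using cP exact_minD(6)[OF eP, of "v \<circ> Inr" 0] v P0 by (simp add: cyc_Plus vecs_Plus)
  have "presents_iso ?E ?CE (A (Suc 0)) ?CF \<beta>"
    unfolding presents_iso_def
  proof (intro conjI ballI lb)
    show "\<beta> ` vecs ?E UNIV \<subseteq> vecs (A (Suc 0)) UNIV" using imb by auto
  next
    fix v :: "nat + nat \<Rightarrow> 'a" assume v: "v \<in> vecs ?E UNIV"
    define q r where "q = v \<circ> Inl" and "r = p 0 (v \<circ> Inr)"
    have q: "q \<in> vecs (A 0) UNIV" using v P0 by (simp add: q_def vecs_Plus)
    have r: "r \<in> vecs (A 0) U" using v pU by (auto simp: r_def vecs_Plus)
    have gv: "g v = sc x q + r" by (simp add: g_def q_def r_def)
    have "\<beta> v \<in> ?CF \<longleftrightarrow> (\<exists>u\<in>vecs (A 0) mm. d 0 (\<beta> v) - sc x u \<in> vecs (A 0) I)" using CF[OF imb] by simp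
    also have "\<dots> \<longleftrightarrow> (\<exists>u\<in>vecs (A 0) mm. g v - sc x u \<in> vecs (A 0) I)"
    proof -
      have "d 0 (\<beta> v) - w \<in> vecs (A 0) I \<longleftrightarrow> g v - w \<in> vecs (A 0) I" for w
        using vec.subspace_add[OF s(1) comm[OF v], of "d 0 (\<beta> v) - w"] vec.subspace_diff[OF s(1) _ comm[OF v], of "g v - w"] by auto
      then show ?thesis by simp
    qed
    \<comment> \<open>injectivity: \<open>r\<close> lies in the hyperplane and \<open>x mm\<close> does too, so \<open>x q + r \<in> x mm\<close> puts \<open>x q\<close> into
      the hyperplane\<close>
    also have "\<dots> \<longleftrightarrow> q \<in> vecs (A 0) mm \<and> r \<in> vecs (A 0) ?J"
    proof
      assume "\<exists>u\<in>vecs (A 0) mm. g v - sc x u \<in> vecs (A 0) I"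
      then obtain u where u: "u \<in> vecs (A 0) mm" "sc x q + r - sc x u \<in> vecs (A 0) I" by (auto simp: gv)
      have "(sc x q + r - sc x u) - sc x (q - u) \<in> vecs (A 0) ?J"
        by (rule vec.subspace_diff[OF s(2) subsetD[OF vecs_span_insert(3)[OF I(1)] u(2)] vecs_span_insert(2)[OF I(1)]])
          (rule vec.subspace_diff[OF s(3) q vecs_UNIV[OF u(1)]])
      then have "r \<in> vecs (A 0) ?J" by (simp add: vec.scale_right_diff_distrib)
      moreover have "q \<in> vecs (A 0) mm"
      proof -
        have "sc x u \<in> vecs (A 0) U" using u(1) x(1) U(4) by (intro sc_vecs vecs_UNIV[OF u(1)]) (auto simp: vecs_def)
        moreover have "sc x q + r - sc x u \<in> vecs (A 0) U" using u(2) vecs_mono[OF U(2)] by blast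
        ultimately have "(sc x q + r - sc x u) - r + sc x u \<in> vecs (A 0) U"
          by (rule vec.subspace_add[OF s(5) vec.subspace_diff[OF s(5) _ r], rotated])
        then have "sc x q \<in> vecs (A 0) U" by simp
        then show ?thesis using q U(6) by (auto simp: vecs_def sc_def)
      qed
      ultimately show "q \<in> vecs (A 0) mm \<and> r \<in> vecs (A 0) ?J" by blast
    next
      assume qr: "q \<in> vecs (A 0) mm \<and> r \<in> vecs (A 0) ?J"
      then obtain w where w: "w \<in> vecs (A 0) UNIV" "r - sc x w \<in> vecs (A 0) I" using vecs_span_insert(1)[OF I(1)] by blast
      have "r - (r - sc x w) \<in> vecs (A 0) U" by (rule vec.subspace_diff[OF s(5) r subsetD[OF vecs_mono[OF U(2)] w(2)]])
      then have "w \<in> vecs (A 0) mm" using w(1) U(6) by (auto simp: vecs_def sc_def)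
      then have "q + w \<in> vecs (A 0) mm" using qr by (intro vec.subspace_add[OF s(4)]) auto
      moreover have "g v - sc x (q + w) = r - sc x w" by (simp add: gv vec.scale_right_distrib)
      ultimately show "\<exists>u\<in>vecs (A 0) mm. g v - sc x u \<in> vecs (A 0) I" using w(2) by (intro bexI[of _ "q + w"]) simp_all
    qed
    also have "\<dots> \<longleftrightarrow> v \<in> ?CE" using CE[OF v] by (simp add: q_def r_def)
    finally show "\<beta> v \<in> ?CF \<longleftrightarrow> v \<in> ?CE" .
  next
    fix f :: "nat \<Rightarrow> 'a" assume f: "f \<in> vecs (A (Suc 0)) UNIV"
    have "d 0 f \<in> cyc ?J (P 0) (P 1) (p 0)" unfolding cP using exact_minD(4)[OF e f] .
    then obtain r where r: "r \<in> vecs (P 1) UNIV" "d 0 f - p 0 r \<in> vecs (A 0) ?J" unfolding P0 by (rule cycE)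
    then obtain q where q: "q \<in> vecs (A 0) UNIV" "d 0 f - p 0 r - sc x q \<in> vecs (A 0) I"
      using vecs_span_insert(1)[OF I(1)] by blast
    define v where "v = case_sum q r"
    have vc: "v \<circ> Inl = q" "v \<circ> Inr = r" by (auto simp: v_def)
    then have v: "v \<in> vecs ?E UNIV" using q(1) r(1) P0 by (simp add: vecs_Plus)
    have "(d 0 f - p 0 r - sc x q) + (g v - d 0 (\<beta> v)) \<in> vecs (A 0) I"
      by (rule vec.subspace_add[OF s(1) q(2) comm[OF v]])
    then have "d 0 (f - \<beta> v) \<in> vecs (A 0) I" by (simp add: g_def vc d0.diff)
    then have "d 0 (f - \<beta> v) - sc x 0 \<in> vecs (A 0) I" by simp
    then have "\<exists>u\<in>vecs (A 0) mm. d 0 (f - \<beta> v) - sc x u \<in> vecs (A 0) I" using vec.subspace_0[OF s(4)] by blast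
    then have "f - \<beta> v \<in> ?CF" using CF[of "f - \<beta> v"] f vec.subspace_diff[OF s(3) _ imb] by simp
    then show "\<exists>v\<in>vecs ?E UNIV. f - \<beta> v \<in> ?CF" using v by blast
  qed
  then have inv: "presents_iso (P 0 <+> P (Suc 0)) (cyc ?J (P 0 <+> P (Suc 0)) (P 1 <+> P (Suc 1)) (direct_map (p 0) (p (Suc 0))))
     (A (Suc 0)) (cyc ?J (A (Suc 0)) (A (Suc 1)) (d (Suc 0))) \<beta>" by simp
  have kF: "killed s ?b (\<lambda>n. A (Suc n)) (\<lambda>n. d (Suc n))"
    by (rule killed_transfer[OF eE eF J inv rg.subspace_span Jb kE])
  show ?case unfolding killed_def
  proof (intro allI ballI)
    fix n and v :: "nat \<Rightarrow> 'a" assume v: "v \<in> vecs (A n) UNIV"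
    show "sc s v \<in> cyc ?b (A n) (A (Suc n)) (d n)"
    proof (cases n)
      case 0
      have "sc s v \<in> vecs (A 0) mm" using v 0 Cons.prems(5) mm_ideal by (intro sc_vecs ideal_times(2)) auto
      then obtain u where "u \<in> vecs (A 1) UNIV" "sc s v - d 0 u \<in> vecs (A 0) I" unfolding A0[symmetric] by (rule cycE)
      then show ?thesis using 0 vecs_mono[of I ?b "A 0"] IJ Jb by (intro cycI[of u]) auto
    next
      case (Suc k)
      then show ?thesis using kF v unfolding killed_def by blast
    qed
  qed
qed

end

section \<open>Adapted regular sequences\<close>

context local_base
begin

definition ring_regular :: "'a list \<Rightarrow> bool" where
  "ring_regular xs \<longleftrightarrow> (\<forall>i<length xs. \<forall>r. xs ! i * r \<in> rg.span (aa \<union> set (take i xs)) \<longrightarrow>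
     r \<in> rg.span (aa \<union> set (take i xs)))"

lemma min_regular_seq_snoc:
  "min_regular_seq I (xs @ [x]) \<longleftrightarrow> min_regular_seq I xs \<and> x \<in> mm \<and>
     (\<forall>r. x * r \<in> rg.span (I \<union> set xs) \<longrightarrow> r \<in> rg.span (I \<union> set xs)) \<and>
     x \<notin> rg.span ({a * b | a b. a \<in> mm \<and> b \<in> mm} \<union> rg.span (I \<union> set xs))"
  if "rg.subspace I" for I xs
  using that
proof (induction xs arbitrary: I)
  case Nil
  then show ?case by (simp add: rg.span_eq_iff[THEN iffD2])
next
  case (Cons y ys)
  have "rg.span (rg.span (insert y I) \<union> set ys) = rg.span (I \<union> set (y # ys))"
    by (simp add: span_span_insert_Un)
  then show ?case using Cons.IH[of "rg.span (insert y I)"] by simp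
qed

text \<open>
  By Nakayama, \<open>mm = mm\<^sup>2 + b\<close> would imply \<open>mm = b\<close>. The elements of \<open>mm\<^sup>2 + b\<close> are combinations of
  generators of \<open>mm\<close> with coefficients in \<open>mm\<close>, up to \<open>b\<close>, which is the set \<open>G\<close>.
\<close>

lemma mm_square_proper:
  assumes b: "rg.subspace b" "aa \<subseteq> b" "b \<subseteq> mm" "b \<noteq> mm"
  shows "\<exists>y\<in>mm. y \<notin> rg.span ({a * b | a b. a \<in> mm \<and> b \<in> mm} \<union> b)"
proof (rule ccontr)
  assume "\<not> ?thesis"
  then have all: "y \<in> rg.span ({a * b | a b. a \<in> mm \<and> b \<in> mm} \<union> b)" if "y \<in> mm" for y using that by blast
  obtain S where S: "finite S" "mm = rg.span (aa \<union> S)"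
    using noeth_aa mm_ideal aa_mm unfolding rg.noeth_def by blast
  have Smm: "S \<subseteq> mm" using S(2) rg.span_superset[of "aa \<union> S"] by blast
  define G where "G = {v. \<exists>c. (\<forall>t\<in>S. c t \<in> mm) \<and> v - (\<Sum>t\<in>S. c t * t) \<in> b}"
  have GI: "v \<in> G" if "\<forall>t\<in>S. c t \<in> mm" "v - (\<Sum>t\<in>S. c t * t) \<in> b" for v c using that by (auto simp: G_def)
  have "rg.subspace G"
  proof (rule rg.subspaceI)
    show "0 \<in> G" using rg.subspace_0[OF b(1)] rg.subspace_0[OF mm_ideal] by (intro GI[of "\<lambda>_. 0"]) auto
    fix u v assume "u \<in> G" "v \<in> G"
    then obtain c d where cd: "\<forall>t\<in>S. c t \<in> mm" "u - (\<Sum>t\<in>S. c t * t) \<in> b" "\<forall>t\<in>S. d t \<in> mm" "v - (\<Sum>t\<in>S. d t * t) \<in> b"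
      by (auto simp: G_def)
    have "(u - (\<Sum>t\<in>S. c t * t)) + (v - (\<Sum>t\<in>S. d t * t)) \<in> b" by (rule rg.subspace_add[OF b(1) cd(2,4)])
    also have "(u - (\<Sum>t\<in>S. c t * t)) + (v - (\<Sum>t\<in>S. d t * t)) = u + v - (\<Sum>t\<in>S. (c t + d t) * t)"
      by (simp add: algebra_simps sum.distrib)
    finally show "u + v \<in> G" using cd(1,3) by (intro GI[of "\<lambda>t. c t + d t"]) (auto intro: rg.subspace_add[OF mm_ideal])
  next
    fix e u assume "u \<in> G"
    then obtain c where c: "\<forall>t\<in>S. c t \<in> mm" "u - (\<Sum>t\<in>S. c t * t) \<in> b" by (auto simp: G_def)
    have "e * (u - (\<Sum>t\<in>S. c t * t)) \<in> b" by (rule ideal_times(1)[OF b(1) c(2)])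
    also have "e * (u - (\<Sum>t\<in>S. c t * t)) = e * u - (\<Sum>t\<in>S. (e * c t) * t)"
      by (simp add: algebra_simps sum_distrib_left)
    finally show "e * u \<in> G" using c(1) by (intro GI[of "\<lambda>t. e * c t"]) (auto intro: ideal_times(1)[OF mm_ideal])
  qed
  moreover have "x * y \<in> G" if xy: "x \<in> mm" "y \<in> mm" for x y
  proof -
    obtain a s where as: "a \<in> rg.span aa" "s \<in> rg.span S" "y = a + s" using xy(2) unfolding S(2) rg.span_Un by blast
    obtain e where e: "s = (\<Sum>t\<in>S. e t * t)" using as(2) rg.span_finite[OF S(1)] by auto
    have "a \<in> b" using as(1) rg.span_minimal[OF b(2,1)] by blast
    have "x * y - (\<Sum>t\<in>S. (x * e t) * t) = x * a" by (simp add: as(3) e algebra_simps sum_distrib_left)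
    then have "x * y - (\<Sum>t\<in>S. (x * e t) * t) \<in> b" using \<open>a \<in> b\<close> ideal_times(1)[OF b(1)] by simp
    then show ?thesis using xy(1) by (intro GI[of "\<lambda>t. x * e t"]) (auto intro: ideal_times(2)[OF mm_ideal])
  qed
  moreover have "b \<subseteq> G" using rg.subspace_0[OF mm_ideal] by (auto intro!: GI[of "\<lambda>_. 0"])
  ultimately have "rg.span ({a * b | a b. a \<in> mm \<and> b \<in> mm} \<union> b) \<subseteq> G" by (intro rg.span_minimal) auto
  then have "mm \<subseteq> G" using all by blast
  have "\<exists>w. w \<notin> mm \<and> (\<forall>t\<in>S. w * t \<in> b)"
  proof (rule rg.nakayama_prime[where g = "\<lambda>x. x", OF mm_prime S(1) b(1)])
    fix t assume "t \<in> S"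
    then have "t \<in> G" using Smm \<open>mm \<subseteq> G\<close> by blast
    then obtain c where "\<forall>t\<in>S. c t \<in> mm" "t - (\<Sum>t\<in>S. c t * t) \<in> b" by (auto simp: G_def)
    then show "\<exists>u c. u \<notin> mm \<and> (\<forall>b\<in>S. c b \<in> mm) \<and> u * t - (\<Sum>b\<in>S. c b * b) \<in> b"
      using one_mm by (intro exI[of _ 1] exI[of _ c]) simp
  qed
  then obtain w where w: "w \<notin> mm" "\<And>t. t \<in> S \<Longrightarrow> w * t \<in> b" by blast
  obtain v where v: "v * w - 1 \<in> aa" using unit_mod[OF w(1)] by blast
  have "t \<in> b" if "t \<in> S" for t
  proof -
    have "v * (w * t) - (v * w - 1) * t \<in> b"
      by (rule rg.subspace_diff[OF b(1) ideal_times(1)[OF b(1) w(2)[OF that]] ideal_times(2)[OF b(1) subsetD[OF b(2) v]]])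
    then show ?thesis by (simp add: algebra_simps)
  qed
  then have "mm \<subseteq> b" unfolding S(2) using b by (intro rg.span_minimal) auto
  then show False using b(3,4) by blast
qed

end

context local_module
begin

text \<open>
  Take a sequence with all the required regularity properties whose ideal is maximal. If the
  conclusion failed, the socle of \<open>S / (xs)\<close> would vanish, and \<open>xs\<close> could be extended on the ring.
  The depth hypothesis then provides a sequence on the module that is longer than \<open>xs\<close>, so the socle
  of the module modulo \<open>xs\<close> vanishes as well. Hence there is an element avoiding the associated
  primes of both quotients, and it can be chosen outside of \<open>mm\<^sup>2 + (xs)\<close>.
\<close>

theorem exists_adapted_sequence:
  assumes B: "submod B"
    and depth: "\<And>xs. ring_regular xs \<Longrightarrow> set xs \<subseteq> mm \<Longrightarrow>
      \<exists>ys. length ys = length xs \<and> set ys \<subseteq> mm \<and> regseq B ys"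
  shows "\<exists>xs. min_regular_seq aa xs \<and> set xs \<subseteq> mm \<and> ring_regular xs \<and> regseq B xs \<and>
    (mm = rg.span (aa \<union> set xs) \<or>
     (\<exists>s\<in>mm. s \<notin> rg.span (aa \<union> set xs) \<and> (\<forall>r\<in>mm. s * r \<in> rg.span (aa \<union> set xs))))"
proof -
  interpret R: local_module "(*)" aa mm aa UNIV
    by unfold_locales (auto simp: noeth_aa intro: ideal_times(2)[OF aa_ideal])
  have Rext: "R.ext aa S = rg.span (aa \<union> S)" for S
  proof
    have "{x * a |x a. x \<in> S \<and> a \<in> UNIV} \<subseteq> rg.span (aa \<union> S)"
      using ideal_times(2)[OF rg.subspace_span rg.span_base, of _ "aa \<union> S"] by blast
    moreover have "aa \<subseteq> rg.span (aa \<union> S)" using rg.span_superset[of "aa \<union> S"] by blast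
    ultimately show "R.ext aa S \<subseteq> rg.span (aa \<union> S)" unfolding R.ext_def by (intro rg.span_minimal) auto
    have "S \<subseteq> {x * a |x a. x \<in> S \<and> a \<in> UNIV}"
      using mult_1_right[symmetric, where 'a = 'a] by blast
    then show "rg.span (aa \<union> S) \<subseteq> R.ext aa S" unfolding R.ext_def by (intro rg.span_mono) auto
  qed
  have Rsub: "R.submod J \<longleftrightarrow> rg.subspace J \<and> aa \<subseteq> J" for J by (simp add: R.submod_def)
  let ?b = "\<lambda>xs. rg.span (aa \<union> set xs)"
  have aab: "aa \<subseteq> ?b xs" for xs using rg.span_superset[of "aa \<union> set xs"] by blast
  have bmm: "?b xs \<subseteq> mm" if "set xs \<subseteq> mm" for xs using that aa_mm by (intro rg.span_minimal mm_ideal) auto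
  define ok where "ok xs \<longleftrightarrow> min_regular_seq aa xs \<and> set xs \<subseteq> mm \<and> ring_regular xs \<and> regseq B xs" for xs
  define C where "C = {?b xs | xs. ok xs}"
  have "ok []" by (simp add: ok_def ring_regular_def regseq_def)
  then have "?b [] \<in> C" unfolding C_def by blast
  moreover have "rg.subspace H \<and> aa \<subseteq> H \<and> H \<subseteq> UNIV" if "H \<in> C" for H using that aab by (auto simp: C_def)
  ultimately obtain M where M: "M \<in> C" and max: "\<forall>H\<in>C. M \<subseteq> H \<longrightarrow> H = M"
    using rg.noeth_max[OF noeth_aa] by meson
  then obtain xs where xs: "M = ?b xs" "ok xs" by (auto simp: C_def)
  have MI: "rg.subspace M" "aa \<subseteq> M" "M \<subseteq> mm" using xs aab bmm by (auto simp: ok_def)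
  have "mm = M \<or> (\<exists>s\<in>mm. s \<notin> M \<and> (\<forall>r\<in>mm. s * r \<in> M))"
  proof (rule ccontr)
    assume neg: "\<not> ?thesis"
    have nsR: "R.no_socle M" unfolding R.no_socle_def
    proof (intro ballI impI)
      fix s assume s: "\<forall>r\<in>mm. r * s \<in> M"
      show "s \<in> M"
      proof (rule ccontr)
        assume "s \<notin> M"
        then have "s \<notin> mm" using neg s by (auto simp: mult.commute)
        then obtain v where v: "v * s - 1 \<in> aa" using unit_mod by blast
        have "r \<in> M" if "r \<in> mm" for r
        proof -
          have "v * (r * s) - (v * s - 1) * r \<in> M" using s that
            by (intro rg.subspace_diff[OF MI(1)] ideal_times(1)[OF MI(1), of "r * s"] ideal_times(2)[OF MI(1) subsetD[OF MI(2) v]]) auto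
          then show ?thesis by (simp add: algebra_simps)
        qed
        then show False using neg MI(3) by blast
      qed
    qed
    obtain z where z: "z \<in> mm" "R.regular_on M z"
      using R.exists_common_regular[of "{M}"] nsR MI Rsub by auto
    have snoc: "ring_regular (xs @ [z])" if "R.regular_on M z" for z
      using xs(2) that unfolding ring_regular_def ok_def R.regular_on_def xs(1)
      by (auto simp: nth_append less_Suc_eq)
    have "set (xs @ [z]) \<subseteq> mm" using xs(2) z(1) by (auto simp: ok_def)
    then obtain ys where ys: "length ys = Suc (length xs)" "set ys \<subseteq> mm" "regseq B ys"
      using depth[OF snoc[OF z(2)]] by auto
    have nsK: "no_socle (ext B (set xs))"
      using xs(2) ys by (intro longer_regseq_no_socle[of B xs ys] B) (auto simp: ok_def)
    have MK: "submod (ext B (set xs))" by (rule submod_ext[OF B])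
    have MR: "R.submod M" using MI Rsub by simp
    define Q where "Q = {p. R.assoc_prime M p} \<union> {p. assoc_prime (ext B (set xs)) p}"
    have finQ: "finite Q" using R.finite_assoc_primes[OF MR] finite_assoc_primes[OF MK] by (simp add: Q_def)
    have Q: "prime_id q \<and> aa \<subseteq> q \<and> \<not> mm \<subseteq> q" if "q \<in> Q" for q
      using that R.assoc_prime_no_socle[OF MR nsR] assoc_prime_no_socle[OF MK nsK] by (auto simp: Q_def)
    let ?N = "rg.span ({a * b | a b. a \<in> mm \<and> b \<in> mm} \<union> M)"
    obtain y where y: "y \<in> mm" "y \<notin> ?N" using mm_square_proper[OF MI] neg by blast
    obtain x where x: "x \<in> mm" "\<forall>q\<in>Q. x \<notin> q" using prime_avoidance[OF finQ Q] by blast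
    \<comment> \<open>prime avoidance with one ideal that need not be prime: an \<open>x\<close> in \<open>?N\<close> is corrected by adding
      a power of it to \<open>y\<close>, which lies outside of \<open>?N\<close>\<close>
    have "\<exists>w\<in>mm. w \<notin> ?N \<and> (\<forall>q\<in>Q. w \<notin> q)"
    proof (cases "x \<in> ?N")
      case True
      obtain j where j: "j \<ge> 1" "\<forall>q\<in>Q. y + x ^ j \<notin> q"
        using shift_avoids_primes[OF finQ _ x(1), of y] Q x(2) by blast
      have e: "x ^ j = x * x ^ (j - 1)" using j(1) by (simp add: power_eq_if)
      have "x ^ j \<in> mm" unfolding e by (rule ideal_times(2)[OF mm_ideal x(1)])
      then have "y + x ^ j \<in> mm" by (rule rg.subspace_add[OF mm_ideal y(1)])
      moreover have "y + x ^ j \<notin> ?N"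
      proof
        assume a: "y + x ^ j \<in> ?N"
        have "x ^ j \<in> ?N" unfolding e by (rule ideal_times(2)[OF rg.subspace_span True])
        from rg.span_diff[OF a this] show False using y(2) by simp
      qed
      ultimately show ?thesis using j(2) by blast
    qed (use x in blast)
    then obtain w where w: "w \<in> mm" "w \<notin> ?N" "\<forall>q\<in>Q. w \<notin> q" by blast
    have wR: "R.regular_on M w" using w(3) by (intro R.regular_on_of_avoid[OF MR]) (auto simp: Q_def)
    have wK: "regular_on (ext B (set xs)) w" using w(3) by (intro regular_on_of_avoid[OF MK]) (auto simp: Q_def)
    have "min_regular_seq aa (xs @ [w])"
      unfolding min_regular_seq_snoc[OF aa_ideal] using xs w wR by (auto simp: ok_def R.regular_on_def)
    moreover have "regseq B (xs @ [w])"
      using xs(2) wK unfolding ok_def regseq_def by (auto simp: nth_append less_Suc_eq)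
    ultimately have "ok (xs @ [w])" using snoc[OF wR] xs(2) w(1) by (auto simp: ok_def)
    then have "?b (xs @ [w]) \<in> C" unfolding C_def by blast
    moreover have "M \<subseteq> ?b (xs @ [w])" unfolding xs(1) by (intro rg.span_mono) auto
    ultimately have "?b (xs @ [w]) = M" using max by blast
    then have "w \<in> M" using rg.span_base[of w "aa \<union> set (xs @ [w])"] by auto
    then show False using w(2) rg.span_base[of w "{a * b | a b. a \<in> mm \<and> b \<in> mm} \<union> M"] by blast
  qed
  then show ?thesis using xs unfolding ok_def by blast
qed

end

section \<open>Weakly regular sequences on modules\<close>

text \<open>
  The submodule \<open>(xs) M\<close>. Recursion over the list suits inductions over regular sequences better than
  the submodule generated by an ideal.
\<close>

fun mults :: "('a, 'b, 'c) module_scheme \<Rightarrow> 'a list \<Rightarrow> 'b set" where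
  "mults M [] = {\<zero>\<^bsub>M\<^esub>}"
| "mults M (x # xs) = {x \<odot>\<^bsub>M\<^esub> y \<oplus>\<^bsub>M\<^esub> z | y z. y \<in> carrier M \<and> z \<in> mults M xs}"

text \<open>
  A regular sequence up to the condition \<open>(xs) M \<noteq> M\<close>, which summands such as \<open>0\<close> do not inherit. The
  regularity of the single members passes to all direct sums and summands.
\<close>

definition weakly_regular :: "('a, 'b, 'c) module_scheme \<Rightarrow> 'a list \<Rightarrow> bool" where
  "weakly_regular M xs \<longleftrightarrow> (\<forall>i<length xs. \<forall>y\<in>carrier M.
     xs ! i \<odot>\<^bsub>M\<^esub> y \<in> mults M (take i xs) \<longrightarrow> y \<in> mults M (take i xs))"

definition kills :: "('a, 'b, 'c) module_scheme \<Rightarrow> 'a \<Rightarrow> 'a list \<Rightarrow> bool" where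
  "kills M s xs \<longleftrightarrow> (\<forall>y\<in>carrier M. s \<odot>\<^bsub>M\<^esub> y \<in> mults M xs)"

lemma in_multsI: "y \<in> carrier M \<Longrightarrow> z \<in> mults M xs \<Longrightarrow> x \<odot>\<^bsub>M\<^esub> y \<oplus>\<^bsub>M\<^esub> z \<in> mults M (x # xs)"
  by auto

lemma take_set: "set xs \<subseteq> S \<Longrightarrow> set (take i xs) \<subseteq> S"
  by (meson order_trans set_take_subset)

context module
begin

lemma mults_carrier: "set xs \<subseteq> carrier R \<Longrightarrow> mults M xs \<subseteq> carrier M"
  by (induction xs) auto

lemma mults_submodule: "set xs \<subseteq> carrier R \<Longrightarrow> submodule (mults M xs) R M"
proof (induction xs)
  case Nil
  show ?case by (rule submoduleI) auto
next
  case (Cons x xs)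
  then have x: "x \<in> carrier R" and sub: "submodule (mults M xs) R M" by auto
  note S = submoduleE[OF sub]
  have S0: "\<zero>\<^bsub>M\<^esub> \<in> mults M xs" using sub by (simp add: submodule.axioms(1) subgroup.one_closed[of _ "add_monoid M", simplified])
  show ?case
  proof (rule submoduleI)
    show "mults M (x # xs) \<subseteq> carrier M" using mults_carrier[OF Cons.prems] .
    have "x \<odot>\<^bsub>M\<^esub> \<zero>\<^bsub>M\<^esub> \<oplus>\<^bsub>M\<^esub> \<zero>\<^bsub>M\<^esub> \<in> mults M (x # xs)" by (rule in_multsI[OF M.zero_closed S0])
    then show "\<zero>\<^bsub>M\<^esub> \<in> mults M (x # xs)" using x by simp
    fix a assume "a \<in> mults M (x # xs)"
    then obtain y z where a: "a = x \<odot>\<^bsub>M\<^esub> y \<oplus>\<^bsub>M\<^esub> z" "y \<in> carrier M" "z \<in> mults M xs" by auto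
    have zc: "z \<in> carrier M" using a(3) S(1) by blast
    have "\<ominus>\<^bsub>M\<^esub> a = x \<odot>\<^bsub>M\<^esub> (\<ominus>\<^bsub>M\<^esub> y) \<oplus>\<^bsub>M\<^esub> \<ominus>\<^bsub>M\<^esub> z" using a x zc by (simp add: smult_r_minus M.minus_add)
    then show "\<ominus>\<^bsub>M\<^esub> a \<in> mults M (x # xs)" using in_multsI[OF M.a_inv_closed[OF a(2)] S(3)[OF a(3)], of x] by simp
    { fix b assume "b \<in> mults M (x # xs)"
      then obtain y' z' where b: "b = x \<odot>\<^bsub>M\<^esub> y' \<oplus>\<^bsub>M\<^esub> z'" "y' \<in> carrier M" "z' \<in> mults M xs" by auto
      have zc': "z' \<in> carrier M" using b(3) S(1) by blast
      have "a \<oplus>\<^bsub>M\<^esub> b = x \<odot>\<^bsub>M\<^esub> (y \<oplus>\<^bsub>M\<^esub> y') \<oplus>\<^bsub>M\<^esub> (z \<oplus>\<^bsub>M\<^esub> z')"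
        using a(1,2) b(1,2) x zc zc' by (simp add: smult_r_distr M.a_ac)
      then show "a \<oplus>\<^bsub>M\<^esub> b \<in> mults M (x # xs)"
        using in_multsI[OF M.a_closed[OF a(2) b(2)] S(5)[OF a(3) b(3)], of x] by simp }
    fix r assume r: "r \<in> carrier R"
    have "r \<odot>\<^bsub>M\<^esub> a = x \<odot>\<^bsub>M\<^esub> (r \<odot>\<^bsub>M\<^esub> y) \<oplus>\<^bsub>M\<^esub> r \<odot>\<^bsub>M\<^esub> z"
      using a(1,2) x r zc by (simp add: smult_r_distr smult_assoc1[symmetric] R.m_comm)
    then show "r \<odot>\<^bsub>M\<^esub> a \<in> mults M (x # xs)"
      using in_multsI[OF smult_closed[OF r a(2)] S(4)[OF r a(3)], of x] by simp
  qed
qed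

lemma submodule_zero: "submodule H R M \<Longrightarrow> \<zero>\<^bsub>M\<^esub> \<in> H"
  by (simp add: submodule.axioms(1) subgroup.one_closed[of _ "add_monoid M", simplified])

lemma mults_zero: "set xs \<subseteq> carrier R \<Longrightarrow> \<zero>\<^bsub>M\<^esub> \<in> mults M xs"
  by (rule submodule_zero[OF mults_submodule])

lemma mults_snoc:
  assumes "set xs \<subseteq> carrier R" "x \<in> carrier R"
  shows "v \<in> mults M (xs @ [x]) \<longleftrightarrow> (\<exists>z\<in>mults M xs. \<exists>y\<in>carrier M. v = z \<oplus>\<^bsub>M\<^esub> x \<odot>\<^bsub>M\<^esub> y)"
  using assms(1)
proof (induction xs arbitrary: v)
  case Nil
  show ?case using assms(2) by (auto intro: M.a_comm) (metis M.r_zero M.l_zero smult_closed)+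
next
  case (Cons w xs)
  then have IH: "\<And>v. v \<in> mults M (xs @ [x]) \<longleftrightarrow> (\<exists>z\<in>mults M xs. \<exists>y\<in>carrier M. v = z \<oplus>\<^bsub>M\<^esub> x \<odot>\<^bsub>M\<^esub> y)" 
    and w: "w \<in> carrier R" and c: "mults M xs \<subseteq> carrier M" using mults_carrier by auto
  have "v \<in> mults M (w # xs @ [x]) \<longleftrightarrow>
    (\<exists>y'\<in>carrier M. \<exists>z\<in>mults M xs. \<exists>y\<in>carrier M. v = w \<odot>\<^bsub>M\<^esub> y' \<oplus>\<^bsub>M\<^esub> (z \<oplus>\<^bsub>M\<^esub> x \<odot>\<^bsub>M\<^esub> y))"
    using IH by auto
  also have "\<dots> \<longleftrightarrow> (\<exists>y'\<in>carrier M. \<exists>z\<in>mults M xs. \<exists>y\<in>carrier M. v = (w \<odot>\<^bsub>M\<^esub> y' \<oplus>\<^bsub>M\<^esub> z) \<oplus>\<^bsub>M\<^esub> x \<odot>\<^bsub>M\<^esub> y)"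
    using c w assms(2) by (intro bex_cong refl) (auto simp: M.a_assoc subset_iff)
  also have "\<dots> \<longleftrightarrow> (\<exists>z\<in>mults M (w # xs). \<exists>y\<in>carrier M. v = z \<oplus>\<^bsub>M\<^esub> x \<odot>\<^bsub>M\<^esub> y)"
    by auto
  finally show ?case by simp
qed

lemma mults_smult_mem:
  assumes "set xs \<subseteq> carrier R" "x \<in> set xs" "y \<in> carrier M"
  shows "x \<odot>\<^bsub>M\<^esub> y \<in> mults M xs"
  using assms
proof (induction xs)
  case (Cons w xs)
  show ?case
  proof (cases "x = w")
    case True
    have "w \<odot>\<^bsub>M\<^esub> y \<oplus>\<^bsub>M\<^esub> \<zero>\<^bsub>M\<^esub> \<in> mults M (w # xs)" using Cons.prems by (intro in_multsI mults_zero) auto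
    then show ?thesis using True Cons.prems by simp
  next
    case False
    then have 1: "x \<odot>\<^bsub>M\<^esub> y \<in> mults M xs" using Cons by auto
    then have "w \<odot>\<^bsub>M\<^esub> \<zero>\<^bsub>M\<^esub> \<oplus>\<^bsub>M\<^esub> x \<odot>\<^bsub>M\<^esub> y \<in> mults M (w # xs)" by (intro in_multsI) auto
    moreover have "x \<odot>\<^bsub>M\<^esub> y \<in> carrier M" using Cons.prems by auto
    ultimately show ?thesis using Cons.prems by auto
  qed
qed simp

end

lemma mults_eq_ideal_times_module:
  fixes M :: "('a, 'b) module"
  assumes "module R M" and xs: "set xs \<subseteq> carrier R"
  shows "ideal_times_module R (Idl\<^bsub>R\<^esub> (set xs)) M = mults M xs"
proof
  interpret module R M by fact
  let ?I = "Idl\<^bsub>R\<^esub> (set xs)"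
  have I: "ideal ?I R" "set xs \<subseteq> ?I" using R.genideal_ideal[OF xs] R.genideal_self[OF xs] by auto
  define J where "J = {r \<in> carrier R. \<forall>y\<in>carrier M. r \<odot>\<^bsub>M\<^esub> y \<in> mults M xs}"
  note S = submoduleE[OF mults_submodule[OF xs]]
  have "ideal J R"
  proof (rule idealI[OF R.ring_axioms])
    show "subgroup J (add_monoid R)"
    proof (rule R.add.subgroupI)
      show "J \<noteq> {}" using mults_zero[OF xs] by (auto simp: J_def intro: exI[of _ "\<zero>\<^bsub>R\<^esub>"])
    qed (use S in \<open>auto simp: J_def smult_l_minus smult_l_distr a_inv_def[symmetric]\<close>)
  qed (use S in \<open>auto simp: J_def smult_assoc1\<close>)
  moreover have "set xs \<subseteq> J" using mults_smult_mem[OF xs] xs by (auto simp: J_def)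
  ultimately have IJ: "?I \<subseteq> J" by (rule R.genideal_minimal)
  show "ideal_times_module R ?I M \<subseteq> mults M xs"
    unfolding ideal_times_module_def generated_submodule_def
    using IJ mults_submodule[OF xs] by (intro Inter_lower) (auto simp: J_def)
  show "mults M xs \<subseteq> ideal_times_module R ?I M"
    unfolding ideal_times_module_def generated_submodule_def
  proof (rule Inter_greatest)
    fix H assume "H \<in> {H. submodule H R M \<and> {r \<odot>\<^bsub>M\<^esub> y |r y. r \<in> ?I \<and> y \<in> carrier M} \<subseteq> H}"
    then have H: "submodule H R M" and IH: "\<And>r y. r \<in> ?I \<Longrightarrow> y \<in> carrier M \<Longrightarrow> r \<odot>\<^bsub>M\<^esub> y \<in> H" by blast+
    have "mults M zs \<subseteq> H" if "set zs \<subseteq> ?I" for zs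
      using that
    proof (induction zs)
      case Nil
      then show ?case using submodule_zero[OF H] by simp
    next
      case (Cons z zs)
      then show ?case using IH submoduleE(5)[OF H] by auto
    qed
    then show "mults M xs \<subseteq> H" using I(2) by blast
  qed
qed

lemma module_homD:
  assumes "f \<in> module_hom R M N"
  shows "y \<in> carrier M \<Longrightarrow> f y \<in> carrier N"
    "y \<in> carrier M \<Longrightarrow> z \<in> carrier M \<Longrightarrow> f (y \<oplus>\<^bsub>M\<^esub> z) = f y \<oplus>\<^bsub>N\<^esub> f z"
    "r \<in> carrier R \<Longrightarrow> y \<in> carrier M \<Longrightarrow> f (r \<odot>\<^bsub>M\<^esub> y) = r \<odot>\<^bsub>N\<^esub> f y"
  using assms by (auto simp: module_hom_def hom_def)

lemma module_hom_zero:
  assumes "f \<in> module_hom R M N" "module R M" "module R N"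
  shows "f \<zero>\<^bsub>M\<^esub> = \<zero>\<^bsub>N\<^esub>"
proof -
  interpret M: module R M by fact
  interpret N: module R N by fact
  have "f \<zero>\<^bsub>M\<^esub> \<oplus>\<^bsub>N\<^esub> f \<zero>\<^bsub>M\<^esub> = f \<zero>\<^bsub>M\<^esub>"
    using module_homD(2)[OF assms(1), of "\<zero>\<^bsub>M\<^esub>" "\<zero>\<^bsub>M\<^esub>"] by simp
  then show ?thesis using module_homD(1)[OF assms(1), of "\<zero>\<^bsub>M\<^esub>"] by (metis M.M.zero_closed N.M.add.r_cancel_one)
qed

lemma mults_hom:
  assumes f: "f \<in> module_hom R M N" and M: "module R M" "module R N" and xs: "set xs \<subseteq> carrier R"
  shows "y \<in> mults M xs \<Longrightarrow> f y \<in> mults N xs"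
  using xs
proof (induction xs arbitrary: y)
  case Nil
  then show ?case using module_hom_zero[OF f M] by simp
next
  case (Cons x xs)
  interpret M: module R M by fact
  obtain u v where u: "y = x \<odot>\<^bsub>M\<^esub> u \<oplus>\<^bsub>M\<^esub> v" "u \<in> carrier M" "v \<in> mults M xs" using Cons.prems(1) by auto
  have "v \<in> carrier M" using u(3) M.mults_carrier[of xs] Cons.prems(2) by auto
  then have "f y = x \<odot>\<^bsub>N\<^esub> f u \<oplus>\<^bsub>N\<^esub> f v" using u Cons.prems(2) by (simp add: module_homD[OF f])
  then show ?case using module_homD(1)[OF f u(2)] Cons.IH[OF u(3)] Cons.prems(2) by auto
qed

lemma mults_surj:
  assumes f: "f \<in> module_hom R M N" "f ` carrier M = carrier N" and M: "module R M" "module R N" and xs: "set xs \<subseteq> carrier R"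
  shows "z \<in> mults N xs \<Longrightarrow> \<exists>y\<in>mults M xs. f y = z"
  using xs
proof (induction xs arbitrary: z)
  case Nil
  then show ?case using module_hom_zero[OF f(1) M] by simp
next
  case (Cons x xs)
  interpret M: module R M by fact
  obtain u v where u: "z = x \<odot>\<^bsub>N\<^esub> u \<oplus>\<^bsub>N\<^esub> v" "u \<in> carrier N" "v \<in> mults N xs" using Cons.prems(1) by auto
  obtain v' where v': "v' \<in> mults M xs" "f v' = v" using Cons.IH[OF u(3)] Cons.prems(2) by auto
  obtain u' where u': "u' \<in> carrier M" "f u' = u" using u(2) f(2) by (metis imageE)
  have "v' \<in> carrier M" using v'(1) M.mults_carrier[of xs] Cons.prems(2) by auto
  then have "f (x \<odot>\<^bsub>M\<^esub> u' \<oplus>\<^bsub>M\<^esub> v') = z" using u u' v' Cons.prems(2) by (simp add: module_homD[OF f(1)])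
  then show ?case using in_multsI[OF u'(1) v'(1)] by blast
qed

lemma kills_surj:
  assumes f: "f \<in> module_hom R M N" "f ` carrier M = carrier N" and M: "module R M" "module R N" 
    and xs: "set xs \<subseteq> carrier R" "s \<in> carrier R" and k: "kills M s xs"
  shows "kills N s xs"
  unfolding kills_def
proof
  fix y assume "y \<in> carrier N"
  then obtain u where u: "u \<in> carrier M" "y = f u" using f(2) by (metis imageE)
  have "f (s \<odot>\<^bsub>M\<^esub> u) \<in> mults N xs" using k u(1) by (intro mults_hom[OF f(1) M xs(1)]) (simp add: kills_def)
  then show "s \<odot>\<^bsub>N\<^esub> y \<in> mults N xs" using u xs(2) by (simp add: module_homD[OF f(1)])
qed

lemma module_isomorphic_sym:
  assumes "module R M" "module R N" "module_isomorphic R M N" shows "module_isomorphic R N M"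
proof -
  interpret M: module R M by fact
  interpret N: module R N by fact
  obtain f where f: "f \<in> module_hom R M N" "bij_betw f (carrier M) (carrier N)"
    using assms(3) unfolding module_isomorphic_def by blast
  let ?g = "inv_into (carrier M) f"
  have g: "bij_betw ?g (carrier N) (carrier M)" by (rule bij_betw_inv_into[OF f(2)])
  have fg: "f (?g y) = y" "?g y \<in> carrier M" if "y \<in> carrier N" for y
    using that f(2) g bij_betw_inv_into_right[OF f(2)] bij_betwE[OF g] by auto
  have gf: "?g (f y) = y" if "y \<in> carrier M" for y using that f(2) bij_betw_inv_into_left by metis
  have "?g \<in> module_hom R N M" unfolding module_hom_def hom_def
  proof (intro CollectI conjI ballI)
    show "?g \<in> carrier (add_monoid N) \<rightarrow> carrier (add_monoid M)" using fg by auto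
    show "?g (y \<otimes>\<^bsub>add_monoid N\<^esub> z) = ?g y \<otimes>\<^bsub>add_monoid M\<^esub> ?g z"
      if "y \<in> carrier (add_monoid N)" "z \<in> carrier (add_monoid N)" for y z
    proof -
      have "f (?g y \<oplus>\<^bsub>M\<^esub> ?g z) = y \<oplus>\<^bsub>N\<^esub> z" using that fg by (simp add: module_homD[OF f(1)])
      then show ?thesis using gf[of "?g y \<oplus>\<^bsub>M\<^esub> ?g z"] that fg by simp
    qed
    show "?g (r \<odot>\<^bsub>N\<^esub> y) = r \<odot>\<^bsub>M\<^esub> ?g y" if "r \<in> carrier R" "y \<in> carrier N" for r y
    proof -
      have "f (r \<odot>\<^bsub>M\<^esub> ?g y) = r \<odot>\<^bsub>N\<^esub> y" using that fg by (simp add: module_homD[OF f(1)])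
      then show ?thesis using gf[of "r \<odot>\<^bsub>M\<^esub> ?g y"] that fg by simp
    qed
  qed
  then show ?thesis unfolding module_isomorphic_def using g by blast
qed

lemma mults_iso:
  assumes f: "f \<in> module_hom R M N" "bij_betw f (carrier M) (carrier N)" and M: "module R M" "module R N" 
    and xs: "set xs \<subseteq> carrier R" and y: "y \<in> carrier M"
  shows "f y \<in> mults N xs \<longleftrightarrow> y \<in> mults M xs"
proof
  show "y \<in> mults M xs \<Longrightarrow> f y \<in> mults N xs" by (rule mults_hom[OF f(1) M xs])
  assume "f y \<in> mults N xs"
  then obtain z where z: "z \<in> mults M xs" "f z = f y"
    using mults_surj[OF f(1) _ M xs] f(2) by (metis bij_betw_imp_surj_on)
  then have "z \<in> carrier M" using module.mults_carrier[OF M(1) xs] by blast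
  then show "y \<in> mults M xs" using z y f(2) by (metis bij_betw_inv_into_left)
qed

lemma weakly_regular_iso:
  assumes M: "module R M" "module R N" and xs: "set xs \<subseteq> carrier R" and i: "module_isomorphic R M N"
    and w: "weakly_regular N xs"
  shows "weakly_regular M xs"
  unfolding weakly_regular_def
proof (intro allI ballI impI)
  fix i y assume i: "i < length xs" and y: "y \<in> carrier M" "xs ! i \<odot>\<^bsub>M\<^esub> y \<in> mults M (take i xs)"
  obtain f where f: "f \<in> module_hom R M N" "bij_betw f (carrier M) (carrier N)"
    using \<open>module_isomorphic R M N\<close> unfolding module_isomorphic_def by blast
  have ts: "set (take i xs) \<subseteq> carrier R" by (rule take_set[OF xs])
  have xi: "xs ! i \<in> carrier R" using xs i by auto
  have "f (xs ! i \<odot>\<^bsub>M\<^esub> y) \<in> mults N (take i xs)" by (rule mults_hom[OF f(1) M ts y(2)])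
  then have "f y \<in> mults N (take i xs)" using w i module_homD[OF f(1)] y(1) xi by (simp add: weakly_regular_def)
  then show "y \<in> mults M (take i xs)" using mults_iso[OF f M ts y(1)] by blast
qed

lemma kills_iso:
  assumes M: "module R M" "module R N" and xs: "set xs \<subseteq> carrier R" "s \<in> carrier R" and i: "module_isomorphic R M N"
    and w: "kills N s xs"
  shows "kills M s xs"
proof -
  obtain f where f: "f \<in> module_hom R N M" "bij_betw f (carrier N) (carrier M)"
    using module_isomorphic_sym[OF M i] unfolding module_isomorphic_def by blast
  show ?thesis by (rule kills_surj[OF f(1) bij_betw_imp_surj_on[OF f(2)] M(2,1) xs w])
qed

section \<open>Direct sums, summands and kernels\<close>

lemma direct_sum_simps:
  "f \<in> carrier (direct_sum I E) \<longleftrightarrow> f \<in> (\<Pi>\<^sub>E i\<in>I. carrier (E i)) \<and> finite {i \<in> I. f i \<noteq> \<zero>\<^bsub>E i\<^esub>}"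
  "\<zero>\<^bsub>direct_sum I E\<^esub> = (\<lambda>i\<in>I. \<zero>\<^bsub>E i\<^esub>)"
  "f \<oplus>\<^bsub>direct_sum I E\<^esub> g = (\<lambda>i\<in>I. f i \<oplus>\<^bsub>E i\<^esub> g i)"
  "r \<odot>\<^bsub>direct_sum I E\<^esub> f = (\<lambda>i\<in>I. r \<odot>\<^bsub>E i\<^esub> f i)"
  by (auto simp: direct_sum_def)

lemma direct_sum_module:
  assumes R: "cring R" and E: "\<And>i. i \<in> I \<Longrightarrow> module R (E i)"
  shows "module R (direct_sum I E)"
proof -
  have ab: "abelian_group (E i)" if "i \<in> I" for i using E[OF that] by (simp add: module_def)
  note m = module.axioms(2)[OF E]
  let ?D = "direct_sum I E"
  have e: "\<And>i f. i \<in> I \<Longrightarrow> f \<in> carrier ?D \<Longrightarrow> f i \<in> carrier (E i)" by (auto simp: direct_sum_simps)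
  have eqI: "f = g" if "f \<in> extensional I" "g \<in> extensional I" "\<And>i. i \<in> I \<Longrightarrow> f i = g i" for f g
    using that by (rule extensionalityI)
  have ext: "f \<in> extensional I" if "f \<in> carrier ?D" for f using that by (auto simp: direct_sum_simps PiE_def)
  have supp: "finite {i \<in> I. h i \<noteq> \<zero>\<^bsub>E i\<^esub>}"
    if "f \<in> carrier ?D" "g \<in> carrier ?D" "\<And>i. i \<in> I \<Longrightarrow> f i = \<zero>\<^bsub>E i\<^esub> \<Longrightarrow> g i = \<zero>\<^bsub>E i\<^esub> \<Longrightarrow> h i = \<zero>\<^bsub>E i\<^esub>" for f g h
  proof (rule finite_subset)
    show "{i \<in> I. h i \<noteq> \<zero>\<^bsub>E i\<^esub>} \<subseteq> {i \<in> I. f i \<noteq> \<zero>\<^bsub>E i\<^esub>} \<union> {i \<in> I. g i \<noteq> \<zero>\<^bsub>E i\<^esub>}" using that(3) by blast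
    show "finite ({i \<in> I. f i \<noteq> \<zero>\<^bsub>E i\<^esub>} \<union> {i \<in> I. g i \<noteq> \<zero>\<^bsub>E i\<^esub>})" using that by (simp add: direct_sum_simps)
  qed
  have z: "\<zero>\<^bsub>E i\<^esub> \<oplus>\<^bsub>E i\<^esub> \<zero>\<^bsub>E i\<^esub> = \<zero>\<^bsub>E i\<^esub>" if "i \<in> I" for i
    using abelian_monoid.l_zero[OF abelian_group.axioms(1)[OF ab[OF that]]] abelian_monoid.zero_closed[OF abelian_group.axioms(1)[OF ab[OF that]]] by blast
  have mz: "\<ominus>\<^bsub>E i\<^esub> \<zero>\<^bsub>E i\<^esub> = \<zero>\<^bsub>E i\<^esub>" if "i \<in> I" for i
    using abelian_group.minus_equality[OF ab[OF that] z[OF that]] abelian_monoid.zero_closed[OF abelian_group.axioms(1)[OF ab[OF that]]] by blast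
  have addc: "f \<oplus>\<^bsub>?D\<^esub> g \<in> carrier ?D" if "f \<in> carrier ?D" "g \<in> carrier ?D" for f g
  proof -
    have "(\<lambda>i\<in>I. f i \<oplus>\<^bsub>E i\<^esub> g i) \<in> (\<Pi>\<^sub>E i\<in>I. carrier (E i))"
      using e[OF _ that(1)] e[OF _ that(2)] ab by (auto intro: abelian_monoid.a_closed[OF abelian_group.axioms(1)])
    moreover have "finite {i \<in> I. (\<lambda>i\<in>I. f i \<oplus>\<^bsub>E i\<^esub> g i) i \<noteq> \<zero>\<^bsub>E i\<^esub>}" by (rule supp[OF that]) (simp add: z)
    ultimately show ?thesis by (simp add: direct_sum_simps)
  qed
  have smc: "r \<odot>\<^bsub>?D\<^esub> f \<in> carrier ?D" if "r \<in> carrier R" "f \<in> carrier ?D" for r f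
  proof -
    have "(\<lambda>i\<in>I. r \<odot>\<^bsub>E i\<^esub> f i) \<in> (\<Pi>\<^sub>E i\<in>I. carrier (E i))"
      using e[OF _ that(2)] that(1) by (auto intro: module.smult_closed[OF E])
    moreover have "finite {i \<in> I. (\<lambda>i\<in>I. r \<odot>\<^bsub>E i\<^esub> f i) i \<noteq> \<zero>\<^bsub>E i\<^esub>}"
      by (rule supp[OF that(2,2)]) (simp add: module.smult_r_null[OF E] that)
    ultimately show ?thesis by (simp add: direct_sum_simps)
  qed
  have zc: "\<zero>\<^bsub>?D\<^esub> \<in> carrier ?D"
    using ab by (auto simp: direct_sum_simps intro: abelian_monoid.zero_closed[OF abelian_group.axioms(1)])
  have ops: "(f \<oplus>\<^bsub>?D\<^esub> g) i = f i \<oplus>\<^bsub>E i\<^esub> g i" "\<zero>\<^bsub>?D\<^esub> i = \<zero>\<^bsub>E i\<^esub>" "(r \<odot>\<^bsub>?D\<^esub> f) i = r \<odot>\<^bsub>E i\<^esub> f i" if "i \<in> I" for f g r i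
    using that by (auto simp: direct_sum_simps)
  show ?thesis
  proof (rule moduleI[OF R])
    show "abelian_group ?D"
    proof (rule abelian_groupI)
      show "x \<oplus>\<^bsub>?D\<^esub> y \<in> carrier ?D" if "x \<in> carrier ?D" "y \<in> carrier ?D" for x y by (rule addc[OF that])
      show "\<zero>\<^bsub>?D\<^esub> \<in> carrier ?D" by (rule zc)
      show "x \<oplus>\<^bsub>?D\<^esub> y \<oplus>\<^bsub>?D\<^esub> z = x \<oplus>\<^bsub>?D\<^esub> (y \<oplus>\<^bsub>?D\<^esub> z)"
        if "x \<in> carrier ?D" "y \<in> carrier ?D" "z \<in> carrier ?D" for x y z
        by (rule eqI) (use that in \<open>auto intro!: ext addc simp: ops e abelian_monoid.a_assoc[OF abelian_group.axioms(1)[OF ab]]\<close>)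
      show "x \<oplus>\<^bsub>?D\<^esub> y = y \<oplus>\<^bsub>?D\<^esub> x" if "x \<in> carrier ?D" "y \<in> carrier ?D" for x y
        by (rule eqI) (use that in \<open>auto intro!: ext addc simp: ops e abelian_monoid.a_comm[OF abelian_group.axioms(1)[OF ab]]\<close>)
      show "\<zero>\<^bsub>?D\<^esub> \<oplus>\<^bsub>?D\<^esub> x = x" if "x \<in> carrier ?D" for x
        by (rule eqI) (use that in \<open>auto intro!: ext addc zc simp: ops e abelian_monoid.l_zero[OF abelian_group.axioms(1)[OF ab]]\<close>)
      show "\<exists>y\<in>carrier ?D. y \<oplus>\<^bsub>?D\<^esub> x = \<zero>\<^bsub>?D\<^esub>" if x: "x \<in> carrier ?D" for x
      proof (rule bexI)
        show nc: "(\<lambda>i\<in>I. \<ominus>\<^bsub>E i\<^esub> x i) \<in> carrier ?D"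
        proof -
          have "(\<lambda>i\<in>I. \<ominus>\<^bsub>E i\<^esub> x i) \<in> (\<Pi>\<^sub>E i\<in>I. carrier (E i))"
            using e[OF _ x] by (auto intro: abelian_group.a_inv_closed[OF ab])
          moreover have "finite {i \<in> I. (\<lambda>i\<in>I. \<ominus>\<^bsub>E i\<^esub> x i) i \<noteq> \<zero>\<^bsub>E i\<^esub>}"
            by (rule supp[OF x x]) (simp add: mz)
          ultimately show ?thesis by (simp add: direct_sum_simps)
        qed
        show "(\<lambda>i\<in>I. \<ominus>\<^bsub>E i\<^esub> x i) \<oplus>\<^bsub>?D\<^esub> x = \<zero>\<^bsub>?D\<^esub>"
          by (rule eqI) (use x nc in \<open>auto intro!: ext addc zc simp: ops e abelian_group.l_neg[OF ab]\<close>)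
      qed
    qed
    fix a b x y assume a: "a \<in> carrier R" "b \<in> carrier R" and x: "x \<in> carrier ?D" "y \<in> carrier ?D"
    have ab: "a \<oplus>\<^bsub>R\<^esub> b \<in> carrier R" "a \<otimes>\<^bsub>R\<^esub> b \<in> carrier R" "\<one>\<^bsub>R\<^esub> \<in> carrier R" using R a
      by (auto simp: cring_def ring.ring_simprules)
    show "a \<odot>\<^bsub>?D\<^esub> x \<in> carrier ?D" by (rule smc[OF a(1) x(1)])
    show "(a \<oplus>\<^bsub>R\<^esub> b) \<odot>\<^bsub>?D\<^esub> x = a \<odot>\<^bsub>?D\<^esub> x \<oplus>\<^bsub>?D\<^esub> b \<odot>\<^bsub>?D\<^esub> x"
      by (rule eqI) (use a ab x in \<open>auto intro!: ext addc smc simp: ops e module.smult_l_distr[OF E]\<close>)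
    show "a \<odot>\<^bsub>?D\<^esub> (x \<oplus>\<^bsub>?D\<^esub> y) = a \<odot>\<^bsub>?D\<^esub> x \<oplus>\<^bsub>?D\<^esub> a \<odot>\<^bsub>?D\<^esub> y"
      by (rule eqI) (use a ab x in \<open>auto intro!: ext addc smc simp: ops e module.smult_r_distr[OF E]\<close>)
    show "a \<otimes>\<^bsub>R\<^esub> b \<odot>\<^bsub>?D\<^esub> x = a \<odot>\<^bsub>?D\<^esub> (b \<odot>\<^bsub>?D\<^esub> x)"
      by (rule eqI) (use a ab x in \<open>auto intro!: ext addc smc simp: ops e module.smult_assoc1[OF E]\<close>)
  next
    fix x assume x: "x \<in> carrier ?D"
    have one: "\<one>\<^bsub>R\<^esub> \<in> carrier R" using R by (simp add: cring_def ring.ring_simprules)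
    show "\<one>\<^bsub>R\<^esub> \<odot>\<^bsub>?D\<^esub> x = x"
      by (rule eqI) (use x one in \<open>auto intro!: ext addc smc simp: ops e module.smult_one[OF E]\<close>)
  qed
qed

text \<open>
  A coefficient is chosen for each component. Where \<open>f\<close> vanishes the choice must be \<open>0\<close>, so that the
  coefficients again have finite support.
\<close>

lemma mults_direct_sum:
  assumes R: "cring R" and E: "\<And>i. i \<in> I \<Longrightarrow> module R (E i)" and xs: "set xs \<subseteq> carrier R"
  shows "f \<in> carrier (direct_sum I E) \<Longrightarrow> f \<in> mults (direct_sum I E) xs \<longleftrightarrow> (\<forall>i\<in>I. f i \<in> mults (E i) xs)"
  using xs
proof (induction xs arbitrary: f)
  case Nil
  have "f = (\<lambda>i\<in>I. \<zero>\<^bsub>E i\<^esub>) \<longleftrightarrow> (\<forall>i\<in>I. f i = \<zero>\<^bsub>E i\<^esub>)"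
    using Nil.prems(1) by (auto simp: direct_sum_simps PiE_def intro!: extensionalityI)
  then show ?case by (simp add: direct_sum_simps)
next
  case (Cons x xs)
  let ?D = "direct_sum I E"
  have x: "x \<in> carrier R" and xs: "set xs \<subseteq> carrier R" using Cons.prems(2) by auto
  interpret D: module R ?D by (rule direct_sum_module[OF R E])
  show ?case
  proof
    assume "f \<in> mults ?D (x # xs)"
    then obtain y z where yz: "f = x \<odot>\<^bsub>?D\<^esub> y \<oplus>\<^bsub>?D\<^esub> z" "y \<in> carrier ?D" "z \<in> mults ?D xs" by auto
    have zc: "z \<in> carrier ?D" using D.mults_carrier[OF xs] yz(3) by blast
    have "\<forall>i\<in>I. z i \<in> mults (E i) xs" using Cons.IH[OF zc xs] yz(3) by blast
    then show "\<forall>i\<in>I. f i \<in> mults (E i) (x # xs)" using yz(1,2) by (auto simp: direct_sum_simps)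
  next
    assume f: "\<forall>i\<in>I. f i \<in> mults (E i) (x # xs)"
    have "\<forall>i\<in>I. \<exists>yz. fst yz \<in> carrier (E i) \<and> snd yz \<in> mults (E i) xs \<and> f i = x \<odot>\<^bsub>E i\<^esub> fst yz \<oplus>\<^bsub>E i\<^esub> snd yz \<and>
      (f i = \<zero>\<^bsub>E i\<^esub> \<longrightarrow> fst yz = \<zero>\<^bsub>E i\<^esub> \<and> snd yz = \<zero>\<^bsub>E i\<^esub>)"
    proof
      fix i assume i: "i \<in> I"
      interpret Ei: module R "E i" by (rule E[OF i])
      show "\<exists>yz. fst yz \<in> carrier (E i) \<and> snd yz \<in> mults (E i) xs \<and> f i = x \<odot>\<^bsub>E i\<^esub> fst yz \<oplus>\<^bsub>E i\<^esub> snd yz \<and>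
        (f i = \<zero>\<^bsub>E i\<^esub> \<longrightarrow> fst yz = \<zero>\<^bsub>E i\<^esub> \<and> snd yz = \<zero>\<^bsub>E i\<^esub>)"
      proof (cases "f i = \<zero>\<^bsub>E i\<^esub>")
        case True
        then show ?thesis using Ei.mults_zero[OF xs] x by (intro exI[of _ "(\<zero>\<^bsub>E i\<^esub>, \<zero>\<^bsub>E i\<^esub>)"]) simp
      next
        case False
        obtain y z where "f i = x \<odot>\<^bsub>E i\<^esub> y \<oplus>\<^bsub>E i\<^esub> z" "y \<in> carrier (E i)" "z \<in> mults (E i) xs" using bspec[OF f i] by auto
        then show ?thesis using False by (intro exI[of _ "(y, z)"]) simp
      qed
    qed
    from bchoice[OF this] obtain h where h: "\<forall>i\<in>I. fst (h i) \<in> carrier (E i) \<and> snd (h i) \<in> mults (E i) xs \<and>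
      f i = x \<odot>\<^bsub>E i\<^esub> fst (h i) \<oplus>\<^bsub>E i\<^esub> snd (h i) \<and> (f i = \<zero>\<^bsub>E i\<^esub> \<longrightarrow> fst (h i) = \<zero>\<^bsub>E i\<^esub> \<and> snd (h i) = \<zero>\<^bsub>E i\<^esub>)" by blast
    have h1: "\<And>i. i \<in> I \<Longrightarrow> fst (h i) \<in> carrier (E i)" and h2: "\<And>i. i \<in> I \<Longrightarrow> snd (h i) \<in> mults (E i) xs"
      and h3: "\<And>i. i \<in> I \<Longrightarrow> f i = x \<odot>\<^bsub>E i\<^esub> fst (h i) \<oplus>\<^bsub>E i\<^esub> snd (h i)"
      and h4: "\<And>i. i \<in> I \<Longrightarrow> f i = \<zero>\<^bsub>E i\<^esub> \<Longrightarrow> fst (h i) = \<zero>\<^bsub>E i\<^esub>"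
      and h5: "\<And>i. i \<in> I \<Longrightarrow> f i = \<zero>\<^bsub>E i\<^esub> \<Longrightarrow> snd (h i) = \<zero>\<^bsub>E i\<^esub>"
      using h by blast+
    define y z where "y = (\<lambda>i\<in>I. fst (h i))" and "z = (\<lambda>i\<in>I. snd (h i))"
    have fin: "finite {i \<in> I. f i \<noteq> \<zero>\<^bsub>E i\<^esub>}" using Cons.prems(1) unfolding direct_sum_simps by blast
    have yc: "y \<in> carrier ?D"
    proof -
      have "{i \<in> I. y i \<noteq> \<zero>\<^bsub>E i\<^esub>} \<subseteq> {i \<in> I. f i \<noteq> \<zero>\<^bsub>E i\<^esub>}" using h4 unfolding y_def by force
      moreover have "y \<in> (\<Pi>\<^sub>E i\<in>I. carrier (E i))" using h1 unfolding y_def by (rule restrict_PiE_iff[THEN iffD2, rule_format])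
      ultimately show ?thesis using finite_subset[OF _ fin] unfolding direct_sum_simps by blast
    qed
    have zc: "z \<in> carrier ?D"
    proof -
      have "{i \<in> I. z i \<noteq> \<zero>\<^bsub>E i\<^esub>} \<subseteq> {i \<in> I. f i \<noteq> \<zero>\<^bsub>E i\<^esub>}" using h5 unfolding z_def by force
      moreover have "snd (h i) \<in> carrier (E i)" if "i \<in> I" for i
        using h2[OF that] module.mults_carrier[OF E[OF that] xs] by blast
      then have "z \<in> (\<Pi>\<^sub>E i\<in>I. carrier (E i))" unfolding z_def by (rule restrict_PiE_iff[THEN iffD2, rule_format])
      ultimately show ?thesis using finite_subset[OF _ fin] unfolding direct_sum_simps by blast
    qed
    have "\<forall>i\<in>I. z i \<in> mults (E i) xs" using h2 by (simp add: z_def)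
    then have "z \<in> mults ?D xs" using Cons.IH[OF zc xs] by blast
    moreover have "f = x \<odot>\<^bsub>?D\<^esub> y \<oplus>\<^bsub>?D\<^esub> z"
    proof (rule extensionalityI[of _ I])
      show "f \<in> extensional I" using Cons.prems(1) by (simp add: direct_sum_simps PiE_def)
      show "x \<odot>\<^bsub>?D\<^esub> y \<oplus>\<^bsub>?D\<^esub> z \<in> extensional I" by (simp add: direct_sum_simps)
      show "f i = (x \<odot>\<^bsub>?D\<^esub> y \<oplus>\<^bsub>?D\<^esub> z) i" if "i \<in> I" for i
        using that h3[OF that] by (simp add: direct_sum_simps y_def z_def)
    qed
    ultimately show "f \<in> mults ?D (x # xs)" using yc by auto
  qed
qed

text \<open>
  The projection along \<open>B\<close> maps \<open>(xs) D\<close> to \<open>(xs) A\<close>.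
\<close>

lemma mults_summand:
  assumes D: "module R D" and A: "submodule A R D" and B: "submodule B R D" "A \<inter> B = {\<zero>\<^bsub>D\<^esub>}" "A <+>\<^bsub>D\<^esub> B = carrier D"
    and xs: "set xs \<subseteq> carrier R"
  shows "a \<in> A \<Longrightarrow> a \<in> mults (D\<lparr>carrier := A\<rparr>) xs \<longleftrightarrow> a \<in> mults D xs"
proof -
  interpret D: module R D by fact
  note SA = D.submoduleE[OF A] and SB = D.submoduleE[OF B(1)]
  let ?A = "D\<lparr>carrier := A\<rparr>"
  interpret A: module R ?A by (rule submodule.submodule_is_module[OF A D])
  have sub: "z \<in> mults ?A zs \<Longrightarrow> z \<in> mults D zs" for z zs
    using SA(1) by (induction zs arbitrary: z) auto
  have AsubA: "z \<in> mults ?A zs \<Longrightarrow> set zs \<subseteq> carrier R \<Longrightarrow> z \<in> A" for z zs using A.mults_carrier[of zs] by auto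
  have split: "\<exists>u\<in>mults ?A zs. \<exists>b\<in>B. z = u \<oplus>\<^bsub>D\<^esub> b" if "z \<in> mults D zs" "set zs \<subseteq> carrier R" for z zs
    using that
  proof (induction zs arbitrary: z)
    case Nil
    then show ?case using D.submodule_zero[OF B(1)] by (auto intro!: bexI[of _ "\<zero>\<^bsub>D\<^esub>"])
  next
    case (Cons x zs)
    obtain y w where yw: "z = x \<odot>\<^bsub>D\<^esub> y \<oplus>\<^bsub>D\<^esub> w" "y \<in> carrier D" "w \<in> mults D zs" using Cons.prems(1) by auto
    obtain u b where u: "u \<in> mults ?A zs" "b \<in> B" "w = u \<oplus>\<^bsub>D\<^esub> b" using Cons.IH[OF yw(3)] Cons.prems(2) by auto
    have uA: "u \<in> A" using AsubA[OF u(1)] Cons.prems(2) by simp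
    have "y \<in> A <+>\<^bsub>D\<^esub> B" using yw(2) B(3) by simp
    then obtain a' b' where ab: "a' \<in> A" "b' \<in> B" "y = a' \<oplus>\<^bsub>D\<^esub> b'" by (auto simp: set_add_def set_mult_def)
    have x: "x \<in> carrier R" using Cons.prems(2) by simp
    have c: "a' \<in> carrier D" "b' \<in> carrier D" "u \<in> carrier D" "b \<in> carrier D" using ab u(2) uA SA(1) SB(1) by auto
    have "z = (x \<odot>\<^bsub>D\<^esub> a' \<oplus>\<^bsub>D\<^esub> u) \<oplus>\<^bsub>D\<^esub> (x \<odot>\<^bsub>D\<^esub> b' \<oplus>\<^bsub>D\<^esub> b)"
      using yw(1) u(3) ab(3) x c by (simp add: D.smult_r_distr D.M.a_ac)
    moreover have "x \<odot>\<^bsub>D\<^esub> a' \<oplus>\<^bsub>D\<^esub> u \<in> mults ?A (x # zs)" using ab(1) u(1) by auto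
    moreover have "x \<odot>\<^bsub>D\<^esub> b' \<oplus>\<^bsub>D\<^esub> b \<in> B" using x ab(2) u(2) SB by blast
    ultimately show ?case by blast
  qed
  assume a: "a \<in> A"
  show "a \<in> mults ?A xs \<longleftrightarrow> a \<in> mults D xs"
  proof
    assume "a \<in> mults D xs"
    then obtain u b where u: "u \<in> mults ?A xs" "b \<in> B" "a = u \<oplus>\<^bsub>D\<^esub> b" using split xs by blast
    have uA: "u \<in> A" by (rule AsubA[OF u(1) xs])
    have c: "u \<in> carrier D" "b \<in> carrier D" "a \<in> carrier D" using uA u(2) a SA(1) SB(1) by auto
    have "b = \<ominus>\<^bsub>D\<^esub> u \<oplus>\<^bsub>D\<^esub> a" using u(3) c by (simp add: D.M.r_neg1)
    then have "b \<in> A" using SA uA a by auto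
    then have "b = \<zero>\<^bsub>D\<^esub>" using u(2) B(2) by blast
    then show "a \<in> mults ?A xs" using u c by simp
  qed (rule sub)
qed

text \<open>
  Both properties are expressed by membership in the submodules \<open>(xs) M\<close>, which are formed
  componentwise in direct sums and are compatible with summands.
\<close>

lemma in_Add_transfer:
  assumes R: "cring R" and C: "\<And>Z. Z \<in> C \<Longrightarrow> module R Z" and M: "in_Add TYPE('i) R C M"
    and xs: "set xs \<subseteq> carrier R" "s \<in> carrier R"
  shows "(\<And>Z. Z \<in> C \<Longrightarrow> kills Z s xs) \<Longrightarrow> kills M s xs"
    and "(\<And>Z. Z \<in> C \<Longrightarrow> weakly_regular Z xs) \<Longrightarrow> weakly_regular M xs"
proof -
  obtain I :: "'i set" and E where E: "\<And>i. i \<in> I \<Longrightarrow> E i \<in> C" and "isomorphic_to_direct_summand R M (direct_sum I E)"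
    and M: "module R M" using M unfolding in_Add_def by blast
  then obtain A B where A: "submodule A R (direct_sum I E)" and B: "submodule B R (direct_sum I E)"
    "A \<inter> B = {\<zero>\<^bsub>direct_sum I E\<^esub>}" "A <+>\<^bsub>direct_sum I E\<^esub> B = carrier (direct_sum I E)"
    and iso: "module_isomorphic R M ((direct_sum I E)\<lparr>carrier := A\<rparr>)"
    unfolding isomorphic_to_direct_summand_def by blast
  let ?D = "direct_sum I E" and ?A = "(direct_sum I E)\<lparr>carrier := A\<rparr>"
  have Em: "\<And>i. i \<in> I \<Longrightarrow> module R (E i)" using C E by blast
  interpret D: module R ?D by (rule direct_sum_module[OF R Em])
  have Am: "module R ?A" by (rule submodule.submodule_is_module[OF A D.module_axioms])
  have AD: "A \<subseteq> carrier ?D" using D.submoduleE(1)[OF A] .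
  note mA = mults_summand[OF D.module_axioms A B]
  have mD: "f \<in> mults ?D zs \<longleftrightarrow> (\<forall>i\<in>I. f i \<in> mults (E i) zs)" if "set zs \<subseteq> carrier R" "f \<in> carrier ?D" for f zs
    by (rule mults_direct_sum[OF R _ that]) (rule Em)
  show "kills M s xs" if k: "\<And>Z. Z \<in> C \<Longrightarrow> kills Z s xs"
  proof (rule kills_iso[OF M Am xs iso])
    show "kills ?A s xs" unfolding kills_def
    proof
      fix y assume "y \<in> carrier ?A"
      then have y: "y \<in> A" by simp
      then have yD: "y \<in> carrier ?D" using AD by blast
      have "s \<odot>\<^bsub>?D\<^esub> y \<in> mults ?D xs"
        using mD[OF xs(1) D.smult_closed[OF xs(2) yD]] k E yD unfolding kills_def by (auto simp: direct_sum_simps)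
      moreover have "s \<odot>\<^bsub>?D\<^esub> y \<in> A" using D.submoduleE(4)[OF A xs(2) y] .
      ultimately show "s \<odot>\<^bsub>?A\<^esub> y \<in> mults ?A xs" using mA[OF xs(1)] by simp
    qed
  qed
  show "weakly_regular M xs" if w: "\<And>Z. Z \<in> C \<Longrightarrow> weakly_regular Z xs"
  proof (rule weakly_regular_iso[OF M Am xs(1) iso])
    show "weakly_regular ?A xs" unfolding weakly_regular_def
    proof (intro allI impI ballI)
      fix j y assume j: "j < length xs" and "y \<in> carrier ?A" and "xs ! j \<odot>\<^bsub>?A\<^esub> y \<in> mults ?A (take j xs)"
      then have y: "y \<in> A" "xs ! j \<odot>\<^bsub>?D\<^esub> y \<in> mults ?A (take j xs)" by auto
      have ts: "set (take j xs) \<subseteq> carrier R" by (rule take_set[OF xs(1)])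
      have xj: "xs ! j \<in> carrier R" using xs(1) j by auto
      have yD: "y \<in> carrier ?D" using AD y by blast
      have "xs ! j \<odot>\<^bsub>?D\<^esub> y \<in> A" using D.submoduleE(4)[OF A xj y(1)] .
      then have "xs ! j \<odot>\<^bsub>?D\<^esub> y \<in> mults ?D (take j xs)" using mA[OF ts] y(2) by blast
      then have 1: "\<forall>i\<in>I. xs ! j \<odot>\<^bsub>E i\<^esub> y i \<in> mults (E i) (take j xs)"
        using mD[OF ts D.smult_closed[OF xj yD]] by (simp add: direct_sum_simps)
      have "\<forall>i\<in>I. y i \<in> mults (E i) (take j xs)"
      proof
        fix i assume i: "i \<in> I"
        have "y i \<in> carrier (E i)" using yD i by (auto simp: direct_sum_simps)
        then show "y i \<in> mults (E i) (take j xs)" using w[OF E[OF i]] j 1 i unfolding weakly_regular_def by blast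
      qed
      then show "y \<in> mults ?A (take j xs)" using mD[OF ts yD] mA[OF ts y(1)] by blast
    qed
  qed
qed

lemma weakly_regular_append: "weakly_regular M (xs @ ys) \<Longrightarrow> weakly_regular M xs"
  unfolding weakly_regular_def
proof (intro allI ballI impI)
  fix i y assume a: "\<forall>i<length (xs @ ys). \<forall>y\<in>carrier M.
     (xs @ ys) ! i \<odot>\<^bsub>M\<^esub> y \<in> mults M (take i (xs @ ys)) \<longrightarrow> y \<in> mults M (take i (xs @ ys))"
   and i: "i < length xs" "y \<in> carrier M" "xs ! i \<odot>\<^bsub>M\<^esub> y \<in> mults M (take i xs)"
  have "(xs @ ys) ! i = xs ! i" "take i (xs @ ys) = take i xs" using i(1) by (auto simp: nth_append)
  then show "y \<in> mults M (take i xs)" using a[rule_format, of i y] i by simp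
qed

text \<open>
  In \<open>z = z' + x y\<close> with \<open>z' \<in> (xs) M\<close> and \<open>g z = 0\<close> the regularity of \<open>x\<close> on \<open>L / (xs) L\<close> gives \<open>g y \<in> (xs) L\<close>,
  and correcting \<open>y\<close> by an element of \<open>(xs) M\<close> moves it into the kernel. Identifying \<open>N\<close> with this kernel,
  the result is \<open>(xs) M \<inter> N = (xs) N\<close>.
\<close>

lemma mults_of_kernel:
  assumes se: "short_exact_modules R N f M g L" and m: "module R N" "module R M" "module R L"
  shows "weakly_regular L xs \<Longrightarrow> set xs \<subseteq> carrier R \<Longrightarrow> z \<in> mults M xs \<Longrightarrow> g z = \<zero>\<^bsub>L\<^esub> \<Longrightarrow> \<exists>y\<in>mults N xs. f y = z"
proof (induction xs arbitrary: z rule: rev_induct)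
  case Nil
  then show ?case using se module_hom_zero[of f R N M] m by (simp add: short_exact_modules_def)
next
  case (snoc x xs)
  interpret N: module R N by fact
  interpret M: module R M by fact
  interpret L: module R L by fact
  have f: "f \<in> module_hom R N M" and g: "g \<in> module_hom R M L" and ker: "f ` carrier N = module_ker M L g"
    and surj: "g ` carrier M = carrier L" using se by (auto simp: short_exact_modules_def)
  have xs: "set xs \<subseteq> carrier R" and x: "x \<in> carrier R" using snoc.prems(2) by auto
  have w: "weakly_regular L xs" by (rule weakly_regular_append[OF snoc.prems(1)])
  have last: "y \<in> mults L xs" if "y \<in> carrier L" "x \<odot>\<^bsub>L\<^esub> y \<in> mults L xs" for y
    using snoc.prems(1)[unfolded weakly_regular_def, rule_format, of "length xs" y] that by simp
  obtain z' y where z: "z' \<in> mults M xs" "y \<in> carrier M" "z = z' \<oplus>\<^bsub>M\<^esub> x \<odot>\<^bsub>M\<^esub> y"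
    using snoc.prems(3) M.mults_snoc[OF xs x] by blast
  have z'c: "z' \<in> carrier M" using z(1) M.mults_carrier[OF xs] by blast
  have gz': "g z' \<in> mults L xs" by (rule mults_hom[OF g m(2,3) xs z(1)])
  have gc: "g z' \<in> carrier L" "g y \<in> carrier L" using module_homD(1)[OF g] z'c z(2) by auto
  have "g z' \<oplus>\<^bsub>L\<^esub> x \<odot>\<^bsub>L\<^esub> g y = \<zero>\<^bsub>L\<^esub>" using snoc.prems(4) z z'c x by (simp add: module_homD[OF g])
  then have "x \<odot>\<^bsub>L\<^esub> g y = \<ominus>\<^bsub>L\<^esub> g z'" using gc x by (metis L.M.minus_equality L.M.a_comm L.smult_closed)
  then have "x \<odot>\<^bsub>L\<^esub> g y \<in> mults L xs" using gz' L.submoduleE(3)[OF L.mults_submodule[OF xs]] by simp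
  then have "g y \<in> mults L xs" using last gc by blast
  then obtain y' where y': "y' \<in> mults M xs" "g y' = g y" using mults_surj[OF g surj m(2,3) xs] by blast
  have y'c: "y' \<in> carrier M" using y'(1) M.mults_carrier[OF xs] by blast
  have gd: "g (y \<oplus>\<^bsub>M\<^esub> \<ominus>\<^bsub>M\<^esub> y') = \<zero>\<^bsub>L\<^esub>"
  proof -
    have "g (y \<oplus>\<^bsub>M\<^esub> \<ominus>\<^bsub>M\<^esub> y') \<oplus>\<^bsub>L\<^esub> g y' = g y"
      using z(2) y'c module_homD(2)[OF g, of "y \<oplus>\<^bsub>M\<^esub> \<ominus>\<^bsub>M\<^esub> y'" y'] by (simp add: M.M.a_assoc M.M.l_neg)
    moreover have "g (y \<oplus>\<^bsub>M\<^esub> \<ominus>\<^bsub>M\<^esub> y') \<in> carrier L" using module_homD(1)[OF g] z(2) y'c by simp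
    ultimately show ?thesis using y'(2) gc(2) L.M.add.l_cancel_one by auto
  qed
  then have "y \<oplus>\<^bsub>M\<^esub> \<ominus>\<^bsub>M\<^esub> y' \<in> module_ker M L g" using z(2) y'c by (simp add: module_ker_def)
  then have "y \<oplus>\<^bsub>M\<^esub> \<ominus>\<^bsub>M\<^esub> y' \<in> f ` carrier N" using ker by simp
  then obtain n where n: "n \<in> carrier N" "f n = y \<oplus>\<^bsub>M\<^esub> \<ominus>\<^bsub>M\<^esub> y'" by (auto elim!: imageE)
  have "y' \<oplus>\<^bsub>M\<^esub> (y \<oplus>\<^bsub>M\<^esub> \<ominus>\<^bsub>M\<^esub> y') = y \<oplus>\<^bsub>M\<^esub> (y' \<oplus>\<^bsub>M\<^esub> \<ominus>\<^bsub>M\<^esub> y')"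
    using z(2) y'c by (intro M.M.a_lcomm) simp_all
  then have y: "y = y' \<oplus>\<^bsub>M\<^esub> f n" using n(2) z(2) y'c by (simp add: M.M.r_neg)
  let ?w = "z' \<oplus>\<^bsub>M\<^esub> x \<odot>\<^bsub>M\<^esub> y'"
  have fn: "f n \<in> carrier M" using module_homD(1)[OF f n(1)] .
  have zw: "z = ?w \<oplus>\<^bsub>M\<^esub> x \<odot>\<^bsub>M\<^esub> f n" using z(3) y z'c y'c fn x by (simp add: M.smult_r_distr M.M.a_assoc)
  have wm: "?w \<in> mults M xs"
    using z(1) y'(1) x M.submoduleE(4,5)[OF M.mults_submodule[OF xs]] by blast
  have "g ?w = \<zero>\<^bsub>L\<^esub>"
  proof -
    have "g ?w = g z' \<oplus>\<^bsub>L\<^esub> x \<odot>\<^bsub>L\<^esub> g y" using z'c y'c x y'(2) by (simp add: module_homD[OF g])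
    then show ?thesis using \<open>g z' \<oplus>\<^bsub>L\<^esub> x \<odot>\<^bsub>L\<^esub> g y = \<zero>\<^bsub>L\<^esub>\<close> by simp
  qed
  then obtain v where v: "v \<in> mults N xs" "f v = ?w" using snoc.IH[OF w xs wm] by blast
  have vc: "v \<in> carrier N" using v(1) N.mults_carrier[OF xs] by blast
  have "v \<oplus>\<^bsub>N\<^esub> x \<odot>\<^bsub>N\<^esub> n \<in> mults N (xs @ [x])" using N.mults_snoc[OF xs x] v(1) n(1) by blast
  moreover have "f (v \<oplus>\<^bsub>N\<^esub> x \<odot>\<^bsub>N\<^esub> n) = z" using vc n(1) x v(2) zw by (simp add: module_homD[OF f])
  ultimately show ?case by blast
qed

lemma kills_kernel:
  assumes se: "short_exact_modules R N f M g L" and m: "module R N" "module R M" "module R L"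
    and w: "weakly_regular L xs" and xs: "set xs \<subseteq> carrier R" "s \<in> carrier R" and k: "kills M s xs"
  shows "kills N s xs"
  unfolding kills_def
proof
  fix y assume y: "y \<in> carrier N"
  interpret N: module R N by fact
  interpret L: module R L by fact
  have f: "f \<in> module_hom R N M" and g: "g \<in> module_hom R M L" and ker: "f ` carrier N = module_ker M L g"
    and inj: "inj_on f (carrier N)" using se by (auto simp: short_exact_modules_def)
  have fy: "f y \<in> carrier M" using module_homD(1)[OF f y] .
  have sy: "s \<odot>\<^bsub>N\<^esub> y \<in> carrier N" using y xs(2) by simp
  have "f (s \<odot>\<^bsub>N\<^esub> y) = s \<odot>\<^bsub>M\<^esub> f y" using y xs(2) by (simp add: module_homD[OF f])
  then have "f (s \<odot>\<^bsub>N\<^esub> y) \<in> mults M xs" using k fy by (simp add: kills_def)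
  moreover have "g (f (s \<odot>\<^bsub>N\<^esub> y)) = \<zero>\<^bsub>L\<^esub>" using ker sy unfolding module_ker_def by blast
  ultimately obtain v where v: "v \<in> mults N xs" "f v = f (s \<odot>\<^bsub>N\<^esub> y)"
    using mults_of_kernel[OF se m w xs(1)] by blast
  have "v \<in> carrier N" using v(1) N.mults_carrier[OF xs(1)] by blast
  then show "s \<odot>\<^bsub>N\<^esub> y \<in> mults N xs" using v inj sy by (metis inj_onD)
qed

section \<open>Quotients of local rings and star properties\<close>

lemma noetherian_localD:
  assumes "noetherian_local_ring R"
  shows "cring R" "noetherian_ring R" "maximalideal (max_ideal R) R"
    "maximalideal J R \<Longrightarrow> J = max_ideal R"
proof -
  show "cring R" "noetherian_ring R" using assms by (auto simp: noetherian_local_ring_def)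
  have ex: "\<exists>!m. maximalideal m R" using assms by (simp add: noetherian_local_ring_def)
  show "maximalideal (max_ideal R) R" unfolding max_ideal_def by (rule theI'[OF ex])
  show "maximalideal J R \<Longrightarrow> J = max_ideal R" unfolding max_ideal_def using the1_equality[OF ex] by blast
qed

lemma max_idealD:
  assumes "noetherian_local_ring R"
  shows "ideal (max_ideal R) R" "max_ideal R \<subseteq> carrier R" "\<one>\<^bsub>R\<^esub> \<notin> max_ideal R"
proof -
  interpret maximalideal "max_ideal R" R by (rule noetherian_localD(3)[OF assms])
  show "ideal (max_ideal R) R" by (rule is_ideal)
  show "max_ideal R \<subseteq> carrier R" by (rule a_subset)
  show "\<one>\<^bsub>R\<^esub> \<notin> max_ideal R" using one_imp_carrier I_notcarr by blast
qed

lemma unit_if_not_in_max_ideal: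
  assumes R: "noetherian_local_ring R" and r: "r \<in> carrier R" "r \<notin> max_ideal R"
  shows "\<exists>v\<in>carrier R. v \<otimes>\<^bsub>R\<^esub> r = \<one>\<^bsub>R\<^esub>"
proof (rule ccontr)
  assume a: "\<not> ?thesis"
  interpret cring R by (rule noetherian_localD(1)[OF R])
  interpret noetherian_ring R by (rule noetherian_localD(2)[OF R])
  define S where "S = {I. ideal I R \<and> PIdl\<^bsub>R\<^esub> r \<subseteq> I \<and> \<one>\<^bsub>R\<^esub> \<notin> I}"
  have "PIdl\<^bsub>R\<^esub> r \<in> S" unfolding S_def
    using cgenideal_ideal[OF r(1)] a by (auto simp: cgenideal_def)
  then have "S \<noteq> {}" by blast
  moreover have "\<Union>C \<in> S" if C: "C \<noteq> {}" "subset.chain S C" for C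
  proof -
    have "subset.chain {I. ideal I R} C" using C(2) by (auto simp: subset_chain_def S_def)
    then have "\<Union>C \<in> C" by (rule ideal_chain_is_trivial[OF C(1)])
    then show ?thesis using C(2) by (auto simp: subset_chain_def)
  qed
  ultimately obtain M where M: "M \<in> S" "\<forall>J\<in>S. M \<subseteq> J \<longrightarrow> J = M"
    using subset_Zorn_nonempty[of S] by blast
  have MI: "ideal M R" "\<one>\<^bsub>R\<^esub> \<notin> M" "PIdl\<^bsub>R\<^esub> r \<subseteq> M" using M(1) by (auto simp: S_def)
  have "maximalideal M R"
  proof (rule maximalidealI[OF MI(1)])
    show "carrier R \<noteq> M" using MI(2) by auto
    fix J assume J: "ideal J R" "M \<subseteq> J" "J \<subseteq> carrier R"
    show "J = M \<or> J = carrier R"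
    proof (cases "\<one>\<^bsub>R\<^esub> \<in> J")
      case True
      then show ?thesis using ideal.one_imp_carrier[OF J(1)] by blast
    next
      case False
      then have "J \<in> S" using J MI by (auto simp: S_def)
      then show ?thesis using M(2) J(2) by blast
    qed
  qed
  then have "M = max_ideal R" by (rule noetherian_localD(4)[OF R])
  then show False using r MI(3) cgenideal_self[OF r(1)] by blast
qed

lemma local_image:
  assumes R: "noetherian_local_ring R" and S: "cring S" "\<one>\<^bsub>S\<^esub> \<noteq> \<zero>\<^bsub>S\<^esub>"
    and h: "h \<in> ring_hom R S" "h ` carrier R = carrier S"
  shows "noetherian_local_ring S" "max_ideal S = h ` max_ideal R"
proof -
  interpret R: cring R by (rule noetherian_localD(1)[OF R])
  interpret S: cring S by fact
  interpret h: ring_hom_ring R S h by (rule ring_hom_ringI2[OF R.ring_axioms S.ring_axioms h(1)])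
  note m = max_idealD[OF R]
  interpret m: ideal "max_ideal R" R by (rule m(1))
  have pre: "ideal {r \<in> carrier R. h r \<in> J} R" if "ideal J S" for J
    using h.ideal_vimage[OF that] by simp
  have noeth: "noetherian_ring S"
  proof (rule S.noetherian_ringI)
    fix J assume J: "ideal J S"
    interpret J: ideal J S by fact
    obtain A where A: "A \<subseteq> carrier R" "finite A" "{r \<in> carrier R. h r \<in> J} = Idl\<^bsub>R\<^esub> A"
      using noetherian_ring.finetely_gen[OF noetherian_localD(2)[OF R] pre[OF J]] by blast
    have hA: "h ` A \<subseteq> carrier S" using A(1) by auto
    have "A \<subseteq> {r \<in> carrier R. h r \<in> J}" unfolding A(3) by (rule R.genideal_self[OF A(1)])
    then have "Idl\<^bsub>S\<^esub> (h ` A) \<subseteq> J" by (intro S.genideal_minimal[OF J]) auto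
    moreover have "J \<subseteq> Idl\<^bsub>S\<^esub> (h ` A)"
    proof
      fix y assume y: "y \<in> J"
      then obtain r where r: "r \<in> carrier R" "y = h r" using J.a_subset h(2) by (metis imageE subsetD)
      have "A \<subseteq> {r \<in> carrier R. h r \<in> Idl\<^bsub>S\<^esub> (h ` A)}" using A(1) S.genideal_self[OF hA] by auto
      then have "Idl\<^bsub>R\<^esub> A \<subseteq> {r \<in> carrier R. h r \<in> Idl\<^bsub>S\<^esub> (h ` A)}"
        by (rule R.genideal_minimal[OF pre[OF S.genideal_ideal[OF hA]]])
      then show "y \<in> Idl\<^bsub>S\<^esub> (h ` A)" using r y A(3) by auto
    qed
    ultimately have "J = Idl\<^bsub>S\<^esub> (h ` A)" by blast
    then show "\<exists>A\<subseteq>carrier S. finite A \<and> J = Idl\<^bsub>S\<^esub> A" using hA A(2) by blast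
  qed
  let ?m = "h ` max_ideal R"
  have mI: "ideal ?m S"
  proof (rule idealI[OF S.ring_axioms])
    show "subgroup ?m (add_monoid S)"
    proof (rule S.add.subgroupI)
      show "?m \<subseteq> carrier S" using m(2) by auto
      show "?m \<noteq> {}" using m.zero_closed by blast
      fix a assume "a \<in> ?m"
      then obtain r where r: "r \<in> max_ideal R" "a = h r" by blast
      then have "\<ominus>\<^bsub>S\<^esub> a = h (\<ominus>\<^bsub>R\<^esub> r)" using m(2) by auto
      then show "\<ominus>\<^bsub>S\<^esub> a \<in> ?m" using imageI[OF m.a_inv_closed[OF r(1)], of h] by simp
      fix b assume "b \<in> ?m"
      then obtain q where q: "q \<in> max_ideal R" "b = h q" by blast
      then have "a \<oplus>\<^bsub>S\<^esub> b = h (r \<oplus>\<^bsub>R\<^esub> q)" using m(2) r by auto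
      then show "a \<oplus>\<^bsub>S\<^esub> b \<in> ?m" using imageI[OF m.a_closed[OF r(1) q(1)], of h] by simp
    qed
    fix a y assume a: "a \<in> ?m" and y: "y \<in> carrier S"
    obtain r where r: "r \<in> max_ideal R" "a = h r" using a by blast
    obtain q where q: "q \<in> carrier R" "y = h q" using y h(2) by (metis imageE)
    have "y \<otimes>\<^bsub>S\<^esub> a = h (q \<otimes>\<^bsub>R\<^esub> r)" "a \<otimes>\<^bsub>S\<^esub> y = h (r \<otimes>\<^bsub>R\<^esub> q)" using r q m(2) by auto
    then show "y \<otimes>\<^bsub>S\<^esub> a \<in> ?m" "a \<otimes>\<^bsub>S\<^esub> y \<in> ?m" using imageI[OF m.I_l_closed[OF r(1) q(1)], of h] imageI[OF m.I_r_closed[OF r(1) q(1)], of h] by simp_all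
  qed
  have m1: "\<one>\<^bsub>S\<^esub> \<notin> ?m"
  proof
    assume "\<one>\<^bsub>S\<^esub> \<in> ?m"
    then obtain r where r: "r \<in> max_ideal R" "h r = \<one>\<^bsub>S\<^esub>" by auto
    have rc: "r \<in> carrier R" using r(1) m(2) by blast
    let ?u = "\<one>\<^bsub>R\<^esub> \<ominus>\<^bsub>R\<^esub> r"
    have "?u \<notin> max_ideal R"
    proof
      assume "?u \<in> max_ideal R"
      then have "?u \<oplus>\<^bsub>R\<^esub> r \<in> max_ideal R" using r(1) by simp
      moreover have "?u \<oplus>\<^bsub>R\<^esub> r = \<one>\<^bsub>R\<^esub>" using rc by (simp add: R.minus_eq R.a_assoc R.l_neg)
      ultimately show False using m(3) by simp
    qed
    then obtain v where v: "v \<in> carrier R" "v \<otimes>\<^bsub>R\<^esub> ?u = \<one>\<^bsub>R\<^esub>" using unit_if_not_in_max_ideal[OF R, of ?u] rc by auto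
    have "h ?u = \<zero>\<^bsub>S\<^esub>" using rc r(2) by (simp add: R.minus_eq S.r_neg)
    then have "h (v \<otimes>\<^bsub>R\<^esub> ?u) = \<zero>\<^bsub>S\<^esub>" using v(1) rc by simp
    then show False using v(2) S(2) by simp
  qed
  have unit: "\<exists>w\<in>carrier S. w \<otimes>\<^bsub>S\<^esub> y = \<one>\<^bsub>S\<^esub>" if y: "y \<in> carrier S" "y \<notin> ?m" for y
  proof -
    obtain q where q: "q \<in> carrier R" "y = h q" using y h(2) by (metis imageE)
    then have "q \<notin> max_ideal R" using y(2) by blast
    then obtain v where v: "v \<in> carrier R" "v \<otimes>\<^bsub>R\<^esub> q = \<one>\<^bsub>R\<^esub>" using unit_if_not_in_max_ideal[OF R q(1)] by blast
    then have "h v \<otimes>\<^bsub>S\<^esub> y = \<one>\<^bsub>S\<^esub>" using q by (metis h.hom_mult h.hom_one)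
    then show ?thesis using v(1) by auto
  qed
  have proper: "J \<subseteq> ?m" if J: "ideal J S" "\<one>\<^bsub>S\<^esub> \<notin> J" for J
  proof
    interpret J: ideal J S by (rule J(1))
    fix y assume y: "y \<in> J"
    show "y \<in> ?m"
    proof (rule ccontr)
      assume "y \<notin> ?m"
      then obtain w where "w \<in> carrier S" "w \<otimes>\<^bsub>S\<^esub> y = \<one>\<^bsub>S\<^esub>" using unit[of y] y J.a_subset by blast
      then show False using J.I_l_closed[OF y] J(2) by metis
    qed
  qed
  have max: "maximalideal ?m S"
  proof (rule maximalidealI[OF mI])
    show "carrier S \<noteq> ?m" using m1 by auto
    fix J assume J: "ideal J S" "?m \<subseteq> J" "J \<subseteq> carrier S"
    show "J = ?m \<or> J = carrier S"
    proof (cases "\<one>\<^bsub>S\<^esub> \<in> J")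
      case True
      then show ?thesis using ideal.one_imp_carrier[OF J(1)] by blast
    next
      case False
      then show ?thesis using proper[OF J(1)] J(2) by blast
    qed
  qed
  have uniq: "J = ?m" if J: "maximalideal J S" for J
  proof -
    interpret J: maximalideal J S by (rule J)
    have "\<one>\<^bsub>S\<^esub> \<notin> J" using J.one_imp_carrier J.I_notcarr by blast
    then have "J \<subseteq> ?m" by (rule proper[OF J.is_ideal])
    moreover have "?m \<subseteq> carrier S" using m(2) by auto
    ultimately show ?thesis using J.I_maximal[OF mI] m1 by auto
  qed
  have "\<exists>!J. maximalideal J S" by (rule ex1I[where a = ?m], rule max, rule uniq)
  then show L: "noetherian_local_ring S" using S(1) noeth by (simp add: noetherian_local_ring_def)
  show "max_ideal S = h ` max_ideal R" using noetherian_localD(4)[OF L max] by simp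
qed

lemma module_image:
  assumes S: "cring S" and M: "module R M" and h: "h \<in> ring_hom R S" "h ` carrier R = carrier S"
    and k: "k ` carrier M = carrier N" "k \<zero>\<^bsub>M\<^esub> = \<zero>\<^bsub>N\<^esub>"
      "\<And>y z. y \<in> carrier M \<Longrightarrow> z \<in> carrier M \<Longrightarrow> k (y \<oplus>\<^bsub>M\<^esub> z) = k y \<oplus>\<^bsub>N\<^esub> k z"
      "\<And>r y. r \<in> carrier R \<Longrightarrow> y \<in> carrier M \<Longrightarrow> k (r \<odot>\<^bsub>M\<^esub> y) = h r \<odot>\<^bsub>N\<^esub> k y"
  shows "module S N"
proof -
  interpret M: module R M by fact
  interpret S: cring S by fact
  note hs = ring_hom_add[OF h(1), symmetric] ring_hom_mult[OF h(1), symmetric] ring_hom_one[OF h(1), symmetric]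
  note ks = k(3)[symmetric] k(4)[symmetric] k(2)[symmetric]
  have kc: "k y \<in> carrier N" if "y \<in> carrier M" for y using k(1) that by blast
  have S_ex: "\<exists>r\<in>carrier R. a = h r" if "a \<in> carrier S" for a using h(2) that by (metis imageE)
  have N_ex: "\<exists>y\<in>carrier M. u = k y" if "u \<in> carrier N" for u using k(1) that by (metis imageE)
  show ?thesis
  proof (rule moduleI[OF S])
    show "abelian_group N"
    proof (rule abelian_groupI)
      fix u v w assume "u \<in> carrier N" "v \<in> carrier N"
      then obtain x y where x: "x \<in> carrier M" "u = k x" and y: "y \<in> carrier M" "v = k y" using N_ex by meson
      show "u \<oplus>\<^bsub>N\<^esub> v \<in> carrier N" using x y by (simp add: ks kc)
      show "u \<oplus>\<^bsub>N\<^esub> v = v \<oplus>\<^bsub>N\<^esub> u" using x y by (simp add: ks M.M.a_comm)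
      assume "w \<in> carrier N"
      then obtain z where z: "z \<in> carrier M" "w = k z" using N_ex by meson
      show "u \<oplus>\<^bsub>N\<^esub> v \<oplus>\<^bsub>N\<^esub> w = u \<oplus>\<^bsub>N\<^esub> (v \<oplus>\<^bsub>N\<^esub> w)" using x y z by (simp add: ks M.M.a_assoc)
    next
      show "\<zero>\<^bsub>N\<^esub> \<in> carrier N" using kc[of "\<zero>\<^bsub>M\<^esub>"] k(2) by simp
      fix u assume "u \<in> carrier N"
      then obtain x where x: "x \<in> carrier M" "u = k x" using N_ex by meson
      show "\<zero>\<^bsub>N\<^esub> \<oplus>\<^bsub>N\<^esub> u = u" using x by (simp add: ks)
      show "\<exists>y\<in>carrier N. y \<oplus>\<^bsub>N\<^esub> u = \<zero>\<^bsub>N\<^esub>"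
        using x kc[of "\<ominus>\<^bsub>M\<^esub> x"] by (intro bexI[of _ "k (\<ominus>\<^bsub>M\<^esub> x)"]) (simp_all add: ks M.M.l_neg)
    qed
    fix a b u v assume "a \<in> carrier S" "b \<in> carrier S" "u \<in> carrier N" "v \<in> carrier N"
    then obtain p q x y where p: "p \<in> carrier R" "a = h p" and q: "q \<in> carrier R" "b = h q"
      and x: "x \<in> carrier M" "u = k x" and y: "y \<in> carrier M" "v = k y" using N_ex S_ex by meson
    show "a \<odot>\<^bsub>N\<^esub> u \<in> carrier N" using p x by (simp add: ks kc)
    show "(a \<oplus>\<^bsub>S\<^esub> b) \<odot>\<^bsub>N\<^esub> u = a \<odot>\<^bsub>N\<^esub> u \<oplus>\<^bsub>N\<^esub> b \<odot>\<^bsub>N\<^esub> u" using p q x by (simp add: ks hs M.smult_l_distr)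
    show "a \<odot>\<^bsub>N\<^esub> (u \<oplus>\<^bsub>N\<^esub> v) = a \<odot>\<^bsub>N\<^esub> u \<oplus>\<^bsub>N\<^esub> a \<odot>\<^bsub>N\<^esub> v" using p x y by (simp add: ks M.smult_r_distr)
    show "a \<otimes>\<^bsub>S\<^esub> b \<odot>\<^bsub>N\<^esub> u = a \<odot>\<^bsub>N\<^esub> (b \<odot>\<^bsub>N\<^esub> u)" using p q x by (simp add: ks hs M.smult_assoc1)
  next
    fix u assume "u \<in> carrier N"
    then obtain x where x: "x \<in> carrier M" "u = k x" using N_ex by meson
    show "\<one>\<^bsub>S\<^esub> \<odot>\<^bsub>N\<^esub> u = u" using x by (simp add: ks hs)
  qed
qed

lemma module_submodule_abelian_subgroup:
  assumes "module R M" "submodule H R M" shows "abelian_subgroup H M"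
proof -
  interpret M: module R M by fact
  show ?thesis
    by (rule abelian_subgroupI3[OF _ M.M.abelian_group_axioms])
      (simp add: additive_subgroup_def submodule.axioms(1)[OF assms(2)])
qed

lemma coset_zero_iff:
  assumes "abelian_subgroup H M" "y \<in> carrier M"
  shows "H +>\<^bsub>M\<^esub> y = H \<longleftrightarrow> y \<in> H"
proof -
  interpret abelian_subgroup H M by fact
  show ?thesis using assms(2) a_rcos_self a_rcos_const by metis
qed

lemma coset_smult:
  assumes M: "module R M" "submodule H R M" and r: "r \<in> carrier R" and y: "y \<in> carrier M"
  shows "z \<in> H +>\<^bsub>M\<^esub> y \<Longrightarrow> H +>\<^bsub>M\<^esub> (r \<odot>\<^bsub>M\<^esub> z) = H +>\<^bsub>M\<^esub> (r \<odot>\<^bsub>M\<^esub> y)"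
proof -
  interpret M: module R M by fact
  interpret H: abelian_subgroup H M by (rule module_submodule_abelian_subgroup[OF M])
  assume "z \<in> H +>\<^bsub>M\<^esub> y"
  then obtain u where u: "u \<in> H" "z = u \<oplus>\<^bsub>M\<^esub> y" by (auto simp: a_r_coset_def')
  have uc: "u \<in> carrier M" using u(1) by simp
  have "r \<odot>\<^bsub>M\<^esub> z = r \<odot>\<^bsub>M\<^esub> u \<oplus>\<^bsub>M\<^esub> r \<odot>\<^bsub>M\<^esub> y" using u uc r y by (simp add: M.smult_r_distr)
  moreover have "r \<odot>\<^bsub>M\<^esub> u \<in> H" by (rule M.submoduleE(4)[OF M(2) r u(1)])
  ultimately have "r \<odot>\<^bsub>M\<^esub> z \<in> H +>\<^bsub>M\<^esub> (r \<odot>\<^bsub>M\<^esub> y)" by (auto simp: a_r_coset_def')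
  then show "H +>\<^bsub>M\<^esub> (r \<odot>\<^bsub>M\<^esub> z) = H +>\<^bsub>M\<^esub> (r \<odot>\<^bsub>M\<^esub> y)" using H.a_repr_independence'[of "r \<odot>\<^bsub>M\<^esub> z" "r \<odot>\<^bsub>M\<^esub> y"] r y by simp
qed

lemma quotient_module_smult:
  fixes M :: "('a, 'b) module"
  assumes M: "module R M" "submodule H R M" and r: "r \<in> carrier R" and y: "y \<in> carrier M"
  shows "r \<odot>\<^bsub>quotient_module M H\<^esub> (H +>\<^bsub>M\<^esub> y) = H +>\<^bsub>M\<^esub> (r \<odot>\<^bsub>M\<^esub> y)"
proof -
  interpret M: module R M by (rule M(1))
  interpret H: abelian_subgroup H M by (rule module_submodule_abelian_subgroup[OF M])
  have "y \<in> H +>\<^bsub>M\<^esub> y" by (rule H.a_rcos_self[OF y])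
  then have "(\<Union>z\<in>H +>\<^bsub>M\<^esub> y. H +>\<^bsub>M\<^esub> (r \<odot>\<^bsub>M\<^esub> z)) = H +>\<^bsub>M\<^esub> (r \<odot>\<^bsub>M\<^esub> y)"
    using coset_smult[OF M r y] by blast
  then show ?thesis by (simp add: quotient_module_def)
qed

lemma regular_element_quotient:
  fixes M :: "('a, 'b) module"
  assumes M: "module R M" "submodule H R M"
  shows "regular_element R (quotient_module M H) x \<longleftrightarrow>
    x \<in> carrier R \<and> (\<forall>y\<in>carrier M. x \<odot>\<^bsub>M\<^esub> y \<in> H \<longrightarrow> y \<in> H)"
proof (cases "x \<in> carrier R")
  case x: True
  interpret M: module R M by fact
  interpret H: abelian_subgroup H M by (rule module_submodule_abelian_subgroup[OF M])
  note sm = quotient_module_smult[OF M x]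
  have car: "carrier (quotient_module M H) = (\<lambda>y. H +>\<^bsub>M\<^esub> y) ` carrier M"
    by (auto simp: quotient_module_def A_RCOSETS_def')
  have zero: "\<zero>\<^bsub>quotient_module M H\<^esub> = H" by (simp add: quotient_module_def)
  have "regular_element R (quotient_module M H) x \<longleftrightarrow>
     (\<forall>y\<in>carrier M. x \<odot>\<^bsub>quotient_module M H\<^esub> (H +>\<^bsub>M\<^esub> y) = H \<longrightarrow> H +>\<^bsub>M\<^esub> y = H)"
    unfolding regular_element_def car zero using x by simp
  also have "\<dots> \<longleftrightarrow> (\<forall>y\<in>carrier M. x \<odot>\<^bsub>M\<^esub> y \<in> H \<longrightarrow> y \<in> H)"
    using coset_zero_iff[OF H.abelian_subgroup_axioms] by (intro ball_cong refl) (simp add: sm x)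
  finally show ?thesis using x by simp
qed (simp add: regular_element_def)

lemma regular_sequence_iff:
  fixes M :: "('a, 'b) module"
  assumes M: "module R M"
  shows "regular_sequence R M xs \<longleftrightarrow> set xs \<subseteq> carrier R \<and> weakly_regular M xs \<and> mults M xs \<noteq> carrier M"
proof (cases "set xs \<subseteq> carrier R")
  case xs: True
  interpret M: module R M by fact
  have m: "ideal_times_module R (Idl\<^bsub>R\<^esub> (set (take i xs))) M = mults M (take i xs)"
    and s: "submodule (mults M (take i xs)) R M" for i
    using take_set[OF xs, of i] mults_eq_ideal_times_module[OF M] M.mults_submodule by auto
  have "regular_element R (quotient_module M (ideal_times_module R (Idl\<^bsub>R\<^esub> (set (take i xs))) M)) (xs ! i) \<longleftrightarrow>
    (\<forall>y\<in>carrier M. xs ! i \<odot>\<^bsub>M\<^esub> y \<in> mults M (take i xs) \<longrightarrow> y \<in> mults M (take i xs))" if "i < length xs" for i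
    using regular_element_quotient[OF M s] m xs that by auto
  moreover have "ideal_times_module R (Idl\<^bsub>R\<^esub> (set xs)) M = mults M xs" by (rule mults_eq_ideal_times_module[OF M xs])
  ultimately show ?thesis unfolding regular_sequence_def weakly_regular_def using xs by auto
qed (simp add: regular_sequence_def)

lemma ring_as_module_simps [simp]:
  "carrier (ring_as_module R) = carrier R" "\<zero>\<^bsub>ring_as_module R\<^esub> = \<zero>\<^bsub>R\<^esub>"
  "r \<odot>\<^bsub>ring_as_module R\<^esub> y = r \<otimes>\<^bsub>R\<^esub> y" "a \<oplus>\<^bsub>ring_as_module R\<^esub> b = a \<oplus>\<^bsub>R\<^esub> b"
  by (simp_all add: ring_as_module_def)

lemma ring_as_module_module:
  assumes "cring R" shows "module R (ring_as_module R)"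
proof -
  interpret cring R by fact
  show ?thesis
  proof (rule moduleI[OF assms])
    show "abelian_group (ring_as_module R)"
    proof (rule abelian_groupI)
      show "\<exists>y\<in>carrier (ring_as_module R). y \<oplus>\<^bsub>ring_as_module R\<^esub> x = \<zero>\<^bsub>ring_as_module R\<^esub>"
        if "x \<in> carrier (ring_as_module R)" for x
        using that by (intro bexI[of _ "\<ominus>\<^bsub>R\<^esub> x"]) (simp_all add: l_neg)
    qed (simp_all add: a_ac)
  qed (auto simp: l_distr r_distr m_assoc)
qed

lemma mults_ring_eq_Idl:
  assumes "cring R" and xs: "set xs \<subseteq> carrier R"
  shows "mults (ring_as_module R) xs = Idl\<^bsub>R\<^esub> (set xs)"
proof
  interpret cring R by fact
  interpret M: module R "ring_as_module R" by (rule ring_as_module_module[OF assms(1)])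
  note S = M.submoduleE[OF M.mults_submodule[OF xs]]
  have "ideal (mults (ring_as_module R) xs) R"
  proof (rule idealI[OF ring_axioms])
    show "subgroup (mults (ring_as_module R) xs) (add_monoid R)"
    proof (rule add.subgroupI)
      show "mults (ring_as_module R) xs \<subseteq> carrier R" using S(1) by simp
      show "mults (ring_as_module R) xs \<noteq> {}" by (rule S(2))
      fix a b assume a: "a \<in> mults (ring_as_module R) xs"
      have ac: "a \<in> carrier R" using S(1) a by auto
      have "(\<ominus>\<^bsub>R\<^esub> \<one>\<^bsub>R\<^esub>) \<otimes>\<^bsub>R\<^esub> a \<in> mults (ring_as_module R) xs" using S(4)[OF _ a, of "\<ominus>\<^bsub>R\<^esub> \<one>\<^bsub>R\<^esub>"] by simp
      then show "\<ominus>\<^bsub>R\<^esub> a \<in> mults (ring_as_module R) xs" using ac by (simp add: l_minus)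
      assume "b \<in> mults (ring_as_module R) xs"
      then show "a \<oplus>\<^bsub>R\<^esub> b \<in> mults (ring_as_module R) xs" using S(5)[OF a] by simp
    qed
    fix a x assume a: "a \<in> mults (ring_as_module R) xs" "x \<in> carrier R"
    show "x \<otimes>\<^bsub>R\<^esub> a \<in> mults (ring_as_module R) xs" using S(4)[OF a(2,1)] by simp
    then show "a \<otimes>\<^bsub>R\<^esub> x \<in> mults (ring_as_module R) xs" using m_comm[of a x] a S(1) by auto
  qed
  moreover have "set xs \<subseteq> mults (ring_as_module R) xs"
  proof
    fix x assume x: "x \<in> set xs"
    then have "x \<in> carrier R" using xs by blast
    then show "x \<in> mults (ring_as_module R) xs" using M.mults_smult_mem[OF xs x, of "\<one>\<^bsub>R\<^esub>"] by simp
  qed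
  ultimately show "Idl\<^bsub>R\<^esub> (set xs) \<subseteq> mults (ring_as_module R) xs" by (rule genideal_minimal)
  interpret I: ideal "Idl\<^bsub>R\<^esub> (set xs)" R by (rule genideal_ideal[OF xs])
  have "mults (ring_as_module R) zs \<subseteq> Idl\<^bsub>R\<^esub> (set xs)" if "set zs \<subseteq> set xs" for zs
    using that
  proof (induction zs)
    case (Cons z zs)
    then show ?case using genideal_self[OF xs] by (auto intro!: I.a_closed I.I_r_closed)
  qed auto
  then show "mults (ring_as_module R) xs \<subseteq> Idl\<^bsub>R\<^esub> (set xs)" by blast
qed

text \<open>
  The copies of \<open>R / x R\<close> and \<open>N / x N\<close> live on representatives of the cosets, in the types of \<open>R\<close>
  and \<open>N\<close>. This allows the passage to a quotient to be iterated.
\<close>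

lemma quotient_copy:
  fixes R :: "'a ring" and N :: "('a, 'n) module"
  assumes R: "noetherian_local_ring R" and N: "module R N" and x: "x \<in> max_ideal R"
  obtains R' :: "'a ring" and N' :: "('a, 'n) module" and \<phi> \<psi> where
    "ring_module_isomorphic (R Quot (PIdl\<^bsub>R\<^esub> x)) (reduced_module R N (PIdl\<^bsub>R\<^esub> x)) R' N'"
    "module R' N'" "noetherian_local_ring R'" "\<phi> \<in> ring_hom R R'" "\<phi> ` carrier R = carrier R'"
    "max_ideal R' = \<phi> ` max_ideal R"
    "\<And>r. r \<in> carrier R \<Longrightarrow> \<phi> r = \<zero>\<^bsub>R'\<^esub> \<longleftrightarrow> (\<exists>r'\<in>carrier R. r = x \<otimes>\<^bsub>R\<^esub> r')"
    "\<psi> ` carrier N = carrier N'"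
    "\<And>y z. y \<in> carrier N \<Longrightarrow> z \<in> carrier N \<Longrightarrow> \<psi> (y \<oplus>\<^bsub>N\<^esub> z) = \<psi> y \<oplus>\<^bsub>N'\<^esub> \<psi> z"
    "\<And>r y. r \<in> carrier R \<Longrightarrow> y \<in> carrier N \<Longrightarrow> \<psi> (r \<odot>\<^bsub>N\<^esub> y) = \<phi> r \<odot>\<^bsub>N'\<^esub> \<psi> y"
    "\<And>y. y \<in> carrier N \<Longrightarrow> \<psi> y = \<zero>\<^bsub>N'\<^esub> \<longleftrightarrow> (\<exists>y'\<in>carrier N. y = x \<odot>\<^bsub>N\<^esub> y')"
proof -
  interpret N: module R N by fact
  have xc: "x \<in> carrier R" using x max_idealD(2)[OF R] by blast
  define I where "I = PIdl\<^bsub>R\<^esub> x"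
  define H where "H = ideal_times_module R I N"
  interpret I: ideal I R unfolding I_def by (rule N.R.cgenideal_ideal[OF xc])
  have IId: "I = Idl\<^bsub>R\<^esub> (set [x])" unfolding I_def using N.R.cgenideal_eq_genideal[OF xc] by simp
  have Hm: "H = mults N [x]" unfolding H_def IId by (rule mults_eq_ideal_times_module[OF N]) (use xc in simp)
  have Hsub: "submodule H R N" unfolding Hm using xc by (intro N.mults_submodule) simp
  interpret H: abelian_subgroup H N by (rule module_submodule_abelian_subgroup[OF N Hsub])
  have H_iff: "y \<in> H \<longleftrightarrow> (\<exists>y'\<in>carrier N. y = x \<odot>\<^bsub>N\<^esub> y')" for y unfolding Hm using xc by auto (metis N.M.r_zero N.smult_closed)
  have I_iff: "r \<in> I \<longleftrightarrow> (\<exists>r'\<in>carrier R. r = x \<otimes>\<^bsub>R\<^esub> r')" for r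
    unfolding I_def cgenideal_def using N.R.m_comm[OF xc] by auto
  have IH: "i \<odot>\<^bsub>N\<^esub> y \<in> H" if "i \<in> I" "y \<in> carrier N" for i y
    using that xc unfolding I_iff H_iff by (auto simp: N.smult_assoc1)
  define Q where "Q = R Quot I"
  define W where "W = reduced_module R N I"
  have Q: "cring Q" unfolding Q_def by (rule I.quotient_is_cring[OF N.R.is_cring])
  have Qc: "carrier Q = (\<lambda>r. I +>\<^bsub>R\<^esub> r) ` carrier R" by (auto simp: Q_def FactRing_def A_RCOSETS_def')
  have Wc: "carrier W = (\<lambda>y. H +>\<^bsub>N\<^esub> y) ` carrier N"
    by (auto simp: W_def reduced_module_def H_def[symmetric] Let_def A_RCOSETS_def')
  have Q0: "\<zero>\<^bsub>Q\<^esub> = I" by (simp add: Q_def FactRing_def)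
  have W0: "\<zero>\<^bsub>W\<^esub> = H" by (simp add: W_def reduced_module_def H_def[symmetric] Let_def)
  have \<alpha>: "(\<lambda>r. I +>\<^bsub>R\<^esub> r) \<in> ring_hom R Q" unfolding Q_def by (rule I.rcos_ring_hom)
  have Wadd: "(H +>\<^bsub>N\<^esub> y) \<oplus>\<^bsub>W\<^esub> (H +>\<^bsub>N\<^esub> z) = H +>\<^bsub>N\<^esub> (y \<oplus>\<^bsub>N\<^esub> z)" if "y \<in> carrier N" "z \<in> carrier N" for y z
    using H.a_rcos_sum[OF that] by (simp add: W_def reduced_module_def Let_def)
  have Wsm: "(I +>\<^bsub>R\<^esub> r) \<odot>\<^bsub>W\<^esub> (H +>\<^bsub>N\<^esub> y) = H +>\<^bsub>N\<^esub> (r \<odot>\<^bsub>N\<^esub> y)" if r: "r \<in> carrier R" and y: "y \<in> carrier N" for r y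
  proof -
    have e: "H +>\<^bsub>N\<^esub> (r' \<odot>\<^bsub>N\<^esub> z) = H +>\<^bsub>N\<^esub> (r \<odot>\<^bsub>N\<^esub> y)" if r': "r' \<in> I +>\<^bsub>R\<^esub> r" and z: "z \<in> H +>\<^bsub>N\<^esub> y" for r' z
    proof -
      have zc: "z \<in> carrier N" using H.a_elemrcos_carrier[OF y z] .
      obtain i where i: "i \<in> I" "r' = i \<oplus>\<^bsub>R\<^esub> r" using r' by (auto simp: a_r_coset_def')
      have ic: "i \<in> carrier R" using i(1) by simp
      have "r' \<odot>\<^bsub>N\<^esub> z = i \<odot>\<^bsub>N\<^esub> z \<oplus>\<^bsub>N\<^esub> r \<odot>\<^bsub>N\<^esub> z" using i ic r zc by (simp add: N.smult_l_distr)
      then have "r' \<odot>\<^bsub>N\<^esub> z \<in> H +>\<^bsub>N\<^esub> (r \<odot>\<^bsub>N\<^esub> z)" using IH[OF i(1) zc] by (auto simp: a_r_coset_def')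
      then have "H +>\<^bsub>N\<^esub> (r' \<odot>\<^bsub>N\<^esub> z) = H +>\<^bsub>N\<^esub> (r \<odot>\<^bsub>N\<^esub> z)"
        using H.a_repr_independence'[of "r' \<odot>\<^bsub>N\<^esub> z" "r \<odot>\<^bsub>N\<^esub> z"] r zc by simp
      also have "\<dots> = H +>\<^bsub>N\<^esub> (r \<odot>\<^bsub>N\<^esub> y)" by (rule coset_smult[OF N Hsub r y z])
      finally show ?thesis .
    qed
    have "(I +>\<^bsub>R\<^esub> r) \<odot>\<^bsub>W\<^esub> (H +>\<^bsub>N\<^esub> y) = (\<Union>r'\<in>I +>\<^bsub>R\<^esub> r. \<Union>z\<in>H +>\<^bsub>N\<^esub> y. H +>\<^bsub>N\<^esub> (r' \<odot>\<^bsub>N\<^esub> z))"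
      by (simp add: W_def reduced_module_def H_def[symmetric] Let_def)
    also have "\<dots> = (\<Union>r'\<in>I +>\<^bsub>R\<^esub> r. \<Union>z\<in>H +>\<^bsub>N\<^esub> y. H +>\<^bsub>N\<^esub> (r \<odot>\<^bsub>N\<^esub> y))"
      by (intro SUP_cong refl e)
    also have "\<dots> = H +>\<^bsub>N\<^esub> (r \<odot>\<^bsub>N\<^esub> y)" using I.a_rcos_self[OF r] H.a_rcos_self[OF y] by blast
    finally show ?thesis .
  qed
  define h where "h C = (SOME r. r \<in> C)" for C :: "'a set"
  define k where "k Y = (SOME y. y \<in> Y)" for Y :: "'n set"
  have hin: "I +>\<^bsub>R\<^esub> h C = C" if "C \<in> carrier Q" for C
  proof -
    obtain r where r: "r \<in> carrier R" "C = I +>\<^bsub>R\<^esub> r" using \<open>C \<in> carrier Q\<close> unfolding Qc by blast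
    have "h C \<in> C" unfolding h_def by (rule someI[of _ r]) (use I.a_rcos_self r in simp)
    then show ?thesis unfolding r(2) using I.a_repr_independence'[of _ r] r(1) by simp
  qed
  have kin: "H +>\<^bsub>N\<^esub> k C = C" if "C \<in> carrier W" for C
  proof -
    obtain r where r: "r \<in> carrier N" "C = H +>\<^bsub>N\<^esub> r" using \<open>C \<in> carrier W\<close> unfolding Wc by blast
    have "k C \<in> C" unfolding k_def by (rule someI[of _ r]) (use H.a_rcos_self r in simp)
    then show ?thesis unfolding r(2) using H.a_repr_independence'[of _ r] r(1) by simp
  qed
  have hinj: "inj_on h (carrier Q)" using hin by (metis inj_onI)
  have kinj: "inj_on k (carrier W)" using kin by (metis inj_onI)
  define g where "g = inv_into (carrier Q) h"
  define l where "l = inv_into (carrier W) k"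
  have gh: "g (h C) = C" if "C \<in> carrier Q" for C unfolding g_def using hinj that by simp
  have lk: "l (k C) = C" if "C \<in> carrier W" for C unfolding l_def using kinj that by simp
  define R' :: "'a ring" where "R' = \<lparr>carrier = h ` carrier Q, monoid.mult = (\<lambda>a b. h (g a \<otimes>\<^bsub>Q\<^esub> g b)),
    one = h \<one>\<^bsub>Q\<^esub>, ring.zero = h \<zero>\<^bsub>Q\<^esub>, add = (\<lambda>a b. h (g a \<oplus>\<^bsub>Q\<^esub> g b))\<rparr>"
  define N' :: "('a, 'n) module" where "N' = \<lparr>carrier = k ` carrier W, monoid.mult = undefined,
    one = undefined, ring.zero = k \<zero>\<^bsub>W\<^esub>, add = (\<lambda>a b. k (l a \<oplus>\<^bsub>W\<^esub> l b)), smult = (\<lambda>a u. k (g a \<odot>\<^bsub>W\<^esub> l u))\<rparr>"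
  have hiso: "h \<in> ring_iso Q R'"
    unfolding ring_iso_def
  proof (intro CollectI conjI ring_hom_memI)
    show "bij_betw h (carrier Q) (carrier R')" using hinj by (simp add: bij_betw_def R'_def)
  qed (auto simp: R'_def gh)
  then have hh: "h \<in> ring_hom Q R'" by (simp add: ring_iso_def)
  have "cring (R'\<lparr>ring.zero := h \<zero>\<^bsub>Q\<^esub>\<rparr>)" by (rule cring.ring_iso_imp_img_cring[OF Q hiso])
  then have R'c: "cring R'" by (simp add: R'_def)
  define \<phi> where "\<phi> r = h (I +>\<^bsub>R\<^esub> r)" for r
  define \<psi> where "\<psi> y = k (H +>\<^bsub>N\<^esub> y)" for y
  have \<phi>: "\<phi> \<in> ring_hom R R'" using ring_hom_trans[OF \<alpha> hh] by (simp add: \<phi>_def[abs_def] comp_def)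
  have \<phi>s: "\<phi> ` carrier R = carrier R'" by (simp add: \<phi>_def[abs_def] R'_def Qc image_image)
  have \<psi>s: "\<psi> ` carrier N = carrier N'" by (simp add: \<psi>_def[abs_def] N'_def Wc image_image)
  have Qm: "I +>\<^bsub>R\<^esub> r \<in> carrier Q" if "r \<in> carrier R" for r using that Qc by blast
  have Wm: "H +>\<^bsub>N\<^esub> y \<in> carrier W" if "y \<in> carrier N" for y using that Wc by blast
  have \<psi>a: "\<psi> (y \<oplus>\<^bsub>N\<^esub> z) = \<psi> y \<oplus>\<^bsub>N'\<^esub> \<psi> z" if "y \<in> carrier N" "z \<in> carrier N" for y z
    using that by (simp add: \<psi>_def N'_def lk Wm Wadd)
  have \<psi>m: "\<psi> (r \<odot>\<^bsub>N\<^esub> y) = \<phi> r \<odot>\<^bsub>N'\<^esub> \<psi> y" if "r \<in> carrier R" "y \<in> carrier N" for r y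
    using that by (simp add: \<psi>_def \<phi>_def N'_def lk gh Wm Qm Wsm)
  have H0: "H +>\<^bsub>N\<^esub> \<zero>\<^bsub>N\<^esub> = H" using coset_zero_iff[OF H.abelian_subgroup_axioms N.M.zero_closed] by simp
  have I0: "I +>\<^bsub>R\<^esub> r = I \<longleftrightarrow> r \<in> I" if "r \<in> carrier R" for r
    by (rule coset_zero_iff[OF I.abelian_subgroup_axioms that])
  have Wz: "H \<in> carrier W" using Wm[OF N.M.zero_closed] H0 by simp
  have Qz: "I \<in> carrier Q" using Qm[OF N.R.zero_closed] I0[OF N.R.zero_closed] by simp
  have \<psi>0: "\<psi> \<zero>\<^bsub>N\<^esub> = \<zero>\<^bsub>N'\<^esub>" by (simp add: \<psi>_def N'_def H0 W0)
  have \<phi>z: "\<phi> r = \<zero>\<^bsub>R'\<^esub> \<longleftrightarrow> r \<in> I" if "r \<in> carrier R" for r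
    using inj_on_eq_iff[OF hinj Qm[OF that] Qz] I0[OF that] by (simp add: \<phi>_def R'_def Q0)
  have \<psi>z: "\<psi> y = \<zero>\<^bsub>N'\<^esub> \<longleftrightarrow> y \<in> H" if "y \<in> carrier N" for y
    using inj_on_eq_iff[OF kinj Wm[OF that] Wz] coset_zero_iff[OF H.abelian_subgroup_axioms that]
    by (simp add: \<psi>_def N'_def W0)
  have m: "module R' N'" by (rule module_image[OF R'c N \<phi> \<phi>s \<psi>s \<psi>0 \<psi>a \<psi>m])
  have "I \<subseteq> max_ideal R" unfolding I_def by (rule N.R.cgenideal_minimal[OF max_idealD(1)[OF R] x])
  then have "\<one>\<^bsub>R\<^esub> \<notin> I" using max_idealD(3)[OF R] by blast
  then have ne: "\<one>\<^bsub>R'\<^esub> \<noteq> \<zero>\<^bsub>R'\<^esub>" using \<phi>z[OF N.R.one_closed] ring_hom_one[OF \<phi>] by simp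
  have iso: "ring_module_isomorphic Q W R' N'"
    unfolding ring_module_isomorphic_def
  proof (intro exI conjI ballI)
    show "h \<in> ring_iso Q R'" by (rule hiso)
    show "k \<in> iso (add_monoid W) (add_monoid N')"
    proof (rule isoI)
      have c: "a \<oplus>\<^bsub>W\<^esub> b \<in> carrier W" if ab: "a \<in> carrier W" "b \<in> carrier W" for a b
      proof -
        obtain y z where "y \<in> carrier N" "z \<in> carrier N" "a = H +>\<^bsub>N\<^esub> y" "b = H +>\<^bsub>N\<^esub> z" using ab unfolding Wc by blast
        then show ?thesis by (simp add: Wadd Wm)
      qed
      show "k \<in> hom (add_monoid W) (add_monoid N')" by (rule homI) (simp_all add: N'_def lk)
      show "bij_betw k (carrier (add_monoid W)) (carrier (add_monoid N'))" using kinj by (simp add: bij_betw_def N'_def)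
    qed
    fix r y assume "r \<in> carrier Q" "y \<in> carrier W"
    then show "k (r \<odot>\<^bsub>W\<^esub> y) = h r \<odot>\<^bsub>N'\<^esub> k y" by (simp add: N'_def gh lk)
  qed
  show thesis
    by (rule that[OF iso[unfolded Q_def W_def I_def] m local_image(1)[OF R R'c ne \<phi> \<phi>s] \<phi> \<phi>s local_image(2)[OF R R'c ne \<phi> \<phi>s]
          _ \<psi>s \<psi>a \<psi>m]) (simp_all add: \<phi>z \<psi>z I_iff H_iff)
qed

text \<open>
  Every element of the maximal ideal annihilates \<open>s\<close>, so no regular sequence can start.
\<close>

lemma depth_zero_of_socle:
  assumes R: "noetherian_local_ring R" and s: "s \<in> carrier R" "s \<noteq> \<zero>\<^bsub>R\<^esub>" 
    and soc: "\<And>r. r \<in> max_ideal R \<Longrightarrow> r \<otimes>\<^bsub>R\<^esub> s = \<zero>\<^bsub>R\<^esub>"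
  shows "depth R (ring_as_module R) = 0"
proof -
  have c: "cring R" by (rule noetherian_localD(1)[OF R])
  have "xs = []" if xs: "set xs \<subseteq> max_ideal R" "regular_sequence R (ring_as_module R) xs" for xs
  proof (rule ccontr)
    assume "xs \<noteq> []"
    then have "xs ! 0 \<in> set xs" by (cases xs) auto
    then have "xs ! 0 \<otimes>\<^bsub>R\<^esub> s = \<zero>\<^bsub>R\<^esub>" using xs(1) soc[of "xs ! 0"] by blast
    moreover have "weakly_regular (ring_as_module R) xs"
      using xs(2) regular_sequence_iff[OF ring_as_module_module[OF c]] by blast
    ultimately show False using s \<open>xs \<noteq> []\<close> unfolding weakly_regular_def by force
  qed
  then have "Sup {enat (length xs) |xs. set xs \<subseteq> max_ideal R \<and> regular_sequence R (ring_as_module R) xs} \<le> 0"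
    by (intro Sup_least) (auto simp: zero_enat_def)
  then show ?thesis unfolding depth_def using s by auto
qed

text \<open>
  The pair \<open>R', N'\<close> is \<open>R / (xs), N / (xs) N\<close> up to isomorphism, with the canonical maps \<open>\<phi>\<close> and \<open>\<psi>\<close>.
\<close>

definition quotient_pair ::
    "'a ring \<Rightarrow> ('a, 'n) module \<Rightarrow> 'a list \<Rightarrow> 'a ring \<Rightarrow> ('a, 'n) module \<Rightarrow> ('a \<Rightarrow> 'a) \<Rightarrow> ('n \<Rightarrow> 'n) \<Rightarrow> bool" where
  "quotient_pair R N xs R' N' \<phi> \<psi> \<longleftrightarrow>
    module R' N' \<and> noetherian_local_ring R' \<and> \<phi> \<in> ring_hom R R' \<and> \<phi> ` carrier R = carrier R' \<and>
    max_ideal R' = \<phi> ` max_ideal R \<and>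
    (\<forall>r\<in>carrier R. \<phi> r = \<zero>\<^bsub>R'\<^esub> \<longleftrightarrow> r \<in> mults (ring_as_module R) xs) \<and>
    \<psi> ` carrier N = carrier N' \<and>
    (\<forall>y\<in>carrier N. \<forall>z\<in>carrier N. \<psi> (y \<oplus>\<^bsub>N\<^esub> z) = \<psi> y \<oplus>\<^bsub>N'\<^esub> \<psi> z) \<and>
    (\<forall>r\<in>carrier R. \<forall>y\<in>carrier N. \<psi> (r \<odot>\<^bsub>N\<^esub> y) = \<phi> r \<odot>\<^bsub>N'\<^esub> \<psi> y) \<and>
    (\<forall>y\<in>carrier N. \<psi> y = \<zero>\<^bsub>N'\<^esub> \<longleftrightarrow> y \<in> mults N xs)"

lemma quotient_pairD:
  assumes "quotient_pair R N xs R' N' \<phi> \<psi>"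
  shows "module R' N'" "noetherian_local_ring R'" "\<phi> \<in> ring_hom R R'" "\<phi> ` carrier R = carrier R'"
    "max_ideal R' = \<phi> ` max_ideal R"
    "\<And>r. r \<in> carrier R \<Longrightarrow> \<phi> r = \<zero>\<^bsub>R'\<^esub> \<longleftrightarrow> r \<in> mults (ring_as_module R) xs"
    "\<psi> ` carrier N = carrier N'"
    "\<And>y z. y \<in> carrier N \<Longrightarrow> z \<in> carrier N \<Longrightarrow> \<psi> (y \<oplus>\<^bsub>N\<^esub> z) = \<psi> y \<oplus>\<^bsub>N'\<^esub> \<psi> z"
    "\<And>r y. r \<in> carrier R \<Longrightarrow> y \<in> carrier N \<Longrightarrow> \<psi> (r \<odot>\<^bsub>N\<^esub> y) = \<phi> r \<odot>\<^bsub>N'\<^esub> \<psi> y"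
    "\<And>y. y \<in> carrier N \<Longrightarrow> \<psi> y = \<zero>\<^bsub>N'\<^esub> \<longleftrightarrow> y \<in> mults N xs"
  using assms unfolding quotient_pair_def by blast+

text \<open>
  The first condition on \<open>P\<close>, applied to the members of the regular sequence one after another.
\<close>

lemma star_property_quotients:
  fixes R :: "'a ring" and N :: "('a, 'n) module"
  assumes P: "star_property P" "P R N" and R: "noetherian_local_ring R" and N: "module R N"
    and xs: "set xs \<subseteq> max_ideal R" "weakly_regular (ring_as_module R) xs"
  shows "i \<le> length xs \<Longrightarrow> \<exists>R' N' \<phi> \<psi>. P R' N' \<and> quotient_pair R N (take i xs) R' N' \<phi> \<psi>"
proof (induction i)
  case 0
  have "(\<lambda>r. r) \<in> ring_hom R R" by (rule ring_hom_memI) auto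
  then show ?case using P(2) N R unfolding quotient_pair_def
    by (intro exI[of _ R] exI[of _ N] exI[of _ "\<lambda>r. r"] exI[of _ "\<lambda>y. y"]) simp
next
  case (Suc i)
  obtain R' N' \<phi> \<psi> where PR': "P R' N'" and q: "quotient_pair R N (take i xs) R' N' \<phi> \<psi>"
    using Suc.IH[OF Suc_leD[OF Suc.prems]] by blast
  note PN = PR' quotient_pairD(1,2)[OF q]
  note \<phi> = quotient_pairD(3-6)[OF q] and \<psi> = quotient_pairD(7-10)[OF q]
  interpret N: module R N by fact
  interpret N': module R' N' by (rule PN(2))
  interpret A: module R "ring_as_module R" by (rule ring_as_module_module[OF N.R.is_cring])
  have xsc: "set xs \<subseteq> carrier R" using xs(1) max_idealD(2)[OF R] by blast
  let ?x = "xs ! i"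
  have i: "i < length xs" using Suc.prems by simp
  have x: "?x \<in> max_ideal R" "?x \<in> carrier R" using i xs(1) xsc by auto
  have ts: "set (take i xs) \<subseteq> carrier R" by (rule take_set[OF xsc])
  have tS: "take (Suc i) xs = take i xs @ [?x]" by (rule take_Suc_conv_app_nth[OF i])
  have x': "\<phi> ?x \<in> max_ideal R'" using \<phi>(3) x(1) by blast
  have \<phi>c: "\<phi> r \<in> carrier R'" if "r \<in> carrier R" for r using that \<phi>(2) by blast
  have \<psi>c: "\<psi> y \<in> carrier N'" if "y \<in> carrier N" for y using that \<psi>(1) by blast
  have reg: "regular_element R' (ring_as_module R') (\<phi> ?x)"
    unfolding regular_element_def
  proof (intro conjI ballI impI)
    show "\<phi> ?x \<in> carrier R'" by (rule \<phi>c[OF x(2)])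
    fix y assume y: "y \<in> carrier (ring_as_module R')" "\<phi> ?x \<odot>\<^bsub>ring_as_module R'\<^esub> y = \<zero>\<^bsub>ring_as_module R'\<^esub>"
    then obtain r where r: "r \<in> carrier R" "y = \<phi> r" using \<phi>(2) by (metis imageE ring_as_module_simps(1))
    then have "\<phi> (?x \<otimes>\<^bsub>R\<^esub> r) = \<zero>\<^bsub>R'\<^esub>" using y(2) x(2) ring_hom_mult[OF \<phi>(1)] by simp
    then have "?x \<otimes>\<^bsub>R\<^esub> r \<in> mults (ring_as_module R) (take i xs)" using \<phi>(4) x(2) r(1) by simp
    then have "r \<in> mults (ring_as_module R) (take i xs)" using xs(2) i r(1) unfolding weakly_regular_def by simp
    then show "y = \<zero>\<^bsub>ring_as_module R'\<^esub>" using \<phi>(4) r by simp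
  qed
  obtain R'' :: "'a ring" and N'' :: "('a, 'n) module" and f g where
    iso: "ring_module_isomorphic (R' Quot (PIdl\<^bsub>R'\<^esub> \<phi> ?x)) (reduced_module R' N' (PIdl\<^bsub>R'\<^esub> \<phi> ?x)) R'' N''"
    and N'': "module R'' N''" "noetherian_local_ring R''" and f: "f \<in> ring_hom R' R''" "f ` carrier R' = carrier R''"
    "max_ideal R'' = f ` max_ideal R'"
    "\<And>r. r \<in> carrier R' \<Longrightarrow> f r = \<zero>\<^bsub>R''\<^esub> \<longleftrightarrow> (\<exists>r'\<in>carrier R'. r = \<phi> ?x \<otimes>\<^bsub>R'\<^esub> r')" and
    g: "g ` carrier N' = carrier N''"
    "\<And>y z. y \<in> carrier N' \<Longrightarrow> z \<in> carrier N' \<Longrightarrow> g (y \<oplus>\<^bsub>N'\<^esub> z) = g y \<oplus>\<^bsub>N''\<^esub> g z"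
    "\<And>r y. r \<in> carrier R' \<Longrightarrow> y \<in> carrier N' \<Longrightarrow> g (r \<odot>\<^bsub>N'\<^esub> y) = f r \<odot>\<^bsub>N''\<^esub> g y"
    "\<And>y. y \<in> carrier N' \<Longrightarrow> g y = \<zero>\<^bsub>N''\<^esub> \<longleftrightarrow> (\<exists>y'\<in>carrier N'. y = \<phi> ?x \<odot>\<^bsub>N'\<^esub> y')"
    by (rule quotient_copy[OF PN(3,2) x']) blast
  have P'': "P R'' N''" using P(1) PN x' reg N''(1) iso unfolding star_property_def by blast
  interpret N'': module R'' N'' by (rule N''(1))
  have "quotient_pair R N (take (Suc i) xs) R'' N'' (f \<circ> \<phi>) (g \<circ> \<psi>)"
    unfolding quotient_pair_def
  proof (intro conjI ballI)
    show "module R'' N''" "noetherian_local_ring R''" by fact+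
    show "f \<circ> \<phi> \<in> ring_hom R R''" by (rule ring_hom_trans[OF \<phi>(1) f(1)])
    show "(f \<circ> \<phi>) ` carrier R = carrier R''" using \<phi>(2) f(2) by (metis image_comp)
    show "max_ideal R'' = (f \<circ> \<phi>) ` max_ideal R" using \<phi>(3) f(3) by (metis image_comp)
    show "(g \<circ> \<psi>) ` carrier N = carrier N''" using \<psi>(1) g(1) by (metis image_comp)
    show "(g \<circ> \<psi>) (y \<oplus>\<^bsub>N\<^esub> z) = (g \<circ> \<psi>) y \<oplus>\<^bsub>N''\<^esub> (g \<circ> \<psi>) z" if "y \<in> carrier N" "z \<in> carrier N" for y z
      using that by (simp add: \<psi>(2) g(2) \<psi>c)
    show "(g \<circ> \<psi>) (r \<odot>\<^bsub>N\<^esub> y) = (f \<circ> \<phi>) r \<odot>\<^bsub>N''\<^esub> (g \<circ> \<psi>) y" if "r \<in> carrier R" "y \<in> carrier N" for r y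
      using that by (simp add: \<psi>(3) g(3) \<psi>c \<phi>c)
  next
    fix r assume r: "r \<in> carrier R"
    have "(f \<circ> \<phi>) r = \<zero>\<^bsub>R''\<^esub> \<longleftrightarrow> (\<exists>r'\<in>carrier R. \<phi> r = \<phi> ?x \<otimes>\<^bsub>R'\<^esub> \<phi> r')"
      by (simp only: comp_apply f(4)[OF \<phi>c[OF r]] \<phi>(2)[symmetric] bex_simps)
    also have "\<dots> \<longleftrightarrow> (\<exists>r'\<in>carrier R. \<phi> (r \<ominus>\<^bsub>R\<^esub> ?x \<otimes>\<^bsub>R\<^esub> r') = \<zero>\<^bsub>R'\<^esub>)"
    proof (intro bex_cong refl)
      fix r' assume r': "r' \<in> carrier R"
      interpret h: ring_hom_ring R R' \<phi> by (rule ring_hom_ringI2[OF N.R.ring_axioms N'.R.ring_axioms \<phi>(1)])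
      have "\<phi> (r \<ominus>\<^bsub>R\<^esub> ?x \<otimes>\<^bsub>R\<^esub> r') = \<phi> r \<ominus>\<^bsub>R'\<^esub> \<phi> ?x \<otimes>\<^bsub>R'\<^esub> \<phi> r'" using r r' x(2) by (simp add: N.R.minus_eq N'.R.minus_eq)
      then show "\<phi> r = \<phi> ?x \<otimes>\<^bsub>R'\<^esub> \<phi> r' \<longleftrightarrow> \<phi> (r \<ominus>\<^bsub>R\<^esub> ?x \<otimes>\<^bsub>R\<^esub> r') = \<zero>\<^bsub>R'\<^esub>"
        using N'.R.r_right_minus_eq[of "\<phi> r" "\<phi> ?x \<otimes>\<^bsub>R'\<^esub> \<phi> r'"] r r' x(2) by simp
    qed
    also have "\<dots> \<longleftrightarrow> (\<exists>r'\<in>carrier R. r \<ominus>\<^bsub>R\<^esub> ?x \<otimes>\<^bsub>R\<^esub> r' \<in> mults (ring_as_module R) (take i xs))"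
      using \<phi>(4) r x(2) by (intro bex_cong refl) simp
    also have "\<dots> \<longleftrightarrow> r \<in> mults (ring_as_module R) (take (Suc i) xs)"
    proof -
      have c: "z \<in> carrier R" if "z \<in> mults (ring_as_module R) (take i xs)" for z using A.mults_carrier[OF ts] that by auto
      have "(\<exists>r'\<in>carrier R. r \<ominus>\<^bsub>R\<^esub> ?x \<otimes>\<^bsub>R\<^esub> r' \<in> mults (ring_as_module R) (take i xs)) \<longleftrightarrow>
        (\<exists>z\<in>mults (ring_as_module R) (take i xs). \<exists>r'\<in>carrier R. r = z \<oplus>\<^bsub>R\<^esub> ?x \<otimes>\<^bsub>R\<^esub> r')" (is "?l \<longleftrightarrow> ?r")
      proof
        assume ?l
        then obtain r' where r': "r' \<in> carrier R" "r \<ominus>\<^bsub>R\<^esub> ?x \<otimes>\<^bsub>R\<^esub> r' \<in> mults (ring_as_module R) (take i xs)" by blast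
        have "r = (r \<ominus>\<^bsub>R\<^esub> ?x \<otimes>\<^bsub>R\<^esub> r') \<oplus>\<^bsub>R\<^esub> ?x \<otimes>\<^bsub>R\<^esub> r'" using r r'(1) x(2) by (simp add: N.R.minus_eq N.R.a_assoc N.R.l_neg)
        then show ?r using r' by blast
      next
        assume ?r
        then obtain z r' where z: "z \<in> mults (ring_as_module R) (take i xs)" "r' \<in> carrier R" "r = z \<oplus>\<^bsub>R\<^esub> ?x \<otimes>\<^bsub>R\<^esub> r'" by blast
        have "r \<ominus>\<^bsub>R\<^esub> ?x \<otimes>\<^bsub>R\<^esub> r' = z" using c[OF z(1)] z(2,3) x(2) by (simp add: N.R.minus_eq N.R.a_assoc N.R.r_neg)
        then show ?l using z(1) by (intro bexI[OF _ z(2)]) simp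
      qed
      then show ?thesis unfolding tS A.mults_snoc[OF ts x(2)] by simp
    qed
    finally show "(f \<circ> \<phi>) r = \<zero>\<^bsub>R''\<^esub> \<longleftrightarrow> r \<in> mults (ring_as_module R) (take (Suc i) xs)" .
  next
    fix y assume y: "y \<in> carrier N"
    have \<psi>minus: "\<psi> (y \<ominus>\<^bsub>N\<^esub> z) = \<zero>\<^bsub>N'\<^esub> \<longleftrightarrow> \<psi> y = \<psi> z" if z: "z \<in> carrier N" for z
    proof -
      have "\<psi> (y \<ominus>\<^bsub>N\<^esub> z) \<oplus>\<^bsub>N'\<^esub> \<psi> z = \<psi> ((y \<ominus>\<^bsub>N\<^esub> z) \<oplus>\<^bsub>N\<^esub> z)" using y z by (simp add: \<psi>(2))
      also have "(y \<ominus>\<^bsub>N\<^esub> z) \<oplus>\<^bsub>N\<^esub> z = y" using y z by (simp add: N.M.minus_eq N.M.a_assoc N.M.l_neg)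
      finally have e: "\<psi> (y \<ominus>\<^bsub>N\<^esub> z) \<oplus>\<^bsub>N'\<^esub> \<psi> z = \<psi> y" .
      have cc: "\<psi> (y \<ominus>\<^bsub>N\<^esub> z) \<in> carrier N'" "\<psi> z \<in> carrier N'" using y z \<psi>c by auto
      have "\<psi> z \<oplus>\<^bsub>N'\<^esub> \<psi> (y \<ominus>\<^bsub>N\<^esub> z) = \<psi> y" using e N'.M.a_comm[OF cc] by simp
      then show ?thesis using N'.M.add.l_cancel_one[OF cc(2,1)] by auto
    qed
    have "(g \<circ> \<psi>) y = \<zero>\<^bsub>N''\<^esub> \<longleftrightarrow> (\<exists>y'\<in>carrier N. \<psi> y = \<phi> ?x \<odot>\<^bsub>N'\<^esub> \<psi> y')"
      by (simp only: comp_apply g(4)[OF \<psi>c[OF y]] \<psi>(1)[symmetric] bex_simps)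
    also have "\<dots> \<longleftrightarrow> (\<exists>y'\<in>carrier N. y \<ominus>\<^bsub>N\<^esub> ?x \<odot>\<^bsub>N\<^esub> y' \<in> mults N (take i xs))"
      using \<psi>(4) y x(2) \<psi>minus \<psi>(3)[OF x(2)] by (intro bex_cong refl) simp
    also have "\<dots> \<longleftrightarrow> y \<in> mults N (take (Suc i) xs)"
    proof -
      have c: "z \<in> carrier N" if "z \<in> mults N (take i xs)" for z using N.mults_carrier[OF ts] that by auto
      have "(\<exists>y'\<in>carrier N. y \<ominus>\<^bsub>N\<^esub> ?x \<odot>\<^bsub>N\<^esub> y' \<in> mults N (take i xs)) \<longleftrightarrow>
        (\<exists>z\<in>mults N (take i xs). \<exists>y'\<in>carrier N. y = z \<oplus>\<^bsub>N\<^esub> ?x \<odot>\<^bsub>N\<^esub> y')" (is "?l \<longleftrightarrow> ?r")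
      proof
        assume ?l
        then obtain y' where y': "y' \<in> carrier N" "y \<ominus>\<^bsub>N\<^esub> ?x \<odot>\<^bsub>N\<^esub> y' \<in> mults N (take i xs)" by blast
        have "y = (y \<ominus>\<^bsub>N\<^esub> ?x \<odot>\<^bsub>N\<^esub> y') \<oplus>\<^bsub>N\<^esub> ?x \<odot>\<^bsub>N\<^esub> y'" using y y'(1) x(2) by (simp add: N.M.minus_eq N.M.a_assoc N.M.l_neg)
        then show ?r using y' by blast
      next
        assume ?r
        then obtain z y' where z: "z \<in> mults N (take i xs)" "y' \<in> carrier N" "y = z \<oplus>\<^bsub>N\<^esub> ?x \<odot>\<^bsub>N\<^esub> y'" by blast
        have "y \<ominus>\<^bsub>N\<^esub> ?x \<odot>\<^bsub>N\<^esub> y' = z" using c[OF z(1)] z(2,3) x(2) by (simp add: N.M.minus_eq N.M.a_assoc N.M.r_neg)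
        then show ?l using z(1) by (intro bexI[OF _ z(2)]) simp
      qed
      then show ?thesis unfolding tS N.mults_snoc[OF ts x(2)] by simp
    qed
    finally show "(g \<circ> \<psi>) y = \<zero>\<^bsub>N''\<^esub> \<longleftrightarrow> y \<in> mults N (take (Suc i) xs)" .
  qed
  then show ?case using P'' by blast
qed

text \<open>
  Modulo \<open>xs\<close> the element \<open>s\<close> becomes a nonzero socle element of a ring which therefore has depth \<open>0\<close>, and
  the second condition on \<open>P\<close> makes the quotient of \<open>N\<close> faithful.
\<close>

theorem star_property_not_killed:
  fixes R :: "'a ring" and N :: "('a, 'n) module"
  assumes P: "star_property P" "P R N" and R: "noetherian_local_ring R" and N: "module R N"
    and xs: "set xs \<subseteq> max_ideal R" "weakly_regular (ring_as_module R) xs"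
    and s: "s \<in> carrier R" "s \<notin> mults (ring_as_module R) xs"
    and soc: "\<And>r. r \<in> max_ideal R \<Longrightarrow> r \<otimes>\<^bsub>R\<^esub> s \<in> mults (ring_as_module R) xs"
  shows "\<not> kills N s xs"
proof
  assume k: "kills N s xs"
  obtain R' N' \<phi> \<psi> where PR': "P R' N'" and q: "quotient_pair R N xs R' N' \<phi> \<psi>"
    using star_property_quotients[OF P R N xs order_refl] unfolding take_all[OF order_refl] by blast
  note PN = PR' quotient_pairD(1,2)[OF q]
  note \<phi> = quotient_pairD(3-6)[OF q] and \<psi> = quotient_pairD(7,9,10)[OF q]
  interpret R: cring R by (rule noetherian_localD(1)[OF R])
  interpret N: module R N by fact
  have \<phi>s: "\<phi> s \<in> carrier R'" "\<phi> s \<noteq> \<zero>\<^bsub>R'\<^esub>" using s \<phi>(2,4) by auto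
  have "r \<otimes>\<^bsub>R'\<^esub> \<phi> s = \<zero>\<^bsub>R'\<^esub>" if r: "r \<in> max_ideal R'" for r
  proof -
    obtain q where q: "q \<in> max_ideal R" "r = \<phi> q" using r \<phi>(3) by blast
    have qc: "q \<in> carrier R" using q(1) max_idealD(2)[OF R] by blast
    have "\<phi> (q \<otimes>\<^bsub>R\<^esub> s) = \<zero>\<^bsub>R'\<^esub>" using \<phi>(4) soc[OF q(1)] qc s(1) by simp
    then show ?thesis using ring_hom_mult[OF \<phi>(1) qc s(1)] q(2) by simp
  qed
  then have "depth R' (ring_as_module R') = 0" by (rule depth_zero_of_socle[OF PN(3) \<phi>s])
  then have ann: "annihilator R' N' = {\<zero>\<^bsub>R'\<^esub>}" using P(1) PN unfolding star_property_def by blast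
  have "\<phi> s \<odot>\<^bsub>N'\<^esub> u = \<zero>\<^bsub>N'\<^esub>" if u: "u \<in> carrier N'" for u
  proof -
    obtain y where y: "y \<in> carrier N" "u = \<psi> y" using u \<psi>(1) by blast
    have "\<psi> (s \<odot>\<^bsub>N\<^esub> y) = \<zero>\<^bsub>N'\<^esub>" using \<psi>(3) k y(1) s(1) by (simp add: kills_def)
    then show ?thesis using \<psi>(2)[OF s(1) y(1)] y(2) by simp
  qed
  then have "\<phi> s \<in> annihilator R' N'" using \<phi>s(1) by (simp add: annihilator_def)
  then show False using ann \<phi>s(2) by blast
qed

section \<open>Local rings as quotients of polynomial rings\<close>

text \<open>
  The polynomial ring over the integers with one variable for each element of the type maps onto \<open>R\<close>.
  Variables for elements outside of the carrier are sent to \<open>1\<close>. In this way a ring given by a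
  record becomes a quotient of a ring given by a type.
\<close>

lemma poly_mapping_ring_surjection:
  fixes R :: "'a ring"
  assumes "cring R"
  shows "\<exists>\<rho> :: ('a multiset \<Rightarrow>\<^sub>0 int) \<Rightarrow> 'a. range \<rho> = carrier R \<and> \<rho> 1 = \<one>\<^bsub>R\<^esub> \<and>
    (\<forall>p q. \<rho> (p + q) = \<rho> p \<oplus>\<^bsub>R\<^esub> \<rho> q) \<and> (\<forall>p q. \<rho> (p * q) = \<rho> p \<otimes>\<^bsub>R\<^esub> \<rho> q)"
proof -
  interpret cring R by fact
  define c where "c a = (if a \<in> carrier R then a else \<one>\<^bsub>R\<^esub>)" for a
  have c: "c a \<in> carrier R" for a by (simp add: c_def)
  define lst where "lst as = foldr (\<otimes>\<^bsub>R\<^esub>) (map c as) \<one>\<^bsub>R\<^esub>" for as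
  have lst_c: "lst as \<in> carrier R" for as by (induction as) (auto simp: lst_def c)
  have lst_append: "lst (as @ bs) = lst as \<otimes>\<^bsub>R\<^esub> lst bs" for as bs
    using lst_c by (induction as) (auto simp: lst_def c m_assoc)
  have lst_perm: "lst as = lst bs" if "mset as = mset bs" for as bs
    unfolding lst_def using that c by (intro multlist_perm_cong) auto
  \<comment> \<open>the value of a monomial, read off from any enumeration of the multiset of its variables\<close>
  define mon where "mon \<mu> = lst (SOME as. mset as = \<mu>)" for \<mu> :: "'a multiset"
  have mon_mset: "mon (mset as) = lst as" for as
    unfolding mon_def by (rule lst_perm) (rule someI_ex, blast)
  have mon_add: "mon (\<mu> + \<nu>) = mon \<mu> \<otimes>\<^bsub>R\<^esub> mon \<nu>" for \<mu> \<nu>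
    using ex_mset[of \<mu>] ex_mset[of \<nu>] by (metis lst_append mon_mset mset_append)
  have mon_c: "mon \<mu> \<in> carrier R" for \<mu> by (simp add: mon_def lst_c)
  obtain \<rho> where h: "\<rho> \<in> hom (free_Abelian_group UNIV) (add_monoid R)" and f: "\<And>\<mu>. \<rho> (frag_of \<mu>) = mon \<mu>"
    using comm_group.free_Abelian_group_universal[OF a_comm_group, of mon UNIV] mon_c
    by (auto simp: image_subset_iff)
  have \<rho>c: "\<rho> p \<in> carrier R" for p using h by (auto simp: hom_def free_Abelian_group_def)
  have \<rho>add: "\<rho> (p + q) = \<rho> p \<oplus>\<^bsub>R\<^esub> \<rho> q" for p q
    using h by (simp add: hom_def free_Abelian_group_def)
  have \<rho>0: "\<rho> 0 = \<zero>\<^bsub>R\<^esub>" using \<rho>add[of 0 0] \<rho>c[of 0] by (simp add: add.l_cancel_one')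
  have \<rho>diff: "\<rho> (p - q) = \<rho> p \<ominus>\<^bsub>R\<^esub> \<rho> q" for p q
  proof -
    have "\<rho> (p - q) \<oplus>\<^bsub>R\<^esub> \<rho> q = \<rho> p" using \<rho>add[of "p - q" q] by simp
    then show ?thesis using \<rho>c by (metis minus_eq a_assoc r_neg r_zero a_inv_closed)
  qed
  have m1: "\<rho> (frag_of \<mu> * q) = \<rho> (frag_of \<mu>) \<otimes>\<^bsub>R\<^esub> \<rho> q" for \<mu> q
  proof (induction q rule: frag_induction[OF subset_UNIV, consumes 0, case_names zero one diff])
    case zero then show ?case using \<rho>0 \<rho>c by simp
  next
    case (diff x y)
    then show ?case using \<rho>c by (simp add: \<rho>diff right_diff_distrib minus_eq r_distr r_minus)
  next
    case (one a)
    have "frag_of \<mu> * frag_of a = frag_of (\<mu> + a)" by (simp add: mult_single)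
    then show ?case by (simp add: f mon_add)
  qed
  have mult: "\<rho> (p * q) = \<rho> p \<otimes>\<^bsub>R\<^esub> \<rho> q" for p q
  proof (induction p rule: frag_induction[OF subset_UNIV, consumes 0, case_names zero one diff])
    case zero then show ?case using \<rho>0 \<rho>c by simp
  next
    case (diff x y)
    then show ?case using \<rho>c by (simp add: \<rho>diff left_diff_distrib minus_eq l_distr l_minus)
  next
    case (one a) show ?case by (rule m1)
  qed
  have "(1 :: 'a multiset \<Rightarrow>\<^sub>0 int) = frag_of {#}" by simp
  then have "\<rho> 1 = mon {#}" using f by metis
  then have one: "\<rho> 1 = \<one>\<^bsub>R\<^esub>" using mon_mset[of "[]"] by (simp add: lst_def)
  have "a \<in> range \<rho>" if "a \<in> carrier R" for a
    using f[of "{#a#}"] mon_mset[of "[a]"] that by (metis c_def foldr.simps comp_apply id_apply list.map lst_def mset.simps r_one rangeI)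
  then have "range \<rho> = carrier R" using \<rho>c by blast
  then show ?thesis using one \<rho>add mult by blast
qed

text \<open>
  A local ring \<open>R\<close> presented as a quotient of a ring \<open>S\<close> that is a type. The statements about \<open>S / aa\<close>
  translate into statements about \<open>R\<close>.
\<close>

locale ring_cover =
  fixes R :: "'a ring" and \<rho> :: "'s::comm_ring_1 \<Rightarrow> 'a"
  assumes local_R: "noetherian_local_ring R"
    and range_cover: "range \<rho> = carrier R" and cover_one: "\<rho> 1 = \<one>\<^bsub>R\<^esub>"
    and cover_add: "\<rho> (p + q) = \<rho> p \<oplus>\<^bsub>R\<^esub> \<rho> q" and cover_mult: "\<rho> (p * q) = \<rho> p \<otimes>\<^bsub>R\<^esub> \<rho> q"
begin

sublocale R: cring R by (rule noetherian_localD(1)[OF local_R])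

definition aa :: "'s set" where "aa = {p. \<rho> p = \<zero>\<^bsub>R\<^esub>}"
definition mm :: "'s set" where "mm = {p. \<rho> p \<in> max_ideal R}"

lemma cover_closed [simp]: "\<rho> p \<in> carrier R" using range_cover by blast

lemma cover_lift: "r \<in> carrier R \<Longrightarrow> \<exists>p. \<rho> p = r" using range_cover by (metis imageE)

lemma cover_zero [simp]: "\<rho> 0 = \<zero>\<^bsub>R\<^esub>"
  using cover_add[of 0 0] by (simp add: R.add.l_cancel_one')

lemma cover_diff: "\<rho> (p - q) = \<rho> p \<ominus>\<^bsub>R\<^esub> \<rho> q"
proof -
  have "\<rho> (p - q) \<oplus>\<^bsub>R\<^esub> \<rho> q = \<rho> p" using cover_add[of "p - q" q] by simp
  then show ?thesis by (metis cover_closed R.minus_eq R.a_assoc R.r_neg R.r_zero R.a_inv_closed)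
qed

lemma cover_eq_iff: "\<rho> p = \<rho> q \<longleftrightarrow> p - q \<in> aa"
  by (simp add: aa_def cover_diff)

lemma ideal_vimage: "ideal I R \<Longrightarrow> rg.subspace (\<rho> -` I)"
  by (rule rg.subspaceI)
    (auto simp: cover_add cover_mult ideal.I_l_closed additive_subgroup.a_closed additive_subgroup.zero_closed ideal.axioms(1))

lemma ideal_image:
  assumes J: "rg.subspace J" shows "ideal (\<rho> ` J) R"
proof (rule idealI[OF R.ring_axioms])
  show "subgroup (\<rho> ` J) (add_monoid R)"
  proof (rule R.add.subgroupI)
    show "\<rho> ` J \<noteq> {}" using rg.subspace_0[OF J] by blast
    fix a assume "a \<in> \<rho> ` J"
    then obtain p where p: "p \<in> J" "a = \<rho> p" by blast
    have "\<rho> (0 - p) = \<ominus>\<^bsub>R\<^esub> a" unfolding p(2) cover_diff by (simp add: R.minus_eq)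
    then show "\<ominus>\<^bsub>R\<^esub> a \<in> \<rho> ` J" 
      using rg.subspace_diff[OF J rg.subspace_0[OF J] p(1)] by (metis image_eqI)
    fix b assume "b \<in> \<rho> ` J"
    then show "a \<oplus>\<^bsub>R\<^esub> b \<in> \<rho> ` J" using p rg.subspace_add[OF J] by (auto simp: cover_add[symmetric])
  qed auto
next
  fix a r assume "a \<in> \<rho> ` J" and r: "r \<in> carrier R"
  then obtain p q where p: "p \<in> J" "a = \<rho> p" "r = \<rho> q" using cover_lift by blast
  have "q * p \<in> J" "p * q \<in> J" using ideal_times[OF J p(1)] by auto
  then show "r \<otimes>\<^bsub>R\<^esub> a \<in> \<rho> ` J" "a \<otimes>\<^bsub>R\<^esub> r \<in> \<rho> ` J" unfolding p by (auto simp: cover_mult[symmetric])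
qed

lemma vimage_image: "rg.subspace J \<Longrightarrow> aa \<subseteq> J \<Longrightarrow> \<rho> p \<in> \<rho> ` J \<longleftrightarrow> p \<in> J"
proof
  assume J: "rg.subspace J" "aa \<subseteq> J" and "\<rho> p \<in> \<rho> ` J"
  then obtain q where q: "q \<in> J" "\<rho> p = \<rho> q" by blast
  then have "p - q \<in> J" using J(2) cover_eq_iff by blast
  then have "p - q + q \<in> J" by (rule rg.subspace_add[OF J(1) _ q(1)])
  then show "p \<in> J" by simp
qed blast

lemma aa_subspace: "rg.subspace aa"
  unfolding aa_def by (rule rg.subspaceI) (auto simp: cover_add cover_mult)

text \<open>
  Image and preimage are inverse to each other on ideals above the kernel, so both sides describe the
  smallest ideal that contains the given generators.
\<close>

lemma cover_Idl_iff: "\<rho> p \<in> Idl\<^bsub>R\<^esub> (\<rho> ` S) \<longleftrightarrow> p \<in> rg.span (aa \<union> S)"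
proof
  have "Idl\<^bsub>R\<^esub> (\<rho> ` S) \<subseteq> \<rho> ` rg.span (aa \<union> S)"
    by (rule R.genideal_minimal[OF ideal_image[OF rg.subspace_span]]) (auto intro: rg.span_base)
  then show "p \<in> rg.span (aa \<union> S)" if "\<rho> p \<in> Idl\<^bsub>R\<^esub> (\<rho> ` S)"
    using that vimage_image[OF rg.subspace_span, of "aa \<union> S" p] rg.span_superset[of "aa \<union> S"] by blast
  have c: "\<rho> ` S \<subseteq> carrier R" by auto
  have "rg.span (aa \<union> S) \<subseteq> \<rho> -` (Idl\<^bsub>R\<^esub> (\<rho> ` S))"
  proof (rule rg.span_minimal[OF _ ideal_vimage[OF R.genideal_ideal[OF c]]])
    interpret I: ideal "Idl\<^bsub>R\<^esub> (\<rho> ` S)" R by (rule R.genideal_ideal[OF c])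
    show "aa \<union> S \<subseteq> \<rho> -` (Idl\<^bsub>R\<^esub> (\<rho> ` S))" using R.genideal_self[OF c] by (auto simp: aa_def)
  qed
  then show "\<rho> p \<in> Idl\<^bsub>R\<^esub> (\<rho> ` S)" if "p \<in> rg.span (aa \<union> S)" using that by blast
qed

lemma max_ideal_cover: "max_ideal R = \<rho> ` mm"
  using max_idealD(2)[OF local_R] cover_lift by (auto simp: mm_def)

sublocale local_base aa mm
proof
  show "rg.subspace aa" by (rule aa_subspace)
  show "rg.subspace mm" using ideal_vimage[OF max_idealD(1)[OF local_R]] by (simp add: mm_def vimage_def)
  interpret m: ideal "max_ideal R" R by (rule max_idealD(1)[OF local_R])
  show "aa \<subseteq> mm" by (auto simp: aa_def mm_def)
  show "1 \<notin> mm" using max_idealD(3)[OF local_R] by (simp add: mm_def cover_one)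
  show "\<exists>v. v * w - 1 \<in> aa" if w: "w \<notin> mm" for w
  proof -
    obtain r where r: "r \<in> carrier R" "r \<otimes>\<^bsub>R\<^esub> \<rho> w = \<one>\<^bsub>R\<^esub>"
      using unit_if_not_in_max_ideal[OF local_R, of "\<rho> w"] w by (auto simp: mm_def)
    obtain v where "\<rho> v = r" using cover_lift[OF r(1)] by blast
    then have "\<rho> (v * w) = \<rho> 1" using r(2) by (simp add: cover_mult cover_one)
    then show ?thesis unfolding cover_eq_iff by blast
  qed
  show "rg.noeth aa UNIV" unfolding rg.noeth_def
  proof (intro allI impI)
    fix H assume H: "rg.subspace H \<and> aa \<subseteq> H \<and> H \<subseteq> UNIV"
    then have I: "ideal (\<rho> ` H) R" using ideal_image by simp
    obtain A where A: "A \<subseteq> carrier R" "finite A" "\<rho> ` H = Idl\<^bsub>R\<^esub> A"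
      using noetherian_ring.finetely_gen[OF noetherian_localD(2)[OF local_R] I] by blast
    have "A \<subseteq> \<rho> ` H" using A(3) R.genideal_self[OF A(1)] by simp
    then obtain G where G: "finite G" "A = \<rho> ` G"
      using A(2) by (metis finite_subset_image)
    have "H = rg.span (aa \<union> G)"
    proof (rule Set.set_eqI)
      fix p
      show "p \<in> H \<longleftrightarrow> p \<in> rg.span (aa \<union> G)"
        using cover_Idl_iff[of p G] vimage_image[of H p] H A(3) G(2) by simp
    qed
    then show "\<exists>G. finite G \<and> H = rg.span (aa \<union> G)" using G(1) by blast
  qed
qed

lemma prime_image:
  assumes p: "prime_id p" "aa \<subseteq> p"
  shows "primeideal (\<rho> ` p) R"
proof (rule primeidealI[OF ideal_image[OF prime_id_ideal[OF p(1)]] R.is_cring])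
  note v = vimage_image[OF prime_id_ideal[OF p(1)] p(2)]
  have "1 \<notin> p" using p(1) by (simp add: prime_id_def)
  then show "carrier R \<noteq> \<rho> ` p" using v[of 1] by (metis cover_closed)
  fix a b assume "a \<in> carrier R" "b \<in> carrier R" and ab: "a \<otimes>\<^bsub>R\<^esub> b \<in> \<rho> ` p"
  then obtain x y where xy: "a = \<rho> x" "b = \<rho> y" using cover_lift by metis
  have "x * y \<in> p" using ab v[of "x * y"] by (simp add: xy cover_mult)
  then show "a \<in> \<rho> ` p \<or> b \<in> \<rho> ` p" using p(1) xy by (auto simp: prime_id_def)
qed

lemma prime_vimage:
  assumes "primeideal I R" shows "prime_id (\<rho> -` I)" "aa \<subseteq> \<rho> -` I" "\<rho> ` (\<rho> -` I) = I"
proof -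
  interpret I: primeideal I R by fact
  show "aa \<subseteq> \<rho> -` I" by (auto simp: aa_def)
  show "prime_id (\<rho> -` I)" unfolding prime_id_def
  proof (intro conjI allI impI)
    show "rg.subspace (\<rho> -` I)" by (rule ideal_vimage[OF I.is_ideal])
    show "1 \<notin> \<rho> -` I" using I.one_imp_carrier I.I_notcarr by (auto simp: cover_one)
    fix a b assume "a * b \<in> \<rho> -` I"
    then show "a \<in> \<rho> -` I \<or> b \<in> \<rho> -` I" using I.I_prime[of "\<rho> a" "\<rho> b"] by (simp add: cover_mult)
  qed
  have "I \<subseteq> range \<rho>" using I.a_subset range_cover by simp
  then show "\<rho> ` (\<rho> -` I) = I" by (simp add: image_vimage_eq inf.absorb1)
qed

lemma prime_chain_cover:
  "(\<exists>p :: nat \<Rightarrow> 'a set. (\<forall>i\<le>n. primeideal (p i) R) \<and> (\<forall>i<n. p i \<subset> p (Suc i))) \<longleftrightarrow>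
   (\<exists>p. prime_chain n p \<and> aa \<subseteq> p 0)" (is "?l \<longleftrightarrow> ?r")
proof
  assume ?l
  then obtain p :: "nat \<Rightarrow> 'a set" where p: "\<And>i. i \<le> n \<Longrightarrow> primeideal (p i) R" "\<And>i. i < n \<Longrightarrow> p i \<subset> p (Suc i)" by blast
  have "prime_chain n (\<lambda>i. \<rho> -` p i)" unfolding prime_chain_def
  proof (intro conjI allI impI)
    show "prime_id (\<rho> -` p i)" if "i \<le> n" for i by (rule prime_vimage(1)[OF p(1)[OF that]])
    fix i assume i: "i < n"
    have "\<rho> ` (\<rho> -` p i) \<noteq> \<rho> ` (\<rho> -` p (Suc i))"
      using prime_vimage(3)[OF p(1)[of i]] prime_vimage(3)[OF p(1)[of "Suc i"]] i p(2)[OF i] by simp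
    then show "\<rho> -` p i \<subset> \<rho> -` p (Suc i)" using p(2)[OF i] by blast
  qed
  then show ?r using prime_vimage(2)[OF p(1)[of 0]] by blast
next
  assume ?r
  then obtain p where p: "prime_chain n p" "aa \<subseteq> p 0" by blast
  have pi: "prime_id (p i)" "aa \<subseteq> p i" if "i \<le> n" for i
    using p prime_chain_mono[OF p(1), of 0 i] that by (auto simp: prime_chain_def)
  have "\<rho> ` p i \<subset> \<rho> ` p (Suc i)" if i: "i < n" for i
  proof -
    have lt: "p i \<subset> p (Suc i)" using p(1) i by (simp add: prime_chain_def)
    then obtain x where "x \<in> p (Suc i)" "x \<notin> p i" by blast
    then have "\<rho> x \<in> \<rho> ` p (Suc i)" "\<rho> x \<notin> \<rho> ` p i"
      using vimage_image[OF prime_id_ideal[OF pi(1)] pi(2), of i x] i by auto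
    then show ?thesis using lt by blast
  qed
  moreover have "primeideal (\<rho> ` p i) R" if "i \<le> n" for i by (rule prime_image[OF pi[OF that]])
  ultimately show ?l by (intro exI[of _ "\<lambda>i. \<rho> ` p i"]) simp
qed

lemma krull_dim_param_seq:
  assumes "param_seq aa ys" "set ys \<subseteq> mm" "\<And>x. x \<in> mm \<Longrightarrow> \<exists>n. x ^ n \<in> rg.span (aa \<union> set ys)"
  shows "krull_dim R = enat (length ys)"
proof -
  have "{enat n | n. \<exists>p :: nat \<Rightarrow> 'a set. (\<forall>i\<le>n. primeideal (p i) R) \<and> (\<forall>i<n. p i \<subset> p (Suc i))} = {enat n | n. n \<le> length ys}"
    unfolding prime_chain_cover by (simp only: dim_of_param_seq[OF assms])
  moreover have "Sup {enat n | n. n \<le> length ys} = enat (length ys)"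
    by (rule Sup_eqI) auto
  ultimately show ?thesis by (simp add: krull_dim_def)
qed

lemma cover_power: "\<rho> (p ^ n) = \<rho> p [^]\<^bsub>R\<^esub> n"
  by (induction n) (simp_all add: cover_one cover_mult mult.commute[of p])

lemma system_of_parameters_cover:
  assumes "param_seq aa ys" "set ys \<subseteq> mm" "\<And>x. x \<in> mm \<Longrightarrow> \<exists>n. x ^ n \<in> rg.span (aa \<union> set ys)"
  shows "system_of_parameters R (map \<rho> ys)"
  unfolding system_of_parameters_def
proof (intro conjI ballI)
  show "set (map \<rho> ys) \<subseteq> max_ideal R" using assms(2) by (auto simp: mm_def)
  show "enat (length (map \<rho> ys)) = krull_dim R" using krull_dim_param_seq[OF assms] by simp
  fix y assume "y \<in> max_ideal R"
  then obtain x where x: "y = \<rho> x" "x \<in> mm" using max_ideal_cover by blast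
  then obtain n where "x ^ n \<in> rg.span (aa \<union> set ys)" using assms(3) by blast
  then show "\<exists>n::nat. y [^]\<^bsub>R\<^esub> n \<in> Idl\<^bsub>R\<^esub> (set (map \<rho> ys))"
    using cover_Idl_iff[of "x ^ n" "set ys"] x(1) by (intro exI[of _ n]) (simp add: cover_power)
qed

lemma regular_local_ring_cover:
  assumes xs: "param_seq aa xs" and m: "mm = rg.span (aa \<union> set xs)"
  shows "regular_local_ring R"
proof -
  have sub: "set xs \<subseteq> mm" using rg.span_superset[of "aa \<union> set xs"] unfolding m by blast
  have "max_ideal R = Idl\<^bsub>R\<^esub> (set (map \<rho> xs))"
  proof (rule Set.set_eqI)
    fix r
    have "set (map \<rho> xs) \<subseteq> carrier R" by auto
    then have "ideal (Idl\<^bsub>R\<^esub> (set (map \<rho> xs))) R" by (rule R.genideal_ideal)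
    then have I: "Idl\<^bsub>R\<^esub> (set (map \<rho> xs)) \<subseteq> carrier R" by (simp add: additive_subgroup.a_subset ideal.axioms(1))
    show "r \<in> max_ideal R \<longleftrightarrow> r \<in> Idl\<^bsub>R\<^esub> (set (map \<rho> xs))"
    proof (cases "r \<in> carrier R")
      case True
      then obtain p where p: "r = \<rho> p" using cover_lift by blast
      have "r \<in> max_ideal R \<longleftrightarrow> p \<in> mm" by (simp add: mm_def p)
      then show ?thesis using m cover_Idl_iff[of p "set xs"] by (simp add: p)
    next
      case False
      then show ?thesis using I max_idealD(2)[OF local_R] by blast
    qed
  qed
  moreover have "krull_dim R = enat (length xs)"
  proof (rule krull_dim_param_seq[OF xs sub])
    fix x assume "x \<in> mm"
    then have "x ^ 1 \<in> rg.span (aa \<union> set xs)" using m by simp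
    then show "\<exists>n. x ^ n \<in> rg.span (aa \<union> set xs)" by blast
  qed
  ultimately show ?thesis unfolding regular_local_ring_def
    using local_R by (intro conjI exI[of _ "map \<rho> xs"]) auto
qed

end

section \<open>Modules as quotients of free modules\<close>

lemma (in lmod) noeth_mono: 
  assumes "noeth B A" "B \<subseteq> B'" shows "noeth B' A"
  unfolding noeth_def
proof (intro allI impI)
  fix H assume H: "local.subspace H \<and> B' \<subseteq> H \<and> H \<subseteq> A"
  then obtain G where G: "finite G" "H = local.span (B \<union> G)"
    using assms unfolding noeth_def by (metis order_trans)
  have "G \<subseteq> H" using G(2) span_superset[of "B \<union> G"] by blast
  then have "local.span (B' \<union> G) \<subseteq> H" using H by (intro span_minimal) auto
  moreover have "H \<subseteq> local.span (B' \<union> G)" unfolding G(2) by (rule span_mono) (use assms(2) in blast)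
  ultimately show "\<exists>G. finite G \<and> H = local.span (B' \<union> G)" using G(1) by blast
qed

text \<open>
  A module over \<open>R\<close> presented as \<open>A\<close> modulo the kernel of \<open>\<kappa>\<close>, in the same way.
\<close>

locale module_cover = ring_cover R \<rho> + lmod scale
  for R :: "'a ring" and \<rho> :: "'s::comm_ring_1 \<Rightarrow> 'a"
    and scale :: "'s \<Rightarrow> 'b::ab_group_add \<Rightarrow> 'b" (infixr \<open>*s\<close> 75) +
  fixes M :: "('a, 'm) module" and \<kappa> :: "'b \<Rightarrow> 'm" and A :: "'b set"
  assumes module_M: "module R M" and A_subspace: "subspace A"
    and image_\<kappa>: "\<kappa> ` A = carrier M"
    and \<kappa>_add: "u \<in> A \<Longrightarrow> v \<in> A \<Longrightarrow> \<kappa> (u + v) = \<kappa> u \<oplus>\<^bsub>M\<^esub> \<kappa> v"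
    and \<kappa>_scale: "v \<in> A \<Longrightarrow> \<kappa> (c *s v) = \<rho> c \<odot>\<^bsub>M\<^esub> \<kappa> v"
    and noeth_ker: "noeth {v \<in> A. \<kappa> v = \<zero>\<^bsub>M\<^esub>} A"
begin

definition ker_\<kappa> :: "'b set" where "ker_\<kappa> = {v \<in> A. \<kappa> v = \<zero>\<^bsub>M\<^esub>}"

sublocale M: module R M by (rule module_M)

lemma \<kappa>_closed: "v \<in> A \<Longrightarrow> \<kappa> v \<in> carrier M" using image_\<kappa> by blast

lemma subspace_ker: "local.subspace ker_\<kappa>"
proof (rule subspaceI)
  have "0 \<in> A" by (rule subspace_0[OF A_subspace])
  then show "0 \<in> ker_\<kappa>" using \<kappa>_scale[of 0 0] \<kappa>_closed[of 0] by (simp add: ker_\<kappa>_def)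
  show "x + y \<in> ker_\<kappa>" if "x \<in> ker_\<kappa>" "y \<in> ker_\<kappa>" for x y
    using that \<kappa>_add subspace_add[OF A_subspace] by (simp add: ker_\<kappa>_def)
  show "c *s x \<in> ker_\<kappa>" if "x \<in> ker_\<kappa>" for c x
    using that \<kappa>_scale subspace_scale[OF A_subspace] by (simp add: ker_\<kappa>_def)
qed

sublocale local_module scale aa mm ker_\<kappa> A
proof
  show "noeth ker_\<kappa> A" using noeth_ker by (simp add: ker_\<kappa>_def)
  show "local.subspace A" by (rule A_subspace)
  show "r *s a \<in> ker_\<kappa>" if "r \<in> aa" "a \<in> A" for r a
    using that \<kappa>_closed[of a] subspace_scale[OF A_subspace] by (simp add: ker_\<kappa>_def \<kappa>_scale aa_def)
qed

lemma submod_ker: "submod ker_\<kappa>"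
  unfolding submod_def using subspace_ker by (auto simp: ker_\<kappa>_def)

text \<open>
  Preimages under \<open>\<kappa>\<close> are determined up to the kernel, which is part of the enlarged submodule.
\<close>

lemma mults_cover: "v \<in> A \<Longrightarrow> \<kappa> v \<in> mults M (map \<rho> xs) \<longleftrightarrow> v \<in> ext ker_\<kappa> (set xs)"
proof (induction xs arbitrary: v)
  case Nil
  then show ?case by (simp add: ext_empty[OF submod_ker]) (simp add: ker_\<kappa>_def)
next
  case (Cons x xs)
  have sub: "ext ker_\<kappa> (set xs) \<subseteq> A" using submod_ext[OF submod_ker] by (simp add: submod_def)
  have mc: "mults M (map \<rho> xs) \<subseteq> carrier M" by (rule M.mults_carrier) auto
  have "\<kappa> v \<in> mults M (map \<rho> (x # xs)) \<longleftrightarrow> (\<exists>a\<in>A. \<exists>z\<in>mults M (map \<rho> xs). \<kappa> v = \<rho> x \<odot>\<^bsub>M\<^esub> \<kappa> a \<oplus>\<^bsub>M\<^esub> z)"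
    by (simp add: image_\<kappa>[symmetric]) blast
  also have "\<dots> \<longleftrightarrow> (\<exists>a\<in>A. v - x *s a \<in> ext ker_\<kappa> (set xs))"
  proof (intro bex_cong refl)
    fix a assume a: "a \<in> A"
    have xa: "x *s a \<in> A" by (rule subspace_scale[OF A_subspace a])
    have d: "v - x *s a \<in> A" by (rule subspace_diff[OF A_subspace Cons.prems xa])
    have eq: "\<kappa> v = \<rho> x \<odot>\<^bsub>M\<^esub> \<kappa> a \<oplus>\<^bsub>M\<^esub> \<kappa> (v - x *s a)"
      using \<kappa>_add[OF xa d] \<kappa>_scale[OF a] by simp
    have "(\<exists>z\<in>mults M (map \<rho> xs). \<kappa> v = \<rho> x \<odot>\<^bsub>M\<^esub> \<kappa> a \<oplus>\<^bsub>M\<^esub> z) \<longleftrightarrow> \<kappa> (v - x *s a) \<in> mults M (map \<rho> xs)"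
      (is "?l \<longleftrightarrow> ?r")
    proof
      assume ?l
      then obtain z where z: "z \<in> mults M (map \<rho> xs)" "\<kappa> v = \<rho> x \<odot>\<^bsub>M\<^esub> \<kappa> a \<oplus>\<^bsub>M\<^esub> z" by blast
      have c: "\<rho> x \<odot>\<^bsub>M\<^esub> \<kappa> a \<in> carrier M" "z \<in> carrier M" "\<kappa> (v - x *s a) \<in> carrier M"
        using \<kappa>_closed[OF a] z(1) mc \<kappa>_closed[OF d] by auto
      have "z = \<kappa> (v - x *s a)" using z(2) eq c M.M.add.l_cancel by metis
      then show ?r using z(1) by simp
    qed (use eq in blast)
    then show "(\<exists>z\<in>mults M (map \<rho> xs). \<kappa> v = \<rho> x \<odot>\<^bsub>M\<^esub> \<kappa> a \<oplus>\<^bsub>M\<^esub> z) \<longleftrightarrow> v - x *s a \<in> ext ker_\<kappa> (set xs)"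
      using Cons.IH[OF d] by blast
  qed
  also have "\<dots> \<longleftrightarrow> v \<in> ext ker_\<kappa> (set (x # xs))"
  proof -
    have eq: "v = h + x *s a \<longleftrightarrow> h = v - x *s a" for h a by (auto simp: algebra_simps)
    show ?thesis unfolding list.set ext_insert eq by blast
  qed
  finally show ?case .
qed

lemma weakly_regular_cover: "weakly_regular M (map \<rho> xs) \<longleftrightarrow> regseq ker_\<kappa> xs"
proof -
  have "(\<forall>y\<in>carrier M. map \<rho> xs ! i \<odot>\<^bsub>M\<^esub> y \<in> mults M (take i (map \<rho> xs)) \<longrightarrow> y \<in> mults M (take i (map \<rho> xs)))
    \<longleftrightarrow> regular_on (ext ker_\<kappa> (set (take i xs))) (xs ! i)" (is "?l \<longleftrightarrow> ?r") if i: "i < length xs" for i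
  proof -
    have "?l \<longleftrightarrow> (\<forall>a\<in>A. \<kappa> ((xs ! i) *s a) \<in> mults M (map \<rho> (take i xs)) \<longrightarrow> \<kappa> a \<in> mults M (map \<rho> (take i xs)))"
      using i by (simp add: image_\<kappa>[symmetric] \<kappa>_scale take_map)
    also have "\<dots> \<longleftrightarrow> ?r" unfolding regular_on_def
      using mults_cover subspace_scale[OF A_subspace] by (intro ball_cong refl) simp
    finally show ?thesis .
  qed
  then show ?thesis unfolding weakly_regular_def regseq_def by simp
qed

end

context ring_cover
begin

lemma mults_ring_cover: "\<rho> p \<in> mults (ring_as_module R) (map \<rho> xs) \<longleftrightarrow> p \<in> rg.span (aa \<union> set xs)"
  using cover_Idl_iff[of p "set xs"] mults_ring_eq_Idl[OF R.is_cring, of "map \<rho> xs"] by (simp add: image_subset_iff)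

lemma ring_regular_cover: "ring_regular xs \<longleftrightarrow> weakly_regular (ring_as_module R) (map \<rho> xs)"
proof -
  have "(\<forall>r. xs ! i * r \<in> rg.span (aa \<union> set (take i xs)) \<longrightarrow> r \<in> rg.span (aa \<union> set (take i xs))) \<longleftrightarrow>
    (\<forall>y\<in>carrier R. map \<rho> xs ! i \<otimes>\<^bsub>R\<^esub> y \<in> mults (ring_as_module R) (take i (map \<rho> xs)) \<longrightarrow>
       y \<in> mults (ring_as_module R) (take i (map \<rho> xs)))" if "i < length xs" for i
    using that by (simp add: range_cover[symmetric] cover_mult[symmetric] take_map mults_ring_cover)
  then show ?thesis unfolding ring_regular_def weakly_regular_def by simp
qed

lemma lift_list: "set zs \<subseteq> max_ideal R \<Longrightarrow> \<exists>ys. zs = map \<rho> ys \<and> set ys \<subseteq> mm"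
proof (induction zs)
  case (Cons z zs)
  then obtain ys where ys: "zs = map \<rho> ys" "set ys \<subseteq> mm" by auto
  obtain y where "z = \<rho> y" "y \<in> mm" using Cons.prems max_ideal_cover by auto
  then show ?case using ys by (intro exI[of _ "y # ys"]) simp
qed simp

lemma length_le_depth:
  assumes xs: "set xs \<subseteq> mm" "ring_regular xs"
  shows "enat (length xs) \<le> depth R (ring_as_module R)"
proof -
  have sub: "set (map \<rho> xs) \<subseteq> max_ideal R" using xs(1) by (auto simp: mm_def)
  then have c: "set (map \<rho> xs) \<subseteq> carrier R" by auto
  have "mults (ring_as_module R) (map \<rho> xs) \<subseteq> max_ideal R"
    unfolding mults_ring_eq_Idl[OF R.is_cring c] by (rule R.genideal_minimal[OF max_idealD(1)[OF local_R] sub])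
  then have "mults (ring_as_module R) (map \<rho> xs) \<noteq> carrier (ring_as_module R)"
    using max_idealD(3)[OF local_R] by auto
  then have "regular_sequence R (ring_as_module R) (map \<rho> xs)"
    using regular_sequence_iff[OF ring_as_module_module[OF R.is_cring]] c xs(2) ring_regular_cover by blast
  then have "enat (length (map \<rho> xs)) \<in> {enat (length xs) | xs. set xs \<subseteq> max_ideal R \<and> regular_sequence R (ring_as_module R) xs}"
    using sub by blast
  then have le: "enat (length (map \<rho> xs)) \<le> Sup {enat (length xs) | xs. set xs \<subseteq> max_ideal R \<and> regular_sequence R (ring_as_module R) xs}"
    by (rule Sup_upper)
  then show ?thesis unfolding depth_def by simp
qed

text \<open>
  The depth is a supremum of lengths, so a regular sequence of length at least \<open>n\<close> exists and can be
  cut off. The zero module has infinite depth but no regular sequences; on it every sequence is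
  weakly regular.
\<close>

lemma weakly_regular_of_depth:
  fixes K :: "('a, 'k) module"
  assumes K: "module R K" and n: "enat n \<le> depth R K"
  shows "\<exists>ys. length ys = n \<and> set ys \<subseteq> mm \<and> weakly_regular K (map \<rho> ys)"
proof (cases "carrier K = {\<zero>\<^bsub>K\<^esub>}")
  case True
  have "weakly_regular K (map \<rho> (replicate n 0))"
    unfolding weakly_regular_def
  proof (intro allI ballI impI)
    fix i y assume "y \<in> carrier K"
    have "\<zero>\<^bsub>K\<^esub> \<in> mults K (take i (map \<rho> (replicate n 0)))"
      by (rule module.mults_zero[OF K]) (rule take_set, auto)
    then show "y \<in> mults K (take i (map \<rho> (replicate n 0)))" using True \<open>y \<in> carrier K\<close> by simp
  qed
  moreover have "set (replicate n 0) \<subseteq> mm" using rg.subspace_0[OF mm_ideal] by (auto simp: set_replicate_conv_if)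
  ultimately show ?thesis by (intro exI[of _ "replicate n 0"]) simp
next
  case False
  define D where "D = {enat (length xs) | xs. set xs \<subseteq> max_ideal R \<and> regular_sequence R K xs}"
  have le: "enat n \<le> Sup D" using n False by (simp add: depth_def D_def)
  have "\<exists>zs. set zs \<subseteq> max_ideal R \<and> weakly_regular K zs \<and> n \<le> length zs"
  proof (cases n)
    case 0
    then show ?thesis by (intro exI[of _ "[]"]) (simp add: weakly_regular_def)
  next
    case (Suc m)
    have "enat m < Sup D" using le Suc by (metis Suc_ile_eq)
    then obtain x where "x \<in> D" "enat m < x" using less_Sup_iff by blast
    then obtain zs where "set zs \<subseteq> max_ideal R" "regular_sequence R K zs" "m < length zs" by (auto simp: D_def)
    then show ?thesis using regular_sequence_iff[OF K] Suc by (intro exI[of _ zs]) simp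
  qed
  then obtain zs where zs: "set zs \<subseteq> max_ideal R" "weakly_regular K zs" "n \<le> length zs" by blast
  obtain ys where ys: "zs = map \<rho> ys" "set ys \<subseteq> mm" using lift_list[OF zs(1)] by blast
  have "weakly_regular K (map \<rho> (take n ys))"
    using zs(2) weakly_regular_append[of K "map \<rho> (take n ys)" "map \<rho> (drop n ys)"] 
    unfolding ys(1) map_append[symmetric] append_take_drop_id by blast
  moreover have "length (take n ys) = n" using zs(3) ys(1) by simp
  moreover have "set (take n ys) \<subseteq> mm" by (rule take_set[OF ys(2)])
  ultimately show ?thesis by blast
qed

text \<open>
  The free module on a finite generating set \<open>S\<close> covers \<open>K\<close>, with the elements of \<open>S\<close> as the index set.
\<close>

lemma generated_module_cover:
  fixes K :: "('a, 'k) module"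
  assumes K: "module R K" and S: "finite S" "S \<subseteq> carrier K" "carrier K = generated_submodule R K S"
  shows "module_cover R \<rho> sc K (\<lambda>v. \<Oplus>\<^bsub>K\<^esub>k\<in>S. \<rho> (v k) \<odot>\<^bsub>K\<^esub> k) (vecs S UNIV)"
proof -
  interpret K: module R K by fact
  let ?\<kappa> = "\<lambda>v. \<Oplus>\<^bsub>K\<^esub>k\<in>S. \<rho> (v k) \<odot>\<^bsub>K\<^esub> k" and ?A = "vecs S (UNIV :: 's set)"
  have fc: "(\<lambda>k. \<rho> (v k) \<odot>\<^bsub>K\<^esub> k) \<in> S \<rightarrow> carrier K" for v :: "'k \<Rightarrow> 's" using S(2) by auto
  have closed: "?\<kappa> v \<in> carrier K" for v :: "'k \<Rightarrow> 's" by (rule K.M.finsum_closed[OF fc])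
  have add: "?\<kappa> (u + v) = ?\<kappa> u \<oplus>\<^bsub>K\<^esub> ?\<kappa> v" for u v :: "'k \<Rightarrow> 's"
  proof -
    have "?\<kappa> (u + v) = (\<Oplus>\<^bsub>K\<^esub>k\<in>S. \<rho> (u k) \<odot>\<^bsub>K\<^esub> k \<oplus>\<^bsub>K\<^esub> \<rho> (v k) \<odot>\<^bsub>K\<^esub> k)"
      using S(2) by (intro K.M.finsum_cong') (auto simp: cover_add K.smult_l_distr subset_iff)
    then show ?thesis using K.M.finsum_addf[OF fc fc] by simp
  qed
  have scale: "?\<kappa> (sc c v) = \<rho> c \<odot>\<^bsub>K\<^esub> ?\<kappa> v" for c v
  proof -
    have "?\<kappa> (sc c v) = (\<Oplus>\<^bsub>K\<^esub>k\<in>S. \<rho> c \<odot>\<^bsub>K\<^esub> (\<rho> (v k) \<odot>\<^bsub>K\<^esub> k))"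
      using S(2) by (intro K.M.finsum_cong') (auto simp: sc_apply cover_mult K.smult_assoc1 subset_iff)
    then show ?thesis using K.finsum_smult_ldistr[OF S(1) _ fc] by simp
  qed
  have neg: "?\<kappa> (sc (-1) v) = \<ominus>\<^bsub>K\<^esub> ?\<kappa> v" for v
  proof -
    have "\<rho> (-1) = \<ominus>\<^bsub>R\<^esub> \<one>\<^bsub>R\<^esub>" using cover_diff[of 0 1] by (simp add: cover_one R.minus_eq)
    then have "?\<kappa> (sc (-1) v) = (\<ominus>\<^bsub>R\<^esub> \<one>\<^bsub>R\<^esub>) \<odot>\<^bsub>K\<^esub> ?\<kappa> v" unfolding scale by simp
    then show ?thesis using closed by (simp only: K.smult_l_minus[OF R.one_closed closed] K.smult_one)
  qed
  have sub: "vec.subspace ?A" by simp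
  have img: "submodule (?\<kappa> ` ?A) R K"
  proof (rule K.submoduleI)
    show "?\<kappa> ` ?A \<subseteq> carrier K" using closed by blast
    have "?\<kappa> 0 = \<zero>\<^bsub>K\<^esub>" using S(2) by (intro K.M.add.finprod_one_eqI) auto
    then show "\<zero>\<^bsub>K\<^esub> \<in> ?\<kappa> ` ?A" by (intro rev_image_eqI[OF vec.subspace_0[OF sub]]) (rule sym)
    show "\<ominus>\<^bsub>K\<^esub> a \<in> ?\<kappa> ` ?A" if "a \<in> ?\<kappa> ` ?A" for a
    proof -
      obtain v where v: "v \<in> ?A" "a = ?\<kappa> v" using \<open>a \<in> _\<close> by (rule imageE)
      show ?thesis unfolding v(2) neg[symmetric] by (rule imageI[OF vec.subspace_scale[OF sub v(1)]])
    qed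
    show "a \<oplus>\<^bsub>K\<^esub> b \<in> ?\<kappa> ` ?A" if "a \<in> ?\<kappa> ` ?A" "b \<in> ?\<kappa> ` ?A" for a b
    proof -
      obtain v where v: "v \<in> ?A" "a = ?\<kappa> v" using \<open>a \<in> _\<close> by (rule imageE)
      obtain w where w: "w \<in> ?A" "b = ?\<kappa> w" using \<open>b \<in> _\<close> by (rule imageE)
      show ?thesis unfolding v(2) w(2) add[symmetric] by (rule imageI[OF vec.subspace_add[OF sub v(1) w(1)]])
    qed
    show "r \<odot>\<^bsub>K\<^esub> a \<in> ?\<kappa> ` ?A" if "r \<in> carrier R" "a \<in> ?\<kappa> ` ?A" for r a
    proof -
      obtain v where v: "v \<in> ?A" "a = ?\<kappa> v" using \<open>a \<in> _\<close> by (rule imageE)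
      obtain c where c: "\<rho> c = r" using cover_lift[OF \<open>r \<in> _\<close>] by blast
      show ?thesis unfolding v(2) c[symmetric] scale[symmetric] by (rule imageI[OF vec.subspace_scale[OF sub v(1)]])
    qed
  qed
  have "S \<subseteq> ?\<kappa> ` ?A"
  proof
    fix k assume k: "k \<in> S"
    have "?\<kappa> (unit k) = (\<Oplus>\<^bsub>K\<^esub>j\<in>S. if k = j then j else \<zero>\<^bsub>K\<^esub>)"
      using S(2) by (intro K.M.finsum_cong') (auto simp: unit_def cover_one subset_iff)
    also have "\<dots> = k" using K.M.finsum_singleton[OF k S(1), of "\<lambda>j. j"] S(2) by auto
    finally show "k \<in> ?\<kappa> ` ?A" by (intro rev_image_eqI[OF unit_vecs[OF k]]) (rule sym)
  qed
  then have "generated_submodule R K S \<subseteq> ?\<kappa> ` ?A" 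
    unfolding generated_submodule_def using img by (intro Inter_lower) simp
  then have image: "?\<kappa> ` ?A = carrier K" using S(3) closed by blast
  have noeth: "vec.noeth {v \<in> ?A. ?\<kappa> v = \<zero>\<^bsub>K\<^esub>} ?A"
  proof (rule vec.noeth_mono[OF vecs_noeth[OF noeth_aa aa_ideal S(1)]])
    have "?\<kappa> v = \<zero>\<^bsub>K\<^esub>" if v: "v \<in> vecs S aa" for v
    proof -
      have "\<rho> (v k) \<odot>\<^bsub>K\<^esub> k = \<zero>\<^bsub>K\<^esub>" if "k \<in> S" for k
        using v that S(2) by (auto simp: vecs_def aa_def)
      then show ?thesis by (intro K.M.add.finprod_one_eqI) auto
    qed
    then show "vecs S aa \<subseteq> {v \<in> ?A. ?\<kappa> v = \<zero>\<^bsub>K\<^esub>}" using vecs_UNIV by blast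
  qed
  show ?thesis
    by unfold_locales (use K image add scale noeth in \<open>auto simp: local_R range_cover\<close>)
qed

text \<open>
  The inequality of depths turns a regular sequence on \<open>R\<close> into one of the same length on \<open>K\<close>,
  which is the depth hypothesis in the construction of the sequence.
\<close>

theorem deep_adapted_sequence:
  fixes K :: "('a, 'k) module"
  assumes "deep_module R K"
  shows "\<exists>xs. min_regular_seq aa xs \<and> set xs \<subseteq> mm \<and> ring_regular xs \<and> weakly_regular K (map \<rho> xs) \<and>
    (mm = rg.span (aa \<union> set xs) \<or>
     (\<exists>s\<in>mm. s \<notin> rg.span (aa \<union> set xs) \<and> (\<forall>r\<in>mm. s * r \<in> rg.span (aa \<union> set xs))))"
proof -
  obtain S where K: "module R K" and S: "finite S" "S \<subseteq> carrier K" "carrier K = generated_submodule R K S"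
    and d: "depth R (ring_as_module R) \<le> depth R K"
    using assms unfolding deep_module_def finitely_generated_module_def by blast
  interpret C: module_cover R \<rho> sc K "\<lambda>v. \<Oplus>\<^bsub>K\<^esub>k\<in>S. \<rho> (v k) \<odot>\<^bsub>K\<^esub> k" "vecs S UNIV"
    by (rule generated_module_cover[OF K S])
  show ?thesis
    unfolding C.weakly_regular_cover
  proof (rule C.exists_adapted_sequence[OF C.submod_ker])
    fix xs assume "ring_regular xs" "set xs \<subseteq> mm"
    then have "enat (length xs) \<le> depth R K" using length_le_depth[of xs] d by (meson order_trans)
    then show "\<exists>ys. length ys = length xs \<and> set ys \<subseteq> mm \<and> C.regseq C.ker_\<kappa> ys"
      using weakly_regular_of_depth[OF K] C.weakly_regular_cover by blast
  qed
qed

end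

section \<open>Lifting resolutions of the residue field\<close>

lemma quotient_module_module:
  fixes M :: "('a, 'b) module"
  assumes M: "module R M" "submodule H R M"
  shows "module R (quotient_module M H)"
proof -
  interpret M: module R M by (rule M(1))
  interpret H: abelian_subgroup H M by (rule module_submodule_abelian_subgroup[OF M])
  have id: "(\<lambda>r. r) \<in> ring_hom R R" by (rule ring_hom_memI) auto
  show ?thesis
  proof (rule module_image[OF M.R.is_cring M(1) id, of "\<lambda>y. H +>\<^bsub>M\<^esub> y"])
    show "(\<lambda>y. H +>\<^bsub>M\<^esub> y) ` carrier M = carrier (quotient_module M H)"
      by (auto simp: quotient_module_def A_RCOSETS_def')
    show "H +>\<^bsub>M\<^esub> \<zero>\<^bsub>M\<^esub> = \<zero>\<^bsub>quotient_module M H\<^esub>"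
      using coset_zero_iff[OF H.abelian_subgroup_axioms M.M.zero_closed] by (simp add: quotient_module_def)
    show "H +>\<^bsub>M\<^esub> (y \<oplus>\<^bsub>M\<^esub> z) = (H +>\<^bsub>M\<^esub> y) \<oplus>\<^bsub>quotient_module M H\<^esub> (H +>\<^bsub>M\<^esub> z)"
      if "y \<in> carrier M" "z \<in> carrier M" for y z
      using H.a_rcos_sum[OF that] by (simp add: quotient_module_def)
    show "H +>\<^bsub>M\<^esub> (r \<odot>\<^bsub>M\<^esub> y) = r \<odot>\<^bsub>quotient_module M H\<^esub> (H +>\<^bsub>M\<^esub> y)"
      if "r \<in> carrier R" "y \<in> carrier M" for r y
      by (rule quotient_module_smult[OF M that, symmetric])
  qed simp
qed

lemma ideal_submodule:
  assumes "cring R" "ideal I R" shows "submodule I R (ring_as_module R)"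
proof -
  interpret cring R by fact
  interpret I: ideal I R by fact
  interpret M: module R "ring_as_module R" by (rule ring_as_module_module) fact
  have minus: "\<ominus>\<^bsub>ring_as_module R\<^esub> a = \<ominus>\<^bsub>R\<^esub> a" for a
    by (simp add: a_inv_def m_inv_def ring_as_module_def)
  show ?thesis
    by (rule M.submoduleI) (auto simp: minus I.I_l_closed)
qed

lemma residue_field_module:
  assumes "noetherian_local_ring R"
  shows "module R (residue_field R)"
    and "s \<in> max_ideal R \<Longrightarrow> y \<in> carrier (residue_field R) \<Longrightarrow> s \<odot>\<^bsub>residue_field R\<^esub> y = \<zero>\<^bsub>residue_field R\<^esub>"
proof -
  note R = noetherian_localD(1)[OF assms] and m = max_idealD[OF assms]
  note M = ring_as_module_module[OF R] ideal_submodule[OF R m(1)]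
  show "module R (residue_field R)" unfolding residue_field_def by (rule quotient_module_module[OF M])
  assume s: "s \<in> max_ideal R" and y: "y \<in> carrier (residue_field R)"
  interpret cring R by (rule R)
  let ?H = "max_ideal R" and ?M = "ring_as_module R"
  obtain x where x: "x \<in> carrier R" "y = ?H +>\<^bsub>?M\<^esub> x"
    using y by (auto simp: residue_field_def quotient_module_def A_RCOSETS_def')
  have sc: "s \<in> carrier R" using s m(2) by blast
  have "s \<odot>\<^bsub>residue_field R\<^esub> y = ?H +>\<^bsub>?M\<^esub> (s \<otimes>\<^bsub>R\<^esub> x)"
    unfolding residue_field_def x(2) using quotient_module_smult[OF M sc, of x] x(1) by simp
  also have "\<dots> = ?H"
    using coset_zero_iff[OF module_submodule_abelian_subgroup[OF M], of "s \<otimes>\<^bsub>R\<^esub> x"] sc x(1) ideal.I_r_closed[OF m(1) s] by simp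
  finally show "s \<odot>\<^bsub>residue_field R\<^esub> y = \<zero>\<^bsub>residue_field R\<^esub>"
    by (simp add: residue_field_def quotient_module_def)
qed

context ring_cover
begin

definition free_cover :: "nat \<Rightarrow> (nat \<Rightarrow> 's) \<Rightarrow> nat \<Rightarrow> 'a" where
  "free_cover n v = (\<lambda>i\<in>{..<n}. \<rho> (v i))"

lemma free_module_module: "module R (free_module R n)"
  unfolding free_module_def by (rule direct_sum_module[OF R.is_cring ring_as_module_module[OF R.is_cring]])

lemma free_cover_closed: "free_cover n v \<in> carrier (free_module R n)"
  by (simp add: free_cover_def free_module_def direct_sum_simps)

lemma free_cover_lift:
  assumes f: "f \<in> carrier (free_module R n)" shows "\<exists>v\<in>vecs {..<n} UNIV. free_cover n v = f"
proof -
  have f': "f \<in> (\<Pi>\<^sub>E i\<in>{..<n}. carrier R)" using f by (simp add: free_module_def direct_sum_simps)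
  then have "\<forall>i\<in>{..<n}. \<exists>p. \<rho> p = f i" using cover_lift by blast
  then obtain g where g: "\<And>i. i < n \<Longrightarrow> \<rho> (g i) = f i" using bchoice[of "{..<n}"] by (metis lessThan_iff)
  define v where "v i = (if i < n then g i else 0)" for i
  have "free_cover n v = f"
  proof
    fix i show "free_cover n v i = f i" using f' g by (cases "i < n") (auto simp: free_cover_def v_def PiE_def extensional_def)
  qed
  moreover have "v \<in> vecs {..<n} UNIV" by (simp add: vecs_def v_def)
  ultimately show ?thesis by blast
qed

lemma free_cover_add: "free_cover n (u + v) = free_cover n u \<oplus>\<^bsub>free_module R n\<^esub> free_cover n v"
  by (auto simp: free_cover_def free_module_def direct_sum_simps cover_add)

lemma free_cover_scale: "free_cover n (sc c v) = \<rho> c \<odot>\<^bsub>free_module R n\<^esub> free_cover n v"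
  by (auto simp: free_cover_def free_module_def direct_sum_simps cover_mult sc_apply)

lemma free_cover_zero: "free_cover n 0 = \<zero>\<^bsub>free_module R n\<^esub>"
  by (auto simp: free_cover_def free_module_def direct_sum_simps)

lemma free_cover_diff_eq_zero:
  "free_cover n (u - v) = \<zero>\<^bsub>free_module R n\<^esub> \<longleftrightarrow> free_cover n u = free_cover n v"
proof -
  have "free_cover n (u - v) = \<zero>\<^bsub>free_module R n\<^esub> \<longleftrightarrow> (\<forall>i<n. \<rho> (u i) = \<rho> (v i))"
    unfolding cover_eq_iff by (auto simp: free_cover_def free_module_def direct_sum_simps fun_eq_iff restrict_def aa_def)
  also have "\<dots> \<longleftrightarrow> free_cover n u = free_cover n v"
    by (auto simp: free_cover_def fun_eq_iff restrict_def)
  finally show ?thesis .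
qed

lemma free_cover_zero_iff:
  "v \<in> vecs {..<n} UNIV \<Longrightarrow> free_cover n v = \<zero>\<^bsub>free_module R n\<^esub> \<longleftrightarrow> v \<in> vecs {..<n} aa"
  by (auto simp: free_cover_def free_module_def direct_sum_simps fun_eq_iff restrict_def vecs_def aa_def)

lemma free_cover_in_max_ideal:
  assumes v: "v \<in> vecs {..<n} UNIV" "free_cover n v \<in> ideal_times_module R (max_ideal R) (free_module R n)"
  shows "v \<in> vecs {..<n} mm"
proof -
  let ?F = "free_module R n"
  interpret m: ideal "max_ideal R" R by (rule max_idealD(1)[OF local_R])
  interpret F: module R ?F by (rule free_module_module)
  define H where "H = {f \<in> carrier ?F. \<forall>i<n. f i \<in> max_ideal R}"
  note s = free_module_def direct_sum_simps
  have sm: "r \<odot>\<^bsub>?F\<^esub> f \<in> H" if "r \<in> carrier R" "f \<in> H" for r f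
    using that F.smult_closed[of r f] unfolding H_def by (auto simp: s m.I_l_closed)
  have "submodule H R ?F"
  proof (rule F.submoduleI)
    show "H \<subseteq> carrier ?F" by (auto simp: H_def)
    show "\<zero>\<^bsub>?F\<^esub> \<in> H" using F.M.zero_closed by (auto simp: H_def s)
    show "a \<oplus>\<^bsub>?F\<^esub> b \<in> H" if "a \<in> H" "b \<in> H" for a b
      using that F.M.a_closed[of a b] unfolding H_def by (auto simp: s)
    show "\<ominus>\<^bsub>?F\<^esub> a \<in> H" if "a \<in> H" for a
    proof -
      have "a \<in> carrier ?F" using that by (simp add: H_def)
      then have "\<ominus>\<^bsub>?F\<^esub> a = (\<ominus>\<^bsub>R\<^esub> \<one>\<^bsub>R\<^esub>) \<odot>\<^bsub>?F\<^esub> a" by (simp add: F.smult_l_minus)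
      then show ?thesis using sm[OF _ that, of "\<ominus>\<^bsub>R\<^esub> \<one>\<^bsub>R\<^esub>"] by simp
    qed
  qed (rule sm)
  moreover have "{r \<odot>\<^bsub>?F\<^esub> y | r y. r \<in> max_ideal R \<and> y \<in> carrier ?F} \<subseteq> H"
  proof
    fix z assume "z \<in> {r \<odot>\<^bsub>?F\<^esub> y | r y. r \<in> max_ideal R \<and> y \<in> carrier ?F}"
    then obtain r y where z: "z = r \<odot>\<^bsub>?F\<^esub> y" "r \<in> max_ideal R" "y \<in> carrier ?F" by blast
    have r: "r \<in> carrier R" using z(2) m.a_subset by blast
    have "z \<in> carrier ?F" unfolding z(1) by (rule F.smult_closed[OF r z(3)])
    moreover have "z i \<in> max_ideal R" if "i < n" for i
    proof -
      have "y i \<in> carrier R" using z(3) that by (auto simp: s)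
      then show ?thesis using that m.I_r_closed[OF z(2)] by (simp add: z(1) s)
    qed
    ultimately show "z \<in> H" by (simp add: H_def)
  qed
  ultimately have "ideal_times_module R (max_ideal R) ?F \<subseteq> H"
    unfolding ideal_times_module_def generated_submodule_def by (intro Inter_lower) simp
  then have "\<forall>i<n. free_cover n v i \<in> max_ideal R" using v(2) by (auto simp: H_def)
  then show ?thesis using v(1) by (simp add: vecs_def mm_def free_cover_def)
qed

lemma free_cover_mults:
  "v \<in> vecs {..<n} (rg.span (aa \<union> set xs)) \<Longrightarrow> free_cover n v \<in> mults (free_module R n) (map \<rho> xs)"
proof (induction xs arbitrary: v)
  case Nil
  then have "v \<in> vecs {..<n} aa" using rg.span_eq_iff[THEN iffD2, OF aa_ideal] by simp
  then show ?case using free_cover_zero_iff[of v n] vecs_UNIV by auto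
next
  case (Cons x xs)
  have e: "rg.span (aa \<union> set (x # xs)) = rg.span (insert x (rg.span (aa \<union> set xs)))"
  proof (rule rg.span_eq[THEN iffD2], rule conjI)
    show "aa \<union> set (x # xs) \<subseteq> rg.span (insert x (rg.span (aa \<union> set xs)))"
      using rg.span_superset[of "aa \<union> set xs"] rg.span_superset[of "insert x (rg.span (aa \<union> set xs))"] by auto
    have "rg.span (aa \<union> set xs) \<subseteq> rg.span (aa \<union> set (x # xs))" by (rule rg.span_mono) auto
    then show "insert x (rg.span (aa \<union> set xs)) \<subseteq> rg.span (aa \<union> set (x # xs))"
      using rg.span_superset[of "aa \<union> set (x # xs)"] by auto
  qed
  obtain q where q: "q \<in> vecs {..<n} UNIV" "v - sc x q \<in> vecs {..<n} (rg.span (aa \<union> set xs))"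
    using vecs_span_insert(1)[OF rg.subspace_span] Cons.prems unfolding e by blast
  have "v = sc x q + (v - sc x q)" by simp
  then have "free_cover n v = \<rho> x \<odot>\<^bsub>free_module R n\<^esub> free_cover n q \<oplus>\<^bsub>free_module R n\<^esub> free_cover n (v - sc x q)"
    by (metis free_cover_add free_cover_scale)
  then show ?case unfolding list.map by (simp only: in_multsI[OF free_cover_closed Cons.IH[OF q(2)]])
qed

text \<open>
  The differentials are lifted on basis vectors. The lifted complex represents the given one over
  \<open>S / aa\<close>, so it inherits exactness and minimality. At the end the cycles are \<open>mm\<close> times the free module:
  minimality gives one inclusion, and the other holds as the residue field is annihilated by \<open>mm\<close>.
\<close>

lemma resolution_lift:
  assumes res: "minimal_free_resolution R (residue_field R) b e d"
  shows "\<exists>D. exact_min aa (\<lambda>n. {..<b n}) D \<and> cyc aa {..<b 0} {..<b 1} (D 0) = vecs {..<b 0} mm \<and>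
    (\<forall>n. \<forall>v\<in>vecs {..<b (Suc n)} UNIV. free_cover (b n) (D n v) = d n (free_cover (b (Suc n)) v))"
proof -
  let ?F = "\<lambda>n. free_module R (b n)" and ?A = "\<lambda>n. {..<b n}" and ?p = "\<lambda>n. free_cover (b n)"
  have e: "e \<in> module_hom R (?F 0) (residue_field R)" 
    and d: "\<And>n. d n \<in> module_hom R (?F (Suc n)) (?F n)"
    and ker_e: "d 0 ` carrier (?F 1) = module_ker (?F 0) (residue_field R) e"
    and ker: "\<And>n. d (Suc n) ` carrier (?F (Suc (Suc n))) = module_ker (?F (Suc n)) (?F n) (d n)"
    and min: "\<And>n. d n ` carrier (?F (Suc n)) \<subseteq> ideal_times_module R (max_ideal R) (?F n)"
    using res unfolding minimal_free_resolution_def Let_def by blast+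
  note F = free_module_module
  have "\<exists>t. \<forall>i. t i \<in> vecs (?A n) UNIV \<and> ?p n (t i) = d n (?p (Suc n) (unit i))" for n
    using free_cover_lift[OF module_homD(1)[OF d free_cover_closed]] by (intro choice) blast
  then have "\<exists>t. \<forall>n i. t n i \<in> vecs (?A n) UNIV \<and> ?p n (t n i) = d n (?p (Suc n) (unit i))"
    by (intro choice) blast
  then obtain t where t: "\<And>n i. t n i \<in> vecs (?A n) UNIV" "\<And>n i. ?p n (t n i) = d n (?p (Suc n) (unit i))" by blast
  define D where "D n = comb (?A (Suc n)) (t n)" for n
  have lin: "linmap (D n)" for n unfolding D_def by (rule linmap_comb)
  have subU: "vec.subspace (vecs A (UNIV :: 's set))" for A :: "nat set" by simp
  have Dv: "D n v \<in> vecs (?A n) UNIV" for n v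
    unfolding D_def by (rule comb_in[OF subU]) (rule vec.subspace_scale[OF subU t(1)])
  have Dadd: "D n (u + v) = D n u + D n v" and Dsc: "D n (sc c u) = sc c (D n u)" for n u v c
    using lin[of n] by (simp_all add: module_hom_def module_hom_axioms_def Modules.module_hom.add Modules.module_hom.scale)
  have com: "?p n (D n v) = d n (?p (Suc n) v)" if "v \<in> vecs (?A (Suc n)) UNIV" for n v
  proof -
    let ?H = "{v. ?p n (D n v) = d n (?p (Suc n) v)}"
    have "vec.subspace ?H"
    proof (rule vec.subspaceI)
      have "D n 0 = 0" using Dsc[of n 0 0] by (simp add: sc_def zero_fun_def)
      then show "0 \<in> ?H" using module_hom_zero[OF d F F] by (simp add: free_cover_zero)
      show "x + y \<in> ?H" if "x \<in> ?H" "y \<in> ?H" for x y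
        using that module_homD(2)[OF d free_cover_closed free_cover_closed] by (simp add: Dadd free_cover_add)
      show "sc c x \<in> ?H" if "x \<in> ?H" for c x
        using that module_homD(3)[OF d cover_closed free_cover_closed] by (simp add: Dsc free_cover_scale)
    qed
    moreover have "unit i \<in> ?H" if "i \<in> ?A (Suc n)" for i
      using comb_unit[OF _ that, of "t n"] t(2) by (simp add: D_def)
    ultimately have "vecs (?A (Suc n)) UNIV \<subseteq> ?H" by (intro comb_vecs_le) auto
    then show ?thesis using that by blast
  qed
  have img: "(\<exists>u\<in>vecs (?A (Suc n)) UNIV. v - D n u \<in> vecs (?A n) aa) \<longleftrightarrow> ?p n v \<in> d n ` carrier (?F (Suc n))"
    if v: "v \<in> vecs (?A n) UNIV" for n v
  proof -
    have eq: "v - D n u \<in> vecs (?A n) aa \<longleftrightarrow> ?p n v = d n (?p (Suc n) u)" if u: "u \<in> vecs (?A (Suc n)) UNIV" for u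
      using free_cover_zero_iff[OF vec.subspace_diff[OF subU v Dv]] free_cover_diff_eq_zero com[OF u] by metis
    have surj: "?p (Suc n) ` vecs (?A (Suc n)) UNIV = carrier (?F (Suc n))"
      using free_cover_closed free_cover_lift by (metis (no_types, opaque_lifting) image_iff subsetI subset_antisym)
    have "(\<exists>u\<in>vecs (?A (Suc n)) UNIV. v - D n u \<in> vecs (?A n) aa) \<longleftrightarrow>
      (\<exists>u\<in>vecs (?A (Suc n)) UNIV. ?p n v = d n (?p (Suc n) u))" by (intro bex_cong refl eq)
    then show ?thesis unfolding surj[symmetric] image_iff bex_simps by blast
  qed
  have cyc_iff: "v \<in> cyc aa (?A n) (?A (Suc n)) (D n) \<longleftrightarrow> ?p n v \<in> d n ` carrier (?F (Suc n))"
    if v: "v \<in> vecs (?A n) UNIV" for n v unfolding cyc_def using img[OF v] by simp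
  have Dmm: "D n v \<in> vecs (?A n) mm" if "v \<in> vecs (?A (Suc n)) UNIV" for n v
    using min[of n] com[OF that] free_cover_closed[of "b (Suc n)" v] by (intro free_cover_in_max_ideal[OF Dv]) auto
  have "exact_min aa ?A D" unfolding exact_min_def
  proof (intro allI conjI ballI)
    fix n
    show "finite (?A n)" by simp
    show "linmap (D n)" by (rule lin)
    show "D n ` vecs (?A (Suc n)) UNIV \<subseteq> vecs (?A n) mm" using Dmm by blast
    fix v :: "nat \<Rightarrow> 's" assume v: "v \<in> vecs (?A (Suc n)) UNIV"
    have "D n v \<in> vecs (?A n) aa \<longleftrightarrow> d n (?p (Suc n) v) = \<zero>\<^bsub>?F n\<^esub>"
      using free_cover_zero_iff[OF Dv] com[OF v] by metis
    also have "\<dots> \<longleftrightarrow> ?p (Suc n) v \<in> d (Suc n) ` carrier (?F (Suc (Suc n)))"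
      unfolding ker module_ker_def using free_cover_closed by simp
    also have "\<dots> \<longleftrightarrow> v \<in> cyc aa (?A (Suc n)) (?A (Suc (Suc n))) (D (Suc n))" using cyc_iff[OF v] by simp
    finally show "D n v \<in> vecs (?A n) aa \<longleftrightarrow> v \<in> cyc aa (?A (Suc n)) (?A (Suc (Suc n))) (D (Suc n))" .
  qed
  moreover have "cyc aa (?A 0) (?A 1) (D 0) = vecs (?A 0) mm"
  proof
    show "cyc aa (?A 0) (?A 1) (D 0) \<subseteq> vecs (?A 0) mm"
      by (rule cyc_le_mm[OF aa_mm]) (use Dmm in auto)
    show "vecs (?A 0) mm \<subseteq> cyc aa (?A 0) (?A 1) (D 0)"
    proof
      fix v :: "nat \<Rightarrow> 's" assume v: "v \<in> vecs (?A 0) mm"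
      note k = residue_field_module[OF local_R]
      interpret k: module R "residue_field R" by (rule k(1))
      let ?H = "{v. e (?p 0 v) = \<zero>\<^bsub>residue_field R\<^esub>}"
      have "vec.subspace ?H"
      proof (rule vec.subspaceI)
        show "0 \<in> ?H" using module_hom_zero[OF e F k(1)] by (simp add: free_cover_zero)
        show "x + y \<in> ?H" if "x \<in> ?H" "y \<in> ?H" for x y
          using that module_homD(2)[OF e free_cover_closed free_cover_closed] by (simp add: free_cover_add)
        show "sc c x \<in> ?H" if "x \<in> ?H" for c x
          using that module_homD(3)[OF e cover_closed free_cover_closed] by (simp add: free_cover_scale)
      qed
      moreover have "sc (v i) (unit i) \<in> ?H" if "i \<in> ?A 0" for i
      proof -
        have "\<rho> (v i) \<in> max_ideal R" using v that by (auto simp: vecs_def mm_def)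
        then show ?thesis using k(2) module_homD(3)[OF e cover_closed free_cover_closed] module_homD(1)[OF e free_cover_closed]
          by (simp add: free_cover_scale)
      qed
      ultimately have "comb (?A 0) unit v \<in> ?H" by (rule comb_in)
      then have "?p 0 v \<in> d 0 ` carrier (?F 1)"
        unfolding ker_e module_ker_def using vec_eq_comb[OF _ vecs_UNIV[OF v]] free_cover_closed by simp
      then show "v \<in> cyc aa (?A 0) (?A 1) (D 0)" using cyc_iff[OF vecs_UNIV[OF v]] by simp
    qed
  qed
  ultimately show ?thesis using com by (intro exI[of _ D]) simp
qed

text \<open>
  For the \<open>n\<close>-th syzygy with \<open>n > 0\<close>, a submodule of a free module, one lifts to the free module covering
  it, applies the result over \<open>S\<close> and maps back. The residue field itself is annihilated by \<open>s\<close>.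
\<close>

theorem syzygies_killed:
  assumes good: "min_regular_seq aa xs" and s: "s \<in> mm" "\<And>r. r \<in> mm \<Longrightarrow> s * r \<in> rg.span (aa \<union> set xs)"
    and Z: "Z \<in> residue_field_syzygies R"
  shows "kills Z (\<rho> s) (map \<rho> xs)"
proof -
  note k = residue_field_module[OF local_R]
  have xs: "set (map \<rho> xs) \<subseteq> carrier R" by auto
  obtain n where "is_syzygy R (residue_field R) n Z" using Z by (auto simp: residue_field_syzygies_def)
  then obtain b e d where ZM: "module R Z" and res: "minimal_free_resolution R (residue_field R) b e d"
    and iso: "case n of 0 \<Rightarrow> module_isomorphic R Z (residue_field R)
        | Suc j \<Rightarrow> module_isomorphic R Z
            ((free_module R (b j)) \<lparr>carrier := d j ` carrier (free_module R (b (Suc j)))\<rparr>)"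
    unfolding is_syzygy_def by blast
  show ?thesis
  proof (cases n)
    case 0
    have "\<rho> s \<in> max_ideal R" using s(1) by (simp add: mm_def)
    then have "kills (residue_field R) (\<rho> s) (map \<rho> xs)"
      unfolding kills_def using k(2) module.mults_zero[OF k(1) xs] by simp
    then show ?thesis using iso 0 by (intro kills_iso[OF ZM k(1) xs cover_closed]) simp_all
  next
    case (Suc j)
    let ?F = "\<lambda>n. free_module R (b n)" and ?p = "\<lambda>n. free_cover (b n)"
    let ?I = "(?F j) \<lparr>carrier := d j ` carrier (?F (Suc j))\<rparr>"
    have d: "\<And>n. d n \<in> module_hom R (?F (Suc n)) (?F n)"
      and ker: "d (Suc j) ` carrier (?F (Suc (Suc j))) = module_ker (?F (Suc j)) (?F j) (d j)"
      using res unfolding minimal_free_resolution_def Let_def by blast+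
    note F = free_module_module
    interpret Fj: module R "?F j" by (rule F)
    obtain D where D: "exact_min aa (\<lambda>n. {..<b n}) D" "cyc aa {..<b 0} {..<b 1} (D 0) = vecs {..<b 0} mm"
      and com: "\<And>n v. v \<in> vecs {..<b (Suc n)} UNIV \<Longrightarrow> ?p n (D n v) = d n (?p (Suc n) v)"
      using resolution_lift[OF res] by blast
    have killed: "killed s (rg.span (aa \<union> set xs)) (\<lambda>n. {..<b n}) D"
      by (rule socle_kills_resolution[OF good aa_ideal subset_refl aa_mm s(1) _ D]) (rule s(2))
    have id: "(\<lambda>r. r) \<in> ring_hom R R" by (rule ring_hom_memI) auto
    have I: "module R ?I"
    proof (rule module_image[OF R.is_cring F id, of "d j"])
      show "d j \<zero>\<^bsub>?F (Suc j)\<^esub> = \<zero>\<^bsub>?I\<^esub>" using module_hom_zero[OF d F F] by simp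
    qed (use module_homD[OF d] in auto)
    have dI: "d j \<in> module_hom R (?F (Suc j)) ?I"
      unfolding module_hom_def hom_def using module_homD(2,3)[OF d] by auto
    have "kills ?I (\<rho> s) (map \<rho> xs)" unfolding kills_def
    proof
      fix z assume "z \<in> carrier ?I"
      then obtain f where "f \<in> carrier (?F (Suc j))" "z = d j f" by auto
      then obtain v where v: "v \<in> vecs {..<b (Suc j)} UNIV" "z = d j (?p (Suc j) v)" using free_cover_lift by blast
      obtain u where u: "u \<in> vecs {..<b (Suc (Suc j))} UNIV"
        "sc s v - D (Suc j) u \<in> vecs {..<b (Suc j)} (rg.span (aa \<union> set xs))"
        using killed v(1) unfolding killed_def cyc_def by blast
      let ?w = "sc s v - D (Suc j) u"
      have "sc s v = D (Suc j) u + ?w" by simp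
      then have "\<rho> s \<odot>\<^bsub>?F (Suc j)\<^esub> ?p (Suc j) v = d (Suc j) (?p (Suc (Suc j)) u) \<oplus>\<^bsub>?F (Suc j)\<^esub> ?p (Suc j) ?w"
        using com[OF u(1)] by (metis free_cover_add free_cover_scale)
      then have "\<rho> s \<odot>\<^bsub>?F j\<^esub> z = d j (d (Suc j) (?p (Suc (Suc j)) u)) \<oplus>\<^bsub>?F j\<^esub> d j (?p (Suc j) ?w)"
        using v(2) module_homD[OF d] free_cover_closed cover_closed by metis
      moreover have "d j (d (Suc j) (?p (Suc (Suc j)) u)) = \<zero>\<^bsub>?F j\<^esub>"
        using ker free_cover_closed[of "b (Suc (Suc j))" u] unfolding module_ker_def by blast
      moreover have "d j (?p (Suc j) ?w) \<in> carrier (?F j)" by (rule module_homD(1)[OF d free_cover_closed])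
      ultimately have "\<rho> s \<odot>\<^bsub>?I\<^esub> z = d j (?p (Suc j) ?w)" by simp
      then show "\<rho> s \<odot>\<^bsub>?I\<^esub> z \<in> mults ?I (map \<rho> xs)"
        using mults_hom[OF dI F I xs free_cover_mults[OF u(2)]] by simp
    qed
    then show ?thesis using iso Suc by (intro kills_iso[OF ZM I xs cover_closed]) simp_all
  qed
qed

end

section \<open>Descent to the module with the star property\<close>

lemma ring_as_module_deep:
  assumes "cring R" shows "deep_module R (ring_as_module R)"
proof -
  interpret cring R by fact
  note M = ring_as_module_module[OF assms]
  have "carrier R \<subseteq> H" if H: "submodule H R (ring_as_module R)" "\<one>\<^bsub>R\<^esub> \<in> H" for H
  proof
    fix r assume r: "r \<in> carrier R"
    have "r \<odot>\<^bsub>ring_as_module R\<^esub> \<one>\<^bsub>R\<^esub> \<in> H" using module.submoduleE(4)[OF M H(1) r H(2)] .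
    then show "r \<in> H" using r by simp
  qed
  moreover have "submodule (carrier R) R (ring_as_module R)"
    using ideal_submodule[OF assms oneideal] .
  ultimately have "carrier R = generated_submodule R (ring_as_module R) {\<one>\<^bsub>R\<^esub>}"
    unfolding generated_submodule_def by (intro equalityI Inter_greatest Inter_lower) auto
  then show ?thesis unfolding deep_module_def finitely_generated_module_def
    using M by (intro conjI exI[of _ "{\<one>\<^bsub>R\<^esub>}"]) auto
qed

text \<open>
  The sequence found above is regular on \<open>R\<close> and so extends to a system of parameters. If it generates
  the maximal ideal, its length is the dimension, and \<open>R\<close> is regular; otherwise there is a socle element.
\<close>

theorem regular_or_killing_socle_element:
  fixes R :: "'a ring" and K :: "('a, 'k) module"
  assumes R: "noetherian_local_ring R" and K: "deep_module R K"
  shows "\<exists>xs. set xs \<subseteq> max_ideal R \<and> weakly_regular (ring_as_module R) xs \<and> weakly_regular K xs \<and>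
    (\<exists>ys. system_of_parameters R (xs @ ys)) \<and>
    (regular_local_ring R \<or>
     (\<exists>s\<in>max_ideal R. s \<notin> mults (ring_as_module R) xs \<and>
        (\<forall>r\<in>max_ideal R. r \<otimes>\<^bsub>R\<^esub> s \<in> mults (ring_as_module R) xs) \<and>
        (\<forall>Z\<in>residue_field_syzygies R. kills Z s xs)))"
proof -
  obtain \<rho> :: "('a multiset \<Rightarrow>\<^sub>0 int) \<Rightarrow> 'a" where "ring_cover R \<rho>"
    using poly_mapping_ring_surjection[OF noetherian_localD(1)[OF R]] R unfolding ring_cover_def by blast
  then interpret ring_cover R \<rho> .
  obtain xs where xs: "min_regular_seq aa xs" "set xs \<subseteq> mm" "ring_regular xs" "weakly_regular K (map \<rho> xs)" and
    alt: "mm = rg.span (aa \<union> set xs) \<or>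
     (\<exists>s\<in>mm. s \<notin> rg.span (aa \<union> set xs) \<and> (\<forall>r\<in>mm. s * r \<in> rg.span (aa \<union> set xs)))"
    using deep_adapted_sequence[OF K] by blast
  have par: "param_seq aa xs"
    by (rule param_seq_of_regular) (use xs(3) in \<open>simp add: ring_regular_def\<close>)
  obtain ys where ys: "param_seq aa (xs @ ys)" "set ys \<subseteq> mm"
    "\<And>x. x \<in> mm \<Longrightarrow> \<exists>n. x ^ n \<in> rg.span (aa \<union> set (xs @ ys))"
    using param_seq_extend[OF par xs(2)] by blast
  have sys: "system_of_parameters R (map \<rho> xs @ map \<rho> ys)"
    using system_of_parameters_cover[OF ys(1) _ ys(3)] xs(2) ys(2) by simp
  have main: "regular_local_ring R \<or>
     (\<exists>s\<in>max_ideal R. s \<notin> mults (ring_as_module R) (map \<rho> xs) \<and>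
        (\<forall>r\<in>max_ideal R. r \<otimes>\<^bsub>R\<^esub> s \<in> mults (ring_as_module R) (map \<rho> xs)) \<and>
        (\<forall>Z\<in>residue_field_syzygies R. kills Z s (map \<rho> xs)))"
    using alt
  proof
    assume "mm = rg.span (aa \<union> set xs)"
    then show ?thesis using regular_local_ring_cover[OF par] by blast
  next
    assume "\<exists>s\<in>mm. s \<notin> rg.span (aa \<union> set xs) \<and> (\<forall>r\<in>mm. s * r \<in> rg.span (aa \<union> set xs))"
    then obtain s where s: "s \<in> mm" "s \<notin> rg.span (aa \<union> set xs)" "\<And>r. r \<in> mm \<Longrightarrow> s * r \<in> rg.span (aa \<union> set xs)" by blast
    have "r \<otimes>\<^bsub>R\<^esub> \<rho> s \<in> mults (ring_as_module R) (map \<rho> xs)" if r: "r \<in> max_ideal R" for r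
    proof -
      obtain p where p: "r = \<rho> p" "p \<in> mm" using r max_ideal_cover by blast
      then have "\<rho> (p * s) \<in> mults (ring_as_module R) (map \<rho> xs)"
        unfolding mults_ring_cover using s(3)[OF p(2)] by (simp only: mult.commute)
      then show ?thesis by (simp only: cover_mult p(1))
    qed
    moreover have "\<rho> s \<notin> mults (ring_as_module R) (map \<rho> xs)" using s(2) mults_ring_cover by blast
    moreover have "\<rho> s \<in> max_ideal R" using s(1) by (simp add: mm_def)
    ultimately show ?thesis using syzygies_killed[OF xs(1) s(1) s(3)] by blast
  qed
  have "set (map \<rho> xs) \<subseteq> max_ideal R" using xs(2) by (auto simp: mm_def)
  then show ?thesis using xs(3,4) sys main ring_regular_cover by blast
qed

lemma residue_field_syzygy_module: "Z \<in> residue_field_syzygies R \<Longrightarrow> module R Z"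
  by (auto simp: residue_field_syzygies_def is_syzygy_def)

text \<open>
  If \<open>R\<close> is not regular, there is an element \<open>s\<close> with \<open>s Z \<subseteq> (xs) Z\<close> for all syzygies \<open>Z\<close> of \<open>k\<close>, hence also
  for \<open>M\<close>. Once this inclusion passes to \<open>N\<close> it contradicts the property \<open>P\<close>.
\<close>

lemma regular_if_killing_descends:
  fixes R :: "'a ring" and M :: "('a, 'm) module" and N :: "('a, 'n) module" and K :: "('a, 'k) module"
  assumes R: "noetherian_local_ring R"
    and M: "module R M" "in_Add TYPE('i) R (residue_field_syzygies R) M"
    and N: "module R N" "star_property P" "P R N"
    and K: "deep_module R K"
    and descends: "\<And>s xs ys. set xs \<subseteq> carrier R \<Longrightarrow> s \<in> carrier R \<Longrightarrow> weakly_regular K xs \<Longrightarrow>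
      system_of_parameters R (xs @ ys) \<Longrightarrow> kills M s xs \<Longrightarrow> kills N s xs"
  shows "regular_local_ring R"
proof (rule ccontr)
  assume nr: "\<not> regular_local_ring R"
  obtain xs ys s where xs: "set xs \<subseteq> max_ideal R" "weakly_regular (ring_as_module R) xs" "weakly_regular K xs"
    "system_of_parameters R (xs @ ys)" and s: "s \<in> max_ideal R" "s \<notin> mults (ring_as_module R) xs"
    "\<And>r. r \<in> max_ideal R \<Longrightarrow> r \<otimes>\<^bsub>R\<^esub> s \<in> mults (ring_as_module R) xs"
    "\<And>Z. Z \<in> residue_field_syzygies R \<Longrightarrow> kills Z s xs"
    using regular_or_killing_socle_element[OF R K] nr by blast
  note c = noetherian_localD(1)[OF R]
  have cc: "set xs \<subseteq> carrier R" "s \<in> carrier R" using xs(1) s(1) max_idealD(2)[OF R] by auto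
  have "kills M s xs"
    by (rule in_Add_transfer(1)[OF c residue_field_syzygy_module M(2) cc s(4)])
  then have "kills N s xs" by (rule descends[OF cc xs(3,4)])
  then show False using star_property_not_killed[OF N(2,3) R N(1) xs(1,2) cc(2) s(2,3)] by blast
qed

theorem corollary1p3:
  fixes R :: "'a ring" and M :: "('a, 'm) module" and N :: "('a, 'n) module"
  assumes "noetherian_local_ring R"
    and "module R M" and "in_Add TYPE('i) R (residue_field_syzygies R) M"
    and "module R N" and "\<exists>P. star_property P \<and> P R N"
    and "(\<exists>g. right_exact_modules R M g N) \<or>
         (\<exists>(L :: ('a, 'l) module) f g.
            module R L \<and> short_exact_modules R N f M g L \<and>
            (balanced_big_CM R L \<or>
             (\<exists>K :: ('a, 'k) module. deep_module R K \<and> in_Add TYPE('j) R {K} L)))"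
  shows "regular_local_ring R"
proof -
  note R = assms(1) and M = assms(2,3) and N = assms(4)
  obtain P where P: "star_property P" "P R N" using assms(5) by blast
  note c = noetherian_localD(1)[OF R]
  note descent = regular_if_killing_descends[OF R M N P]
  note R_deep = ring_as_module_deep[OF c]
  from assms(6) consider (quotient) g where "right_exact_modules R M g N"
    | (CM) L :: "('a, 'l) module" and f g where "module R L" "short_exact_modules R N f M g L" "balanced_big_CM R L"
    | (deep) L :: "('a, 'l) module" and f g and K :: "('a, 'k) module" where "module R L" "short_exact_modules R N f M g L"
        "deep_module R K" "in_Add TYPE('j) R {K} L"
    by blast
  then show ?thesis
  proof cases
    case quotient
    then have g: "g \<in> module_hom R M N" "g ` carrier M = carrier N" by (simp_all add: right_exact_modules_def)
    show ?thesis
      by (rule descent[OF R_deep]) (rule kills_surj[OF g M(1) N])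
  next
    case CM
    show ?thesis
    proof (rule descent[OF R_deep])
      fix s xs ys
      assume cc: "set xs \<subseteq> carrier R" "s \<in> carrier R" and sys: "system_of_parameters R (xs @ ys)" and k: "kills M s xs"
      have "regular_sequence R L (xs @ ys)" using CM(3) sys unfolding balanced_big_CM_def by blast
      then have "weakly_regular L xs" using regular_sequence_iff[OF CM(1)] weakly_regular_append by blast
      then show "kills N s xs" using kills_kernel[OF CM(2) N M(1) CM(1)] cc k by blast
    qed
  next
    case deep
    have K: "module R K" using deep(3) by (simp add: deep_module_def finitely_generated_module_def)
    show ?thesis
    proof (rule descent[OF deep(3)])
      fix s xs ys
      assume cc: "set xs \<subseteq> carrier R" "s \<in> carrier R" and w: "weakly_regular K xs" and k: "kills M s xs"
      have "weakly_regular L xs"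
        by (rule in_Add_transfer(2)[OF c _ deep(4) cc]) (use K w in auto)
      then show "kills N s xs" using kills_kernel[OF deep(2) N M(1) deep(1)] cc k by blast
    qed
  qed
qed

end
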